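(* Let $n\in\mathbb{Z}_{\ge1}$, $k\in\{1,2\}$, $S\in T_{\mathrm{HOR}k}(n,\mathbb{R})$, $S=S^{(k)}(p)$ with $p\in T^{pol}_{\mathrm{HOR}k}(n,\mathbb{R})$. Let $H_{\mathbb{R}}$ be a real vector space with basis $\underline e=(e_1,\dots,e_n)$, with bilinear form $L$ given by $L(\underline e^t,\underline e)=S^t$, and with automorphisms $M$ and $R_{(k)}(S)$ given by $M\underline e=\underline e\cdot S^{-1}S^t$ and $R_{(k)}(S)\,\underline e=\underline e\cdot R^{mat}_{(k)}(S)$. Let $H_{\mathbb{C}}=H_{\mathbb{R}}\otimes\mathbb{C}$ and let $N$ be the nilpotent part of $M$. (a) $(-1)^k\cdot S^{-1}S^t=R^{mat}_{(k)}(S)^n$ and $(-1)^k\cdot M=R_{(k)}(S)^n$. The generalized eigenspaces of $R_{(k)}(S)$ are the spaces $H^{(R)}_\kappa:=\ker((R_{(k)}(S)-\kappa\cdot\mathrm{id})^n)\subset H_{\mathbb{C}}$ with $p(\kappa)=0$. The generalized eigenspaces of $M$ are the spaces $H_\lambda=\bigoplus_{\kappa:(-1)^k\kappa^n=\lambda}H^{(R)}_\kappa$. Especially, $T_{\mathrm{HOR}k}(n,\mathbb{R})\subset T(n,\mathbb{R})$. The monodromy $M$ and the automorphism $R_{(k)}(S)$ each have a single Jordan block on $H_\kappa^{(R)}$. (b) $R_{(k)}(S)$ respects $L$. Therefore $H_{\mathbb{R}}$ decomposes $L$-orthogonally into the Seifert form pairs $(H^{(R)}_1\cap H_{\mathbb{R}},L)$,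 $(H^{(R)}_{-1}\cap H_{\mathbb{R}},L)$ and $((H^{(R)}_\kappa\oplus H^{(R)}_{\overline\kappa})\cap H_{\mathbb{R}},L)$ for each $\kappa\in S^1$ with $\mathrm{Im}\,\kappa>0$ and $H^{(R)}_\kappa\ne\{0\}$. (c) $\mathrm{Spp}(S)$ and the decomposition of $(H_{\mathbb{R}},L)$ in (b) give a polarized enhancement of $(H_{\mathbb{R}},L)$: $\mathrm{Spp}(S)$ consists of spp-ladders, one for each eigenvalue $\kappa$ of $R_{(k)}(S)$. The spp-ladder for $\kappa$ has length $l+1=\dim H^{(R)}_\kappa$, center $m=1$, and a first spectral number $\alpha$ with $e^{-2\pi i\alpha}=(-1)^k\kappa^n$. Furthermore $$L(a,N^l\overline a)\in e^{\frac12\pi i(2\alpha+l)}\cdot\mathbb{R}_{>0}\quad\text{for }a\in H^{(R)}_\kappa-N(H^{(R)}_\kappa).$$ If $\kappa=\pm1$, it is a single spp-ladder. If $\kappa\neq\pm1$, the partner spp-ladder is the one for $\overline\kappa$. (d) The underlying spectrum $\mathrm{Sp}(S)$ is obtained as follows: for any continuous path $\sigma:[0,1]\to T_{\mathrm{HOR}k}(n,\mathbb{R})$ with $\sigma(0)=E_n$, $\sigma(1)=S$ and $\sigma([0,1))\subset\mathrm{int}(T_{\mathrm{HOR}k}(n,\mathbb{R}))$, let $\alpha_1,\dots,\alpha_n:[0,1]\to\mathbb{R}$ be the unique continuous functions with $\alpha_j(0)=0$ such that $e^{-2\pi i(\alpha_j(r)+j-\frac k2)/n}$, $j\in\{1,\dots,n\}$,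 are the eigenvalues of $R^{mat}_{(k)}(\sigma(r))$ for all $r$; then $\mathrm{Sp}(S)=\sum_{j=1}^n(\alpha_j(1))$.
   Context: $E_n$ is the unit matrix, $S^1$ the unit circle. $T(n,\mathbb{R})$: real upper triangular $n\times n$ matrices $S$ with $1$'s on the diagonal such that all eigenvalues of $S^{-1}S^t$ are in $S^1$. **HOR matrices.** $T^{scal}_{\mathrm{HOR}1}(n,\mathbb{R})=\{\underline\beta\in[0,1]^n\mid \beta_1\le\dots\le\beta_n,\ \beta_j+\beta_{n+1-j}=1\}$, $T^{scal}_{\mathrm{HOR}2}(n,\mathbb{R})=\{\underline\beta\in[0,1]^n\mid 0=\beta_1\le\dots\le\beta_n,\ \beta_j+\beta_{n+2-j}=1\text{ for }j\ge2\}$ (closed simplices). $\Pi(\underline\beta)=\prod_{j=1}^n(x-e^{-2\pi i\beta_j})$ is injective on each; $T^{pol}_{\mathrm{HOR}k}(n,\mathbb{R})=\Pi(T^{scal}_{\mathrm{HOR}k}(n,\mathbb{R}))$ is the set of monic real polynomials $p=\sum_{j=0}^n p_jx^j$ of degree $n$ with $p_j=(-1)^{k-1}p_{n-j}$ and all zeros in $S^1$. $S^{(k)}(p)$ is the upper triangular Toeplitz matrix with $(i,j)$-entry $p_{n-(j-i)}$ for $i\le j$; $T_{\mathrm{HOR}k}(n,\mathbb{R}):=S^{(k)}(T^{pol}_{\mathrm{HOR}k}(n,\mathbb{R}))$; $\mathrm{int}(T_{\mathrm{HOR}k}(n,\mathbb{R}))$ is the image under $S^{(k)}\circ\Pi$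 of the relative interior of the simplex $T^{scal}_{\mathrm{HOR}k}(n,\mathbb{R})$. $R^{mat}_{(k)}(S^{(k)}(p))$ is the companion matrix with first row $(-p_{n-1},\dots,-p_1,-p_0)$, with $E_{n-1}$ in rows $2,\dots,n$ and columns $1,\dots,n-1$, zeros elsewhere. **Spectral pairs of $S$.** For $S=S^{(k)}(\Pi(\underline\beta))$, $\underline\beta\in T^{scal}_{\mathrm{HOR}k}(n,\mathbb{R})$, put $\alpha_j=n\beta_j-j+\frac k2$, $\mathrm{Sp}(S)=\sum_{j=1}^n(\alpha_j)$ (unordered tuple). For each zero $\kappa$ of $p$ of multiplicity $l+1$ the $\alpha_j$ with $e^{-2\pi i\beta_j}=\kappa$ are $\alpha,\alpha+1,\dots,\alpha+l$ for some $\alpha$; $\mathrm{Spp}(S)$ is the sum over the zeros $\kappa$ of $\sum_{j=0}^l(\alpha+j,1+l-2j)$ (the spp-ladder for $\kappa$). **Spectral pair ladders.** An spp-ladder with center $m\in\mathbb{Z}$, length $l+1\ge1$ and first spectral number $\alpha\in\mathbb{R}$ is $\sum_{j=0}^l(\alpha+j,m+l-2j)$. Its partner is $\sum_{j=0}^l(m-l-1-\alpha+j,m+l-2j)$. It is single if it equals its partner, i.e. $2\alpha+l+1-m=0$. An sppl-pair is an unordered pair of two spp-ladders which are partners of one another and for which $2\alpha+l+1-m\ne0$. **Seifert form pairs.** A Seifert form pair $(H_{\mathbb{R}},L)$ is a finite dimensional real vector space with a nondegenerate bilinear form $L$; its monodromy $M$ is the automorphism with $L(Ma,b)=L(b,a)$;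 $N=\log M_u$ with $M_u$ the unipotent part; $H_\lambda\subset H_{\mathbb{C}}$ generalized eigenspaces of $M$; $L$ is extended $\mathbb{C}$-bilinearly. It is an $S^1$-Seifert form pair if all eigenvalues of $M$ are in $S^1$. Irreducible ($L$-orthogonally indecomposable) $S^1$-Seifert form pairs, up to isomorphism: • $\mathrm{Seif}(\lambda,1,q,\varepsilon)$, ($\lambda=1$, $q$ odd) or ($\lambda=-1$, $q$ even), $\varepsilon\in\{\pm1\}$: $\dim H_{\mathbb{R}}=q$, $H_{\mathbb{C}}=H_\lambda$, one Jordan block, $L(a,N^{q-1}a)\in\varepsilon\mathbb{R}_{>0}$ for $a\in H_{\mathbb{R}}-\mathrm{Im}N$. • $\mathrm{Seif}(\lambda,2,q)$, ($\lambda=1$, $q$ even) or ($\lambda=-1$, $q$ odd): $\dim H_{\mathbb{R}}=2q$, $H_{\mathbb{C}}=H_\lambda$, two Jordan blocks of size $q$. • $\mathrm{Seif}(\lambda,2,q,\zeta)\cong\mathrm{Seif}(\overline\lambda,2,q,\overline\zeta)$, $\lambda,\zeta\in S^1$, $\lambda\neq\pm1$, $\zeta^2=\overline\lambda(-1)^{q+1}$: $\dim H_{\mathbb{R}}=2q$, $H_{\mathbb{C}}=H_\lambda\oplus H_{\overline\lambda}$, two Jordan blocks of size $q$, $L(a,N^{q-1}\overline a)\in\zeta\mathbb{R}_{>0}$ for $a\in H_\lambda-\mathrm{Im}N$. **Polarized enhancement.** An enhancement with center $m$ of an $S^1$-Seifert form pair is a direct $L$-orthogonal decomposition into Seifert form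 pairs $(H^{(j)}_{\mathbb{R}},L^{(j)})$ together with unordered tuples of spectral pairs $\mathrm{Spp}^{(j)}$ such that: (i) $\mathrm{Spp}^{(j)}$ consists of finitely many copies of the same sppl-pair or the same single spp-ladder, of center $m$ (the same for all $j$), length $l_j+1$ of each ladder, and first spectral number $\alpha_j$ of the (or one of the two) ladder(s), and the number of pairs in $\mathrm{Spp}^{(j)}$ is $\dim H^{(j)}_{\mathbb{R}}$; (ii) with $\lambda_j=(-1)^{m+1}e^{-2\pi i\alpha_j}$, $(H^{(j)}_{\mathbb{R}},L^{(j)})$ decomposes into copies of one irreducible Seifert form pair, namely $\mathrm{Seif}(\lambda_j,2,l_j+1,\zeta_j)$ if $2\alpha_j+l_j+1-m\notin\mathbb{Z}$, $\mathrm{Seif}(\lambda_j,2,l_j+1)$ if $2\alpha_j+l_j+1-m$ is an odd integer, $\mathrm{Seif}(\lambda_j,1,l_j+1,\varepsilon_j)$ if it is an even integer. It is polarized if in the first and third case $\zeta_j$ resp. $\varepsilon_j$ equals $e^{\frac12\pi i(2\alpha_j+l_j+1-m)}$. *)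

theory Defs
  imports
    Complex_Main
    "HOL-Library.Multiset"
    "HOL-Library.FuncSet"
    "HOL-Analysis.Linear_Algebra"
    "Jordan_Normal_Form.Char_Poly"
    "Jordan_Normal_Form.Gauss_Jordan_Elimination"
begin

subsection \<open>Complexification of a real vector space\<close>

text \<open>The complexification of a real vector space with underlying type \<open>'v\<close> is carried by
  \<open>'v \<times> 'v\<close>, where the pair \<open>(x, y)\<close> stands for \<open>x + i y\<close>. The complexification of a real
  subspace \<open>V\<close> is \<open>V \<times> V\<close>, and that of a real endomorphism \<open>f\<close> is \<open>map_prod f f\<close>.\<close>

definition cscale :: "complex \<Rightarrow> 'v::real_vector \<times> 'v \<Rightarrow> 'v \<times> 'v" where
  "cscale c a = (Re c *\<^sub>R fst a - Im c *\<^sub>R snd a, Re c *\<^sub>R snd a + Im c *\<^sub>R fst a)"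

interpretation cplx: Vector_Spaces.vector_space
  "cscale :: complex \<Rightarrow> 'v::real_vector \<times> 'v \<Rightarrow> 'v \<times> 'v"
  by unfold_locales (auto simp: cscale_def algebra_simps)

definition cconj :: "'v::real_vector \<times> 'v \<Rightarrow> 'v \<times> 'v" where
  "cconj a = (fst a, - snd a)"

definition cmap :: "('v \<Rightarrow> 'v) \<Rightarrow> 'v \<times> 'v \<Rightarrow> 'v \<times> 'v" where
  "cmap f = map_prod f f"

definition cbil :: "('v::real_vector \<Rightarrow> 'v \<Rightarrow> real) \<Rightarrow> 'v \<times> 'v \<Rightarrow> 'v \<times> 'v \<Rightarrow> complex" where
  "cbil L a b = Complex (L (fst a) (fst b) - L (snd a) (snd b)) (L (fst a) (snd b) + L (snd a) (fst b))"

definition real_points :: "('v::real_vector \<times> 'v) set \<Rightarrow> 'v set" where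
  "real_points W = {x. (x, 0) \<in> W}"

definition direct_sum :: "'i set \<Rightarrow> ('i \<Rightarrow> 'w::comm_monoid_add set) \<Rightarrow> 'w set \<Rightarrow> bool" where
  "direct_sum I U W \<longleftrightarrow> finite I \<and>
     W = {\<Sum>i\<in>I. w i | w. \<forall>i\<in>I. w i \<in> U i} \<and>
     (\<forall>w. (\<forall>i\<in>I. w i \<in> U i) \<and> (\<Sum>i\<in>I. w i) = 0 \<longrightarrow> (\<forall>i\<in>I. w i = 0))"


subsection \<open>Eigenspaces and Jordan blocks\<close>

definition eigenval_on ::
  "('v::real_vector \<times> 'v) set \<Rightarrow> ('v \<times> 'v \<Rightarrow> 'v \<times> 'v) \<Rightarrow> complex \<Rightarrow> bool" where
  "eigenval_on W F c \<longleftrightarrow> (\<exists>a\<in>W. a \<noteq> 0 \<and> F a = cscale c a)"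

definition gen_eigenspace ::
  "('v::real_vector \<times> 'v) set \<Rightarrow> ('v \<times> 'v \<Rightarrow> 'v \<times> 'v) \<Rightarrow> complex \<Rightarrow> ('v \<times> 'v) set" where
  "gen_eigenspace W F c = {a \<in> W. \<exists>m. ((\<lambda>x. F x - cscale c x) ^^ m) a = 0}"

definition jordan_block_on ::
  "('v::real_vector \<times> 'v) set \<Rightarrow> ('v \<times> 'v \<Rightarrow> 'v \<times> 'v) \<Rightarrow> nat \<Rightarrow> complex \<Rightarrow> bool" where
  "jordan_block_on W F q c \<longleftrightarrow> q \<ge> 1 \<and>
     (\<exists>v. inj_on v {..<q} \<and> cplx.independent (v ` {..<q}) \<and> cplx.span (v ` {..<q}) = W \<and>
          F (v 0) = cscale c (v 0) \<and>
          (\<forall>i. Suc i < q \<longrightarrow> F (v (Suc i)) = cscale c (v (Suc i)) + v i))"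

text \<open>The list contains the sizes and eigenvalues of the Jordan blocks.\<close>

definition jordan_blocks_on ::
  "('v::real_vector \<times> 'v) set \<Rightarrow> ('v \<times> 'v \<Rightarrow> 'v \<times> 'v) \<Rightarrow> (nat \<times> complex) list \<Rightarrow> bool" where
  "jordan_blocks_on W F bs \<longleftrightarrow>
     (\<exists>U. direct_sum {..<length bs} U W \<and>
          (\<forall>i<length bs. jordan_block_on (U i) F (fst (bs ! i)) (snd (bs ! i))))"


subsection \<open>Unipotent and nilpotent part of an automorphism\<close>

definition linear_endo_on :: "'v::real_vector set \<Rightarrow> ('v \<Rightarrow> 'v) \<Rightarrow> bool" where
  "linear_endo_on V f \<longleftrightarrow> f ` V \<subseteq> V \<and>
     (\<forall>x\<in>V. \<forall>y\<in>V. f (x + y) = f x + f y) \<and> (\<forall>c. \<forall>x\<in>V. f (c *\<^sub>R x) = c *\<^sub>R f x)"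

text \<open>Multiplicative Jordan decomposition: \<open>s\<close> is semisimple (diagonalizable over the complex
  numbers), \<open>u\<close> is unipotent, and they commute with product \<open>f\<close>.\<close>

definition jordan_decomp_on ::
  "'v::real_vector set \<Rightarrow> ('v \<Rightarrow> 'v) \<Rightarrow> ('v \<Rightarrow> 'v) \<Rightarrow> ('v \<Rightarrow> 'v) \<Rightarrow> bool" where
  "jordan_decomp_on V f s u \<longleftrightarrow> linear_endo_on V s \<and> linear_endo_on V u \<and>
     (\<forall>x\<in>V. s (u x) = f x \<and> u (s x) = f x) \<and>
     (\<exists>B. cplx.span B = V \<times> V \<and> (\<forall>b\<in>B. \<exists>c. cmap s b = cscale c b)) \<and>
     (\<exists>m. \<forall>x\<in>V. ((\<lambda>y. u y - y) ^^ m) x = 0)"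

definition unipotent_part :: "'v::real_vector set \<Rightarrow> ('v \<Rightarrow> 'v) \<Rightarrow> 'v \<Rightarrow> 'v" where
  "unipotent_part V f = (THE u. u \<in> extensional V \<and> (\<exists>s. jordan_decomp_on V f s u))"

text \<open>Logarithm of the unipotent part; the logarithm series stops at the exponent \<open>dim V\<close>.\<close>

definition nilpotent_part :: "'v::real_vector set \<Rightarrow> ('v \<Rightarrow> 'v) \<Rightarrow> 'v \<Rightarrow> 'v" where
  "nilpotent_part V f x =
     (\<Sum>j=1..dim V. ((-1) ^ (j + 1) / real j) *\<^sub>R ((\<lambda>y. unipotent_part V f y - y) ^^ j) x)"


subsection \<open>Seifert form pairs\<close>

text \<open>All pairs below are subspaces \<open>V\<close> of one real vector space, with the restriction to \<open>V\<close>
  of a bilinear form \<open>L\<close> on that space.\<close>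

definition seifert_pair :: "'v::real_vector set \<Rightarrow> ('v \<Rightarrow> 'v \<Rightarrow> real) \<Rightarrow> bool" where
  "seifert_pair V L \<longleftrightarrow> subspace V \<and> (\<exists>B. finite B \<and> span B = V) \<and> bilinear L \<and>
     (\<forall>a\<in>V. (\<forall>b\<in>V. L a b = 0) \<longrightarrow> a = 0)"

definition monodromy :: "'v::real_vector set \<Rightarrow> ('v \<Rightarrow> 'v \<Rightarrow> real) \<Rightarrow> 'v \<Rightarrow> 'v" where
  "monodromy V L = (\<lambda>a\<in>V. THE c. c \<in> V \<and> (\<forall>b\<in>V. L c b = L b a))"

definition S1_seifert_pair :: "'v::real_vector set \<Rightarrow> ('v \<Rightarrow> 'v \<Rightarrow> real) \<Rightarrow> bool" where
  "S1_seifert_pair V L \<longleftrightarrow> seifert_pair V L \<and>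
     (\<forall>c. eigenval_on (V \<times> V) (cmap (monodromy V L)) c \<longrightarrow> cmod c = 1)"

definition seifert_decomp ::
  "'v::real_vector set \<Rightarrow> ('v \<Rightarrow> 'v \<Rightarrow> real) \<Rightarrow> 'j set \<Rightarrow> ('j \<Rightarrow> 'v set) \<Rightarrow> bool" where
  "seifert_decomp V L J U \<longleftrightarrow> direct_sum J U V \<and> (\<forall>j\<in>J. seifert_pair (U j) L) \<and>
     (\<forall>i\<in>J. \<forall>j\<in>J. i \<noteq> j \<longrightarrow> (\<forall>a\<in>U i. \<forall>b\<in>U j. L a b = 0))"

definition irreducible_S1_pair :: "'v::real_vector set \<Rightarrow> ('v \<Rightarrow> 'v \<Rightarrow> real) \<Rightarrow> bool" where
  "irreducible_S1_pair V L \<longleftrightarrow> S1_seifert_pair V L \<and> V \<noteq> {0} \<and>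
     \<not> (\<exists>U. seifert_decomp V L {..<2::nat} U \<and> U 0 \<noteq> {0} \<and> U 1 \<noteq> {0})"

definition Seif1 ::
  "complex \<Rightarrow> nat \<Rightarrow> complex \<Rightarrow> 'v::real_vector set \<Rightarrow> ('v \<Rightarrow> 'v \<Rightarrow> real) \<Rightarrow> bool" where
  "Seif1 lam q eps V L \<longleftrightarrow>
     (let M = monodromy V L; N = nilpotent_part V M in
        (lam = 1 \<and> odd q \<or> lam = -1 \<and> even q) \<and> eps \<in> {1, -1} \<and>
        irreducible_S1_pair V L \<and> dim V = q \<and>
        gen_eigenspace (V \<times> V) (cmap M) lam = V \<times> V \<and>
        jordan_blocks_on (V \<times> V) (cmap M) [(q, lam)] \<and>
        (\<forall>a \<in> V - N ` V. \<exists>r>0. complex_of_real (L a ((N ^^ (q - 1)) a)) = eps * of_real r))"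

definition Seif2 ::
  "complex \<Rightarrow> nat \<Rightarrow> 'v::real_vector set \<Rightarrow> ('v \<Rightarrow> 'v \<Rightarrow> real) \<Rightarrow> bool" where
  "Seif2 lam q V L \<longleftrightarrow>
     (let M = monodromy V L in
        (lam = 1 \<and> even q \<or> lam = -1 \<and> odd q) \<and>
        irreducible_S1_pair V L \<and> dim V = 2 * q \<and>
        gen_eigenspace (V \<times> V) (cmap M) lam = V \<times> V \<and>
        jordan_blocks_on (V \<times> V) (cmap M) [(q, lam), (q, lam)])"

definition Seif2z ::
  "complex \<Rightarrow> nat \<Rightarrow> complex \<Rightarrow> 'v::real_vector set \<Rightarrow> ('v \<Rightarrow> 'v \<Rightarrow> real) \<Rightarrow> bool" where
  "Seif2z lam q zeta V L \<longleftrightarrow>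
     (let M = monodromy V L; N = nilpotent_part V M in
        cmod lam = 1 \<and> cmod zeta = 1 \<and> lam \<noteq> 1 \<and> lam \<noteq> -1 \<and> zeta\<^sup>2 = cnj lam * (-1) ^ (q + 1) \<and>
        irreducible_S1_pair V L \<and> dim V = 2 * q \<and>
        direct_sum {lam, cnj lam} (gen_eigenspace (V \<times> V) (cmap M)) (V \<times> V) \<and>
        jordan_blocks_on (V \<times> V) (cmap M) [(q, lam), (q, cnj lam)] \<and>
        (\<forall>a \<in> gen_eigenspace (V \<times> V) (cmap M) lam - cmap N ` (V \<times> V).
           \<exists>r>0. cbil L a ((cmap N ^^ (q - 1)) (cconj a)) = zeta * of_real r))"

definition sum_of_copies ::
  "('v::real_vector set \<Rightarrow> ('v \<Rightarrow> 'v \<Rightarrow> real) \<Rightarrow> bool) \<Rightarrow> 'v set \<Rightarrow> ('v \<Rightarrow> 'v \<Rightarrow> real) \<Rightarrow> bool" where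
  "sum_of_copies Q V L \<longleftrightarrow> (\<exists>(t::nat) U. seifert_decomp V L {..<t} U \<and> (\<forall>i<t. Q (U i) L))"


subsection \<open>Spectral pair ladders and polarized enhancements\<close>

text \<open>First spectral number \<open>al\<close>, center \<open>m\<close>, length \<open>l + 1\<close>.\<close>

definition spp_ladder :: "real \<Rightarrow> int \<Rightarrow> nat \<Rightarrow> (real \<times> int) multiset" where
  "spp_ladder al m l = image_mset (\<lambda>j. (al + real j, m + int l - 2 * int j)) (mset_set {0..l})"

definition spp_partner :: "real \<Rightarrow> int \<Rightarrow> nat \<Rightarrow> (real \<times> int) multiset" where
  "spp_partner al m l = spp_ladder (of_int m - real l - 1 - al) m l"

definition single_ladder :: "real \<Rightarrow> int \<Rightarrow> nat \<Rightarrow> bool" where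
  "single_ladder al m l \<longleftrightarrow> spp_ladder al m l = spp_partner al m l"

definition ladder_copies :: "real \<Rightarrow> int \<Rightarrow> nat \<Rightarrow> (real \<times> int) multiset \<Rightarrow> bool" where
  "ladder_copies al m l P \<longleftrightarrow> (\<exists>c\<ge>1.
     single_ladder al m l \<and> P = repeat_mset c (spp_ladder al m l) \<or>
     2 * al + real l + 1 - of_int m \<noteq> 0 \<and>
       P = repeat_mset c (spp_ladder al m l + spp_partner al m l))"

definition is_odd_int :: "real \<Rightarrow> bool" where
  "is_odd_int x \<longleftrightarrow> (\<exists>i::int. odd i \<and> x = of_int i)"

definition is_even_int :: "real \<Rightarrow> bool" where
  "is_even_int x \<longleftrightarrow> (\<exists>i::int. even i \<and> x = of_int i)"

text \<open>The number \<open>z j\<close> is the parameter called zeta respectively epsilon of the irreducible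
  pairs in the summand with index \<open>j\<close>.\<close>

definition enhancement ::
  "int \<Rightarrow> 'v::real_vector set \<Rightarrow> ('v \<Rightarrow> 'v \<Rightarrow> real) \<Rightarrow> 'j set \<Rightarrow> ('j \<Rightarrow> 'v set) \<Rightarrow>
   ('j \<Rightarrow> (real \<times> int) multiset) \<Rightarrow> ('j \<Rightarrow> real) \<Rightarrow> ('j \<Rightarrow> nat) \<Rightarrow> ('j \<Rightarrow> complex) \<Rightarrow> bool" where
  "enhancement m H L J U P al l z \<longleftrightarrow> S1_seifert_pair H L \<and> seifert_decomp H L J U \<and>
     (\<forall>j\<in>J. ladder_copies (al j) m (l j) (P j) \<and> size (P j) = dim (U j) \<and>
        (let lam = (-1) powi (m + 1) * cis (- 2 * pi * al j);
             d = 2 * al j + real (l j) + 1 - of_int m in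
           (d \<notin> \<int> \<longrightarrow> sum_of_copies (Seif2z lam (l j + 1) (z j)) (U j) L) \<and>
           (is_odd_int d \<longrightarrow> sum_of_copies (Seif2 lam (l j + 1)) (U j) L) \<and>
           (is_even_int d \<longrightarrow> sum_of_copies (Seif1 lam (l j + 1) (z j)) (U j) L)))"

definition polarized_enhancement ::
  "int \<Rightarrow> 'v::real_vector set \<Rightarrow> ('v \<Rightarrow> 'v \<Rightarrow> real) \<Rightarrow> 'j set \<Rightarrow> ('j \<Rightarrow> 'v set) \<Rightarrow>
   ('j \<Rightarrow> (real \<times> int) multiset) \<Rightarrow> bool" where
  "polarized_enhancement m H L J U P \<longleftrightarrow>
     (\<exists>al l z. enhancement m H L J U P al l z \<and>
        (\<forall>j\<in>J. let d = 2 * al j + real (l j) + 1 - of_int m in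
           \<not> is_odd_int d \<longrightarrow> z j = cis (pi / 2 * d)))"


subsection \<open>HOR matrices\<close>

text \<open>Points of \<open>n\<close>-dimensional real space are functions on the indices \<open>1, \<dots>, n\<close>, with value
  \<open>0\<close> at all other indices.\<close>

definition Tscal1 :: "nat \<Rightarrow> (nat \<Rightarrow> real) set" where
  "Tscal1 n = {b. (\<forall>j. j \<notin> {1..n} \<longrightarrow> b j = 0) \<and> (\<forall>j\<in>{1..n}. b j \<in> {0..1}) \<and> mono_on {1..n} b \<and>
     (\<forall>j\<in>{1..n}. b j + b (n + 1 - j) = 1)}"

definition Tscal2 :: "nat \<Rightarrow> (nat \<Rightarrow> real) set" where
  "Tscal2 n = {b. (\<forall>j. j \<notin> {1..n} \<longrightarrow> b j = 0) \<and> (\<forall>j\<in>{1..n}. b j \<in> {0..1}) \<and> mono_on {1..n} b \<and>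
     b 1 = 0 \<and> (\<forall>j\<in>{2..n}. b j + b (n + 2 - j) = 1)}"

definition Tscal :: "nat \<Rightarrow> nat \<Rightarrow> (nat \<Rightarrow> real) set" where
  "Tscal k n = (if k = 1 then Tscal1 n else Tscal2 n)"

definition affine_hull_fun :: "(nat \<Rightarrow> real) set \<Rightarrow> (nat \<Rightarrow> real) set" where
  "affine_hull_fun A = {(\<lambda>j. \<Sum>b\<in>F. u b * b j) | F u. finite F \<and> F \<subseteq> A \<and> sum u F = 1}"

definition rel_interior_fun :: "nat \<Rightarrow> (nat \<Rightarrow> real) set \<Rightarrow> (nat \<Rightarrow> real) set" where
  "rel_interior_fun n A = {b \<in> A. \<exists>e>0. \<forall>c \<in> affine_hull_fun A.
     (\<forall>j\<in>{1..n}. \<bar>c j - b j\<bar> < e) \<longrightarrow> c \<in> A}"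

definition hor_Pi :: "nat \<Rightarrow> (nat \<Rightarrow> real) \<Rightarrow> complex poly" where
  "hor_Pi n b = (\<Prod>j=1..n. [:- cis (- 2 * pi * b j), 1:])"

definition Tpol :: "nat \<Rightarrow> nat \<Rightarrow> real poly set" where
  "Tpol k n = {p. \<exists>b\<in>Tscal k n. map_poly complex_of_real p = hor_Pi n b}"

text \<open>Rows and columns of matrices are indexed by \<open>0, \<dots>, n - 1\<close>.\<close>

definition hor_S :: "nat \<Rightarrow> real poly \<Rightarrow> real mat" where
  "hor_S n p = mat n n (\<lambda>(i, j). if i \<le> j then coeff p (n - (j - i)) else 0)"

definition T_HOR :: "nat \<Rightarrow> nat \<Rightarrow> real mat set" where
  "T_HOR k n = hor_S n ` Tpol k n"

definition int_T_HOR :: "nat \<Rightarrow> nat \<Rightarrow> real mat set" where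
  "int_T_HOR k n = {hor_S n p | p b.
     b \<in> rel_interior_fun n (Tscal k n) \<and> map_poly complex_of_real p = hor_Pi n b}"

definition hor_poly :: "nat \<Rightarrow> real mat \<Rightarrow> real poly" where
  "hor_poly k S = (THE p. p \<in> Tpol k (dim_row S) \<and> S = hor_S (dim_row S) p)"

definition hor_beta :: "nat \<Rightarrow> real mat \<Rightarrow> nat \<Rightarrow> real" where
  "hor_beta k S = (THE b. b \<in> Tscal k (dim_row S) \<and>
     map_poly complex_of_real (hor_poly k S) = hor_Pi (dim_row S) b)"

definition companion_row :: "nat \<Rightarrow> real poly \<Rightarrow> real mat" where
  "companion_row n p = mat n n (\<lambda>(i, j).
     if i = 0 then - coeff p (n - 1 - j) else if i = j + 1 then 1 else 0)"

definition hor_Rmat :: "nat \<Rightarrow> real mat \<Rightarrow> real mat" where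
  "hor_Rmat k S = companion_row (dim_row S) (hor_poly k S)"

definition mat_inv :: "real mat \<Rightarrow> real mat" where
  "mat_inv S = the (mat_inverse S)"

definition T_mat :: "nat \<Rightarrow> real mat set" where
  "T_mat n = {S \<in> carrier_mat n n. upper_triangular S \<and> (\<forall>i<n. S $$ (i, i) = 1) \<and>
     (\<forall>c. eigenvalue (map_mat complex_of_real (mat_inv S * transpose_mat S)) c \<longrightarrow> cmod c = 1)}"

definition hor_eigenspace :: "nat \<Rightarrow> ('v::real_vector \<Rightarrow> 'v) \<Rightarrow> complex \<Rightarrow> ('v \<times> 'v) set" where
  "hor_eigenspace n R c = {a. ((\<lambda>x. cmap R x - cscale c x) ^^ n) a = 0}"

text \<open>The real summand attached to \<open>c\<close>: real points of the generalized eigenspace of \<open>c\<close> if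
  \<open>c\<close> is \<open>1\<close> or \<open>-1\<close>, and else of the sum of those of \<open>c\<close> and its conjugate.\<close>

definition hor_summand :: "nat \<Rightarrow> ('v::real_vector \<Rightarrow> 'v) \<Rightarrow> complex \<Rightarrow> 'v set" where
  "hor_summand n R c =
     (if c \<in> {1, -1} then real_points (hor_eigenspace n R c)
      else real_points {a + b | a b. a \<in> hor_eigenspace n R c \<and> b \<in> hor_eigenspace n R (cnj c)})"


subsection \<open>Spectrum and spectral pairs of a HOR matrix\<close>

definition hor_alpha :: "nat \<Rightarrow> real mat \<Rightarrow> nat \<Rightarrow> real" where
  "hor_alpha k S j = real (dim_row S) * hor_beta k S j - real j + real k / 2"

definition hor_Sp :: "nat \<Rightarrow> real mat \<Rightarrow> real multiset" where
  "hor_Sp k S = image_mset (hor_alpha k S) (mset_set {1..dim_row S})"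

text \<open>The ladder of a zero \<open>c\<close> of multiplicity \<open>l + 1\<close> has length \<open>l + 1\<close>, where
  \<open>l = hor_ladder_l k S c\<close>.\<close>

definition hor_ladder_l :: "nat \<Rightarrow> real mat \<Rightarrow> complex \<Rightarrow> nat" where
  "hor_ladder_l k S c = order c (map_poly complex_of_real (hor_poly k S)) - 1"

definition hor_ladder_alpha :: "nat \<Rightarrow> real mat \<Rightarrow> complex \<Rightarrow> real" where
  "hor_ladder_alpha k S c = (THE al.
     {hor_alpha k S j | j. j \<in> {1..dim_row S} \<and> cis (- 2 * pi * hor_beta k S j) = c} =
     {al + real i | i. i \<le> hor_ladder_l k S c})"

definition hor_ladder :: "nat \<Rightarrow> real mat \<Rightarrow> complex \<Rightarrow> (real \<times> int) multiset" where
  "hor_ladder k S c = spp_ladder (hor_ladder_alpha k S c) 1 (hor_ladder_l k S c)"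

definition hor_Spp :: "nat \<Rightarrow> real mat \<Rightarrow> (real \<times> int) multiset" where
  "hor_Spp k S =
     (\<Sum>c \<in> {c. poly (map_poly complex_of_real (hor_poly k S)) c = 0}. hor_ladder k S c)"


subsection \<open>Continuous eigenvalue functions along a path of HOR matrices\<close>

text \<open>The topology on matrices is the entrywise one.\<close>

definition hor_path :: "nat \<Rightarrow> nat \<Rightarrow> real mat \<Rightarrow> (real \<Rightarrow> real mat) \<Rightarrow> bool" where
  "hor_path k n S g \<longleftrightarrow> (\<forall>r\<in>{0..1}. g r \<in> T_HOR k n) \<and>
     (\<forall>i<n. \<forall>j<n. continuous_on {0..1} (\<lambda>r. g r $$ (i, j))) \<and>
     g 0 = 1\<^sub>m n \<and> g 1 = S \<and> (\<forall>r\<in>{0..<1}. g r \<in> int_T_HOR k n)"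

text \<open>Eigenvalues are counted with their algebraic multiplicity.\<close>

definition hor_lift :: "nat \<Rightarrow> nat \<Rightarrow> (real \<Rightarrow> real mat) \<Rightarrow> (nat \<Rightarrow> real \<Rightarrow> real) \<Rightarrow> bool" where
  "hor_lift k n g al \<longleftrightarrow>
     (\<forall>j\<in>{1..n}. continuous_on {0..1} (al j) \<and> al j 0 = 0) \<and>
     (\<forall>r\<in>{0..1}. char_poly (map_mat complex_of_real (hor_Rmat k (g r))) =
        (\<Prod>j=1..n. [:- cis (- 2 * pi * (al j r + real j - real k / 2) / real n), 1:]))"

end

theory Submission
  imports Defs "HOL-Analysis.Function_Metric"
begin

text \<open>
  The vector \<open>e 0\<close> is cyclic for \<open>R\<close> with minimal polynomial \<open>p\<close>, so the complexification is
  \<open>\<complex>[x]/(p)\<close> with \<open>R\<close> acting as multiplication by \<open>x\<close>. Since \<open>L\<close> is given by a Toeplitz matrix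
  made from the palindromic polynomial \<open>p\<close>, the map \<open>R\<close> is an isometry of \<open>L\<close> and
  \<open>L (R\<^sup>n a) b = (-1)\<^sup>k L b a\<close>; hence the monodromy is \<open>(-1)\<^sup>k R\<^sup>n\<close>, which gives the generalized
  eigenspaces, the Jordan blocks and the orthogonal decomposition.

  For the signs one only needs \<open>L a (N\<^sup>l (cconj a))\<close> at one generator \<open>a\<close> of the block of a zero
  \<open>\<kappa>\<close> of multiplicity \<open>l + 1\<close>: the value is, up to a positive factor, an explicit expression in
  \<open>\<kappa>\<close> and the \<open>l + 1\<close>-st derivative of \<open>p\<close> at \<open>\<kappa>\<close>, whose phase is found by counting the zeros
  on the arc between \<open>1\<close> and \<open>\<kappa>\<close>. This count is what the spectral numbers record.

  If the monodromy eigenvalue of a pair of conjugate zeros is real, its summand contains two Jordan blocks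
  of the same eigenvalue. The form \<open>L a (N\<^sup>l b)\<close> on the tops of the chains is then definite or
  alternating, and the summand splits into two orthogonal chains or is irreducible, respectively.

  The eigenvalue functions along a path are continuous because \<open>\<beta> \<mapsto> \<Pi>(\<beta>)\<close> is a continuous
  injection of a compact simplex, hence a homeomorphism onto its image.
\<close>

section \<open>Combinatorics of the angles\<close>

text \<open>The sign is computable because every ingredient is a polynomial in \<open>R\<close>. On
  the block of a zero c of multiplicity l + 1 the logarithm \<open>N\<close> is (R - c) times a
  polynomial with value n / c at c, the logarithmic derivative of x^n; hence the power l of
  \<open>N\<close> only sees the value at c of the polynomial representing a vector. Up to a
  positive factor there remains the product of 1 - kappa / c over the other zeros kappa. A factor 1
  - e^(2 pi i s) has argument pi s - (pi / 2) sgn s, so the phase splits into a sum of angles, known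
  from the reflection symmetry, and a count of zeros on either side of c. The obstacle is that
  \<open>unipotent_part\<close> is a definite description, relative to a subspace and to a map
  prescribed only there. It is met by a global construction: the Chinese remainder theorem gives
  polynomials in \<open>M\<close> for both parts, averaging with the conjugate makes them real, and
  uniqueness is shown on every \<open>M\<close>-invariant subspace. The logarithm series is cut off
  at the dimension of the subspace, so its action on blocks is determined for every cutoff d at
  least 1.\<close>

declare One_nat_def [simp del]

lemma cis_neg_2pi_eq_iff:
  "cis (- 2 * pi * s) = cis (- 2 * pi * t) \<longleftrightarrow> s - t \<in> \<int>"
proof -
  have "cis (- 2 * pi * s) = cis (- 2 * pi * t) \<longleftrightarrow> (\<exists>m::int. - 2 * pi * s = - 2 * pi * t + 2 * pi * m)"
    by (subst sin_cos_eq_iff[symmetric]) (auto simp: complex_eq_iff)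
  also have "\<dots> \<longleftrightarrow> (\<exists>m::int. s - t = of_int m)"
  proof safe
    fix m :: int assume "- 2 * pi * s = - 2 * pi * t + 2 * pi * m"
    then have "2 * pi * (t - s) = 2 * pi * m" by (simp add: algebra_simps)
    then have "t - s = m" by simp
    then show "\<exists>m::int. s - t = of_int m" by (intro exI[of _ "-m"]) auto
  next
    fix m :: int assume "s - t = of_int m"
    then have "s = t + m" by simp
    then show "\<exists>m::int. - 2 * pi * s = - 2 * pi * t + 2 * pi * m"
      by (intro exI[of _ "-m"]) (simp add: algebra_simps)
  qed
  finally show ?thesis by (auto simp: Ints_def)
qed

text \<open>In the unit interval only the angles 0 and 1 give the same point of the circle. This
  ambiguity is why the zero 1 is treated apart from the other zeros below.\<close>

lemma cis_neg_2pi_eq_unit_iff: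
  assumes "s \<in> {0..1}" "t \<in> {0..1}"
  shows "cis (- 2 * pi * s) = cis (- 2 * pi * t) \<longleftrightarrow> s = t \<or> (s = 0 \<and> t = 1) \<or> (s = 1 \<and> t = 0)"
proof -
  have "s - t \<in> \<int> \<longleftrightarrow> s - t \<in> {-1, 0, 1}"
  proof
    assume "s - t \<in> \<int>"
    then obtain m :: int where m: "s - t = of_int m" by (auto elim: Ints_cases)
    with assms have "of_int m \<le> (1::real)" "-1 \<le> (of_int m :: real)" by auto
    then have "m \<le> 1" "-1 \<le> m" by linarith+
    then have "m = -1 \<or> m = 0 \<or> m = 1" by arith
    with m show "s - t \<in> {-1, 0, 1}" by auto
  qed auto
  also have "\<dots> \<longleftrightarrow> s = t \<or> (s = 0 \<and> t = 1) \<or> (s = 1 \<and> t = 0)"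
    using assms by auto
  finally show ?thesis unfolding cis_neg_2pi_eq_iff .
qed

lemma cis_neg_2pi_unit_eq_1_iff:
  assumes "s \<in> {0..1}"
  shows "cis (- 2 * pi * s) = 1 \<longleftrightarrow> s = 0 \<or> s = 1"
  using cis_neg_2pi_eq_unit_iff[of s 0] assms by auto

lemma order_prod_linear:
  assumes "finite I"
  shows "Polynomial.order c (\<Prod>j\<in>I. [:- f j, 1:]) = card {j\<in>I. f j = (c::complex)}"
  using assms
proof (induction I rule: finite_induct)
  case (insert x I)
  have "(\<Prod>j\<in>I. [:- f j, 1:]) \<noteq> 0" using insert by (auto simp: prod_zero_iff)
  moreover have "Polynomial.order c [:- f x, 1:] = (if f x = c then 1 else 0)"
    using order_power_n_n[of c 1] by (auto simp: order_0I)
  moreover have "{j \<in> insert x I. f j = c} = (if f x = c then insert x {j\<in>I. f j = c} else {j\<in>I. f j = c})"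
    by auto
  ultimately show ?case using insert by (simp add: order_mult del: mult_pCons_left)
qed auto

lemma initial_segment_eq:
  fixes X :: "nat set"
  assumes "X \<subseteq> {1..n}" "\<And>i i'. i \<le> i' \<Longrightarrow> 1 \<le> i \<Longrightarrow> i' \<in> X \<Longrightarrow> i \<in> X"
  shows "X = {1..card X}"
proof (cases "X = {}")
  case False
  have fin: "finite X" using assms(1) finite_subset by blast
  have "X = {1..Max X}"
  proof (intro Set.set_eqI iffI)
    fix i assume "i \<in> X" then show "i \<in> {1..Max X}" using Max_ge[OF fin] assms(1) by auto
  next
    fix i assume "i \<in> {1..Max X}" then show "i \<in> X" using assms(2)[of i "Max X"] Max_in[OF fin False] by auto
  qed
  then show ?thesis by (metis card_atLeastAtMost diff_Suc_1)
qed simp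

lemma final_segment_eq:
  fixes X :: "nat set"
  assumes "X \<subseteq> {1..n}" "\<And>i i'. i' \<le> i \<Longrightarrow> i \<le> n \<Longrightarrow> i' \<in> X \<Longrightarrow> i \<in> X"
  shows "X = {n + 1 - card X..n}"
proof (cases "X = {}")
  case False
  have fin: "finite X" using assms(1) finite_subset by blast
  have eq: "X = {Min X..n}"
  proof (intro Set.set_eqI iffI)
    fix i assume "i \<in> X" then show "i \<in> {Min X..n}" using Min_le[OF fin] assms(1) by auto
  next
    fix i assume "i \<in> {Min X..n}" then show "i \<in> X" using assms(2)[of "Min X" i] Min_in[OF fin False] by auto
  qed
  have "Min X \<le> n" using assms Min_in[OF fin False] by auto
  then have "n + 1 - card X = Min X" using arg_cong[OF eq, of card] by simp
  then show ?thesis using eq by simp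
qed simp

text \<open>Monotonicity makes the indices with value below t an initial segment and those with
  value above t a final one. A spectral number depends on the position j of an angle; this turns
  positions into two counts.\<close>

lemma mono_on_block:
  fixes b :: "nat \<Rightarrow> real"
  assumes "mono_on {1..n} b"
  shows "{j\<in>{1..n}. b j = t} = {card {j\<in>{1..n}. b j < t} + 1 .. n - card {j\<in>{1..n}. b j > t}}"
proof -
  have lt: "{j\<in>{1..n}. b j < t} = {1..card {j\<in>{1..n}. b j < t}}"
  proof (rule initial_segment_eq[of _ n])
    fix i i' assume "i \<le> i'" "1 \<le> i" "i' \<in> {j\<in>{1..n}. b j < t}"
    then show "i \<in> {j\<in>{1..n}. b j < t}" using mono_onD[OF assms, of i i'] by auto
  qed auto
  have gt: "{j\<in>{1..n}. b j > t} = {n + 1 - card {j\<in>{1..n}. b j > t}..n}"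
  proof (rule final_segment_eq)
    fix i i' assume "i' \<le> i" "i \<le> n" "i' \<in> {j\<in>{1..n}. b j > t}"
    then show "i \<in> {j\<in>{1..n}. b j > t}" using mono_onD[OF assms, of i' i] by auto
  qed auto
  have le: "card {j\<in>{1..n}. b j > t} \<le> n"
    using card_mono[of "{1..n}" "{j\<in>{1..n}. b j > t}"] by (simp add: subset_iff)
  have *: "X - Y - Z = {y + 1..n - z}"
    if "X = {1..n}" "Y = {1..y}" "Z = {n + 1 - z..n}" "z \<le> n" for X Y Z :: "nat set" and y z
    using that by auto
  have "{j\<in>{1..n}. b j = t} = {1..n} - {j\<in>{1..n}. b j < t} - {j\<in>{1..n}. b j > t}" by auto
  also have "\<dots> = {card {j\<in>{1..n}. b j < t} + 1 .. n - card {j\<in>{1..n}. b j > t}}"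
    by (rule *[OF refl lt gt le])
  finally show ?thesis .
qed

text \<open>A sorted list is determined by its multiset of entries, and the counts at all values t
  determine that multiset.\<close>

lemma mono_on_eq_of_card_eq:
  fixes b b' :: "nat \<Rightarrow> real"
  assumes "mono_on {1..n} b" "mono_on {1..n} b'"
    and "\<And>t. card {j\<in>{1..n}. b j = t} = card {j\<in>{1..n}. b' j = t}"
    and "j \<in> {1..n}"
  shows "b j = b' j"
proof -
  have s: "sorted (map b [1..<Suc n])" if "mono_on {1..n} b" for b :: "nat \<Rightarrow> real"
    using that by (auto simp: sorted_iff_nth_mono_less simp del: upt_Suc intro!: mono_onD[OF that])
  have c: "count (mset (map b [1..<Suc n])) t = card {j\<in>{1..n}. b j = t}" for b :: "nat \<Rightarrow> real" and t
    by (subst mset_map, subst count_image_mset', simp only: mset_upt, subst sum.mono_neutral_cong_right[where S="{j\<in>{1..n}. b j = t}" and h="\<lambda>_. 1"]) auto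
  have "mset (map b [1..<Suc n]) = mset (map b' [1..<Suc n])"
    by (rule multiset_eqI) (simp only: c assms)
  then have "map b [1..<Suc n] = map b' [1..<Suc n]"
    using s[OF assms(1)] s[OF assms(2)] by (metis properties_for_sort)
  then have "map b [1..<Suc n] ! (j - 1) = map b' [1..<Suc n] ! (j - 1)" by (rule arg_cong)
  then show ?thesis using assms(4) by (auto simp del: upt_Suc simp: nth_upt less_Suc_eq_le)
qed

section \<open>The reflection symmetry of the angles\<close>

locale hor_scal =
  fixes n k :: nat and b :: "nat \<Rightarrow> real"
  assumes n1: "n \<ge> 1" and k12: "k \<in> {1, 2}" and b_Tscal: "b \<in> Tscal k n"
begin

lemma b_range: "j \<in> {1..n} \<Longrightarrow> b j \<in> {0..1}"
  and b_mono: "mono_on {1..n} b"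
  and b_outside: "j \<notin> {1..n} \<Longrightarrow> b j = 0"
  using b_Tscal by (auto simp: Tscal_def Tscal1_def Tscal2_def split: if_splits)

text \<open>The involution of the indices that realises the passage from beta to 1 - beta. For k = 2
  the index 1, whose angle is 0, is sent to itself, which causes the terms k - 1 below.\<close>

definition rfl :: "nat \<Rightarrow> nat" where
  "rfl j = (if k = 1 then n + 1 - j else if j = 1 then 1 else n + 2 - j)"

lemma b_rfl: "j \<in> {1..n} \<Longrightarrow> b j + b (rfl j) = (if k = 2 \<and> j = 1 then 0 else 1)"
  unfolding rfl_def using b_Tscal k12
  by (cases "k = 1"; cases "j = 1") (auto simp: Tscal_def Tscal1_def Tscal2_def dest!: bspec[where x=j])

lemma b_1_k2: "k = 2 \<Longrightarrow> b 1 = 0"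
  using b_Tscal by (auto simp: Tscal_def Tscal2_def)

lemma rfl_in: "j \<in> {1..n} \<Longrightarrow> rfl j \<in> {1..n}" and rfl_rfl: "j \<in> {1..n} \<Longrightarrow> rfl (rfl j) = j"
  and rfl_eq_1: "k = 2 \<Longrightarrow> j \<in> {1..n} \<Longrightarrow> rfl j = 1 \<longleftrightarrow> j = 1"
  unfolding rfl_def using k12 by auto

lemma bij_rfl: "bij_betw rfl {1..n} {1..n}"
  by (rule bij_betwI[of _ _ _ rfl]) (use rfl_in rfl_rfl in auto)

text \<open>Twice the sum equals the number of indices whose angle and reflected angle add up to 1,
  since for k = 2 the index 1 contributes 0. The value fixes the constant coefficient of the
  polynomial and enters the phase.\<close>

lemma sum_b: "(\<Sum>j=1..n. b j) = (real n + 1 - real k) / 2"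
proof -
  have "2 * (\<Sum>j=1..n. b j) = (\<Sum>j=1..n. b j) + (\<Sum>j=1..n. b (rfl j))"
    using sum.reindex_bij_betw[OF bij_rfl, of b] by simp
  also have "\<dots> = (\<Sum>j=1..n. if k = 2 \<and> j = 1 then 0 else 1)"
    by (subst sum.distrib[symmetric], rule sum.cong) (use b_rfl in auto)
  also have "\<dots> = real n + 1 - real k"
  proof (cases "k = 2")
    case True
    have "(\<Sum>j=1..n. if k = 2 \<and> j = 1 then 0 else (1::real)) = (\<Sum>j\<in>{2..n}. 1)"
      by (rule sum.mono_neutral_cong_right) (use True in auto)
    then show ?thesis using True n1 by (simp add: of_nat_diff)
  next
    case False then show ?thesis using k12 by auto
  qed
  finally show ?thesis by simp
qed

lemma card_rfl: "card {j\<in>{1..n}. Q (rfl j)} = card {j\<in>{1..n}. Q j}"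
proof -
  have "bij_betw rfl {j\<in>{1..n}. Q (rfl j)} {j\<in>{1..n}. Q j}"
    by (rule bij_betwI[of _ _ _ rfl]) (use rfl_in rfl_rfl in auto)
  then show ?thesis by (rule bij_betw_same_card)
qed

text \<open>Reflection exchanges the angles 0 and 1, except that for k = 2 the index 1 keeps the
  angle 0.\<close>

lemma card_b_0: "card {j\<in>{1..n}. b j = 0} = card {j\<in>{1..n}. b j = 1} + (k - 1)"
proof -
  have "card {j\<in>{1..n}. b j = 1} = card {j\<in>{1..n}. b (rfl j) = 1}"
    using card_rfl[of "\<lambda>j. b j = 1"] by simp
  also have "{j\<in>{1..n}. b (rfl j) = 1} = {j\<in>{1..n}. b j = 0} - (if k = 2 then {1} else {})"
    (is "?X = ?Y")
  proof -
    have "j \<in> ?X \<longleftrightarrow> j \<in> ?Y" for j using b_rfl[of j] k12 b_1_k2 by (cases "j = 1") auto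
    then show ?thesis by blast
  qed
  also have "card \<dots> = card {j\<in>{1..n}. b j = 0} - (k - 1)"
    using k12 b_1_k2 n1 by (auto simp: card_Diff_subset)
  finally have *: "card {j\<in>{1..n}. b j = 1} = card {j\<in>{1..n}. b j = 0} - (k - 1)" .
  have "card {j\<in>{1..n}. b j = 0} \<ge> k - 1"
  proof (cases "k = 2")
    case True then have "1 \<in> {j\<in>{1..n}. b j = 0}" using b_1_k2 n1 by auto
    then have "card {j\<in>{1..n}. b j = 0} > 0" by (subst card_gt_0_iff) auto
    then show ?thesis using True by simp
  qed (use k12 in auto)
  with * show ?thesis by simp
qed

lemma card_b_refl_eq:
  assumes "0 < t" "t < 1" shows "card {j\<in>{1..n}. b j = 1 - t} = card {j\<in>{1..n}. b j = t}"
proof -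
  have "card {j\<in>{1..n}. b j = 1 - t} = card {j\<in>{1..n}. b (rfl j) = 1 - t}"
    using card_rfl[of "\<lambda>j. b j = 1 - t"] by simp
  also have "{j\<in>{1..n}. b (rfl j) = 1 - t} = {j\<in>{1..n}. b j = t}"
    (is "?X = ?Y")
  proof -
    have "j \<in> ?X \<longleftrightarrow> j \<in> ?Y" for j
      using b_rfl[of j] k12 b_1_k2 assms by (cases "j = 1 \<and> k = 2") auto
    then show ?thesis by blast
  qed
  finally show ?thesis .
qed

text \<open>Reflection turns angles above 1 - t into angles below t. The exception is the index 1
  for k = 2, which is counted below t but reflects to itself.\<close>

lemma card_b_refl_gt:
  assumes "0 < t" "t < 1" shows "card {j\<in>{1..n}. b j > 1 - t} + (k - 1) = card {j\<in>{1..n}. b j < t}"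
proof -
  have "card {j\<in>{1..n}. b j > 1 - t} = card {j\<in>{1..n}. b (rfl j) > 1 - t}"
    using card_rfl[of "\<lambda>j. b j > 1 - t"] by simp
  also have "{j\<in>{1..n}. b (rfl j) > 1 - t} = {j\<in>{1..n}. b j < t} - (if k = 2 then {1} else {})"
    (is "?X = ?Y")
  proof -
    have "j \<in> ?X \<longleftrightarrow> j \<in> ?Y" for j
      using b_rfl[of j] k12 b_1_k2 assms by (cases "j = 1") auto
    then show ?thesis by blast
  qed
  also have "card \<dots> = card {j\<in>{1..n}. b j < t} - (k - 1)"
    using k12 b_1_k2 n1 assms by (auto simp: card_Diff_subset)
  finally have *: "card {j\<in>{1..n}. b j > 1 - t} = card {j\<in>{1..n}. b j < t} - (k - 1)" .
  have "card {j\<in>{1..n}. b j < t} \<ge> k - 1"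
  proof (cases "k = 2")
    case True then have "1 \<in> {j\<in>{1..n}. b j < t}" using b_1_k2 n1 assms by auto
    then have "card {j\<in>{1..n}. b j < t} > 0" by (subst card_gt_0_iff) auto
    then show ?thesis using True by simp
  qed (use k12 in auto)
  with * show ?thesis by simp
qed

lemma card_b_total:
  "card {j\<in>{1..n}. b j < t} + card {j\<in>{1..n}. b j = t} + card {j\<in>{1..n}. b j > t} = n"
proof -
  have "{1..n} = {j\<in>{1..n}. b j < t} \<union> {j\<in>{1..n}. b j = t} \<union> {j\<in>{1..n}. b j > t}" by auto
  then have "n = card ({j\<in>{1..n}. b j < t} \<union> {j\<in>{1..n}. b j = t} \<union> {j\<in>{1..n}. b j > t})"
    by (metis card_atLeastAtMost diff_Suc_1)
  also have "\<dots> = card {j\<in>{1..n}. b j < t} + card {j\<in>{1..n}. b j = t} + card {j\<in>{1..n}. b j > t}"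
    by (subst card_Un_disjoint, simp, simp, force, subst card_Un_disjoint) auto
  finally show ?thesis by simp
qed

definition kap :: "nat \<Rightarrow> complex" where "kap j = cis (- 2 * pi * b j)"

lemma kap_nonzero [simp]: "kap j \<noteq> 0" and norm_kap [simp]: "cmod (kap j) = 1"
  by (simp_all add: kap_def)

lemma Pi_kap: "hor_Pi n b = (\<Prod>j=1..n. [:- kap j, 1:])"
  by (simp add: hor_Pi_def kap_def)

lemma order_Pi: "Polynomial.order c (hor_Pi n b) = card {j\<in>{1..n}. kap j = c}"
  unfolding Pi_kap by (rule order_prod_linear) simp

lemma kap_block:
  assumes "0 < t" "t < 1"
  shows "{j\<in>{1..n}. kap j = cis (- 2 * pi * t)} = {j\<in>{1..n}. b j = t}"
proof -
  have "kap j = cis (- 2 * pi * t) \<longleftrightarrow> b j = t" if "j \<in> {1..n}" for j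
    unfolding kap_def using cis_neg_2pi_eq_unit_iff[OF b_range[OF that], of t] assms by auto
  then show ?thesis by blast
qed

lemma kap_block_1: "{j\<in>{1..n}. kap j = 1} = {j\<in>{1..n}. b j = 0} \<union> {j\<in>{1..n}. b j = 1}"
  unfolding kap_def using b_range cis_neg_2pi_unit_eq_1_iff by blast

lemma order_Pi_1: "Polynomial.order 1 (hor_Pi n b) = 2 * card {j\<in>{1..n}. b j = 1} + (k - 1)"
proof -
  have "Polynomial.order 1 (hor_Pi n b) = card {j\<in>{1..n}. b j = 0} + card {j\<in>{1..n}. b j = 1}"
    unfolding order_Pi kap_block_1 by (rule card_Un_disjoint) auto
  then show ?thesis using card_b_0 by simp
qed

lemma Pi_degree: "degree (hor_Pi n b) = n"
  unfolding Pi_kap by (subst degree_prod_eq_sum_degree) auto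

lemma Pi_nonzero: "hor_Pi n b \<noteq> 0"
  unfolding Pi_kap by (auto simp: prod_zero_iff)

lemma Pi_monic: "coeff (hor_Pi n b) n = 1"
  using lead_coeff_prod[of "\<lambda>j. [:- kap j, 1:]" "{1..n}"] Pi_degree by (simp add: Pi_kap)

lemma kap_rfl: "j \<in> {1..n} \<Longrightarrow> kap (rfl j) = inverse (kap j)"
  using cis_neg_2pi_eq_iff[of "b (rfl j)" "- b j"] b_rfl[of j]
  by (auto simp: kap_def add.commute split: if_splits)

text \<open>A product of points of the circle depends only on the sum of the angles, which
  \<open>sum_b\<close> provides. The result is the constant coefficient of the polynomial.\<close>

lemma prod_kap: "(\<Prod>j=1..n. - kap j) = (-1) ^ (k - 1)"
proof -
  have "(\<Prod>j\<in>A. - kap j) = (-1) ^ card A * cis (- 2 * pi * (\<Sum>j\<in>A. b j))" if "finite A" for A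
    using that by (induction A rule: finite_induct) (auto simp: kap_def cis_mult algebra_simps)
  from this[of "{1..n}"] have "(\<Prod>j=1..n. - kap j) = (-1) ^ n * cis (- 2 * pi * ((real n + 1 - real k) / 2))"
    unfolding sum_b by simp
  also have "cis (- 2 * pi * ((real n + 1 - real k) / 2)) = cis (- 2 * pi * (- (real n + (real k - 1)) / 2))"
    unfolding cis_neg_2pi_eq_iff using k12 by (auto simp: field_simps)
  also have "\<dots> = cis pi ^ n * cis pi ^ (k - 1)"
    unfolding Complex.DeMoivre cis_mult using k12
    by (intro arg_cong[of _ _ cis]) (auto simp: field_simps)
  finally show ?thesis by (simp flip: power_mult_distrib mult.assoc)
qed

text \<open>Reversing the coefficients of a linear factor inverts its zero, and inversion permutes
  the zeros because \<open>rfl\<close> negates the angles modulo 1.\<close>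

lemma reflect_Pi: "reflect_poly (hor_Pi n b) = Polynomial.smult ((-1) ^ (k - 1)) (hor_Pi n b)"
proof -
  have r: "reflect_poly [:- kap j, 1:] = Polynomial.smult (- kap j) [:- inverse (kap j), 1:]" for j
    by (simp add: reflect_poly_pCons)
  have "reflect_poly (hor_Pi n b) = (\<Prod>j=1..n. Polynomial.smult (- kap j) [:- inverse (kap j), 1:])"
    unfolding Pi_kap reflect_poly_prod r ..
  also have "\<dots> = Polynomial.smult (\<Prod>j=1..n. - kap j) (\<Prod>j=1..n. [:- inverse (kap j), 1:])"
    by (rule prod_smult)
  also have "(\<Prod>j=1..n. [:- inverse (kap j), 1:]) = (\<Prod>j=1..n. [:- kap (rfl j), 1:])"
    by (rule prod.cong) (use kap_rfl in auto)
  also have "\<dots> = hor_Pi n b"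
    unfolding Pi_kap by (rule prod.reindex_bij_betw[OF bij_rfl])
  finally show ?thesis using prod_kap by simp
qed

lemma Pi_palindromic: "i \<le> n \<Longrightarrow> coeff (hor_Pi n b) (n - i) = (-1) ^ (k - 1) * coeff (hor_Pi n b) i"
  using arg_cong[OF reflect_Pi, of "\<lambda>q. coeff q i"] by (simp add: coeff_reflect_poly Pi_degree)

lemma poly_Pi_0_iff: "poly (hor_Pi n b) c = 0 \<longleftrightarrow> (\<exists>j\<in>{1..n}. kap j = c)"
  by (auto simp: Pi_kap poly_prod prod_zero_iff)

end

text \<open>Multiplicities give the number of indices at every angle strictly between 0 and 1. At
  the zero 1 they give only the total for the angles 0 and 1, which the symmetry in
  \<open>card_b_0\<close> splits.\<close>

lemma hor_Pi_inj:
  assumes "n \<ge> 1" "k \<in> {1, 2}" "b \<in> Tscal k n" "b' \<in> Tscal k n" "hor_Pi n b = hor_Pi n b'"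
  shows "b = b'"
proof
  fix j
  interpret b: hor_scal n k b using assms by unfold_locales
  interpret b': hor_scal n k b' using assms by unfold_locales
  have o1: "card {j\<in>{1..n}. b j = 1} = card {j\<in>{1..n}. b' j = 1}"
    using b.order_Pi_1 b'.order_Pi_1 assms by simp
  have "card {j\<in>{1..n}. b j = t} = card {j\<in>{1..n}. b' j = t}" for t
  proof -
    consider "t < 0 \<or> t > 1" | "t = 0" | "t = 1" | "0 < t" "t < 1" by linarith
    then show ?thesis
    proof cases
      case 1
      then have "{j\<in>{1..n}. b j = t} = {}" "{j\<in>{1..n}. b' j = t} = {}"
        using b.b_range b'.b_range by force+
      then show ?thesis by (simp only:)
    next
      case 2 then show ?thesis using b.card_b_0 b'.card_b_0 o1 by simp
    next
      case 3 then show ?thesis using o1 by simp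
    next
      case 4
      then show ?thesis using b.order_Pi[of "cis (- 2 * pi * t)"] b'.order_Pi[of "cis (- 2 * pi * t)"] assms
        by (simp only: b.kap_block b'.kap_block)
    qed
  qed
  then show "b j = b' j"
    using mono_on_eq_of_card_eq[OF b.b_mono b'.b_mono] b.b_outside b'.b_outside by metis
qed

text \<open>With theta = pi s one has 1 - e^(2 i theta) = - 2 i sin theta e^(i theta), and the sign
  of sin theta is that of s.\<close>

lemma one_minus_cis:
  assumes "0 < \<bar>s\<bar>" "\<bar>s\<bar> < 1"
  shows "\<exists>r>0. 1 - cis (2 * pi * s) = of_real r * cis (pi * s - pi / 2 * sgn s)"
proof -
  have sinpos: "sin (pi * u) > 0" if "0 < u" "u < 1" for u
    using that by (intro sin_gt_zero) auto
  have c: "cos (2 * pi * s) = 1 - 2 * sin (pi * s) * sin (pi * s)"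
    using cos_double_sin[of "pi * s"] by (simp add: power2_eq_square mult.assoc)
  have s: "sin (2 * pi * s) = 2 * sin (pi * s) * cos (pi * s)"
    using sin_double[of "pi * s"] by (simp add: mult.assoc)
  show ?thesis
  proof (cases "s > 0")
    case True
    then have "1 - cis (2 * pi * s) = of_real (2 * sin (pi * s)) * cis (pi * s - pi / 2 * sgn s)"
      by (simp add: complex_eq_iff c s cos_diff sin_diff)
    moreover have "2 * sin (pi * s) > 0" using sinpos[of s] True assms by auto
    ultimately show ?thesis by blast
  next
    case False
    then have "s < 0" using assms by auto
    then have "1 - cis (2 * pi * s) = of_real (2 * sin (pi * (-s))) * cis (pi * s - pi / 2 * sgn s)"
      by (simp add: complex_eq_iff c s cos_add sin_add)
    moreover have "2 * sin (pi * (-s)) > 0" using sinpos[of "-s"] \<open>s < 0\<close> assms by auto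
    ultimately show ?thesis by blast
  qed
qed

lemma prod_polar:
  assumes "finite A" "\<And>j. j \<in> A \<Longrightarrow> \<exists>r>0. f j = complex_of_real r * cis (g j)"
  shows "\<exists>r>0. (\<Prod>j\<in>A. f j) = complex_of_real r * cis (\<Sum>j\<in>A. g j)"
  using assms
proof (induction A rule: finite_induct)
  case empty then show ?case by (intro exI[of _ 1]) simp
next
  case (insert x A)
  obtain r1 where 1: "r1 > 0" "f x = complex_of_real r1 * cis (g x)" using insert by auto
  obtain r2 where 2: "r2 > 0" "(\<Prod>j\<in>A. f j) = complex_of_real r2 * cis (\<Sum>j\<in>A. g j)" using insert by auto
  show ?case using insert 1 2
    by (intro exI[of _ "r1 * r2"]) (simp add: cis_mult[symmetric] algebra_simps)
qed

locale hor_data = hor_scal +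
  fixes p :: "real poly" and S :: "real mat"
  assumes p_Pi: "map_poly complex_of_real p = hor_Pi n b" and S_def: "S = hor_S n p"
begin

lemma p_Tpol: "p \<in> Tpol k n"
  using p_Pi b_Tscal by (auto simp: Tpol_def)

lemma of_real_coeff_p: "complex_of_real (coeff p i) = coeff (hor_Pi n b) i"
  by (simp add: p_Pi[symmetric] coeff_map_poly)

lemma p_monic: "coeff p n = 1"
  using of_real_coeff_p[of n] Pi_monic by simp

lemma p_degree: "degree p = n"
proof -
  have "degree (map_poly complex_of_real p) = degree p" by (rule degree_map_poly) simp
  then show ?thesis using Pi_degree p_Pi by simp
qed

lemma p_palindromic: "i \<le> n \<Longrightarrow> coeff p (n - i) = (-1) ^ (k - 1) * coeff p i"
proof -
  assume "i \<le> n"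
  from Pi_palindromic[OF this] have "complex_of_real (coeff p (n - i)) = complex_of_real ((-1) ^ (k - 1) * coeff p i)"
    by (simp add: of_real_coeff_p)
  then show ?thesis by (simp only: of_real_eq_iff)
qed

lemma p_const: "coeff p 0 = (-1) ^ (k - 1)"
  using p_palindromic[of n] p_monic by simp

lemma S_carrier: "S \<in> carrier_mat n n" and dim_S: "dim_row S = n"
  by (simp_all add: S_def hor_S_def)

end

lemma hor_data_exists:
  assumes "n \<ge> 1" "k \<in> {1, 2}" "p \<in> Tpol k n"
  shows "\<exists>b. hor_data n k b p (hor_S n p)"
proof -
  obtain b where "b \<in> Tscal k n" "map_poly complex_of_real p = hor_Pi n b"
    using assms by (auto simp: Tpol_def)
  then show ?thesis using assms by (intro exI[of _ b]) (unfold_locales, auto)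
qed

text \<open>The entries of the matrix show the coefficients 1 to n only; the constant coefficient is
  a sign determined by k.\<close>

lemma hor_S_inj:
  assumes "n \<ge> 1" "k \<in> {1, 2}" "p \<in> Tpol k n" "q \<in> Tpol k n" "hor_S n p = hor_S n q"
  shows "p = q"
proof -
  obtain b where "hor_data n k b p (hor_S n p)" using hor_data_exists assms by blast
  then interpret p: hor_data n k b p "hor_S n p" .
  obtain b' where "hor_data n k b' q (hor_S n q)" using hor_data_exists assms by blast
  then interpret q: hor_data n k b' q "hor_S n q" .
  have "coeff p i = coeff q i" for i
  proof -
    consider "i = 0" | "i > n" | "1 \<le> i" "i \<le> n" by linarith
    then show ?thesis
    proof cases
      case 1 then show ?thesis using p.p_const q.p_const by simp
    next
      case 2 then show ?thesis using p.p_degree q.p_degree by (simp add: coeff_eq_0)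
    next
      case 3
      have "hor_S n p $$ (0, n - i) = hor_S n q $$ (0, n - i)" using assms by simp
      then show ?thesis using 3 assms(1) by (simp add: hor_S_def)
    qed
  qed
  then show ?thesis by (simp add: poly_eq_iff)
qed

section \<open>Spectral pair ladders of the zeros\<close>

context hor_data
begin

lemma hor_poly_S: "hor_poly k S = p"
  unfolding hor_poly_def dim_S
  by (rule the_equality) (use p_Tpol S_def hor_S_inj[OF n1 k12] in auto)

lemma hor_beta_S: "hor_beta k S = b"
  unfolding hor_beta_def dim_S hor_poly_S
  by (rule the_equality) (use p_Pi b_Tscal hor_Pi_inj[OF n1 k12] in auto)

lemma hor_alpha_S: "hor_alpha k S j = real n * b j - real j + real k / 2"
  by (simp add: hor_alpha_def dim_S hor_beta_S)

abbreviation lad_l :: "complex \<Rightarrow> nat" where "lad_l c \<equiv> hor_ladder_l k S c"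
abbreviation lad_al :: "complex \<Rightarrow> real" where "lad_al c \<equiv> hor_ladder_alpha k S c"

lemma root_iff: "poly (map_poly complex_of_real p) c = 0 \<longleftrightarrow> (\<exists>j\<in>{1..n}. kap j = c)"
  by (simp only: p_Pi poly_Pi_0_iff)

lemma card_root_pos: "poly (map_poly complex_of_real p) c = 0 \<Longrightarrow> card {j\<in>{1..n}. kap j = c} > 0"
  unfolding root_iff by (subst card_gt_0_iff) auto

lemma lad_l_eq: "lad_l c = card {j\<in>{1..n}. kap j = c} - 1"
  unfolding hor_ladder_l_def hor_poly_S p_Pi order_Pi ..

text \<open>The first spectral number is the least element of the set, so the definite description
  in \<open>hor_ladder_alpha\<close> denotes it.\<close>

lemma lad_al_unique:
  assumes "{hor_alpha k S j | j. j \<in> {1..n} \<and> kap j = c} = {al + real i | i. i \<le> lad_l c}"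
  shows "lad_al c = al"
  unfolding hor_ladder_alpha_def dim_S hor_beta_S kap_def[symmetric]
proof (rule the_equality)
  show "{hor_alpha k S j | j. j \<in> {1..n} \<and> kap j = c} = {al + real i | i. i \<le> lad_l c}" by (rule assms)
next
  fix al' assume "{hor_alpha k S j | j. j \<in> {1..n} \<and> kap j = c} = {al' + real i | i. i \<le> lad_l c}"
  with assms have eq: "{al + real i | i. i \<le> lad_l c} = {al' + real i | i. i \<le> lad_l c}" by simp
  have "al + real 0 \<in> {al + real i | i. i \<le> lad_l c}" by blast
  then have "al' \<le> al" unfolding eq by auto
  moreover have "al' + real 0 \<in> {al' + real i | i. i \<le> lad_l c}" by blast
  then have "al \<le> al'" unfolding eq[symmetric] by auto
  ultimately show "al' = al" by simp
qed

text \<open>The angle t occupies the consecutive indices from A + 1 to n - G, with A and G the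
  numbers of angles below and above t. Along them alpha decreases by 1 at each index, so the ladder
  starts at the last index n - G.\<close>

lemma lad_al_interior:
  assumes t: "0 < t" "t < 1" and c: "c = cis (- 2 * pi * t)" and r: "poly (map_poly complex_of_real p) c = 0"
  shows "lad_al c = real n * t + real k / 2 - real n + real (card {j\<in>{1..n}. b j > t})"
proof (rule lad_al_unique)
  let ?A = "card {j\<in>{1..n}. b j < t}" and ?G = "card {j\<in>{1..n}. b j > t}"
  have tot: "?A + card {j\<in>{1..n}. b j = t} + ?G = n" by (rule card_b_total)
  have blk: "{j\<in>{1..n}. kap j = c} = {?A + 1 .. n - ?G}"
    unfolding c kap_block[OF t] by (rule mono_on_block[OF b_mono])
  have l: "lad_l c + ?A + ?G + 1 = n"
    using tot card_root_pos[OF r] lad_l_eq[of c] unfolding c kap_block[OF t] by simp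
  have "{hor_alpha k S j | j. j \<in> {1..n} \<and> kap j = c} = (\<lambda>j. real n * t - real j + real k / 2) ` {?A + 1 .. n - ?G}"
  proof -
    have "{hor_alpha k S j | j. j \<in> {1..n} \<and> kap j = c} = hor_alpha k S ` {j\<in>{1..n}. kap j = c}" by blast
    also have "\<dots> = (\<lambda>j. real n * t - real j + real k / 2) ` {j\<in>{1..n}. kap j = c}"
      using kap_block[OF t] c by (intro image_cong) (auto simp: hor_alpha_S)
    finally show ?thesis unfolding blk .
  qed
  also have "\<dots> = {real n * t + real k / 2 - real n + real ?G + real i | i. i \<le> lad_l c}" (is "?f ` _ = _")
  proof (intro Set.set_eqI iffI)
    fix x assume "x \<in> ?f ` {?A + 1 .. n - ?G}"
    then obtain j where j: "j \<in> {?A + 1 .. n - ?G}" "x = ?f j" by blast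
    then show "x \<in> {real n * t + real k / 2 - real n + real ?G + real i | i. i \<le> lad_l c}"
      using l by (intro CollectI exI[of _ "n - ?G - j"]) (auto simp: of_nat_diff)
  next
    fix x assume "x \<in> {real n * t + real k / 2 - real n + real ?G + real i | i. i \<le> lad_l c}"
    then obtain i where i: "i \<le> lad_l c" "x = real n * t + real k / 2 - real n + real ?G + real i" by blast
    then show "x \<in> ?f ` {?A + 1 .. n - ?G}"
      using l by (intro image_eqI[of _ _ "n - ?G - i"]) (auto simp: of_nat_diff)
  qed
  finally show "{hor_alpha k S j | j. j \<in> {1..n} \<and> kap j = c} =
    {real n * t + real k / 2 - real n + real ?G + real i | i. i \<le> lad_l c}" .
qed

text \<open>Two runs of indices join to one ladder. The initial indices with angle 0 give k / 2 -
  B0, ..., k / 2 - 1; the final indices with angle 1 are raised by n and continue with k / 2, ..., k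
  / 2 + B1 - 1. The symmetry about 0 comes from B0 = B1 + k - 1.\<close>

lemma lad_one:
  assumes r: "poly (map_poly complex_of_real p) 1 = 0"
  shows "lad_al 1 = real k / 2 - real (card {j\<in>{1..n}. b j = 0})" (is ?th1)
    and "2 * lad_al 1 + real (lad_l 1) = 0" (is ?th2)
    and "lad_l 1 + 1 = card {j\<in>{1..n}. b j = 0} + card {j\<in>{1..n}. b j = 1}" (is ?th3)
proof -
  let ?B0 = "card {j\<in>{1..n}. b j = 0}" and ?B1 = "card {j\<in>{1..n}. b j = 1}"
  have "card {j\<in>{1..n}. kap j = 1} = ?B0 + ?B1"
    unfolding kap_block_1 by (rule card_Un_disjoint) auto
  then show l: ?th3 using card_root_pos[OF r] lad_l_eq[of 1] by linarith
  have "{j\<in>{1..n}. b j < 0} = {}" "{j\<in>{1..n}. b j > 1} = {}" using b_range by force+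
  then have e0: "card {j\<in>{1..n}. b j < 0} = 0" "card {j\<in>{1..n}. b j > 1} = 0" by (metis card.empty)+
  have B0: "{j\<in>{1..n}. b j = 0} = {1..?B0}"
  proof -
    have "?B0 + card {j\<in>{1..n}. b j > 0} = n" using card_b_total[of 0] e0 by linarith
    then have "n - card {j\<in>{1..n}. b j > 0} = ?B0" by arith
    then show ?thesis using mono_on_block[OF b_mono, of 0] e0 by (simp only: add_0)
  qed
  have B1: "{j\<in>{1..n}. b j = 1} = {n + 1 - ?B1..n}"
  proof -
    have "card {j\<in>{1..n}. b j < 1} + ?B1 = n" using card_b_total[of 1] e0 by linarith
    then have "n + 1 - ?B1 = card {j\<in>{1..n}. b j < 1} + 1" by arith
    then show ?thesis using mono_on_block[OF b_mono, of 1] e0 by (simp only: diff_zero)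
  qed
  have le: "?B0 \<le> n" "?B1 \<le> n" using card_b_total[of 0] card_b_total[of 1] by auto
  show al: ?th1
  proof (rule lad_al_unique)
    have "{hor_alpha k S j | j. j \<in> {1..n} \<and> kap j = 1} = hor_alpha k S ` {j\<in>{1..n}. kap j = 1}" by blast
    also have "\<dots> = hor_alpha k S ` {j\<in>{1..n}. b j = 0} \<union> hor_alpha k S ` {j\<in>{1..n}. b j = 1}"
      unfolding kap_block_1 by blast
    also have "hor_alpha k S ` {j\<in>{1..n}. b j = 0} = (\<lambda>j. real k / 2 - real j) ` {j\<in>{1..n}. b j = 0}"
      by (rule image_cong) (auto simp: hor_alpha_S)
    also have "\<dots> = (\<lambda>i. real k / 2 - real ?B0 + real i) ` {..<?B0}"
    proof (intro Set.set_eqI iffI)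
      fix x assume "x \<in> (\<lambda>j. real k / 2 - real j) ` {j\<in>{1..n}. b j = 0}"
      then obtain j where "j \<in> {1..?B0}" "x = real k / 2 - real j" using B0 by blast
      then show "x \<in> (\<lambda>i. real k / 2 - real ?B0 + real i) ` {..<?B0}"
        by (intro image_eqI[of _ _ "?B0 - j"]) (auto simp: of_nat_diff)
    next
      fix x assume "x \<in> (\<lambda>i. real k / 2 - real ?B0 + real i) ` {..<?B0}"
      then obtain i where i: "i < ?B0" "x = real k / 2 - real ?B0 + real i" by blast
      then have "?B0 - i \<in> {1..?B0}" by auto
      then have "?B0 - i \<in> {j\<in>{1..n}. b j = 0}" by (subst B0)
      with i show "x \<in> (\<lambda>j. real k / 2 - real j) ` {j\<in>{1..n}. b j = 0}"
        by (intro image_eqI[of _ _ "?B0 - i"]) (auto simp: of_nat_diff)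
    qed
    also have "hor_alpha k S ` {j\<in>{1..n}. b j = 1} = (\<lambda>j. real n + real k / 2 - real j) ` {j\<in>{1..n}. b j = 1}"
      by (rule image_cong) (auto simp: hor_alpha_S)
    also have "\<dots> = (\<lambda>i. real k / 2 - real ?B0 + real i) ` {?B0..<?B0 + ?B1}"
    proof (intro Set.set_eqI iffI)
      fix x assume "x \<in> (\<lambda>j. real n + real k / 2 - real j) ` {j\<in>{1..n}. b j = 1}"
      then obtain j where "j \<in> {n + 1 - ?B1..n}" "x = real n + real k / 2 - real j" using B1 by blast
      then show "x \<in> (\<lambda>i. real k / 2 - real ?B0 + real i) ` {?B0..<?B0 + ?B1}"
        using le by (intro image_eqI[of _ _ "?B0 + (n - j)"]) (auto simp: of_nat_diff)
    next
      fix x assume "x \<in> (\<lambda>i. real k / 2 - real ?B0 + real i) ` {?B0..<?B0 + ?B1}"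
      then obtain i where i: "?B0 \<le> i" "i < ?B0 + ?B1" "x = real k / 2 - real ?B0 + real i" by auto
      then have "n + ?B0 - i \<in> {n + 1 - ?B1..n}" using le by auto
      then have "n + ?B0 - i \<in> {j\<in>{1..n}. b j = 1}" by (subst B1)
      with i le show "x \<in> (\<lambda>j. real n + real k / 2 - real j) ` {j\<in>{1..n}. b j = 1}"
        by (intro image_eqI[of _ _ "n + ?B0 - i"]) (auto simp: of_nat_diff)
    qed
    also have "(\<lambda>i. real k / 2 - real ?B0 + real i) ` {..<?B0} \<union>
      (\<lambda>i. real k / 2 - real ?B0 + real i) ` {?B0..<?B0 + ?B1} =
      (\<lambda>i. real k / 2 - real ?B0 + real i) ` {..lad_l 1}"
    proof -
      have "{..<?B0} \<union> {?B0..<?B0 + ?B1} = {..<lad_l 1 + 1}" unfolding l by auto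
      also have "\<dots> = {..lad_l 1}" by auto
      finally show ?thesis by (metis image_Un)
    qed
    finally show "{hor_alpha k S j | j. j \<in> {1..n} \<and> kap j = 1} =
        {real k / 2 - real ?B0 + real i | i. i \<le> lad_l 1}" by (auto simp: image_def)
  qed
  have "?B0 = ?B1 + (k - 1)" by (rule card_b_0)
  then have "real ?B0 = real ?B1 + (real k - 1)" using k12 by auto
  moreover have "real (lad_l 1) + 1 = real ?B0 + real ?B1" using l by linarith
  ultimately show ?th2 using al by simp
qed

lemma root_cases:
  assumes r: "poly (map_poly complex_of_real p) c = 0"
  obtains (one) "c = 1" | (interior) t where "0 < t" "t < 1" "c = cis (- 2 * pi * t)"
proof -
  obtain j where j: "j \<in> {1..n}" "kap j = c" using r root_iff by auto
  show ?thesis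
  proof (cases "b j = 0 \<or> b j = 1")
    case True then show ?thesis using j kap_def one cis_neg_2pi_unit_eq_1_iff[OF b_range[OF j(1)]] by auto
  next
    case False then show ?thesis using j b_range[OF j(1)] by (intro interior[of "b j"]) (auto simp: kap_def)
  qed
qed

lemma order_p: "Polynomial.order c (map_poly complex_of_real p) = card {j\<in>{1..n}. kap j = c}"
  unfolding p_Pi order_Pi ..

lemma lad_l_order:
  "poly (map_poly complex_of_real p) c = 0 \<Longrightarrow> lad_l c + 1 = Polynomial.order c (map_poly complex_of_real p)"
  using card_root_pos[of c] lad_l_eq[of c] order_p[of c] by linarith

text \<open>Modulo 1 a spectral number equals n beta + k / 2, and the summand k / 2 contributes the
  sign.\<close>

lemma cis_lad_al:
  assumes r: "poly (map_poly complex_of_real p) c = 0"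
  shows "cis (- 2 * pi * lad_al c) = (-1) ^ k * c ^ n"
proof -
  have k: "cis (- 2 * pi * (real k / 2)) = (-1) ^ k" using k12
    by (auto simp: complex_eq_iff mult.commute)
  from r show ?thesis
  proof (cases rule: root_cases)
    case one
    have "cis (- 2 * pi * lad_al 1) = cis (- 2 * pi * (real k / 2))"
      unfolding cis_neg_2pi_eq_iff using lad_one r one by simp
    then show ?thesis using k one by simp
  next
    case (interior t)
    have "cis (- 2 * pi * lad_al c) = cis (- 2 * pi * (real n * t + real k / 2))"
      unfolding cis_neg_2pi_eq_iff using lad_al_interior[OF interior r] by simp
    also have "\<dots> = cis (- 2 * pi * (real k / 2)) * cis (- 2 * pi * t) ^ n"
      unfolding Complex.DeMoivre cis_mult by (simp add: algebra_simps)
    finally show ?thesis using k interior by simp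
  qed
qed

text \<open>Each other zero contributes pi (t - b) - (pi / 2) sgn (t - b), where t is the angle of
  c. The linear terms add up to n t minus the known sum of all angles, the sgn terms to the
  difference of the counts below and above t. Eliminating the count below t by means of n and the
  multiplicity l + 1 leaves the first spectral number.\<close>

lemma phase:
  assumes r: "poly (map_poly complex_of_real p) c = 0"
  shows "\<exists>r>0. (\<Prod>j\<in>{j\<in>{1..n}. kap j \<noteq> c}. 1 - kap j / c) =
    complex_of_real r * cis (pi / 2 * (2 * lad_al c + real (lad_l c)))"
  using r
proof (cases rule: root_cases)
  case one
  let ?K = "{j\<in>{1..n}. kap j \<noteq> c}"
  have K: "?K = {j\<in>{1..n}. b j \<noteq> 0 \<and> b j \<noteq> 1}" using kap_block_1 one by auto
  have "\<exists>r>0. (\<Prod>j\<in>?K. 1 - kap j / c) = complex_of_real r * cis (\<Sum>j\<in>?K. pi * (0 - b j) - pi / 2 * sgn (0 - b j))"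
  proof (rule prod_polar)
    fix j assume "j \<in> ?K"
    then have "0 < \<bar>0 - b j\<bar>" "\<bar>0 - b j\<bar> < 1" using b_range[of j] unfolding K by auto
    from one_minus_cis[OF this] show "\<exists>r>0. 1 - kap j / c = complex_of_real r * cis (pi * (0 - b j) - pi / 2 * sgn (0 - b j))"
      using one by (simp add: kap_def)
  qed simp
  \<comment> \<open>Here c = 1 has angle 0. Every remaining angle is positive, so each term is pi /
    2 - pi b, and the angles equal to 1, which belong to c, are subtracted from the known
    total.\<close>
  moreover have "(\<Sum>j\<in>?K. pi * (0 - b j) - pi / 2 * sgn (0 - b j)) = 0"
  proof -
    have "(\<Sum>j\<in>?K. pi * (0 - b j) - pi / 2 * sgn (0 - b j)) = (\<Sum>j\<in>?K. pi / 2 - pi * b j)"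
    proof (rule sum.cong)
      fix j assume "j \<in> ?K"
      then have "0 < b j" using b_range[of j] unfolding K by auto
      then show "pi * (0 - b j) - pi / 2 * sgn (0 - b j) = pi / 2 - pi * b j" by simp
    qed simp
    also have "\<dots> = pi / 2 * real (card ?K) - pi * (\<Sum>j\<in>?K. b j)"
      by (simp add: sum_subtractf sum_distrib_left)
    also have "(\<Sum>j\<in>?K. b j) = (\<Sum>j=1..n. b j) - (\<Sum>j\<in>{j\<in>{1..n}. kap j = c}. b j)"
    proof -
      have "?K = {1..n} - {j\<in>{1..n}. kap j = c}" by auto
      from arg_cong[OF this, of "sum b"] show ?thesis by (rule trans) (rule sum_diff, auto)
    qed
    also have "(\<Sum>j\<in>{j\<in>{1..n}. kap j = c}. b j) = real (card {j\<in>{1..n}. b j = 1})"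
    proof -
      have "(\<Sum>j\<in>{j\<in>{1..n}. kap j = c}. b j) = (\<Sum>j\<in>{j\<in>{1..n}. b j = 1}. 1)"
        using kap_block_1 one by (intro sum.mono_neutral_cong_right) auto
      then show ?thesis by simp
    qed
    also have "real (card ?K) = real n - (real (lad_l c) + 1)"
    proof -
      have "?K = {1..n} - {j\<in>{1..n}. kap j = c}" by auto
      from arg_cong[OF this, of card] have "card ?K = n - card {j\<in>{1..n}. kap j = c}"
        by (rule trans) (subst card_Diff_subset, auto)
      moreover have "card {j\<in>{1..n}. kap j = c} \<le> card {1..n}" by (rule card_mono) auto
      ultimately show ?thesis using lad_l_order[OF r] order_p[of c] by simp
    qed
    finally have *: "(\<Sum>j\<in>?K. pi * (0 - b j) - pi / 2 * sgn (0 - b j)) =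
      pi / 2 * (real n - (real (lad_l c) + 1)) - pi * ((\<Sum>j=1..n. b j) - real (card {j\<in>{1..n}. b j = 1}))" .
    have l: "real (lad_l c) + 1 = real k - 1 + 2 * real (card {j\<in>{1..n}. b j = 1})"
      using lad_one(3) r one card_b_0 k12 by auto
    show ?thesis unfolding * l sum_b by (simp add: field_simps)
  qed
  moreover have "2 * lad_al c + real (lad_l c) = 0" using lad_one r one by simp
  ultimately show ?thesis by simp
next
  case (interior t)
  let ?K = "{j\<in>{1..n}. kap j \<noteq> c}"
  let ?A = "card {j\<in>{1..n}. b j < t}" and ?B = "card {j\<in>{1..n}. b j = t}" and ?G = "card {j\<in>{1..n}. b j > t}"
  have K: "?K = {j\<in>{1..n}. b j \<noteq> t}" using kap_block interior by blast
  have "\<exists>r>0. (\<Prod>j\<in>?K. 1 - kap j / c) = complex_of_real r * cis (\<Sum>j\<in>?K. pi * (t - b j) - pi / 2 * sgn (t - b j))"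
  proof (rule prod_polar)
    fix j assume "j \<in> ?K"
    then have "0 < \<bar>t - b j\<bar>" "\<bar>t - b j\<bar> < 1" using b_range[of j] interior unfolding K by auto
    moreover have "kap j / c = cis (2 * pi * (t - b j))"
      by (simp add: kap_def interior cis_divide algebra_simps)
    ultimately show "\<exists>r>0. 1 - kap j / c = complex_of_real r * cis (pi * (t - b j) - pi / 2 * sgn (t - b j))"
      using one_minus_cis[of "t - b j"] by simp
  qed simp
  moreover have "(\<Sum>j\<in>?K. pi * (t - b j) - pi / 2 * sgn (t - b j)) = pi / 2 * (2 * lad_al c + real (lad_l c))"
  proof -
    have "(\<Sum>j\<in>?K. pi * (t - b j) - pi / 2 * sgn (t - b j)) = (\<Sum>j=1..n. pi * (t - b j) - pi / 2 * sgn (t - b j))"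
      by (subst K, rule sum.mono_neutral_left) auto
    also have "\<dots> = pi * (real n * t - (\<Sum>j=1..n. b j)) - pi / 2 * (\<Sum>j=1..n. sgn (t - b j))"
      by (simp add: sum_subtractf sum_distrib_left[symmetric] sum_divide_distrib[symmetric])
    also have "(\<Sum>j=1..n. sgn (t - b j)) = (\<Sum>j=1..n. (if b j < t then 1 else 0) - (if b j > t then 1 else 0))"
      by (rule sum.cong) (auto simp: sgn_if)
    also have "\<dots> = real ?A - real ?G"
      by (simp add: sum_subtractf flip: sum.inter_filter)
    finally have *: "(\<Sum>j\<in>?K. pi * (t - b j) - pi / 2 * sgn (t - b j)) =
      pi * (real n * t - (\<Sum>j=1..n. b j)) - pi / 2 * (real ?A - real ?G)" .
    have "real ?A + real ?B + real ?G = real n" using card_b_total[of t] by linarith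
    moreover have "real (lad_l c) + 1 = real ?B"
      using lad_l_order[OF r] order_p[of c] kap_block interior by auto
    ultimately have A: "real ?A = real n - (real (lad_l c) + 1) - real ?G" by linarith
    show ?thesis unfolding * A lad_al_interior[OF interior r] sum_b by (simp add: field_simps)
  qed
  ultimately show ?thesis by (simp only:)
qed

text \<open>Conjugation replaces the angle t by 1 - t, and \<open>card_b_refl_gt\<close> turns the
  count above 1 - t into the one below t. The value - l - alpha is the first spectral number of the
  partner ladder for the center 1.\<close>

lemma lad_l_cnj: "poly (map_poly complex_of_real p) c = 0 \<Longrightarrow> lad_l (cnj c) = lad_l c"
  and lad_al_cnj: "poly (map_poly complex_of_real p) c = 0 \<Longrightarrow> lad_al (cnj c) = - real (lad_l c) - lad_al c"
  and root_cnj: "poly (map_poly complex_of_real p) c = 0 \<Longrightarrow> poly (map_poly complex_of_real p) (cnj c) = 0"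
proof -
  assume r: "poly (map_poly complex_of_real p) c = 0"
  have "lad_l (cnj c) = lad_l c \<and> lad_al (cnj c) = - real (lad_l c) - lad_al c \<and> poly (map_poly complex_of_real p) (cnj c) = 0"
    using r
  proof (cases rule: root_cases)
    case one then show ?thesis using lad_one(2) r by auto
  next
    case (interior t)
    have t': "0 < 1 - t" "1 - t < 1" using interior by auto
    have cnj: "cnj c = cis (- 2 * pi * (1 - t))"
    proof -
      have "cnj c = cis (- 2 * pi * (- t))" by (simp add: interior cis_cnj)
      also have "\<dots> = cis (- 2 * pi * (1 - t))" unfolding cis_neg_2pi_eq_iff by simp
      finally show ?thesis .
    qed
    have ceq: "card {j\<in>{1..n}. kap j = cnj c} = card {j\<in>{1..n}. kap j = c}"
      using card_b_refl_eq[OF interior(1,2)] kap_block[OF t'] kap_block[OF interior(1,2)]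
      by (simp only: cnj) (simp only: interior(3))
    then have l: "lad_l (cnj c) = lad_l c" by (simp add: lad_l_eq)
    have r': "poly (map_poly complex_of_real p) (cnj c) = 0"
      using card_root_pos[OF r] unfolding ceq[symmetric] root_iff by (auto simp: card_gt_0_iff)
    let ?A = "card {j\<in>{1..n}. b j < t}" and ?B = "card {j\<in>{1..n}. b j = t}" and ?G = "card {j\<in>{1..n}. b j > t}"
    have "real ?A + real ?B + real ?G = real n" using card_b_total[of t] by linarith
    moreover have "real (lad_l c) + 1 = real ?B"
      using lad_l_order[OF r] order_p[of c] kap_block interior by auto
    moreover have "real (card {j\<in>{1..n}. b j > 1 - t}) + (real k - 1) = real ?A"
      using card_b_refl_gt[OF interior(1,2)] k12 by auto
    ultimately show ?thesis using l r' lad_al_interior[OF interior r] lad_al_interior[OF t' cnj r']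
      by (simp add: algebra_simps)
  qed
  then show "lad_l (cnj c) = lad_l c" "lad_al (cnj c) = - real (lad_l c) - lad_al c"
    "poly (map_poly complex_of_real p) (cnj c) = 0" by auto
qed

end

section \<open>Polynomials acting on the complexification\<close>

text \<open>Chains are indexed families, so repetitions have to be excluded along with dependence:
  two equal vectors would satisfy a relation with coefficients 1 and -1.\<close>

lemma (in Vector_Spaces.vector_space) independent_familyI:
  assumes fin: "finite I" and z: "\<And>g. (\<Sum>i\<in>I. scale (g i) (v i)) = 0 \<Longrightarrow> (\<forall>i\<in>I. g i = 0)"
  shows "inj_on v I" "independent (v ` I)"
proof -
  show inj: "inj_on v I"
  proof (rule inj_onI, rule ccontr)
    fix i j assume ij: "i \<in> I" "j \<in> I" "v i = v j" "i \<noteq> j"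
    let ?g = "\<lambda>m. if m = i then (1::'a) else if m = j then - 1 else 0"
    have "(\<Sum>m\<in>I. scale (?g m) (v m)) = (\<Sum>m\<in>{i, j}. scale (?g m) (v m))"
      by (rule sum.mono_neutral_right) (use fin ij in auto)
    also have "\<dots> = 0" using ij by simp
    finally have "?g i = 0" using z[of ?g] ij(1) by blast
    then show False by simp
  qed
  show "independent (v ` I)"
  proof
    assume "dependent (v ` I)"
    then obtain u where u: "\<exists>x\<in>v ` I. u x \<noteq> 0" "(\<Sum>x\<in>v ` I. scale (u x) x) = 0"
      using dependent_finite[of "v ` I"] fin by auto
    have "(\<Sum>i\<in>I. scale (u (v i)) (v i)) = 0"
      using u(2) sum.reindex[OF inj, of "\<lambda>x. scale (u x) x"] by simp
    from z[OF this] u(1) show False by auto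
  qed
qed

lemma (in Vector_Spaces.vector_space) span_familyE:
  assumes "finite I" "x \<in> span (v ` I)"
  obtains g where "x = (\<Sum>i\<in>I. scale (g i) (v i))"
proof -
  have "\<exists>g. x = (\<Sum>i\<in>I. scale (g i) (v i))"
    using assms(2)
  proof (induction rule: span_induct_alt)
    case base then show ?case by (intro exI[of _ "\<lambda>_. 0"]) simp
  next
    case (step c y z)
    then obtain i g where i: "i \<in> I" "y = v i" and g: "z = (\<Sum>i\<in>I. scale (g i) (v i))" by auto
    have "(\<Sum>j\<in>I. scale (if j = i then c else 0) (v j)) = (\<Sum>j\<in>{i}. scale (if j = i then c else 0) (v j))"
      by (rule sum.mono_neutral_right) (use assms i in auto)
    then have "scale c y + z = (\<Sum>j\<in>I. scale ((if j = i then c else 0) + g j) (v j))"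
      using i g by (simp add: scale_left_distrib sum.distrib)
    then show ?case by (rule exI[of _ "\<lambda>j. (if j = i then c else 0) + g j"])
  qed
  then show ?thesis using that by blast
qed

lemma (in Vector_Spaces.vector_space) independent_familyD:
  assumes "finite I" "inj_on v I" "independent (v ` I)" "(\<Sum>i\<in>I. scale (g i) (v i)) = 0" "i \<in> I"
  shows "g i = 0"
proof -
  have "(\<Sum>x\<in>v ` I. scale (g (the_inv_into I v x)) x) = 0"
    using assms by (subst sum.reindex) (auto simp: the_inv_into_f_f)
  then have "g (the_inv_into I v (v i)) = 0"
    using assms by (intro independentD[of "v ` I" "v ` I"]) auto
  then show ?thesis using assms by (simp add: the_inv_into_f_f)
qed

locale clin =
  fixes F :: "'v::real_vector \<times> 'v \<Rightarrow> 'v \<times> 'v"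
  assumes add: "F (x + y) = F x + F y" and scale: "F (cscale c x) = cscale c (F x)"
begin

lemma zero [simp]: "F 0 = 0"
  using scale[of 0 0] by simp

lemma diff: "F (x - y) = F x - F y"
  using add[of "x - y" y] by simp

lemma sum: "F (\<Sum>i\<in>I. w i) = (\<Sum>i\<in>I. F (w i))"
  by (induction I rule: infinite_finite_induct) (auto simp: add)

lemma clin_funpow: "clin (F ^^ m)"
  by unfold_locales (induction m, auto simp: add scale)+

end

text \<open>Evaluation of the polynomial f at the operator F, applied to a, as a Horner fold. It
  makes the complexification a module over the complex polynomials, where most later computations
  take place.\<close>

definition pact :: "('v::real_vector \<times> 'v \<Rightarrow> 'v \<times> 'v) \<Rightarrow> complex poly \<Rightarrow> 'v \<times> 'v \<Rightarrow> 'v \<times> 'v" where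
  "pact F f a = fold_coeffs (\<lambda>c y. cscale c a + F y) f 0"

lemma pact_0 [simp]: "pact F 0 a = 0"
  by (simp add: pact_def)

context clin
begin

lemma pact_pCons: "pact F (pCons c f) a = cscale c a + F (pact F f a)"
  by (cases "c = 0 \<and> f = 0") (auto simp: pact_def fold_coeffs_pCons_not_0_0_eq)

lemma pact_const: "pact F [:c:] a = cscale c a"
  by (simp add: pact_pCons)

lemma pact_1 [simp]: "pact F 1 a = a"
  unfolding one_pCons pact_const by simp

lemma pact_add: "pact F (f + g) a = pact F f a + pact F g a"
  by (induction f g rule: poly_induct2) (auto simp: pact_pCons cplx.scale_left_distrib add)

lemma pact_smult: "pact F (Polynomial.smult c f) a = cscale c (pact F f a)"
  by (induction f) (auto simp: pact_pCons cplx.scale_right_distrib scale)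

lemma pact_minus: "pact F (- f) a = - pact F f a"
  using pact_smult[of "-1" f a] by simp

lemma pact_diff: "pact F (f - g) a = pact F f a - pact F g a"
  using pact_add[of f "- g" a] by (simp add: pact_minus)

lemma pact_sum: "pact F (\<Sum>i\<in>I. f i) a = (\<Sum>i\<in>I. pact F (f i) a)"
  by (induction I rule: infinite_finite_induct) (auto simp: pact_add)

lemma clin_pact: "clin (pact F f)"
proof
  show "pact F f (x + y) = pact F f x + pact F f y" for x y
    by (induction f) (auto simp: pact_pCons add cplx.scale_right_distrib)
  show "pact F f (cscale c x) = cscale c (pact F f x)" for c x
    by (induction f) (auto simp: pact_pCons scale cplx.scale_right_distrib mult.commute)
qed

lemma pact_mult: "pact F (f * g) a = pact F f (pact F g a)"
  by (induction f) (auto simp: pact_pCons pact_add pact_smult)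

lemma pact_X: "pact F [:0, 1:] a = F a"
  by (simp add: pact_pCons)

lemma pact_linear: "pact F [:- c, 1:] a = F a - cscale c a"
  by (simp add: pact_pCons)

lemma pact_power: "pact F (f ^ m) a = (pact F f ^^ m) a"
  by (induction m) (auto simp: pact_mult)

lemma pact_linear_power: "((\<lambda>x. F x - cscale c x) ^^ m) a = pact F ([:- c, 1:] ^ m) a"
proof -
  have "(\<lambda>x. F x - cscale c x) = pact F [:- c, 1:]" by (auto simp: pact_linear)
  then show ?thesis by (simp only: pact_power)
qed

lemma pact_X_power: "pact F ([:0, 1:] ^ m) a = (F ^^ m) a"
  by (induction m) (simp_all add: pact_mult pact_X del: mult_pCons_left)

lemma pact_pcompose: "pact (pact F g) f a = pact F (pcompose f g) a"
proof -
  interpret g: clin "pact F g" by (rule clin_pact)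
  show ?thesis by (induction f) (auto simp: g.pact_pCons pcompose_pCons pact_add pact_mult pact_const)
qed

lemma pact_invariant:
  assumes "cplx.subspace X" "\<And>x. x \<in> X \<Longrightarrow> F x \<in> X" "a \<in> X"
  shows "pact F f a \<in> X"
  by (induction f) (use assms in \<open>auto simp: pact_pCons cplx.subspace_0 cplx.subspace_add cplx.subspace_scale\<close>)

lemma gen_eigenspace_pact:
  "gen_eigenspace X F c = {a \<in> X. \<exists>m. pact F ([:- c, 1:] ^ m) a = 0}"
  by (simp add: gen_eigenspace_def pact_linear_power)

end

text \<open>Coprimality of a power of x - c with a polynomial that does not vanish at c. For
  exponent 1 it is division with remainder h(c); the induction multiplies the identities for the
  exponents m and 1.\<close>

lemma linear_power_bezout:
  fixes h :: "complex poly"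
  assumes "poly h c \<noteq> 0"
  shows "\<exists>u v. u * [:- c, 1:] ^ m + v * h = 1"
proof (induction m)
  case 0 then show ?case by (intro exI[of _ 1] exI[of _ 0]) simp
next
  case (Suc m)
  then obtain u v where uv: "u * [:- c, 1:] ^ m + v * h = 1" by blast
  have "poly (h - [:poly h c:]) c = 0" by simp
  then have "[:- c, 1:] dvd h - [:poly h c:]" using poly_eq_0_iff_dvd by blast
  then obtain h' where h': "h - [:poly h c:] = [:- c, 1:] * h'" by (rule dvdE)
  have "h - [:- c, 1:] * h' = [:poly h c:]" using h' by (simp add: algebra_simps)
  then have "Polynomial.smult (inverse (poly h c)) (h - [:- c, 1:] * h') = 1"
    using assms by (simp add: one_pCons)
  then have "[: inverse (poly h c) :] * (h - [:- c, 1:] * h') = 1" by simp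
  then obtain u1 v1 where uv1: "u1 * [:- c, 1:] + v1 * h = 1"
  proof -
    let ?i = "[: inverse (poly h c) :]"
    assume a: "?i * (h - [:- c, 1:] * h') = 1" and *: "\<And>u1 v1. u1 * [:- c, 1:] + v1 * h = 1 \<Longrightarrow> thesis"
    have "(- ?i * h') * [:- c, 1:] + ?i * h = ?i * (h - [:- c, 1:] * h')"
      by (simp only: algebra_simps mult_minus_left mult_minus_right add.right_inverse) simp
    with a * show thesis by metis
  qed
  have "1 = (u * [:- c, 1:] ^ m + v * h) * (u1 * [:- c, 1:] + v1 * h)" using uv uv1 by simp
  also have "\<dots> = (u * u1) * [:- c, 1:] ^ Suc m + (u * [:- c, 1:] ^ m * v1 + v * u1 * [:- c, 1:] + v * v1 * h) * h"
    by (simp only: power_Suc algebra_simps)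
  finally show ?case by metis
qed

context clin
begin

text \<open>Induction on the zeros of an annihilating polynomial: a Bezout identity splits a into a
  part killed by one linear power and a part killed by the remaining factor. Both parts are
  polynomials in F applied to a and so stay in X.\<close>

lemma gen_eigenspace_decomp:
  assumes X: "cplx.subspace X" "\<And>x. x \<in> X \<Longrightarrow> F x \<in> X"
    and "g \<noteq> 0" "a \<in> X" "pact F g a = 0"
  shows "\<exists>w. (\<forall>c. poly g c = 0 \<longrightarrow> w c \<in> gen_eigenspace X F c) \<and> a = (\<Sum>c\<in>{c. poly g c = 0}. w c)"
  using assms(3-5)
proof (induction g arbitrary: a rule: poly_root_order_induct)
  case (no_roots p)
  then obtain c where c: "p = [:c:]" by (metis fundamental_theorem_of_algebra constant_degree degree_eq_zeroE)
  then have "c \<noteq> 0" using no_roots by auto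
  then have "a = 0" using no_roots c by (auto simp: pact_const)
  then show ?case using no_roots by simp
next
  case (root p x m)
  obtain u v where uv: "u * [:- x, 1:] ^ m + v * p = 1" using linear_power_bezout root.hyps by blast
  let ?a1 = "pact F (u * [:- x, 1:] ^ m) a" and ?a2 = "pact F (v * p) a"
  have a: "a = ?a1 + ?a2" using uv pact_add[symmetric] by simp
  have "pact F p ?a1 = pact F u (pact F ([:- x, 1:] ^ m * p) a)"
    by (simp only: pact_mult[symmetric] mult_ac)
  then have "pact F p ?a1 = 0" using root.prems by (simp add: clin.zero[OF clin_pact])
  moreover have "?a1 \<in> X" using pact_invariant[OF X] root.prems by blast
  moreover have "p \<noteq> 0" using root.hyps by auto
  ultimately obtain w where w: "\<forall>c. poly p c = 0 \<longrightarrow> w c \<in> gen_eigenspace X F c"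
      "?a1 = (\<Sum>c\<in>{c. poly p c = 0}. w c)" using root.IH[of ?a1] by blast
  have "pact F ([:- x, 1:] ^ m) ?a2 = pact F v (pact F ([:- x, 1:] ^ m * p) a)"
    by (simp only: pact_mult[symmetric] mult_ac)
  then have "pact F ([:- x, 1:] ^ m) ?a2 = 0" using root.prems by (simp add: clin.zero[OF clin_pact])
  moreover have "?a2 \<in> X" using pact_invariant[OF X] root.prems by blast
  ultimately have a2: "?a2 \<in> gen_eigenspace X F x" unfolding gen_eigenspace_pact by blast
  have rts: "{c. poly ([:- x, 1:] ^ m * p) c = 0} = insert x {c. poly p c = 0}"
    using root.hyps by (auto simp: poly_power)
  have fin: "finite {c. poly p c = 0}" using \<open>p \<noteq> 0\<close> poly_roots_finite by blast
  have x: "x \<notin> {c. poly p c = 0}" using root.hyps by auto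
  let ?w = "w(x := ?a2)"
  have "(\<Sum>c\<in>{c. poly ([:- x, 1:] ^ m * p) c = 0}. ?w c) = ?a2 + (\<Sum>c\<in>{c. poly p c = 0}. ?w c)"
    unfolding rts using fin x by simp
  also have "(\<Sum>c\<in>{c. poly p c = 0}. ?w c) = ?a1"
  proof -
    have "(\<Sum>c\<in>{c. poly p c = 0}. ?w c) = (\<Sum>c\<in>{c. poly p c = 0}. w c)"
      by (rule sum.cong) (use x in auto)
    then show ?thesis using w(2) by (rule trans[OF _ sym])
  qed
  also have "?a2 + ?a1 = a" by (rule trans[OF add.commute a[symmetric]])
  finally have "a = (\<Sum>c\<in>{c. poly ([:- x, 1:] ^ m * p) c = 0}. ?w c)" by (rule sym)
  moreover have "\<forall>c. poly ([:- x, 1:] ^ m * p) c = 0 \<longrightarrow> ?w c \<in> gen_eigenspace X F c"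
  proof (intro allI impI)
    fix c assume "poly ([:- x, 1:] ^ m * p) c = 0"
    then have "c \<in> insert x {c. poly p c = 0}" using rts by blast
    then show "?w c \<in> gen_eigenspace X F c" using w(1) a2 by (cases "c = x") auto
  qed
  ultimately show ?case by blast
qed auto

text \<open>A power of one linear factor kills one term; the induction hypothesis, applied to the
  images of the others, shows that it kills them too. A vector killed by powers of two distinct
  linear factors is zero by Bezout.\<close>

lemma gen_eigenspace_indep:
  assumes "finite K" "\<And>c. c \<in> K \<Longrightarrow> w c \<in> gen_eigenspace X F c" "(\<Sum>c\<in>K. w c) = 0"
  shows "\<forall>c\<in>K. w c = 0"
proof -
  \<comment> \<open>The induction replaces w by its images, so it runs with annihilation alone in
    place of membership in X.\<close>
  have "\<forall>c\<in>K. w c = 0" if "\<And>c. c \<in> K \<Longrightarrow> \<exists>m. pact F ([:- c, 1:] ^ m) (w c) = 0" "(\<Sum>c\<in>K. w c) = 0" for w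
    using \<open>finite K\<close> that
  proof (induction K arbitrary: w rule: finite_induct)
    case (insert x K)
    obtain m where m: "pact F ([:- x, 1:] ^ m) (w x) = 0" using insert by blast
    interpret T: clin "pact F ([:- x, 1:] ^ m)" by (rule clin_pact)
    let ?w = "\<lambda>c. pact F ([:- x, 1:] ^ m) (w c)"
    have "w x + (\<Sum>c\<in>K. w c) = 0" using insert by simp
    then have "pact F ([:- x, 1:] ^ m) (w x + (\<Sum>c\<in>K. w c)) = 0" by (simp only: T.zero)
    then have "(\<Sum>c\<in>K. ?w c) = 0" using m by (simp only: T.add T.sum add_0)
    moreover have "\<exists>m. pact F ([:- c, 1:] ^ m) (?w c) = 0" if "c \<in> K" for c
    proof -
      obtain m' where m': "pact F ([:- c, 1:] ^ m') (w c) = 0" using insert \<open>c \<in> K\<close> by blast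
      have "pact F ([:- c, 1:] ^ m') (?w c) = pact F ([:- x, 1:] ^ m) (pact F ([:- c, 1:] ^ m') (w c))"
        by (simp only: pact_mult[symmetric] mult.commute)
      then show ?thesis using m' by auto
    qed
    ultimately have wz: "\<forall>c\<in>K. ?w c = 0" by (rule insert.IH[rotated])
    have K0: "w c = 0" if c: "c \<in> K" for c
    proof -
      obtain m' where m': "pact F ([:- c, 1:] ^ m') (w c) = 0" using insert \<open>c \<in> K\<close> by blast
      have "poly ([:- c, 1:] ^ m') x \<noteq> 0" using c insert by (auto simp: poly_power)
      then obtain u v where uv: "u * [:- x, 1:] ^ m + v * [:- c, 1:] ^ m' = 1" using linear_power_bezout by blast
      have "w c = pact F (u * [:- x, 1:] ^ m + v * [:- c, 1:] ^ m') (w c)" using uv by simp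
      also have "\<dots> = 0" using wz c m' by (simp add: pact_add pact_mult clin.zero[OF clin_pact])
      finally show ?thesis .
    qed
    then have "(\<Sum>c\<in>K. w c) = 0" by (intro sum.neutral) auto
    with K0 insert show ?case by auto
  qed auto
  then show ?thesis using assms unfolding gen_eigenspace_pact by blast
qed

lemma gen_eigenspace_subspace:
  assumes "cplx.subspace X" shows "cplx.subspace (gen_eigenspace X F c)"
proof (rule cplx.subspaceI)
  show "0 \<in> gen_eigenspace X F c" unfolding gen_eigenspace_pact
    using assms by (auto simp: cplx.subspace_0 clin.zero[OF clin_pact])
next
  fix x y assume "x \<in> gen_eigenspace X F c" "y \<in> gen_eigenspace X F c"
  then obtain m m' where x: "x \<in> X" "pact F ([:- c, 1:] ^ m) x = 0" and y: "y \<in> X" "pact F ([:- c, 1:] ^ m') y = 0"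
    unfolding gen_eigenspace_pact by blast
  have "pact F ([:- c, 1:] ^ (m + m')) x = pact F ([:- c, 1:] ^ m') (pact F ([:- c, 1:] ^ m) x)"
    by (simp only: pact_mult[symmetric] power_add mult.commute)
  moreover have "pact F ([:- c, 1:] ^ (m + m')) y = pact F ([:- c, 1:] ^ m) (pact F ([:- c, 1:] ^ m') y)"
    by (simp only: pact_mult[symmetric] power_add)
  ultimately have "pact F ([:- c, 1:] ^ (m + m')) (x + y) = 0"
    using x y by (simp add: clin.zero[OF clin_pact] clin.add[OF clin_pact])
  then show "x + y \<in> gen_eigenspace X F c" unfolding gen_eigenspace_pact
    using x y assms by (auto intro: cplx.subspace_add)
next
  fix d x assume "x \<in> gen_eigenspace X F c"
  then show "cscale d x \<in> gen_eigenspace X F c" unfolding gen_eigenspace_pact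
    using assms by (auto simp: clin.scale[OF clin_pact] cplx.subspace_scale)
qed

lemma direct_sum_gen_eigenspace:
  assumes X: "cplx.subspace X" "\<And>x. x \<in> X \<Longrightarrow> F x \<in> X" and "finite K"
    and g: "g \<noteq> 0" "\<And>a. a \<in> X \<Longrightarrow> pact F g a = 0" "{c. poly g c = 0} \<subseteq> K"
  shows "direct_sum K (gen_eigenspace X F) X"
  unfolding direct_sum_def
proof (intro conjI allI impI Set.set_eqI iffI)
  show "finite K" by fact
next
  fix x assume x: "x \<in> X"
  obtain w where w: "\<forall>c. poly g c = 0 \<longrightarrow> w c \<in> gen_eigenspace X F c" "x = (\<Sum>c\<in>{c. poly g c = 0}. w c)"
    using gen_eigenspace_decomp[OF X g(1) x g(2)[OF x]] by blast
  let ?w = "\<lambda>c. if poly g c = 0 then w c else 0"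
  have "x = (\<Sum>c\<in>K. ?w c)"
    unfolding w(2) by (rule sum.mono_neutral_cong_left) (use assms in auto)
  moreover have "\<forall>c\<in>K. ?w c \<in> gen_eigenspace X F c"
    using w(1) gen_eigenspace_subspace[OF X(1)] by (auto simp: cplx.subspace_0)
  ultimately show "x \<in> {\<Sum>c\<in>K. w c | w. \<forall>c\<in>K. w c \<in> gen_eigenspace X F c}" by blast
next
  fix x assume "x \<in> {\<Sum>c\<in>K. w c | w. \<forall>c\<in>K. w c \<in> gen_eigenspace X F c}"
  then obtain w where "x = (\<Sum>c\<in>K. w c)" "\<forall>c\<in>K. w c \<in> gen_eigenspace X F c" by blast
  then show "x \<in> X" by (auto intro!: cplx.subspace_sum[OF X(1)] simp: gen_eigenspace_def)
next
  fix w assume "(\<forall>c\<in>K. w c \<in> gen_eigenspace X F c) \<and> (\<Sum>c\<in>K. w c) = 0"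
  then show "\<forall>c\<in>K. w c = 0" using gen_eigenspace_indep[OF \<open>finite K\<close>] by blast
qed

text \<open>Applying the power l - i of F - c sends the terms after i to 0 and the i-th vector to
  the last one of the chain; the coefficients before i vanish by induction.\<close>

lemma chain_independent:
  assumes "pact F ([:- c, 1:] ^ Suc l) v = 0" "pact F ([:- c, 1:] ^ l) v \<noteq> 0"
    and "(\<Sum>i\<le>l. cscale (g i) (pact F ([:- c, 1:] ^ i) v)) = 0" "i \<le> l"
  shows "g i = 0"
proof -
  let ?T = "\<lambda>i. pact F ([:- c, 1:] ^ i)"
  have big: "?T j v = 0" if "j > l" for j
  proof -
    have "[:- c, 1:] ^ j = [:- c, 1:] ^ (j - Suc l) * [:- c, 1:] ^ Suc l"
      using that by (simp only: power_add[symmetric]) simp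
    then have "?T j v = ?T (j - Suc l) (?T (Suc l) v)" by (simp only: pact_mult)
    then show ?thesis using assms(1) by (simp add: clin.zero[OF clin_pact])
  qed
  show ?thesis using \<open>i \<le> l\<close>
  proof (induction i rule: less_induct)
    case (less i)
    have "0 = ?T (l - i) (\<Sum>j\<le>l. cscale (g j) (?T j v))"
      using assms(3) by (simp add: clin.zero[OF clin_pact])
    also have "\<dots> = (\<Sum>j\<le>l. cscale (g j) (?T (l - i + j) v))"
      by (simp only: clin.sum[OF clin_pact] clin.scale[OF clin_pact] power_add pact_mult)
    also have "\<dots> = (\<Sum>j\<in>{i}. cscale (g j) (?T (l - i + j) v))"
    proof (rule sum.mono_neutral_right)
      show "\<forall>j\<in>{..l} - {i}. cscale (g j) (?T (l - i + j) v) = 0"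
      proof
        fix j assume j: "j \<in> {..l} - {i}"
        show "cscale (g j) (?T (l - i + j) v) = 0"
        proof (cases "j < i")
          case True then show ?thesis using less by simp
        next
          case False
          then have "l - i + j > l" using j less by auto
          then show ?thesis using big by simp
        qed
      qed
    qed (use less in auto)
    finally have "cscale (g i) (?T l v) = 0" using less by simp
    then show ?case using assms(2) by simp
  qed
qed

lemma jordan_block_chain:
  assumes "pact F ([:- c, 1:] ^ Suc l) v = 0" "pact F ([:- c, 1:] ^ l) v \<noteq> 0"
    and X: "X = cplx.span ((\<lambda>i. pact F ([:- c, 1:] ^ i) v) ` {..l})"
  shows "jordan_block_on X F (Suc l) c"
    and "inj_on (\<lambda>i. pact F ([:- c, 1:] ^ i) v) {..l}"
    and "cplx.independent ((\<lambda>i. pact F ([:- c, 1:] ^ i) v) ` {..l})"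
proof -
  define u where "u = (\<lambda>i. pact F ([:- c, 1:] ^ i) v)"
  have st: "F (u i) = cscale c (u i) + u (Suc i)" for i
    unfolding u_def by (simp only: power_Suc pact_mult pact_linear) simp
  have u0: "u (Suc l) = 0" using assms(1) by (simp only: u_def)
  have Xu: "X = cplx.span (u ` {..l})" using X by (simp only: u_def)
  have i: "inj_on u {..l}" "cplx.independent (u ` {..l})"
    using cplx.independent_familyI[of "{..l}" u] chain_independent[OF assms(1,2)]
    unfolding u_def by blast+
  then show "inj_on (\<lambda>i. pact F ([:- c, 1:] ^ i) v) {..l}"
    and "cplx.independent ((\<lambda>i. pact F ([:- c, 1:] ^ i) v) ` {..l})" unfolding u_def by auto
  \<comment> \<open>\<open>jordan_block_on\<close> counts from the eigenvector upwards, whereas u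
    starts at the generator.\<close>
  let ?w = "\<lambda>i. u (l - i)"
  have im: "?w ` {..<Suc l} = u ` {..l}"
  proof (intro Set.set_eqI iffI)
    fix x assume "x \<in> u ` {..l}"
    then obtain m where "m \<le> l" "x = u m" by auto
    then show "x \<in> ?w ` {..<Suc l}" by (intro image_eqI[of _ _ "l - m"]) auto
  qed auto
  have wi: "inj_on ?w {..<Suc l}"
    by (rule eq_card_imp_inj_on) (use im card_image[OF i(1)] in simp_all)
  have w0: "F (?w 0) = cscale c (?w 0)" using st[of l] u0 by simp
  have ws: "\<forall>i. Suc i < Suc l \<longrightarrow> F (?w (Suc i)) = cscale c (?w (Suc i)) + ?w i"
  proof (intro allI impI)
    fix i assume "Suc i < Suc l"
    then have "Suc (l - Suc i) = l - i" by auto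
    then show "F (?w (Suc i)) = cscale c (?w (Suc i)) + ?w i" using st[of "l - Suc i"] by simp
  qed
  have "cplx.independent (?w ` {..<Suc l})" "cplx.span (?w ` {..<Suc l}) = X"
    unfolding im Xu by (rule i(2), rule refl)
  with wi w0 ws show "jordan_block_on X F (Suc l) c"
    unfolding jordan_block_on_def by (intro conjI exI[of _ ?w]) (assumption | simp)+
qed

end

text \<open>The monodromy of a summand agrees with the global map only on that summand; its block
  structure is carried over with this.\<close>

lemma jordan_block_on_cong:
  assumes "\<And>x. x \<in> W \<Longrightarrow> F x = G x" shows "jordan_block_on W F q c = jordan_block_on W G q c"
proof -
  have *: "jordan_block_on W G q c" if FG: "jordan_block_on W F q c" "\<And>x. x \<in> W \<Longrightarrow> F x = G x" for F G
  proof -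
    obtain v where v: "q \<ge> 1" "inj_on v {..<q}" "cplx.independent (v ` {..<q})" "cplx.span (v ` {..<q}) = W"
      "F (v 0) = cscale c (v 0)" "\<forall>i. Suc i < q \<longrightarrow> F (v (Suc i)) = cscale c (v (Suc i)) + v i"
      using FG(1) unfolding jordan_block_on_def by blast
    have "v i \<in> W" if "i < q" for i using v(4) that cplx.span_base[of "v i" "v ` {..<q}"] by auto
    then show ?thesis unfolding jordan_block_on_def using v FG(2)
      by (intro conjI exI[of _ v]) auto
  qed
  show ?thesis
  proof
    assume "jordan_block_on W F q c" from *[OF this assms] show "jordan_block_on W G q c" .
  next
    assume "jordan_block_on W G q c" from *[OF this assms[symmetric]] show "jordan_block_on W F q c" .
  qed
qed

lemma gen_eigenspace_cong:
  assumes "\<And>x. x \<in> W \<Longrightarrow> F x = G x" "\<And>x. x \<in> W \<Longrightarrow> G x \<in> W" "cplx.subspace W"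
  shows "gen_eigenspace W F c = gen_eigenspace W G c"
proof -
  have "((\<lambda>x. F x - cscale c x) ^^ m) a = ((\<lambda>x. G x - cscale c x) ^^ m) a \<and> ((\<lambda>x. G x - cscale c x) ^^ m) a \<in> W"
    if "a \<in> W" for a m
  proof (induction m)
    case (Suc m)
    then show ?case using assms(1,2)[of "((\<lambda>x. G x - cscale c x) ^^ m) a"]
      by (simp add: cplx.subspace_diff[OF assms(3)] cplx.subspace_scale[OF assms(3)])
  qed (use that in simp)
  then show ?thesis unfolding gen_eigenspace_def by auto
qed

section \<open>Complex conjugation and the complex bilinear extension of the form\<close>

lemma cconj_add: "cconj (x + y) = cconj x + cconj y"
  and cconj_diff: "cconj (x - y) = cconj x - cconj y"
  and cconj_cscale: "cconj (cscale c x) = cscale (cnj c) (cconj x)"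
  and cconj_cconj [simp]: "cconj (cconj x) = x"
  and cconj_0 [simp]: "cconj 0 = 0"
  by (auto simp: cconj_def cscale_def prod_eq_iff)

lemma cconj_eq_0_iff [simp]: "cconj x = 0 \<longleftrightarrow> x = 0"
  by (auto simp: cconj_def prod_eq_iff)

lemma cmap_Pair [simp]: "cmap f (x, y) = (f x, f y)"
  by (simp add: cmap_def)

lemma clin_cmap: assumes "linear f" shows "clin (cmap f)"
  by unfold_locales (auto simp: cmap_def cscale_def map_prod_def split_beta linear_add[OF assms] linear_diff[OF assms] linear_scale[OF assms])

lemma cmap_cconj: assumes "linear f" shows "cmap f (cconj a) = cconj (cmap f a)"
  by (simp add: cmap_def cconj_def map_prod_def split_beta linear_neg[OF assms])

lemma pact_cconj:
  assumes "linear f" shows "cconj (pact (cmap f) g a) = pact (cmap f) (map_poly cnj g) (cconj a)"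
proof -
  interpret clin "cmap f" by (rule clin_cmap[OF assms])
  have m: "map_poly cnj (pCons c g) = pCons (cnj c) (map_poly cnj g)" for c g
    by (rule poly_eqI) (simp add: coeff_map_poly coeff_pCons split: nat.split)
  show ?thesis
    by (induction g) (simp_all add: pact_pCons m cconj_add cconj_cscale cmap_cconj[OF assms, symmetric])
qed

lemma cmap_funpow: "(cmap f ^^ m) (x, y) = ((f ^^ m) x, (f ^^ m) y)"
  by (induction m) auto

lemma cbil_bilinear:
  assumes "bilinear L"
  shows cbil_add_left: "cbil L (a + a') b = cbil L a b + cbil L a' b"
    and cbil_add_right: "cbil L b (a + a') = cbil L b a + cbil L b a'"
    and cbil_scale_left: "cbil L (cscale c a) b = c * cbil L a b"
    and cbil_scale_right: "cbil L b (cscale c a) = c * cbil L b a"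
  using assms
  by (auto simp: cbil_def complex_eq_iff cscale_def bilinear_ladd bilinear_radd bilinear_lmul bilinear_rmul
      bilinear_lsub bilinear_rsub algebra_simps)

lemma cbil_zero: assumes "bilinear L" shows "cbil L 0 b = 0" "cbil L b 0 = 0"
  using cbil_scale_left[OF assms, of 0 0 b] cbil_scale_right[OF assms, of b 0 0] by auto

lemma cbil_cconj: assumes "bilinear L" shows "cbil L (cconj a) (cconj b) = cnj (cbil L a b)"
  using assms by (auto simp: cbil_def cconj_def complex_eq_iff bilinear_lneg bilinear_rneg)

lemma cbil_real [simp]: assumes "bilinear L" shows "cbil L (x, 0) (y, 0) = of_real (L x y)"
  using assms by (auto simp: cbil_def complex_eq_iff bilinear_lzero bilinear_rzero)

lemma csubspace_Times:
  assumes "subspace V" shows "cplx.subspace (V \<times> V)"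
  by (rule cplx.subspaceI)
     (use assms in \<open>auto simp: cscale_def zero_prod_def subspace_0 subspace_add[OF assms]
      subspace_diff[OF assms] subspace_scale[OF assms]\<close>)

section \<open>Continuous eigenvalue functions along paths\<close>

lemma closed_Ints_real: "closed (\<int> :: real set)"
proof -
  have "x \<in> \<int> \<longleftrightarrow> sin (pi * x) = 0" for x :: real
    unfolding sin_zero_iff_int2 by (auto simp: Ints_def mult.commute)
  then have "(\<int> :: real set) = {x. sin (pi * x) = 0}" by blast
  also have "closed \<dots>" by (intro closed_Collect_eq continuous_intros)
  finally show ?thesis .
qed

text \<open>Laplace expansion along the last column, whose nonzero entries are in the first and the
  last row. Deleting the last row and column leaves the same kind of matrix with the coefficients
  shifted by one; deleting the first row leaves a triangular matrix with -1 on the diagonal, and its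
  sign cancels that of the cofactor.\<close>

lemma det_companion:
  fixes f :: "nat \<Rightarrow> 'a::comm_ring_1"
  shows "det (mat (Suc m) (Suc m) (\<lambda>(i, j). (if i = j then [:0, 1:] else 0) +
      (if i = 0 then [:f (m - j):] else if i = Suc j then - 1 else 0))) =
    [:0, 1:] ^ Suc m + (\<Sum>i\<le>m. [:f i:] * [:0, 1:] ^ i)"
    (is "det (?D m f) = _")
proof (induction m arbitrary: f)
  case 0
  show ?case by (subst det_upper_triangular[where n=1]) (auto simp: diag_mat_def)
next
  case (Suc m)
  let ?n = "Suc (Suc m)" and ?X = "[:0, 1:] :: 'a poly"
  let ?A = "?D (Suc m) f"
  have A: "?A \<in> carrier_mat ?n ?n" by simp
  have "det ?A = (\<Sum>i<?n. ?A $$ (i, Suc m) * cofactor ?A i (Suc m))"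
    by (rule laplace_expansion_column[OF A]) simp
  also have "\<dots> = (\<Sum>i\<in>{0, Suc m}. ?A $$ (i, Suc m) * cofactor ?A i (Suc m))"
    by (rule sum.mono_neutral_right) auto
  also have "\<dots> = [:f 0:] * cofactor ?A 0 (Suc m) + ?X * cofactor ?A (Suc m) (Suc m)"
    by simp
  also have "cofactor ?A (Suc m) (Suc m) = det (?D m (\<lambda>i. f (Suc i)))"
  proof -
    have "mat_delete ?A (Suc m) (Suc m) = ?D m (\<lambda>i. f (Suc i))"
      by (rule eq_matI) (auto simp: mat_delete_def Suc_diff_le)
    then show ?thesis by (simp add: cofactor_def)
  qed
  also have "\<dots> = ?X ^ Suc m + (\<Sum>i\<le>m. [:f (Suc i):] * ?X ^ i)" by (rule Suc.IH)
  also have "cofactor ?A 0 (Suc m) = 1"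
  proof -
    let ?B = "mat_delete ?A 0 (Suc m)"
    have B: "?B \<in> carrier_mat (Suc m) (Suc m)" by (auto simp: mat_delete_def)
    have ut: "upper_triangular ?B" by (auto simp: mat_delete_def)
    have "diag_mat ?B = map (\<lambda>_. - 1) [0..<Suc m]" unfolding diag_mat_def by (auto simp: mat_delete_def simp del: upt_Suc)
    then have "det ?B = (- 1) ^ Suc m" using det_upper_triangular[OF ut B] by (simp add: map_replicate_const del: upt_Suc replicate_Suc)
    then show ?thesis by (simp add: cofactor_def power_mult_distrib[symmetric])
  qed
  also have "[:f 0:] * 1 + ?X * (?X ^ Suc m + (\<Sum>i\<le>m. [:f (Suc i):] * ?X ^ i)) =
      ?X ^ ?n + (\<Sum>i\<le>Suc m. [:f i:] * ?X ^ i)"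
  proof -
    have "(\<Sum>i\<le>Suc m. [:f i:] * ?X ^ i) = [:f 0:] + (\<Sum>i\<le>m. [:f (Suc i):] * ?X ^ Suc i)"
      by (subst sum.atMost_Suc_shift) simp
    also have "(\<Sum>i\<le>m. [:f (Suc i):] * ?X ^ Suc i) = ?X * (\<Sum>i\<le>m. [:f (Suc i):] * ?X ^ i)"
      unfolding sum_distrib_left by (rule sum.cong) (simp_all only: power_Suc mult_ac)
    finally show ?thesis by (simp only: distrib_left power_Suc mult_1_right add_ac)
  qed
  finally show ?case .
qed

lemma char_poly_companion:
  assumes "degree q = n" "coeff q n = 1" "n \<ge> 1"
  shows "char_poly (map_mat complex_of_real (companion_row n q)) = map_poly complex_of_real q"
proof -
  obtain m where m: "n = Suc m" using assms(3) by (cases n) auto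
  let ?f = "\<lambda>i. complex_of_real (coeff q i)" and ?X = "[:0, 1:] :: complex poly"
  have "char_poly_matrix (map_mat complex_of_real (companion_row n q)) =
    mat (Suc m) (Suc m) (\<lambda>(i, j). (if i = j then ?X else 0) + (if i = 0 then [:?f (m - j):] else if i = Suc j then - 1 else 0))"
    unfolding char_poly_matrix_def m companion_row_def
    by (rule eq_matI) (auto simp: one_pCons)
  then have "char_poly (map_mat complex_of_real (companion_row n q)) = ?X ^ n + (\<Sum>i\<le>m. [:?f i:] * ?X ^ i)"
    unfolding char_poly_def using det_companion[of m ?f] m by simp
  also have "\<dots> = (\<Sum>i\<le>n. [:?f i:] * ?X ^ i)" using assms(2) by (simp add: m one_pCons)
  also have "\<dots> = (\<Sum>i\<le>n. monom (?f i) i)" by (simp add: monom_altdef)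
  also have "\<dots> = map_poly complex_of_real q"
  proof (rule poly_eqI)
    fix i
    show "coeff (\<Sum>i\<le>n. monom (?f i) i) i = coeff (map_poly complex_of_real q) i"
      using assms(1) by (auto simp: coeff_sum coeff_map_poly coeff_eq_0)
  qed
  finally show ?thesis .
qed

text \<open>The angles for which all spectral numbers vanish: n beta_j = j - k / 2. The zeros are
  those of x^n - (-1)^k, so this is the point of the simplex that belongs to the identity
  matrix.\<close>

definition hor_center :: "nat \<Rightarrow> nat \<Rightarrow> nat \<Rightarrow> real" where
  "hor_center k n j = (if j \<in> {1..n} then (real j - real k / 2) / real n else 0)"

lemma hor_center_Tscal: assumes "n \<ge> 1" "k \<in> {1, 2}" shows "hor_center k n \<in> Tscal k n"
proof -
  have n: "real n > 0" using assms by simp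
  have mono: "mono_on {1..n} (hor_center k n)"
    by (rule mono_onI) (use n in \<open>auto simp: hor_center_def divide_right_mono\<close>)
  have rng: "hor_center k n j \<in> {0..1}" if "j \<in> {1..n}" for j
    using that assms n by (auto simp: hor_center_def field_simps)
  show ?thesis
  proof (cases "k = 1")
    case True
    have "hor_center 1 n j + hor_center 1 n (n + 1 - j) = 1" if "j \<in> {1..n}" for j
    proof -
      have "n + 1 - j \<in> {1..n}" "real (n + 1 - j) = real n + 1 - real j" using that by (auto simp: of_nat_diff)
      then show ?thesis using that n unfolding hor_center_def by (simp only: if_True) (simp add: field_simps)
    qed
    then show ?thesis using True mono rng unfolding Tscal_def Tscal1_def by (auto simp: hor_center_def)
  next
    case False
    then have k: "k = 2" using assms by auto
    have "hor_center 2 n j + hor_center 2 n (n + 2 - j) = 1" if "j \<in> {2..n}" for j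
    proof -
      have "j \<in> {1..n}" "n + 2 - j \<in> {1..n}" "real (n + 2 - j) = real n + 2 - real j" using that by (auto simp: of_nat_diff)
      then show ?thesis using n unfolding hor_center_def by (simp only: if_True) (simp add: field_simps)
    qed
    moreover have "hor_center 2 n 1 = 0" by (simp add: hor_center_def)
    ultimately show ?thesis using k mono rng unfolding Tscal_def Tscal2_def by (auto simp: hor_center_def)
  qed
qed

lemma hor_center_strict:
  assumes "n \<ge> 1" "k \<in> {1, 2}"
  shows "i \<in> {1..n} \<Longrightarrow> j \<in> {1..n} \<Longrightarrow> i < j \<Longrightarrow> hor_center k n i < hor_center k n j"
    "j \<in> {1..n} \<Longrightarrow> hor_center k n j < 1" "k = 1 \<Longrightarrow> j \<in> {1..n} \<Longrightarrow> hor_center k n j > 0"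
  using assms by (auto simp: hor_center_def field_simps)

text \<open>The n points are distinct zeros of both polynomials. Both are monic of degree n, so a
  nonzero difference would have degree below n and too many zeros.\<close>

lemma hor_Pi_center:
  assumes "n \<ge> 1" "k \<in> {1, 2}"
  shows "hor_Pi n (hor_center k n) = monom 1 n - [:(-1) ^ k:]"
proof -
  interpret c: hor_scal n k "hor_center k n" using assms hor_center_Tscal by unfold_locales
  let ?q = "hor_Pi n (hor_center k n) - (monom 1 n - [:(-1) ^ k:])"
  have n: "real n > 0" using assms by simp
  have pw: "c.kap j ^ n = (-1) ^ k" if j: "j \<in> {1..n}" for j
  proof -
    have "c.kap j ^ n = cis (- 2 * pi * (real j - real k / 2))"
      unfolding c.kap_def Complex.DeMoivre using j n by (intro arg_cong[of _ _ cis]) (auto simp: hor_center_def field_simps)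
    also have "\<dots> = cis (- 2 * pi * (real k / 2))"
      unfolding cis_neg_2pi_eq_iff using assms by auto
    also have "\<dots> = (-1) ^ k" using assms by (auto simp: complex_eq_iff mult.commute)
    finally show ?thesis .
  qed
  have inj: "inj_on c.kap {1..n}"
  proof (rule inj_onI)
    fix i j assume ij: "i \<in> {1..n}" "j \<in> {1..n}" "c.kap i = c.kap j"
    have "hor_center k n i = hor_center k n j \<or> (hor_center k n i = 0 \<and> hor_center k n j = 1) \<or> (hor_center k n i = 1 \<and> hor_center k n j = 0)"
      using ij(3) unfolding c.kap_def cis_neg_2pi_eq_unit_iff[OF c.b_range[OF ij(1)] c.b_range[OF ij(2)]] .
    then have "hor_center k n i = hor_center k n j"
      using hor_center_strict(2)[OF assms ij(1)] hor_center_strict(2)[OF assms ij(2)] by auto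
    then show "i = j" using ij n by (auto simp: hor_center_def)
  qed
  have "?q = 0"
  proof (rule ccontr)
    assume q: "?q \<noteq> 0"
    have "coeff ?q i = 0" if "i \<ge> n" for i
    proof -
      have 1: "coeff [:(-1) ^ k :: complex:] i = 0" using that assms by (cases i) auto
      have 2: "coeff (hor_Pi n (hor_center k n)) i = (if i = n then 1 else 0)"
        using that c.Pi_degree c.Pi_monic by (cases "i = n") (simp_all add: coeff_eq_0)
      show ?thesis unfolding coeff_diff 1 2 by simp
    qed
    then have "degree ?q \<le> n - 1" by (intro degree_le allI impI) auto
    moreover have sub: "c.kap ` {1..n} \<subseteq> {x. poly ?q x = 0}"
    proof safe
      fix j assume j: "j \<in> {1..n}"
      then have "poly (hor_Pi n (hor_center k n)) (c.kap j) = 0" using c.poly_Pi_0_iff by blast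
      then show "poly ?q (c.kap j) = 0" using pw[OF j] by (simp add: poly_monom)
    qed
    have "card (c.kap ` {1..n}) \<le> card {x. poly ?q x = 0}" by (rule card_mono[OF poly_roots_finite[OF q] sub])
    then have "n \<le> card {x. poly ?q x = 0}" using card_image[OF inj] by simp
    ultimately show False using card_poly_roots_bound[OF q] assms(1) by linarith
  qed
  then show ?thesis by simp
qed

lemma continuous_coeff_prod:
  fixes f :: "'j \<Rightarrow> 'a::topological_space \<Rightarrow> complex"
  assumes "finite I" "\<And>j. j \<in> I \<Longrightarrow> continuous_on A (f j)"
  shows "continuous_on A (\<lambda>b. coeff (\<Prod>j\<in>I. [:f j b, 1:]) i)"
  using assms
proof (induction I arbitrary: i rule: finite_induct)
  case (insert j I)
  have "coeff (\<Prod>j\<in>insert j I. [:f j b, 1:]) i =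
     f j b * coeff (\<Prod>j\<in>I. [:f j b, 1:]) i + (if i = 0 then 0 else coeff (\<Prod>j\<in>I. [:f j b, 1:]) (i - 1))" for b
    using insert.hyps by (cases i) (simp_all add: coeff_pCons)
  moreover have "continuous_on A (\<lambda>b. f j b * coeff (\<Prod>j\<in>I. [:f j b, 1:]) i + (if i = 0 then 0 else coeff (\<Prod>j\<in>I. [:f j b, 1:]) (i - 1)))"
    using insert by (cases "i = 0") (auto intro!: continuous_intros)
  ultimately show ?case by simp
qed simp

text \<open>The points are functions on all natural numbers, so compactness comes from a product of
  intervals, reduced to a point outside 1, ..., n, and cut down by closed conditions on
  coordinates.\<close>

lemma compact_Tscal: "compact (Tscal k n)"
proof -
  have cc: "continuous_on UNIV (\<lambda>b :: nat \<Rightarrow> real. b j)" for j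
    by (rule continuous_on_product_coordinates)
  have cl: "closed {b :: nat \<Rightarrow> real. b j = 0}" "closed {b :: nat \<Rightarrow> real. b i \<le> b j}" "closed {b :: nat \<Rightarrow> real. b i + b j = 1}" for i j
    by (intro closed_Collect_eq closed_Collect_le continuous_intros cc)+
  let ?X = "PiE UNIV (\<lambda>j. if j \<in> {1..n} then {0..1::real} else {0})"
  have X: "compact ?X"
  proof -
    have "compactin (product_topology (\<lambda>_. euclidean) UNIV) ?X" unfolding compactin_PiE by auto
    then show ?thesis by (simp add: euclidean_product_topology)
  qed
  have s1: "Tscal1 n = ?X \<inter> (\<Inter>i\<in>{1..n}. \<Inter>j\<in>{i..n}. {b. b i \<le> b j}) \<inter> (\<Inter>j\<in>{1..n}. {b. b j + b (n + 1 - j) = 1})"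
    unfolding Tscal1_def mono_on_def by (auto simp: PiE_iff split: if_splits)
  have s2: "Tscal2 n = ?X \<inter> (\<Inter>i\<in>{1..n}. \<Inter>j\<in>{i..n}. {b. b i \<le> b j}) \<inter> {b. b 1 = 0} \<inter> (\<Inter>j\<in>{2..n}. {b. b j + b (n + 2 - j) = 1})"
    unfolding Tscal2_def mono_on_def by (auto simp: PiE_iff split: if_splits)
  have "compact (Tscal1 n)" unfolding s1 by (intro compact_Int_closed X closed_INT ballI cl)
  moreover have "compact (Tscal2 n)" unfolding s2 by (intro compact_Int_closed X closed_INT ballI cl)
  ultimately show ?thesis unfolding Tscal_def by simp
qed

text \<open>A short extension beyond b of the segment from the center to b lies in the affine hull,
  hence still in the simplex. If b satisfied one of the inequalities with equality, the strict
  inequality at the center would be reversed beyond b.\<close>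

lemma rel_interior_strict:
  assumes nk: "n \<ge> 1" "k \<in> {1, 2}" and b: "b \<in> rel_interior_fun n (Tscal k n)"
  shows "i \<in> {1..n} \<Longrightarrow> j \<in> {1..n} \<Longrightarrow> i < j \<Longrightarrow> b i < b j"
    "j \<in> {1..n} \<Longrightarrow> b j < 1" "k = 1 \<Longrightarrow> j \<in> {1..n} \<Longrightarrow> b j > 0"
proof -
  let ?c = "hor_center k n"
  have bT: "b \<in> Tscal k n" using b unfolding rel_interior_fun_def by blast
  obtain ep where ep: "ep > 0" "\<And>c. c \<in> affine_hull_fun (Tscal k n) \<Longrightarrow> (\<forall>j\<in>{1..n}. \<bar>c j - b j\<bar> < ep) \<Longrightarrow> c \<in> Tscal k n"
    using b unfolding rel_interior_fun_def by blast
  interpret b: hor_scal n k b using nk bT by unfold_locales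
  interpret c: hor_scal n k ?c using nk hor_center_Tscal by unfold_locales
  \<comment> \<open>Coordinates of b and of the center differ by at most 1, so moving by t changes
    each coordinate by less than ep.\<close>
  define t where "t = ep / 2"
  have t: "t > 0" "t < ep" using ep by (auto simp: t_def)
  let ?d = "\<lambda>j. b j + t * (b j - ?c j)"
  have dT: "?d \<in> Tscal k n"
  proof (rule ep(2))
    show "?d \<in> affine_hull_fun (Tscal k n)"
    proof (cases "b = ?c")
      case True
      then have "?d = (\<lambda>j. \<Sum>x\<in>{b}. 1 * x j)" by auto
      then show ?thesis unfolding affine_hull_fun_def using bT
        by (intro CollectI exI[of _ "{b}"] exI[of _ "\<lambda>_. 1"]) auto
    next
      case False
      let ?u = "\<lambda>x. if x = b then 1 + t else - t"
      have "?d = (\<lambda>j. \<Sum>x\<in>{b, ?c}. ?u x * x j)" using False by (auto simp: algebra_simps)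
      then show ?thesis unfolding affine_hull_fun_def using bT hor_center_Tscal[OF nk] False
        by (intro CollectI exI[of _ "{b, ?c}"] exI[of _ ?u]) auto
    qed
    show "\<forall>j\<in>{1..n}. \<bar>?d j - b j\<bar> < ep"
    proof
      fix j assume j: "j \<in> {1..n}"
      have "\<bar>b j - ?c j\<bar> \<le> 1" using b.b_range[OF j] c.b_range[OF j] by auto
      then have "\<bar>t * (b j - ?c j)\<bar> \<le> t" using t by (simp add: abs_mult mult_left_le)
      then show "\<bar>?d j - b j\<bar> < ep" using t by simp
    qed
  qed
  interpret d: hor_scal n k ?d using nk dT by unfold_locales
  show "b i < b j" if ij: "i \<in> {1..n}" "j \<in> {1..n}" "i < j"
  proof (rule ccontr)
    assume "\<not> b i < b j"
    then have eq: "b i = b j" using mono_onD[OF b.b_mono ij(1,2)] ij(3) by auto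
    have "?d i \<le> ?d j" using mono_onD[OF d.b_mono ij(1,2)] ij(3) by simp
    then have "t * (?c j - ?c i) \<le> 0" using eq by (simp add: algebra_simps)
    then show False using t hor_center_strict(1)[OF nk ij] by (simp add: mult_le_0_iff)
  qed
  show "b j < 1" if j: "j \<in> {1..n}"
  proof (rule ccontr)
    assume "\<not> b j < 1"
    then have "b j = 1" using b.b_range[OF j] by auto
    moreover have "?d j \<le> 1" using d.b_range[OF j] by auto
    ultimately have "t * (1 - ?c j) \<le> 0" by (simp add: algebra_simps)
    then show False using t hor_center_strict(2)[OF nk j] by (simp add: mult_le_0_iff)
  qed
  show "b j > 0" if k: "k = 1" and j: "j \<in> {1..n}"
  proof (rule ccontr)
    assume "\<not> b j > 0"
    then have "b j = 0" using b.b_range[OF j] by auto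
    moreover have "?d j \<ge> 0" using d.b_range[OF j] by auto
    ultimately have "t * ?c j \<le> 0" by (simp add: algebra_simps)
    then show False using t hor_center_strict(3)[OF nk k j] by (simp add: mult_le_0_iff)
  qed
qed

section \<open>Continuous angles along one path\<close>

context
  fixes n k :: nat and S :: "real mat" and g :: "real \<Rightarrow> real mat"
  assumes nk: "n \<ge> 1" "k \<in> {1, 2}" and path: "hor_path k n S g"
begin

definition gb :: "real \<Rightarrow> nat \<Rightarrow> real" where "gb r = hor_beta k (g r)"

lemma path_data: assumes "r \<in> {0..1}" shows "hor_data n k (gb r) (hor_poly k (g r)) (g r)"
proof -
  have "g r \<in> T_HOR k n" using path assms unfolding hor_path_def by blast
  then obtain q where q: "q \<in> Tpol k n" "g r = hor_S n q" unfolding T_HOR_def by blast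
  obtain b where b: "hor_data n k b q (g r)" using hor_data_exists[OF nk q(1)] q(2) by auto
  then interpret hor_data n k b q "g r" .
  show ?thesis using b hor_poly_S hor_beta_S unfolding gb_def by simp
qed

lemma gb_continuous: "continuous_on {0..1} (\<lambda>r. gb r j)"
proof -
  let ?F = "\<lambda>b i. coeff (hor_Pi n b) i"
  have cF: "continuous_on (Tscal k n) ?F"
  proof (rule continuous_on_coordinatewise_then_product)
    fix i
    have "continuous_on (Tscal k n) (\<lambda>b. coeff (\<Prod>j\<in>{1..n}. [:- cis (- 2 * pi * b j), 1:]) i)"
      by (rule continuous_coeff_prod)
         (auto intro!: continuous_intros continuous_on_subset[OF continuous_on_product_coordinates])
    then show "continuous_on (Tscal k n) (\<lambda>b. ?F b i)" unfolding hor_Pi_def .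
  qed
  have inj: "inj_on ?F (Tscal k n)"
    by (rule inj_onI, rule hor_Pi_inj[OF nk]) (auto simp: poly_eq_iff fun_eq_iff)
  have ct: "compact (Tscal k n)" by (rule compact_Tscal)
  have ci: "continuous_on (?F ` Tscal k n) (inv_into (Tscal k n) ?F)"
    by (rule continuous_on_inv[OF cF ct]) (use inv_into_f_f[OF inj] in auto)
  have cg: "continuous_on {0..1} (\<lambda>r. ?F (gb r))"
  proof (rule continuous_on_coordinatewise_then_product)
    fix i
    \<comment> \<open>The coefficients are matrix entries, except for the constant one, which the
      matrix does not contain and which is a sign depending on k only.\<close>
    have eq: "?F (gb r) i = (if i = 0 then (-1) ^ (k - 1) else if i \<le> n then complex_of_real (g r $$ (0, n - i)) else 0)"
      if r: "r \<in> {0..1}" for r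
    proof -
      interpret hor_data n k "gb r" "hor_poly k (g r)" "g r" by (rule path_data[OF r])
      have e: "?F (gb r) i = complex_of_real (coeff (hor_poly k (g r)) i)" using of_real_coeff_p by simp
      consider "i = 0" | "1 \<le> i" "i \<le> n" | "i > n" by linarith
      then show ?thesis
      proof cases
        case 1 then show ?thesis using e p_const by simp
      next
        case 2
        have "g r $$ (0, n - i) = coeff (hor_poly k (g r)) i"
          using arg_cong[OF S_def, of "\<lambda>A. A $$ (0, n - i)"] 2 nk(1) by (simp add: hor_S_def)
        then show ?thesis using e 2 by simp
      next
        case 3 then show ?thesis using Pi_degree by (simp add: coeff_eq_0)
      qed
    qed
    have "continuous_on {0..1} (\<lambda>r. if i = 0 then (-1) ^ (k - 1) else if i \<le> n then complex_of_real (g r $$ (0, n - i)) else 0)"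
    proof -
      consider "i = 0" | "1 \<le> i" "i \<le> n" | "i > n" by linarith
      then show ?thesis
      proof cases
        case 2
        then have "continuous_on {0..1} (\<lambda>r. g r $$ (0, n - i))" using path nk(1) unfolding hor_path_def by auto
        then have "continuous_on {0..1} (\<lambda>r. complex_of_real (g r $$ (0, n - i)))" by (rule continuous_on_of_real)
        then show ?thesis using 2 by simp
      qed simp_all
    qed
    then show "continuous_on {0..1} (\<lambda>r. ?F (gb r) i)" by (rule continuous_on_eq) (rule eq[symmetric])
  qed
  have T: "gb r \<in> Tscal k n" if "r \<in> {0..1}" for r
    using path_data[OF that] unfolding hor_data_def hor_scal_def by blast
  have "continuous_on {0..1} (\<lambda>r. inv_into (Tscal k n) ?F (?F (gb r)))"
    by (rule continuous_on_compose2[OF ci cg]) (use T in auto)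
  then have "continuous_on {0..1} gb" by (rule continuous_on_eq) (rule inv_into_f_f[OF inj T])
  then show ?thesis by (rule continuous_on_product_then_coordinatewise)
qed

lemma gb_0: "gb 0 = hor_center k n"
proof -
  have "0 \<in> {0..1::real}" by simp
  then interpret hor_data n k "gb 0" "hor_poly k (g 0)" "g 0" by (rule path_data)
  have g0: "g 0 = 1\<^sub>m n" using path unfolding hor_path_def by blast
  have "coeff (hor_Pi n (gb 0)) i = coeff (monom 1 n - [:(-1) ^ k:]) i" for i
  proof -
    consider "i = 0" | "1 \<le> i" "i \<le> n" | "i > n" by linarith
    then show ?thesis
    proof cases
      case 1
      have "(-1) ^ (k - 1) = - ((-1) ^ k :: complex)" using nk by auto
      then show ?thesis using of_real_coeff_p[of 0, symmetric] p_const nk(1) 1 by simp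
    next
      case 2
      have "coeff (hor_poly k (g 0)) i = g 0 $$ (0, n - i)"
        using arg_cong[OF S_def, of "\<lambda>A. A $$ (0, n - i)"] 2 nk(1) by (simp add: hor_S_def)
      then show ?thesis using of_real_coeff_p[of i] g0 2 by (auto simp: coeff_pCons split: nat.split)
    next
      case 3 then show ?thesis using Pi_degree by (auto simp: coeff_eq_0 coeff_pCons split: nat.split)
    qed
  qed
  then have "hor_Pi n (gb 0) = hor_Pi n (hor_center k n)" unfolding hor_Pi_center[OF nk] by (rule poly_eqI)
  then show ?thesis using hor_Pi_inj[OF nk b_Tscal hor_center_Tscal[OF nk]] by blast
qed

lemma char_poly_path: assumes "r \<in> {0..1}"
  shows "char_poly (map_mat complex_of_real (hor_Rmat k (g r))) = (\<Prod>j=1..n. [:- cis (- 2 * pi * gb r j), 1:])"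
proof -
  interpret hor_data n k "gb r" "hor_poly k (g r)" "g r" by (rule path_data[OF assms])
  show ?thesis unfolding hor_Rmat_def dim_S char_poly_companion[OF p_degree p_monic nk(1)] p_Pi hor_Pi_def ..
qed

text \<open>Before the end of the path the eigenvalues are pairwise distinct, so that a continuous
  branch cannot pass from one angle to another.\<close>

lemma gb_strict: assumes r: "0 \<le> r" "r < 1" and ij: "i \<in> {1..n}" "j \<in> {1..n}" "i \<noteq> j"
  shows "gb r j - gb r i \<notin> \<int>"
proof
  assume int: "gb r j - gb r i \<in> \<int>"
  have "r \<in> {0..1}" using r by simp
  then interpret hor_data n k "gb r" "hor_poly k (g r)" "g r" by (rule path_data)
  have "g r \<in> int_T_HOR k n" using path r unfolding hor_path_def by simp
  then obtain q b where qb: "g r = hor_S n q" "b \<in> rel_interior_fun n (Tscal k n)" "map_poly complex_of_real q = hor_Pi n b"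
    unfolding int_T_HOR_def by blast
  have bT: "b \<in> Tscal k n" using qb(2) unfolding rel_interior_fun_def by blast
  have "hor_data n k b q (g r)" using nk bT qb by unfold_locales auto
  then have "gb r = b" unfolding gb_def by (rule hor_data.hor_beta_S)
  then have st: "gb r i < gb r j \<or> gb r j < gb r i" "gb r i < 1" "gb r j < 1"
    using rel_interior_strict[OF nk qb(2)] ij by (auto simp: neq_iff)
  have "cis (- 2 * pi * gb r j) = cis (- 2 * pi * gb r i)" using int by (simp only: cis_neg_2pi_eq_iff)
  then show False using st unfolding cis_neg_2pi_eq_unit_iff[OF b_range[OF ij(2)] b_range[OF ij(1)]] by auto
qed

text \<open>The set of r below 1 where the branch h agrees with the j-th angle is closed by
  continuity. It is open: nearby the differences of h to all other angles avoid the integers, yet h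
  differs from some angle by an integer, hence from the j-th one, and by less than 1. The half-open
  interval is connected.\<close>

lemma lift_unique:
  assumes lift: "hor_lift k n g al" and j: "j \<in> {1..n}" and r: "r \<in> {0..1}"
  shows "al j r = real n * gb r j - real j + real k / 2"
proof -
  define h where "h = (\<lambda>r. (al j r + real j - real k / 2) / real n)"
  have n: "real n > 0" using nk by simp
  have ch: "continuous_on {0..1} h"
    unfolding h_def using lift j n unfolding hor_lift_def by (auto intro!: continuous_intros)
  have h0: "h 0 = gb 0 j" using lift j unfolding hor_lift_def h_def gb_0 by (simp add: hor_center_def)
  have root: "\<exists>i\<in>{1..n}. h r - gb r i \<in> \<int>" if r: "r \<in> {0..1}" for r
  proof -
    have "(\<Prod>i=1..n. [:- cis (- 2 * pi * gb r i), 1:]) = (\<Prod>i=1..n. [:- cis (- 2 * pi * (al i r + real i - real k / 2) / real n), 1:])"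
    proof -
      have "char_poly (map_mat complex_of_real (hor_Rmat k (g r))) =
          (\<Prod>i=1..n. [:- cis (- 2 * pi * (al i r + real i - real k / 2) / real n), 1:])"
        using lift r unfolding hor_lift_def by blast
      then show ?thesis by (rule trans[OF char_poly_path[OF r, symmetric]])
    qed
    then have "poly (\<Prod>i=1..n. [:- cis (- 2 * pi * gb r i), 1:]) (cis (- 2 * pi * h r)) =
       poly (\<Prod>i=1..n. [:- cis (- 2 * pi * (al i r + real i - real k / 2) / real n), 1:]) (cis (- 2 * pi * h r))" by (simp only:)
    also have "\<dots> = 0"
    proof -
      have hc: "cis (- 2 * pi * h r) = cis (- 2 * pi * (al j r + real j - real k / 2) / real n)" by (simp add: h_def)
      show ?thesis unfolding hc poly_prod by (rule prod_zero) (use j in \<open>auto intro!: bexI[of _ j]\<close>)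
    qed
    finally have "\<exists>i\<in>{1..n}. poly [:- cis (- 2 * pi * gb r i), 1:] (cis (- 2 * pi * h r)) = 0"
      by (simp only: poly_prod prod_zero_iff finite_atLeastAtMost)
    then obtain i where i: "i \<in> {1..n}" "poly [:- cis (- 2 * pi * gb r i), 1:] (cis (- 2 * pi * h r)) = 0" by blast
    have "poly [:- a, 1:] x = 0 \<Longrightarrow> x = a" for a x :: complex by simp
    from this[OF i(2)] have "h r - gb r i \<in> \<int>" unfolding cis_neg_2pi_eq_iff .
    with i(1) show ?thesis by blast
  qed
  let ?D = "\<lambda>i r. h r - gb r i"
  have cD: "continuous_on {0..<1} (?D i)" for i
    by (rule continuous_on_subset[of "{0..1}"]) (auto intro!: continuous_intros ch gb_continuous)
  let ?A = "{r\<in>{0..<1}. ?D j r = 0}"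
  have "closedin (top_of_set {0..<1}) ?A"
    by (rule continuous_closedin_preimage_constant[OF cD])
  moreover have "openin (top_of_set {0..<1}) ?A"
  proof (subst openin_subopen, intro ballI)
    fix r0 assume r0: "r0 \<in> ?A"
    let ?B = "{0..<1} \<inter> (\<Inter>i\<in>{1..n} - {j}. {0..<1} \<inter> ?D i -` (- \<int>)) \<inter> ({0..<1} \<inter> ?D j -` {-1<..<1})"
    have o1: "openin (top_of_set {0..<1}) ({0..<1} \<inter> ?D i -` (- \<int>))" for i
      by (rule continuous_openin_preimage_gen[OF cD]) (simp add: closed_Ints_real open_Compl)
    have o2: "openin (top_of_set {0..<1}) ({0..<1} \<inter> ?D j -` {-1<..<1})"
      by (rule continuous_openin_preimage_gen[OF cD]) simp
    have "openin (top_of_set {0..<1}) ({0..<1} \<inter> (\<Inter>i\<in>{1..n} - {j}. {0..<1} \<inter> ?D i -` (- \<int>)))"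
    proof (cases "{1..n} - {j} = {}")
      case True then show ?thesis by (simp only: image_empty Inter_empty) simp
    next
      case False
      then have "openin (top_of_set {0..<1}) (\<Inter>i\<in>{1..n} - {j}. {0..<1} \<inter> ?D i -` (- \<int>))"
        by (intro openin_INT2 o1) auto
      then show ?thesis by (intro openin_Int) auto
    qed
    then have "openin (top_of_set {0..<1}) ?B" using o2 by (rule openin_Int)
    moreover have "r0 \<in> ?B"
    proof -
      have r01: "0 \<le> r0" "r0 < 1" "h r0 = gb r0 j" using r0 by auto
      have "?D i r0 \<notin> \<int>" if "i \<in> {1..n} - {j}" for i using gb_strict[OF r01(1,2) _ j, of i] that r01(3) by auto
      then show ?thesis using r0 by auto
    qed
    moreover have "?B \<subseteq> ?A"
    proof
      fix s assume s: "s \<in> ?B"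
      then have s01: "s \<in> {0..1}" "s \<in> {0..<1}" by auto
      obtain i where i: "i \<in> {1..n}" "?D i s \<in> \<int>" using root[OF s01(1)] by blast
      have "i = j"
      proof (rule ccontr)
        assume "i \<noteq> j" then have "i \<in> {1..n} - {j}" using i by blast
        then have "?D i s \<notin> \<int>" using s by blast
        then show False using i by blast
      qed
      then obtain m :: int where m: "?D j s = of_int m" using i by (auto elim: Ints_cases)
      have "-1 < ?D j s" "?D j s < 1" using s by auto
      then have "m = 0" unfolding m by linarith
      then show "s \<in> ?A" using m s01 by simp
    qed
    ultimately show "\<exists>T. openin (top_of_set {0..<1}) T \<and> r0 \<in> T \<and> T \<subseteq> ?A" by blast
  qed
  moreover have "connected {0..<1::real}" by simp
  ultimately have "?A = {} \<or> ?A = {0..<1}" unfolding connected_clopen by blast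
  moreover have "0 \<in> ?A" using h0 by simp
  ultimately have A: "?A = {0..<1}" by blast
  have eq: "h r = gb r j"
  proof (cases "r < 1")
    case True then have "r \<in> ?A" using A r by auto then show ?thesis by simp
  next
    case False
    \<comment> \<open>At the end point zeros may collide, so the equality there is obtained as a
      limit.\<close>
    have c1: "continuous_on {0..1} (?D j)" by (intro continuous_intros ch gb_continuous)
    have "?D j 1 = 0"
    proof (rule continuous_constant_on_closure[of "{0..<1}" "?D j" 0])
      show "continuous_on (closure {0..<1}) (?D j)" using c1 by simp
      fix x :: real assume "x \<in> {0..<1}"
      then have "x \<in> ?A" using A by blast
      then show "?D j x = 0" by simp
    qed simp
    moreover have "r = 1" using False r by auto
    ultimately show ?thesis by simp
  qed
  then show ?thesis using n unfolding h_def by (simp add: field_simps)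
qed

lemma path_lift:
  "\<exists>al. hor_lift k n g al \<and>
     (\<forall>al'. hor_lift k n g al' \<longrightarrow> (\<forall>j\<in>{1..n}. \<forall>r\<in>{0..1}. al' j r = al j r)) \<and>
     hor_Sp k S = image_mset (\<lambda>j. al j 1) (mset_set {1..n})"
proof (intro exI conjI allI impI ballI)
  let ?al = "\<lambda>j r. real n * gb r j - real j + real k / 2"
  show "hor_lift k n g ?al"
    unfolding hor_lift_def
  proof (intro conjI ballI)
    fix j assume j: "j \<in> {1..n}"
    show "continuous_on {0..1} (?al j)" by (intro continuous_intros gb_continuous)
    show "?al j 0 = 0" using j nk unfolding gb_0 by (simp add: hor_center_def)
  next
    fix r :: real assume r: "r \<in> {0..1}"
    have "- 2 * pi * (?al j r + real j - real k / 2) / real n = - 2 * pi * gb r j" for j using nk by simp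
    then show "char_poly (map_mat complex_of_real (hor_Rmat k (g r))) =
       (\<Prod>j=1..n. [:- cis (- 2 * pi * (?al j r + real j - real k / 2) / real n), 1:])"
      using char_poly_path[OF r] by (simp only:)
  qed
  show "al' j r = ?al j r" if "hor_lift k n g al'" "j \<in> {1..n}" "r \<in> {0..1}" for al' j r
    using lift_unique that by blast
  have "g 1 = S" using path unfolding hor_path_def by blast
  moreover have "1 \<in> {0..1::real}" by simp
  then interpret hor_data n k "gb 1" "hor_poly k (g 1)" "g 1" by (rule path_data)
  have "hor_alpha k (g 1) j = ?al j 1" for j using hor_alpha_S by simp
  then have "hor_alpha k (g 1) = (\<lambda>j. ?al j 1)" by (rule ext)
  moreover have "dim_row S = n" using dim_S \<open>g 1 = S\<close> by simp
  ultimately show "hor_Sp k S = image_mset (\<lambda>j. ?al j 1) (mset_set {1..n})"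
    unfolding hor_Sp_def using \<open>g 1 = S\<close> by (simp only:)
qed

end

section \<open>The automorphism R as an isometry\<close>

declare One_nat_def [simp]

text \<open>The partial results x^j + q_(n-1) x^(j-1) + ... + q_(n-j) of Horner's rule for a monic q
  of degree n. Evaluated at R and applied to \<open>e 0\<close> they give the basis vectors
  (\<open>Phi_horner\<close>).\<close>

primrec horner :: "complex poly \<Rightarrow> nat \<Rightarrow> nat \<Rightarrow> complex poly" where
  "horner q n 0 = 1"
| "horner q n (Suc j) = pCons (coeff q (n - Suc j)) (horner q n j)"

lemma coeff_horner:
  assumes "degree q = n" "coeff q n = 1" "j \<le> n"
  shows "coeff (horner q n j) i = coeff q (n - j + i)"
  using assms(3)
proof (induction j arbitrary: i)
  case 0 then show ?case using assms by (cases i) (auto simp: coeff_eq_0)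
next
  case (Suc j)
  then show ?case by (cases i) (auto simp: Suc_diff_Suc)
qed

lemma S_inverse:
  assumes "hor_data n k b p S"
  shows "S * mat_inv S = 1\<^sub>m n" "mat_inv S * S = 1\<^sub>m n" "mat_inv S \<in> carrier_mat n n"
    "upper_triangular S" "\<And>i. i < n \<Longrightarrow> S $$ (i, i) = 1"
proof -
  interpret hor_data n k b p S by fact
  show d: "S $$ (i, i) = 1" if "i < n" for i
    using that p_monic by (simp add: S_def hor_S_def)
  show ut: "upper_triangular S" by (auto simp: S_def hor_S_def)
  have "det S = prod_list (diag_mat S)" by (rule det_upper_triangular[OF ut S_carrier])
  also have "diag_mat S = map (\<lambda>_. 1) [0..<n]" unfolding diag_mat_def using d S_carrier by auto
  finally have "det S \<noteq> 0" by (simp add: map_replicate_const)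
  from det_non_zero_imp_unit[OF S_carrier this, of undefined] have "mat_inverse S \<noteq> None"
    using mat_inverse(1)[OF S_carrier, of undefined] by blast
  then have "mat_inverse S = Some (mat_inv S)" unfolding mat_inv_def by auto
  from mat_inverse(2)[OF S_carrier this]
  show "S * mat_inv S = 1\<^sub>m n" "mat_inv S * S = 1\<^sub>m n" "mat_inv S \<in> carrier_mat n n" by auto
qed

locale hor_space = hor_data n k beta p S for n k :: nat and beta p S +
  fixes e :: "nat \<Rightarrow> 'v::real_vector" and L :: "'v \<Rightarrow> 'v \<Rightarrow> real" and M R :: "'v \<Rightarrow> 'v"
  assumes inj_e: "inj_on e {..<n}" and indep_e: "independent (e ` {..<n})" and span_e: "span (e ` {..<n}) = UNIV"
    and bil: "bilinear L" and L_e0: "\<And>i j. i < n \<Longrightarrow> j < n \<Longrightarrow> L (e i) (e j) = transpose_mat S $$ (i, j)"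
    and lin_M: "linear M"
    and M_e: "\<And>j. j < n \<Longrightarrow> M (e j) = (\<Sum>i<n. (mat_inv S * transpose_mat S) $$ (i, j) *\<^sub>R e i)"
    and lin_R: "linear R"
    and R_e0: "\<And>j. j < n \<Longrightarrow> R (e j) = (\<Sum>i<n. hor_Rmat k S $$ (i, j) *\<^sub>R e i)"
begin

lemma n0: "0 < n" using n1 by simp

lemma L_e: "i < n \<Longrightarrow> j < n \<Longrightarrow> L (e i) (e j) = (if j \<le> i then coeff p (n - (i - j)) else 0)"
  using L_e0[of i j] S_carrier by (simp add: S_def hor_S_def)

lemma R_e:
  assumes "j < n"
  shows "R (e j) = (if Suc j < n then e (Suc j) else 0) - coeff p (n - Suc j) *\<^sub>R e 0"
proof -
  have "R (e j) = (\<Sum>i<n. (if i = 0 then - coeff p (n - Suc j) *\<^sub>R e 0 else if i = Suc j then e (Suc j) else 0))"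
    unfolding R_e0[OF assms]
    by (rule sum.cong) (use assms in \<open>auto simp: hor_Rmat_def companion_row_def hor_poly_S dim_S\<close>)
  also have "\<dots> = (\<Sum>i<n. (if i = 0 then - coeff p (n - Suc j) *\<^sub>R e 0 else 0) + (if i = Suc j then e (Suc j) else 0))"
    by (rule sum.cong) auto
  also have "\<dots> = - coeff p (n - Suc j) *\<^sub>R e 0 + (if Suc j < n then e (Suc j) else 0)"
    unfolding sum.distrib using n0 by (simp add: sum.delta)
  finally show ?thesis by simp
qed

lemma span_e_familyE: obtains g where "x = (\<Sum>i<n. g i *\<^sub>R e i)"
  using real_vector.span_familyE[of "{..<n}" x e] span_e by auto

lemma e_indepD: "(\<Sum>i<n. g i *\<^sub>R e i) = 0 \<Longrightarrow> i < n \<Longrightarrow> g i = 0"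
  using real_vector.independent_familyD[of "{..<n}" e g i] inj_e indep_e by auto

lemma bilinear_eq_e:
  assumes "bilinear f" "bilinear g" "\<And>i j. i < n \<Longrightarrow> j < n \<Longrightarrow> f (e i) (e j) = g (e i) (e j)"
  shows "f x y = (g x y :: real)"
  by (rule bilinear_eq[OF assms(1,2), of UNIV "e ` {..<n}" UNIV "e ` {..<n}"]) (use assms span_e in auto)

lemma bilinear_comp: assumes "linear f" "linear g" shows "bilinear (\<lambda>x y. L (f x) (g y))"
  using bil linear_compose[OF assms(1)] linear_compose[OF assms(2)]
  unfolding bilinear_def by (auto simp: o_def)

lemma bilinear_swap: "bilinear (\<lambda>x y. L y x)"
  using bil unfolding bilinear_def by auto

lemma L_sum_left: "L (\<Sum>i\<in>I. g i *\<^sub>R x i) y = (\<Sum>i\<in>I. g i * L (x i) y)"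
  by (induction I rule: infinite_finite_induct)
     (auto simp: bilinear_ladd[OF bil] bilinear_lmul[OF bil] bilinear_lzero[OF bil])

lemma lin_Rn: "linear (R ^^ m)"
proof (induction m)
  case (Suc m) then show ?case using linear_compose[OF Suc lin_R] by (simp add: o_def)
qed (auto simp: linear_iff)

text \<open>Checked on the basis. If neither index is the last one, the corrections by multiples of
  \<open>e 0\<close> cancel and the Toeplitz shape gives the equality. If an index is the last one,
  there is no next basis vector and only the corrections remain; when only the first index is last,
  these match by the palindromic symmetry of p.\<close>

lemma L_R: "L (R a) (R b) = L a b"
proof (rule bilinear_eq_e[of "\<lambda>a b. L (R a) (R b)" L])
  show "bilinear (\<lambda>a b. L (R a) (R b))" by (rule bilinear_comp[OF lin_R lin_R])
  show "bilinear L" by (rule bil)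
next
  fix i j assume ij: "i < n" "j < n"
  have pal: "coeff p (n - m) = (-1) ^ (k - 1) * coeff p m" if "m \<le> n" for m using p_palindromic that by blast
  have sq: "(-1) ^ (k - 1) * ((-1) ^ (k - 1) * (x::real)) = x" for x
    by (simp add: mult.assoc[symmetric] power_add[symmetric])
  have exp: "L (x - a *\<^sub>R e 0) (y - b *\<^sub>R e 0) = L x y - b * L x (e 0) - a * L (e 0) y + a * b * L (e 0) (e 0)" for x y a b
    using bil by (simp add: bilinear_lsub bilinear_rsub bilinear_lmul bilinear_rmul algebra_simps)
  have L00: "L (e 0) (e 0) = 1" using L_e[of 0 0] n0 p_monic by simp
  have z: "L x 0 = 0" "L 0 x = 0" for x using bil by (simp_all add: bilinear_lzero bilinear_rzero)
  consider "Suc i < n" "Suc j < n" | "Suc i < n" "Suc j = n" | "Suc i = n" "Suc j < n" | "Suc i = n" "Suc j = n"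
    using ij by linarith
  then show "L (R (e i)) (R (e j)) = L (e i) (e j)"
  proof cases
    case 1
    then show ?thesis using n0 ij unfolding R_e[OF ij(1)] R_e[OF ij(2)] exp
      by (simp add: L00 L_e)
  next
    case 2
    then have "L (e i) (e j) = 0" using ij by (simp add: L_e)
    moreover have "L (e (Suc i)) (e 0) = coeff p (n - Suc i)" using 2 n0 by (simp add: L_e)
    ultimately show ?thesis unfolding R_e[OF ij(1)] R_e[OF ij(2)] exp using 2 by (simp add: z L00)
  next
    case 3
    have "n - (i - j) = Suc j" "j \<le> i" using 3 ij by arith+
    then have "L (e i) (e j) = coeff p (Suc j)" using L_e[OF ij] by simp
    moreover have "L (e 0) (e (Suc j)) = 0" using 3 n0 by (simp add: L_e)
    moreover have "coeff p (n - Suc j) = (-1) ^ (k - 1) * coeff p (Suc j)" using pal 3 by simp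
    ultimately show ?thesis unfolding R_e[OF ij(1)] R_e[OF ij(2)] exp using 3 p_const by (simp add: z L00 sq)
  next
    case 4
    then have "i = j" by simp
    then have "L (e i) (e j) = 1" using ij p_monic by (simp add: L_e)
    then show ?thesis unfolding R_e[OF ij(1)] R_e[OF ij(2)] exp using 4 p_const sq[of 1] by (simp add: z L00)
  qed
qed

lemma L_Rn: "L ((R ^^ m) a) ((R ^^ m) b) = L a b"
  by (induction m arbitrary: a b) (auto simp: L_R)

lemma R_surj: "\<exists>y. R y = x"
proof -
  have sub: "subspace (range R)" using linear_subspace_image[OF lin_R subspace_UNIV] .
  have "n - 1 < n" "Suc (n - 1) = n" using n0 by auto
  then have "R (e (n - 1)) = - coeff p 0 *\<^sub>R e 0" using R_e[of "n - 1"] by simp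
  then have "- coeff p 0 *\<^sub>R R (e (n - 1)) = e 0" using p_const by (simp add: power_add[symmetric])
  then have e0: "e 0 \<in> range R" using subspace_scale[OF sub, of "R (e (n - 1))" "- coeff p 0"] by auto
  have "e j \<in> range R" if "j < n" for j
  proof (cases j)
    case (Suc i)
    then have "e j = R (e i) + coeff p (n - Suc i) *\<^sub>R e 0" using R_e[of i] that by simp
    then show ?thesis using subspace_add[OF sub _ subspace_scale[OF sub e0]] by auto
  qed (use e0 in simp)
  then have "span (e ` {..<n}) \<subseteq> range R" by (intro span_minimal sub) auto
  then show ?thesis using span_e by (metis UNIV_I imageE subsetD)
qed

text \<open>The Gram matrix is triangular with ones on the diagonal. The coefficients of a vanish
  from the last index downwards, by pairing with the basis vector of that index; the induction
  variable m counts from the end.\<close>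

lemma L_nondeg: assumes "\<And>b. L a b = 0" shows "a = 0"
proof -
  obtain g where g: "a = (\<Sum>i<n. g i *\<^sub>R e i)" by (rule span_e_familyE)
  have "\<forall>i<n. n - Suc m \<le> i \<longrightarrow> g i = 0" if "m < n" for m
    using that
  proof (induction m rule: less_induct)
    case (less m)
    have z: "g i = 0" if "i < n" "n - Suc m < i" for i
    proof -
      have "n - Suc i < m" "n - Suc (n - Suc i) \<le> i" using that less by auto
      then show ?thesis using less.IH[of "n - Suc i"] that less by auto
    qed
    let ?t = "n - Suc m"
    have t: "?t < n" using less by auto
    have "0 = L a (e ?t)" using assms by simp
    also have "\<dots> = (\<Sum>i<n. g i * L (e i) (e ?t))"
      unfolding g by (rule L_sum_left)
    also have "\<dots> = (\<Sum>i\<in>{?t}. g i * L (e i) (e ?t))"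
    proof (rule sum.mono_neutral_right)
      show "\<forall>i\<in>{..<n} - {?t}. g i * L (e i) (e ?t) = 0"
      proof
        fix i assume i: "i \<in> {..<n} - {?t}"
        show "g i * L (e i) (e ?t) = 0"
          using i z[of i] L_e[of i ?t] t by (cases "i < ?t") auto
      qed
    qed (use t in auto)
    also have "\<dots> = g ?t" using L_e[OF t t] p_monic by simp
    finally show ?case using z by (metis le_neq_implies_less)
  qed
  from this[of "n - 1"] n0 have "g i = 0" if "i < n" for i using that by auto
  then show ?thesis unfolding g by simp
qed

text \<open>For i = 1 and j below n - 1 the two terms of R applied to \<open>e j\<close> cancel. In
  general one application of R trades a power of R for the next basis vector and keeps i + j; at i +
  j = n the basis ends and the correction by a multiple of \<open>e 0\<close> is what
  survives.\<close>

lemma L_R_e0: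
  assumes "1 \<le> i"
  shows "i + j < n \<Longrightarrow> L ((R ^^ i) (e j)) (e 0) = 0"
    and "i + j = n \<Longrightarrow> L ((R ^^ i) (e j)) (e 0) = - coeff p 0"
proof -
  have L00: "L (e 0) (e 0) = 1" using L_e[of 0 0] n0 p_monic by simp
  have step: "L ((R ^^ m) (R (e j))) (e 0) = (if Suc j < n then L ((R ^^ m) (e (Suc j))) (e 0) else 0) - coeff p (n - Suc j) * L ((R ^^ m) (e 0)) (e 0)"
    if "j < n" for j m
    unfolding R_e[OF that] linear_diff[OF lin_Rn] linear_scale[OF lin_Rn]
    using bil by (simp add: bilinear_lsub bilinear_lmul bilinear_lzero linear_0[OF lin_Rn])
  have A: "\<forall>j. i + j < n \<longrightarrow> L ((R ^^ i) (e j)) (e 0) = 0" if "1 \<le> i" for i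
    using that
  proof (induction i rule: nat_induct_at_least)
    case base
    show ?case
    proof (intro allI impI)
      fix j assume "1 + j < n"
      then show "L ((R ^^ 1) (e j)) (e 0) = 0" using step[of j 0] n0 by (simp add: L00 L_e)
    qed
  next
    case (Suc i)
    show ?case
    proof (intro allI impI)
      fix j assume j: "Suc i + j < n"
      then have "L ((R ^^ i) (e (Suc j))) (e 0) = 0" "L ((R ^^ i) (e 0)) (e 0) = 0" using Suc by auto
      then show "L ((R ^^ Suc i) (e j)) (e 0) = 0" using step[of j i] j by (simp add: funpow_swap1)
    qed
  qed
  then show "i + j < n \<Longrightarrow> L ((R ^^ i) (e j)) (e 0) = 0" using assms by blast
  have "\<forall>j. i + j = n \<longrightarrow> L ((R ^^ i) (e j)) (e 0) = - coeff p 0"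
    using assms
  proof (induction i rule: nat_induct_at_least)
    case base
    show ?case
    proof (intro allI impI)
      fix j assume "1 + j = n"
      then show "L ((R ^^ 1) (e j)) (e 0) = - coeff p 0" using step[of j 0] n0 by (simp add: L00)
    qed
  next
    case (Suc i)
    show ?case
    proof (intro allI impI)
      fix j assume j: "Suc i + j = n"
      then have "L ((R ^^ i) (e (Suc j))) (e 0) = - coeff p 0" "L ((R ^^ i) (e 0)) (e 0) = 0" using Suc A[of i] by auto
      then show "L ((R ^^ Suc i) (e j)) (e 0) = - coeff p 0" using step[of j i] j Suc by (simp add: funpow_swap1)
    qed
  qed
  then show "i + j = n \<Longrightarrow> L ((R ^^ i) (e j)) (e 0) = - coeff p 0" by blast
qed

lemma span_powers: "span ((\<lambda>i. (R ^^ i) (e 0)) ` {..<n}) = UNIV"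
proof -
  let ?W = "\<lambda>m. span ((\<lambda>i. (R ^^ i) (e 0)) ` {..<m})"
  have up: "R x \<in> ?W (Suc m)" if "x \<in> ?W m" for x m
  proof -
    have "R x \<in> R ` ?W m" using that by auto
    also have "\<dots> = span (R ` (\<lambda>i. (R ^^ i) (e 0)) ` {..<m})" using linear_span_image[OF lin_R] by metis
    also have "\<dots> \<subseteq> ?W (Suc m)"
    proof (rule span_mono)
      show "R ` (\<lambda>i. (R ^^ i) (e 0)) ` {..<m} \<subseteq> (\<lambda>i. (R ^^ i) (e 0)) ` {..<Suc m}"
      proof
        fix y assume "y \<in> R ` (\<lambda>i. (R ^^ i) (e 0)) ` {..<m}"
        then obtain i where "i < m" "y = R ((R ^^ i) (e 0))" by auto
        then show "y \<in> (\<lambda>i. (R ^^ i) (e 0)) ` {..<Suc m}" by (intro image_eqI[of _ _ "Suc i"]) auto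
      qed
    qed
    finally show ?thesis .
  qed
  have ej: "e j \<in> ?W (Suc j)" if "j < n" for j using that
  proof (induction j)
    case 0
    have "(R ^^ 0) (e 0) \<in> ?W 1" by (rule span_base) (rule image_eqI[of _ _ 0], auto)
    then show ?case by simp
  next
    case (Suc j)
    have "e 0 \<in> ?W (Suc (Suc j))" using span_base[of "(R ^^ 0) (e 0)" "(\<lambda>i. (R ^^ i) (e 0)) ` {..<Suc (Suc j)}"] by force
    moreover have "e (Suc j) = R (e j) + coeff p (n - Suc j) *\<^sub>R e 0" using R_e[of j] Suc by simp
    ultimately show ?case using up[OF Suc.IH] Suc by (auto intro: span_add span_scale)
  qed
  have "?W (Suc j) \<subseteq> ?W n" if "j < n" for j using that by (intro span_mono image_mono) auto
  with ej have "e ` {..<n} \<subseteq> ?W n" by blast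
  then have "span (e ` {..<n}) \<subseteq> ?W n" by (intro span_minimal) auto
  then show ?thesis using span_e by auto
qed

text \<open>As R is an isometry and \<open>e 0\<close> is cyclic, the case a = \<open>e 0\<close>, b
  = R^d applied to \<open>e 0\<close>, with d below n, suffices. Both sides are then values from
  \<open>L_R_e0\<close>: zero for d > 0, and for d = 0 the left side is minus the constant
  coefficient.\<close>

lemma L_Rn_swap: "L ((R ^^ n) a) b = (-1) ^ k * L b a"
proof -
  let ?B = "\<lambda>a b. L ((R ^^ n) a) b - (-1) ^ k * L b a"
  have p0: "- coeff p 0 = (-1) ^ k" using p_const k12 by auto
  have base: "?B (e 0) ((R ^^ d) (e 0)) = 0" if "d < n" for d
  proof -
    have "(R ^^ n) (e 0) = (R ^^ d) ((R ^^ (n - d)) (e 0))"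
      using funpow_add[of d "n - d" R] that by simp
    then have "L ((R ^^ n) (e 0)) ((R ^^ d) (e 0)) = L ((R ^^ (n - d)) (e 0)) (e 0)" using L_Rn by simp
    moreover have "L (e 0) (e 0) = 1" using L_e[of 0 0] n0 p_monic by simp
    ultimately show ?thesis
      using L_R_e0[of n 0] L_R_e0(1)[of "n - d" 0] L_R_e0(1)[of d 0] that p0 n0
      by (cases "d = 0") auto
  qed
  have linb: "linear (\<lambda>b. ?B a b)" for a
    using bil by (auto simp: linear_iff bilinear_radd bilinear_ladd bilinear_rmul bilinear_lmul algebra_simps)
  have lina: "linear (\<lambda>a. ?B a b)" for b
    using bil by (auto simp: linear_iff bilinear_radd bilinear_ladd bilinear_rmul bilinear_lmul algebra_simps
        linear_add[OF lin_Rn] linear_scale[OF lin_Rn])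
  have zero: "linear (\<lambda>b::'v. 0::real)" by (auto simp: linear_iff)
  have B0: "?B (e 0) b = 0" for b
    by (rule linear_eq_on_span[OF linb zero, of "(\<lambda>i. (R ^^ i) (e 0)) ` {..<n}"]) (use base span_powers in auto)
  have Bi: "?B ((R ^^ i) (e 0)) b = 0" for i b
  proof (induction i arbitrary: b)
    case (Suc i)
    \<comment> \<open>Surjectivity allows one R to be removed from both arguments, which lowers the
      power of R in the first.\<close>
    obtain b' where b': "b = R b'" using R_surj by metis
    have "(R ^^ n) ((R ^^ Suc i) (e 0)) = R ((R ^^ n) ((R ^^ i) (e 0)))" by (simp add: funpow_swap1)
    then show ?case using Suc[of b'] b' L_R by simp
  qed (use B0 in simp)
  have "?B a b = 0"
    by (rule linear_eq_on_span[OF lina zero, of "(\<lambda>i. (R ^^ i) (e 0)) ` {..<n}"]) (use Bi span_powers in auto)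
  then show ?thesis by simp
qed

text \<open>This identifies M with the monodromy. In matrices it is (S A)^t = S for A = S^(-1)
  S^t.\<close>

lemma L_M: "L (M a) b = L b a"
proof (rule bilinear_eq_e[of "\<lambda>a b. L (M a) b" "\<lambda>a b. L b a"])
  show "bilinear (\<lambda>a b. L (M a) b)" using bilinear_comp[OF lin_M linear_id] by simp
  show "bilinear (\<lambda>a b. L b a)" by (rule bilinear_swap)
next
  fix j l assume jl: "j < n" "l < n"
  note inv = S_inverse[OF hor_data_axioms]
  let ?A = "mat_inv S * transpose_mat S"
  have A: "?A \<in> carrier_mat n n" using inv S_carrier by auto
  have "L (M (e j)) (e l) = (\<Sum>i<n. ?A $$ (i, j) * L (e i) (e l))"
    unfolding M_e[OF jl(1)] by (rule L_sum_left)
  also have "\<dots> = (\<Sum>i<n. transpose_mat ?A $$ (j, i) * transpose_mat S $$ (i, l))"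
    by (rule sum.cong) (use jl A S_carrier L_e0 inv in auto)
  also have "\<dots> = (transpose_mat ?A * transpose_mat S) $$ (j, l)"
  proof -
    have "(\<Sum>i<n. B $$ (j, i) * C $$ (i, l)) = (B * C) $$ (j, l)"
      if "B \<in> carrier_mat n n" "C \<in> carrier_mat n n" for B C :: "real mat"
      using that jl by (simp add: scalar_prod_def atLeast0LessThan)
    then show ?thesis using A S_carrier by simp
  qed
  also have "transpose_mat ?A * transpose_mat S = transpose_mat (S * ?A)"
    using transpose_mult[OF S_carrier A] by simp
  also have "S * ?A = transpose_mat S"
    using assoc_mult_mat[OF S_carrier inv(3), of "transpose_mat S" n] S_carrier inv(1) by simp
  finally show "L (M (e j)) (e l) = L (e l) (e j)" using L_e0[of l j] jl S_carrier by simp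
qed

lemma M_eq: "M x = (-1) ^ k *\<^sub>R (R ^^ n) x"
proof -
  have sq: "(-1) ^ k * ((-1) ^ k * (x::real)) = x" for x
    by (simp add: mult.assoc[symmetric] power_add[symmetric])
  have "L (M x - (-1) ^ k *\<^sub>R (R ^^ n) x) b = 0" for b
    using bil by (simp add: bilinear_lsub bilinear_lmul L_M L_Rn_swap sq)
  from L_nondeg[OF this] show ?thesis by simp
qed

lemma R_pow_e:
  "j < n \<Longrightarrow> (R ^^ m) (e j) = (\<Sum>i<n. (hor_Rmat k S ^\<^sub>m m) $$ (i, j) *\<^sub>R e i)"
proof (induction m arbitrary: j)
  case 0
  have d: "dim_row (hor_Rmat k S) = n" by (simp add: hor_Rmat_def companion_row_def dim_S)
  have "(\<Sum>i<n. (1\<^sub>m n) $$ (i, j) *\<^sub>R e i) = (\<Sum>i\<in>{j}. (1\<^sub>m n) $$ (i, j) *\<^sub>R e i)"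
    by (rule sum.mono_neutral_right) (use 0 in auto)
  then show ?case using 0 d by simp
next
  case (Suc m)
  let ?A = "hor_Rmat k S"
  have A: "?A \<in> carrier_mat n n" by (simp add: hor_Rmat_def companion_row_def dim_S)
  have Am: "?A ^\<^sub>m m \<in> carrier_mat n n" using A by simp
  have "(R ^^ Suc m) (e j) = (R ^^ m) (\<Sum>l<n. ?A $$ (l, j) *\<^sub>R e l)"
    unfolding R_e0[OF Suc.prems, symmetric] by (simp add: funpow_swap1)
  also have "\<dots> = (\<Sum>l<n. ?A $$ (l, j) *\<^sub>R (\<Sum>i<n. (?A ^\<^sub>m m) $$ (i, l) *\<^sub>R e i))"
    using Suc.IH by (simp add: linear_sum[OF lin_Rn] linear_scale[OF lin_Rn])
  also have "\<dots> = (\<Sum>i<n. \<Sum>l<n. (?A $$ (l, j) * (?A ^\<^sub>m m) $$ (i, l)) *\<^sub>R e i)"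
    by (simp add: scaleR_sum_right) (rule sum.swap)
  also have "\<dots> = (\<Sum>i<n. (?A ^\<^sub>m Suc m) $$ (i, j) *\<^sub>R e i)"
  proof (rule sum.cong)
    fix i assume i: "i \<in> {..<n}"
    have "(?A ^\<^sub>m Suc m) $$ (i, j) = (\<Sum>l<n. (?A ^\<^sub>m m) $$ (i, l) * ?A $$ (l, j))"
      using i Suc.prems A Am by (simp add: scalar_prod_def atLeast0LessThan)
    then show "(\<Sum>l<n. (?A $$ (l, j) * (?A ^\<^sub>m m) $$ (i, l)) *\<^sub>R e i) = (?A ^\<^sub>m Suc m) $$ (i, j) *\<^sub>R e i"
      by (simp add: scaleR_sum_left mult.commute)
  qed simp
  finally show ?case .
qed

text \<open>Read off from \<open>M_eq\<close> by comparing coordinates in the basis.\<close>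

lemma mat_eq: "(-1) ^ k \<cdot>\<^sub>m (mat_inv S * transpose_mat S) = hor_Rmat k S ^\<^sub>m n"
proof (rule eq_matI)
  note inv = S_inverse[OF hor_data_axioms]
  have A: "mat_inv S * transpose_mat S \<in> carrier_mat n n" using inv S_carrier by auto
  have B: "hor_Rmat k S ^\<^sub>m n \<in> carrier_mat n n" by (simp add: hor_Rmat_def companion_row_def dim_S)
  show "dim_row ((-1) ^ k \<cdot>\<^sub>m (mat_inv S * transpose_mat S)) = dim_row (hor_Rmat k S ^\<^sub>m n)"
    "dim_col ((-1) ^ k \<cdot>\<^sub>m (mat_inv S * transpose_mat S)) = dim_col (hor_Rmat k S ^\<^sub>m n)"
    using carrier_matD[OF A] carrier_matD[OF B] by (simp_all only: index_smult_mat)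
  fix i j assume "i < dim_row (hor_Rmat k S ^\<^sub>m n)" "j < dim_col (hor_Rmat k S ^\<^sub>m n)"
  then have ij: "i < n" "j < n" using carrier_matD[OF B] by (simp_all only:)
  have sq: "(-1) ^ k * ((-1) ^ k * (x::real)) = x" for x
    by (simp add: mult.assoc[symmetric] power_add[symmetric])
  have "(R ^^ n) (e j) = (-1) ^ k *\<^sub>R M (e j)" unfolding M_eq by (simp add: sq[of 1, simplified])
  then have "(\<Sum>i<n. ((hor_Rmat k S ^\<^sub>m n) $$ (i, j) - (-1) ^ k * (mat_inv S * transpose_mat S) $$ (i, j)) *\<^sub>R e i) = 0"
    unfolding R_pow_e[OF ij(2)] M_e[OF ij(2)] by (simp add: scaleR_sum_right scaleR_diff_left sum_subtractf)
  from e_indepD[OF this ij(1)]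
  show "((-1) ^ k \<cdot>\<^sub>m (mat_inv S * transpose_mat S)) $$ (i, j) = (hor_Rmat k S ^\<^sub>m n) $$ (i, j)"
    using ij carrier_matD[OF A] by (simp del: index_mult_mat)
qed

end

section \<open>Cyclic vector and generalized eigenspaces\<close>

lemma (in clin) funpow_eq_pact: "(F ^^ m) a = pact F (monom 1 m) a"
  using pact_X_power[of m a] by (simp add: monom_altdef)

lemma pcompose_power: "pcompose (f ^ m) g = (pcompose f g :: complex poly) ^ m"
  by (induction m) (simp_all add: pcompose_mult pcompose_1)

text \<open>T is a local parameter at c, and this is the T-adic expansion of f up to order d. The
  next coefficient is h(c) / eta(c)^d, which makes the remainder divisible by x - c.\<close>

lemma T_expansion:
  fixes eta :: "complex poly"
  assumes T: "T = [:- c, 1:] * eta" and eta: "poly eta c \<noteq> 0"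
  shows "\<exists>g h. f = (\<Sum>i<d. Polynomial.smult (g i) (T ^ i)) + [:- c, 1:] ^ d * h"
proof (induction d)
  case 0 then show ?case by (intro exI[of _ "\<lambda>_. 0"] exI[of _ f]) simp
next
  case (Suc d)
  then obtain g h where gh: "f = (\<Sum>i<d. Polynomial.smult (g i) (T ^ i)) + [:- c, 1:] ^ d * h" by blast
  define q where "q = poly h c / poly eta c ^ d"
  have "poly (h - Polynomial.smult q (eta ^ d)) c = 0" using eta by (simp add: q_def poly_power)
  then have "[:- c, 1:] dvd h - Polynomial.smult q (eta ^ d)" using poly_eq_0_iff_dvd by blast
  then obtain h' where h': "h - Polynomial.smult q (eta ^ d) = [:- c, 1:] * h'" by (rule dvdE)
  then have hh: "h = Polynomial.smult q (eta ^ d) + [:- c, 1:] * h'" by (metis add.commute diff_add_cancel)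
  have "[:- c, 1:] ^ d * h = Polynomial.smult q (T ^ d) + [:- c, 1:] ^ Suc d * h'"
    unfolding T power_mult_distrib by (subst hh) (simp only: distrib_left mult_smult_right mult_smult_left power_Suc mult_ac)
  then have "f = (\<Sum>i<Suc d. Polynomial.smult ((g(d := q)) i) (T ^ i)) + [:- c, 1:] ^ Suc d * h'"
    by (subst gh) (simp add: add.assoc)
  then show ?case by blast
qed

context hor_space
begin

abbreviation "P \<equiv> map_poly complex_of_real p"
abbreviation "CR \<equiv> cmap R"
abbreviation "CM \<equiv> cmap M"
abbreviation "H \<equiv> hor_eigenspace n R"

sublocale R: clin CR by (rule clin_cmap[OF lin_R])
sublocale M: clin CM by (rule clin_cmap[OF lin_M])

text \<open>The quotient map from the complex polynomials onto the complexification: evaluation at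
  R, applied to the cyclic vector. Its kernel is the ideal of \<open>P\<close>
  (\<open>Phi_eq_0_iff\<close>).\<close>

definition Phi :: "complex poly \<Rightarrow> 'v \<times> 'v" where "Phi f = pact CR f (e 0, 0)"

lemma Phi_pCons: "Phi (pCons c f) = cscale c (e 0, 0) + CR (Phi f)"
  unfolding Phi_def by (rule R.pact_pCons)
lemma Phi_add: "Phi (f + g) = Phi f + Phi g"
  unfolding Phi_def by (rule R.pact_add)
lemma Phi_diff: "Phi (f - g) = Phi f - Phi g"
  unfolding Phi_def by (rule R.pact_diff)
lemma Phi_smult: "Phi (Polynomial.smult c f) = cscale c (Phi f)"
  unfolding Phi_def by (rule R.pact_smult)
lemma Phi_sum: "Phi (\<Sum>i\<in>I. f i) = (\<Sum>i\<in>I. Phi (f i))"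
  unfolding Phi_def by (rule R.pact_sum)
lemma pact_Phi: "pact CR f (Phi g) = Phi (f * g)"
  unfolding Phi_def by (rule R.pact_mult[symmetric])
lemma Phi_0 [simp]: "Phi 0 = 0" by (simp add: Phi_def)

lemma P_degree: "degree P = n" and P_monic: "coeff P n = 1" and P_nonzero: "P \<noteq> 0"
  using Pi_degree Pi_monic Pi_nonzero p_Pi by auto

lemma Phi_horner: "j < n \<Longrightarrow> Phi (horner P n j) = (e j, 0)"
proof (induction j)
  case 0 then show ?case by (simp add: Phi_def)
next
  case (Suc j)
  then have "Phi (horner P n (Suc j)) = cscale (coeff P (n - Suc j)) (e 0, 0) + CR (e j, 0)"
    by (simp add: Phi_pCons)
  also have "\<dots> = (e (Suc j), 0)"
    using Suc.prems R_e[of j] linear_0[OF lin_R] by (simp add: cscale_def coeff_map_poly)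
  finally show ?case .
qed

lemma horner_n: "horner P n n = P"
  by (rule poly_eqI) (simp add: coeff_horner[OF P_degree P_monic])

text \<open>One more Horner step from the last basis vector reaches \<open>P\<close>. There is no
  next basis vector, so \<open>R_e\<close> leaves a multiple of \<open>e 0\<close>, which cancels
  the constant coefficient.\<close>

lemma Phi_P: "Phi P = 0"
proof -
  obtain m where m: "n = Suc m" using n0 by (cases n) auto
  have "Phi P = Phi (horner P n (Suc m))" using horner_n m by simp
  also have "\<dots> = cscale (coeff P 0) (e 0, 0) + CR (e m, 0)"
    using Phi_horner[of m] m by (simp add: Phi_pCons)
  also have "\<dots> = 0"
    using R_e[of m] m linear_0[OF lin_R] by (simp add: cscale_def coeff_map_poly zero_prod_def)
  finally show ?thesis .
qed

lemma Phi_sum_horner: "Phi (\<Sum>j<n. Polynomial.smult (g j) (horner P n j)) = (\<Sum>j<n. Re (g j) *\<^sub>R e j, \<Sum>j<n. Im (g j) *\<^sub>R e j)"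
proof -
  have "Phi (\<Sum>j<n. Polynomial.smult (g j) (horner P n j)) = (\<Sum>j<n. cscale (g j) (e j, 0))"
    unfolding Phi_sum Phi_smult by (rule sum.cong) (auto simp: Phi_horner)
  also have "\<dots> = (\<Sum>j<n. (Re (g j) *\<^sub>R e j, Im (g j) *\<^sub>R e j))" by (simp add: cscale_def)
  also have "\<dots> = (\<Sum>j<n. Re (g j) *\<^sub>R e j, \<Sum>j<n. Im (g j) *\<^sub>R e j)" by (rule sum_prod)
  finally show ?thesis .
qed

lemma Phi_surj: obtains f where "a = Phi f"
proof -
  obtain g where g: "fst a = (\<Sum>i<n. g i *\<^sub>R e i)" by (rule span_e_familyE)
  obtain h where h: "snd a = (\<Sum>i<n. h i *\<^sub>R e i)" by (rule span_e_familyE)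
  have "a = Phi (\<Sum>j<n. Polynomial.smult (Complex (g j) (h j)) (horner P n j))"
    unfolding Phi_sum_horner using g h by (simp add: prod_eq_iff)
  then show ?thesis using that by blast
qed

text \<open>The Horner polynomials are monic of degree j, hence triangular with respect to the
  powers of x.\<close>

lemma horner_expansion:
  "degree r < d \<Longrightarrow> d \<le> n \<Longrightarrow> \<exists>g. r = (\<Sum>j<d. Polynomial.smult (g j) (horner P n j))"
proof (induction d arbitrary: r)
  case (Suc d)
  define hd where "hd = horner P n d"
  define q where "q = r - Polynomial.smult (coeff r d) hd"
  have cd: "coeff hd d = 1" using Suc.prems P_monic by (simp add: hd_def coeff_horner[OF P_degree P_monic])
  have cd': "coeff hd i = 0" if "i > d" for i
    unfolding hd_def coeff_horner[OF P_degree P_monic Suc_leD[OF Suc.prems(2)]]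
    by (rule coeff_eq_0) (use that Suc.prems P_degree in linarith)
  have deg: "coeff q i = 0" if "i \<ge> d" for i
  proof (cases "i = d")
    case False
    then have "coeff r i = 0" "coeff hd i = 0" using that Suc.prems cd' by (auto intro!: coeff_eq_0)
    then show ?thesis by (simp add: q_def)
  qed (simp add: q_def cd)
  have "\<exists>g. q = (\<Sum>j<d. Polynomial.smult (g j) (horner P n j))"
  proof (cases "d = 0")
    case True
    then have "q = 0" using deg by (auto simp: poly_eq_iff)
    then show ?thesis using True by simp
  next
    case False
    have "degree q \<le> d - 1" by (rule degree_le) (use deg False in auto)
    then show ?thesis using Suc.IH[of q] False Suc.prems(2) by auto
  qed
  then obtain g where g: "q = (\<Sum>j<d. Polynomial.smult (g j) (horner P n j))" by blast
  have "(\<Sum>j<d. Polynomial.smult ((g(d := coeff r d)) j) (horner P n j)) = q"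
    unfolding g by (rule sum.cong) auto
  then have "r = (\<Sum>j<Suc d. Polynomial.smult ((g(d := coeff r d)) j) (horner P n j))"
    unfolding sum.lessThan_Suc by (simp add: q_def hd_def)
  then show ?case by blast
qed simp

text \<open>Modulo \<open>P\<close> the degree may be taken below n. Such a polynomial is a
  combination of Horner polynomials, which \<open>Phi\<close> sends to the independent vectors
  \<open>e j\<close>.\<close>

lemma Phi_eq_0_iff: "Phi f = 0 \<longleftrightarrow> P dvd f"
proof
  assume "P dvd f"
  then obtain g where "f = g * P" by (metis dvdE mult.commute)
  then show "Phi f = 0" using pact_Phi[of g P] Phi_P by (simp add: clin.zero[OF R.clin_pact])
next
  assume f: "Phi f = 0"
  let ?r = "f mod P"
  have "f = (f div P) * P + ?r" by (rule div_mult_mod_eq[symmetric])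
  then have "Phi f = Phi ((f div P) * P) + Phi ?r" by (metis Phi_add)
  also have "Phi ((f div P) * P) = 0" using pact_Phi[of "f div P" P] Phi_P by (simp add: clin.zero[OF R.clin_pact])
  finally have r: "Phi ?r = 0" using f by simp
  have "degree ?r < n"
    using degree_mod_less[OF P_nonzero, of f] P_degree n0 by auto
  then obtain g where g: "?r = (\<Sum>j<n. Polynomial.smult (g j) (horner P n j))" using horner_expansion by blast
  have "(\<Sum>j<n. Re (g j) *\<^sub>R e j) = 0" "(\<Sum>j<n. Im (g j) *\<^sub>R e j) = 0"
    using r unfolding g Phi_sum_horner by (auto simp: zero_prod_def)
  then have "g j = 0" if "j < n" for j
    using e_indepD[of "\<lambda>j. Re (g j)" j] e_indepD[of "\<lambda>j. Im (g j)" j] that by (simp add: complex_eq_iff)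
  then have "?r = 0" unfolding g by simp
  then show "P dvd f" by (simp only: mod_eq_0_iff_dvd)
qed

lemma Phi_eq_iff: "Phi f = Phi g \<longleftrightarrow> P dvd f - g"
  using Phi_eq_0_iff[of "f - g"] by (simp add: Phi_diff)

abbreviation mu :: "complex \<Rightarrow> nat" where "mu c \<equiv> Polynomial.order c P"

text \<open>The factor of \<open>P\<close> prime to x - c. The block of c consists of the classes of
  the multiples of \<open>Q c\<close>, so \<open>Phi (Q c)\<close> generates it.\<close>

definition Q :: "complex \<Rightarrow> complex poly" where "Q c = P div [:- c, 1:] ^ mu c"

lemma P_Q: "P = [:- c, 1:] ^ mu c * Q c" and poly_Q: "poly (Q c) c \<noteq> 0"
proof -
  show eq: "P = [:- c, 1:] ^ mu c * Q c" unfolding Q_def by (rule dvd_mult_div_cancel[OF order_1, symmetric])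
  show "poly (Q c) c \<noteq> 0"
  proof
    assume "poly (Q c) c = 0"
    then have "[:- c, 1:] dvd Q c" using poly_eq_0_iff_dvd by blast
    then have "[:- c, 1:] ^ mu c * [:- c, 1:] dvd [:- c, 1:] ^ mu c * Q c" by (rule mult_dvd_mono[OF dvd_refl])
    then have "[:- c, 1:] ^ mu c * [:- c, 1:] dvd P" unfolding eq[symmetric] .
    then have "[:- c, 1:] ^ Suc (mu c) dvd P" by (simp only: power_Suc mult.commute)
    then show False using order_2[OF P_nonzero] by blast
  qed
qed

lemma mu_le: "mu c \<le> n"
  using order_degree[OF P_nonzero, of c] P_degree by simp

text \<open>Powers of x - c are invertible modulo \<open>Q c\<close>, so beyond the multiplicity of
  c they do not affect divisibility.\<close>

lemma dvd_Q_iff: "m \<ge> mu c \<Longrightarrow> P dvd [:- c, 1:] ^ m * f \<longleftrightarrow> Q c dvd f"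
proof
  assume "P dvd [:- c, 1:] ^ m * f"
  moreover have "Q c dvd P" by (subst P_Q[of c]) (rule dvd_triv_right)
  ultimately have "Q c dvd [:- c, 1:] ^ m * f" by (rule dvd_trans[rotated])
  moreover obtain u v where "u * [:- c, 1:] ^ m + v * Q c = 1" using linear_power_bezout[OF poly_Q] by blast
  then have "(u * [:- c, 1:] ^ m + v * Q c) * f = f" by simp
  then have "u * ([:- c, 1:] ^ m * f) + Q c * (v * f) = f" by (simp only: distrib_left distrib_right mult_ac)
  moreover have "Q c dvd u * ([:- c, 1:] ^ m * f) + Q c * (v * f)"
    by (rule dvd_add[OF dvd_mult[OF \<open>Q c dvd [:- c, 1:] ^ m * f\<close>] dvd_triv_left])
  ultimately show "Q c dvd f" by (simp only:)
next
  assume m: "m \<ge> mu c" and "Q c dvd f"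
  then have "[:- c, 1:] ^ mu c * Q c dvd [:- c, 1:] ^ m * f" by (intro mult_dvd_mono le_imp_power_dvd)
  then show "P dvd [:- c, 1:] ^ m * f" unfolding P_Q[symmetric] .
qed

lemma H_pact: "H c = {a. pact CR ([:- c, 1:] ^ n) a = 0}"
  by (simp add: hor_eigenspace_def R.pact_linear_power)

lemma Phi_in_H: "Phi f \<in> H c \<longleftrightarrow> Q c dvd f"
  unfolding H_pact using dvd_Q_iff[OF mu_le, of c] by (simp only: mem_Collect_eq pact_Phi Phi_eq_0_iff)

lemma H_elim: assumes "a \<in> H c" obtains f where "a = Phi (Q c * f)"
proof -
  obtain g where g: "a = Phi g" by (rule Phi_surj)
  then have "Q c dvd g" using assms Phi_in_H by simp
  then show ?thesis using that g by (metis dvdE)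
qed

lemma Phi_Q_in_H [simp]: "Phi (Q c * f) \<in> H c"
  unfolding Phi_in_H by simp

lemma gen_eigenspace_R: "gen_eigenspace UNIV CR c = H c"
proof (intro Set.set_eqI iffI)
  fix a assume "a \<in> gen_eigenspace UNIV CR c"
  then obtain m where m: "pact CR ([:- c, 1:] ^ m) a = 0" unfolding R.gen_eigenspace_pact by blast
  obtain f where f: "a = Phi f" by (rule Phi_surj)
  have "P dvd [:- c, 1:] ^ m * f" using m by (simp only: f pact_Phi Phi_eq_0_iff)
  then have "P dvd [:- c, 1:] ^ n * ([:- c, 1:] ^ m * f)" by (rule dvd_mult)
  then have "P dvd [:- c, 1:] ^ (m + n) * f" by (simp only: power_add mult_ac)
  moreover have "m + n \<ge> mu c" using mu_le[of c] by simp
  ultimately show "a \<in> H c" using dvd_Q_iff Phi_in_H f by blast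
next
  fix a assume "a \<in> H c"
  then show "a \<in> gen_eigenspace UNIV CR c" unfolding R.gen_eigenspace_pact H_pact by blast
qed

lemma H_subspace: "cplx.subspace (H c)"
  using R.gen_eigenspace_subspace[OF cplx.subspace_UNIV] gen_eigenspace_R by metis

lemma pact_H: "a \<in> H c \<Longrightarrow> pact CR f a \<in> H c"
proof -
  assume "a \<in> H c"
  then obtain g where "a = Phi (Q c * g)" by (rule H_elim)
  then have "pact CR f a = Phi (Q c * (f * g))" by (simp only: pact_Phi mult_ac)
  then show ?thesis by (simp only: Phi_Q_in_H)
qed

lemma H_nonroot: "poly P c \<noteq> 0 \<Longrightarrow> H c = {0}"
proof -
  assume "poly P c \<noteq> 0"
  then have "mu c = 0" using order_root by blast
  then have "Q c = P" by (simp add: Q_def)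
  then have "a = 0" if "a \<in> H c" for a
  proof -
    obtain f where "a = Phi (Q c * f)" using H_elim[OF \<open>a \<in> H c\<close>] .
    then show ?thesis using \<open>Q c = P\<close> Phi_eq_0_iff by simp
  qed
  then show ?thesis using cplx.subspace_0[OF H_subspace] by blast
qed

lemma pact_P: "pact CR P a = 0"
proof -
  obtain f where "a = Phi f" by (rule Phi_surj)
  then show ?thesis using Phi_eq_0_iff pact_Phi by simp
qed

lemma finite_roots: "finite {c. poly P c = 0}"
  using poly_roots_finite[OF P_nonzero] .

lemma direct_sum_H:
  assumes "finite K" "{c. poly P c = 0} \<subseteq> K" shows "direct_sum K H UNIV"
proof -
  have "gen_eigenspace UNIV CR = H" using gen_eigenspace_R by blast
  then show ?thesis
    using R.direct_sum_gen_eigenspace[OF cplx.subspace_UNIV _ assms(1) P_nonzero _ assms(2)] pact_P by auto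
qed

lemma H_indep:
  "finite K \<Longrightarrow> (\<And>c. c \<in> K \<Longrightarrow> w c \<in> H c) \<Longrightarrow> (\<Sum>c\<in>K. w c) = 0 \<Longrightarrow> c \<in> K \<Longrightarrow> w c = 0"
  using R.gen_eigenspace_indep[of K w UNIV] gen_eigenspace_R by blast

text \<open>The polynomial with Z(R) = M. Its value at a zero c is the eigenvalue of the monodromy
  on the block of c.\<close>

definition Z :: "complex poly" where "Z = monom ((-1) ^ k) n"

lemma poly_Z: "poly Z c = (-1) ^ k * c ^ n"
  by (simp add: Z_def poly_monom)

lemma CM_eq: "CM a = pact CR Z a"
proof -
  have "pact CR Z a = cscale ((-1) ^ k) ((CR ^^ n) a)"
    using R.pact_smult[of "(-1) ^ k" "monom 1 n" a] by (simp add: Z_def smult_monom R.funpow_eq_pact)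
  also have "\<dots> = CM a"
  proof -
    have re: "Re ((-1) ^ k) = (-1) ^ k" "Im ((-1) ^ k) = 0" using k12 by auto
    show ?thesis by (cases a) (simp add: cmap_funpow cscale_def re M_eq)
  qed
  finally show ?thesis by simp
qed

lemma pact_CM: "pact CM f a = pact CR (pcompose f Z) a"
proof -
  have "CM = pact CR Z" using CM_eq by blast
  then show ?thesis by (simp only: R.pact_pcompose)
qed

text \<open>Evaluated at R this is M minus the eigenvalue that belongs to c.\<close>

definition T :: "complex \<Rightarrow> complex poly" where "T c = Z - [:poly Z c:]"

lemma pact_CM_linear_power: "pact CM ([:- poly Z c, 1:] ^ m) a = pact CR (T c ^ m) a"
proof -
  have "pcompose [:- poly Z c, 1:] Z = T c" unfolding T_def
    by (simp add: pcompose_pCons)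
  then show ?thesis by (simp add: pact_CM pcompose_power)
qed

text \<open>The value of the cofactor at c is the derivative of Z at c, which is nonzero for nonzero
  c. Hence M minus its eigenvalue and R - c differ on the block of c by an invertible
  factor.\<close>

lemma T_eta: obtains eta where "T c = [:- c, 1:] * eta" "poly eta c = (-1) ^ k * of_nat n * c ^ (n - 1)"
proof -
  have "poly (T c) c = 0" by (simp add: T_def)
  then have "[:- c, 1:] dvd T c" using poly_eq_0_iff_dvd by blast
  then obtain eta where eta: "T c = [:- c, 1:] * eta" by (rule dvdE)
  have "pderiv (T c) = pderiv Z" by (simp add: T_def pderiv_diff pderiv_pCons)
  then have "poly (pderiv (T c)) c = (-1) ^ k * of_nat n * c ^ (n - 1)"
    by (simp add: Z_def pderiv_monom poly_monom)
  moreover have "poly (pderiv (T c)) c = poly eta c"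
    unfolding eta pderiv_mult by (simp add: pderiv_pCons)
  ultimately show ?thesis using that eta by simp
qed

lemma root_norm: "poly P c = 0 \<Longrightarrow> cmod c = 1"
  using root_iff by auto

lemma root_nonzero: "poly P c = 0 \<Longrightarrow> c \<noteq> 0"
  using root_norm[of c] by force

lemma mu_root: "poly P c = 0 \<Longrightarrow> mu c = Suc (lad_l c)"
  using lad_l_order by simp

text \<open>Expanding in powers of the local parameter TT shows that its powers applied to
  \<open>Phi (Q c)\<close> span the block: the remainder of order l + 1 is a multiple of
  \<open>P\<close>. For TT = x - c this gives the Jordan block of R, for TT = \<open>T c\<close>
  that of M.\<close>

lemma chain_H:
  assumes r: "poly P c = 0" and TT: "TT = [:- c, 1:] * eta" "poly eta c \<noteq> 0"
  shows "pact CR (TT ^ Suc (lad_l c)) (Phi (Q c)) = 0"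
    and "pact CR (TT ^ lad_l c) (Phi (Q c)) \<noteq> 0"
    and "H c = cplx.span ((\<lambda>i. pact CR (TT ^ i) (Phi (Q c))) ` {..lad_l c})"
proof -
  let ?l = "lad_l c" and ?X = "[:- c, 1:]"
  have PQ: "P = ?X ^ Suc ?l * Q c" using P_Q[of c] unfolding mu_root[OF r] .
  have TTp: "TT ^ i = ?X ^ i * eta ^ i" for i unfolding TT(1) power_mult_distrib ..
  have "P dvd TT ^ Suc ?l * Q c"
  proof -
    have "TT ^ Suc ?l * Q c = (?X ^ Suc ?l * Q c) * eta ^ Suc ?l" unfolding TTp by (simp only: mult_ac)
    then show ?thesis unfolding PQ[symmetric] by simp
  qed
  then show "pact CR (TT ^ Suc ?l) (Phi (Q c)) = 0" by (simp only: pact_Phi Phi_eq_0_iff)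
  show "pact CR (TT ^ ?l) (Phi (Q c)) \<noteq> 0"
  proof
    assume "pact CR (TT ^ ?l) (Phi (Q c)) = 0"
    then have "P dvd TT ^ ?l * Q c" by (simp only: pact_Phi Phi_eq_0_iff)
    then obtain g where "TT ^ ?l * Q c = P * g" by (rule dvdE)
    also have "P * g = ?X ^ Suc ?l * Q c * g" by (subst PQ) (rule refl)
    finally have "(?X ^ ?l * Q c) * eta ^ ?l = (?X ^ ?l * Q c) * (?X * g)"
      unfolding TTp by (simp only: power_Suc mult_ac)
    moreover have "?X ^ ?l * Q c \<noteq> 0" using poly_Q[of c] by auto
    ultimately have "eta ^ ?l = ?X * g" using mult_left_cancel[THEN iffD1] by blast
    then have "poly (eta ^ ?l) c = 0" by simp
    then show False using TT(2) by (simp add: poly_power)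
  qed
  show "H c = cplx.span ((\<lambda>i. pact CR (TT ^ i) (Phi (Q c))) ` {..?l})"
  proof
    show "cplx.span ((\<lambda>i. pact CR (TT ^ i) (Phi (Q c))) ` {..?l}) \<subseteq> H c"
      by (rule cplx.span_minimal[OF _ H_subspace]) (auto simp: Phi_in_H pact_Phi)
    show "H c \<subseteq> cplx.span ((\<lambda>i. pact CR (TT ^ i) (Phi (Q c))) ` {..?l})"
    proof
      fix a assume "a \<in> H c"
      then obtain f where f: "a = Phi (Q c * f)" by (rule H_elim)
      obtain g h where gh: "f = (\<Sum>i<Suc ?l. Polynomial.smult (g i) (TT ^ i)) + ?X ^ Suc ?l * h"
        using T_expansion[OF TT] by blast
      have "Q c * f = (\<Sum>i<Suc ?l. Polynomial.smult (g i) (TT ^ i * Q c)) + P * h"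
      proof -
        have "Q c * f = (\<Sum>i<Suc ?l. Polynomial.smult (g i) (TT ^ i * Q c)) + (?X ^ Suc ?l * Q c) * h"
          by (subst gh) (simp only: distrib_left sum_distrib_left mult_smult_right mult_smult_left mult_ac)
        then show ?thesis unfolding PQ[symmetric] .
      qed
      then have "a = (\<Sum>i<Suc ?l. cscale (g i) (pact CR (TT ^ i) (Phi (Q c)))) + Phi (P * h)"
        unfolding f by (simp only: Phi_add Phi_sum Phi_smult pact_Phi)
      moreover have "Phi (P * h) = 0" using Phi_eq_0_iff by simp
      ultimately have "a = (\<Sum>i<Suc ?l. cscale (g i) (pact CR (TT ^ i) (Phi (Q c))))" by simp
      then show "a \<in> cplx.span ((\<lambda>i. pact CR (TT ^ i) (Phi (Q c))) ` {..?l})"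
        by (simp only:) (intro cplx.span_sum cplx.span_scale cplx.span_base, auto)
    qed
  qed
qed

lemma jordan_R: assumes r: "poly P c = 0" shows "jordan_block_on (H c) CR (Suc (lad_l c)) c"
  and dim_H: "cplx.dim (H c) = Suc (lad_l c)"
proof -
  have "[:- c, 1:] = [:- c, 1:] * 1" "poly 1 c \<noteq> 0" by auto
  note ch = chain_H[OF r this]
  note jb = R.jordan_block_chain[OF ch]
  show "jordan_block_on (H c) CR (Suc (lad_l c)) c" by (rule jb)
  show "cplx.dim (H c) = Suc (lad_l c)"
    unfolding ch(3) cplx.dim_span_eq_card_independent[OF jb(3)] card_image[OF jb(2)] by simp
qed

lemma eta_nonzero: "poly P c = 0 \<Longrightarrow> (-1) ^ k * of_nat n * c ^ (n - 1) \<noteq> 0"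
  using root_nonzero n0 by auto

lemma jordan_M: assumes r: "poly P c = 0" shows "jordan_block_on (H c) CM (Suc (lad_l c)) (poly Z c)"
proof -
  obtain eta where eta: "T c = [:- c, 1:] * eta" "poly eta c = (-1) ^ k * of_nat n * c ^ (n - 1)" by (rule T_eta)
  then have "poly eta c \<noteq> 0" using eta_nonzero[OF r] by simp
  note ch = chain_H[OF r eta(1) this]
  show ?thesis
    by (rule M.jordan_block_chain(1)[of "poly Z c" "lad_l c" "Phi (Q c)"]; unfold pact_CM_linear_power; rule ch)
qed

lemma jordan_blocks_single:
  assumes "jordan_block_on W F q c" shows "jordan_blocks_on W F [(q, c)]"
proof -
  have "W = {\<Sum>i<1. w i | w :: nat \<Rightarrow> _. \<forall>i\<in>{..<1}. w i \<in> W}"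
  proof (intro Set.set_eqI iffI)
    fix x assume "x \<in> W"
    then show "x \<in> {\<Sum>i<1. w i | w :: nat \<Rightarrow> _. \<forall>i\<in>{..<1}. w i \<in> W}"
      by (intro CollectI exI[of _ "\<lambda>_. x"]) simp
  qed auto
  then show ?thesis
    unfolding jordan_blocks_on_def direct_sum_def using assms by (intro exI[of _ "\<lambda>_. W"]) simp
qed

lemma roots_Z: "finite {c. (-1) ^ k * c ^ n = (lam::complex)}"
proof -
  have "coeff (Z - [:lam:]) n = (-1) ^ k" unfolding Z_def using n0 by (cases n) auto
  then have "Z - [:lam:] \<noteq> 0" by auto
  from poly_roots_finite[OF this] show ?thesis by (simp add: poly_Z)
qed

text \<open>Substituting Z into a power of x - lam gives a polynomial whose zeros are among the
  solutions c. The index set contains all solutions; those that are not zeros of \<open>P\<close>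
  contribute the zero space.\<close>

lemma gen_eigenspace_M: "direct_sum {c. (-1) ^ k * c ^ n = lam} H (gen_eigenspace UNIV CM lam)"
  unfolding direct_sum_def
proof (intro conjI allI impI Set.set_eqI iffI)
  let ?K = "{c. (-1) ^ k * c ^ n = lam}"
  show fin: "finite ?K" by (rule roots_Z)
  show "\<forall>i\<in>?K. w i = 0" if "(\<forall>i\<in>?K. w i \<in> H i) \<and> (\<Sum>i\<in>?K. w i) = 0" for w
    using H_indep[OF fin, of w] that by blast
  fix a
  {
    assume "a \<in> gen_eigenspace UNIV CM lam"
    then obtain m where m: "pact CM ([:- lam, 1:] ^ m) a = 0" unfolding M.gen_eigenspace_pact by blast
    let ?g = "(Z - [:lam:]) ^ m"
    have "pcompose [:- lam, 1:] Z = Z - [:lam:]"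
      by (simp add: pcompose_pCons)
    then have "pact CR ?g a = 0" using m by (simp only: pact_CM pcompose_power)
    moreover have "coeff (Z - [:lam:]) n = (-1) ^ k" unfolding Z_def using n0 by (cases n) auto
    then have "Z - [:lam:] \<noteq> 0" by auto
    then have "?g \<noteq> 0" by simp
    ultimately obtain w where w: "\<forall>c. poly ?g c = 0 \<longrightarrow> w c \<in> gen_eigenspace UNIV CR c" "a = (\<Sum>c\<in>{c. poly ?g c = 0}. w c)"
      using R.gen_eigenspace_decomp[OF cplx.subspace_UNIV, of ?g a] by blast
    have sub: "{c. poly ?g c = 0} \<subseteq> ?K" by (auto simp: poly_power poly_Z)
    let ?w = "\<lambda>c. if poly ?g c = 0 then w c else 0"
    have "a = (\<Sum>c\<in>?K. ?w c)"
      unfolding w(2) by (rule sum.mono_neutral_cong_left) (use fin sub in auto)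
    moreover have "\<forall>c\<in>?K. ?w c \<in> H c"
      using w(1) gen_eigenspace_R cplx.subspace_0[OF H_subspace] by auto
    ultimately show "a \<in> {\<Sum>i\<in>?K. w i | w. \<forall>i\<in>?K. w i \<in> H i}" by blast
  }
  {
    assume "a \<in> {\<Sum>i\<in>?K. w i | w. \<forall>i\<in>?K. w i \<in> H i}"
    then obtain w where w: "a = (\<Sum>i\<in>?K. w i)" "\<forall>i\<in>?K. w i \<in> H i" by blast
    have "w c \<in> gen_eigenspace UNIV CM lam" if c: "c \<in> ?K" for c
    proof -
      have lam: "poly Z c = lam" using c by (simp add: poly_Z)
      obtain eta where eta: "T c = [:- c, 1:] * eta" by (rule T_eta)
      have "pact CR (T c ^ n) (w c) = pact CR (eta ^ n) (pact CR ([:- c, 1:] ^ n) (w c))"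
        unfolding eta power_mult_distrib by (simp only: R.pact_mult[symmetric] mult.commute)
      also have "\<dots> = 0" using w(2) c unfolding H_pact by (simp add: clin.zero[OF R.clin_pact])
      finally have "pact CM ([:- lam, 1:] ^ n) (w c) = 0" using pact_CM_linear_power lam by metis
      then show ?thesis unfolding M.gen_eigenspace_pact by blast
    qed
    then show "a \<in> gen_eigenspace UNIV CM lam"
      unfolding w(1) by (intro cplx.subspace_sum M.gen_eigenspace_subspace cplx.subspace_UNIV) auto
  }
qed

lemma eigenval_R: "eigenval_on UNIV CR c \<longleftrightarrow> poly P c = 0"
proof
  assume "eigenval_on UNIV CR c"
  then obtain a where a: "a \<noteq> 0" "CR a = cscale c a" unfolding eigenval_on_def by blast
  have "pact CR ([:- c, 1:] ^ 1) a = 0" using a by (simp add: R.pact_linear)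
  then have "a \<in> H c" using gen_eigenspace_R R.gen_eigenspace_pact by blast
  then show "poly P c = 0" using H_nonroot a by blast
next
  assume "poly P c = 0"
  from jordan_R[OF this] obtain v where v: "inj_on v {..<Suc (lad_l c)}" "cplx.independent (v ` {..<Suc (lad_l c)})"
    "CR (v 0) = cscale c (v 0)" unfolding jordan_block_on_def by blast
  have "v 0 \<in> v ` {..<Suc (lad_l c)}" by auto
  then have "v 0 \<noteq> 0" using v(2) cplx.dependent_zero by metis
  then show "eigenval_on UNIV CR c" unfolding eigenval_on_def using v by blast
qed

lemma eigenval_M:
  assumes "a \<noteq> 0" "CM a = cscale lam a" obtains c where "poly P c = 0" "(-1) ^ k * c ^ n = lam" "cmod lam = 1"
proof -
  have "pact CM ([:- lam, 1:] ^ 1) a = 0" using assms by (simp add: M.pact_linear)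
  then have "a \<in> gen_eigenspace UNIV CM lam" unfolding M.gen_eigenspace_pact by blast
  then obtain w where w: "a = (\<Sum>c\<in>{c. (-1) ^ k * c ^ n = lam}. w c)" "\<forall>c\<in>{c. (-1) ^ k * c ^ n = lam}. w c \<in> H c"
    using gen_eigenspace_M[of lam] unfolding direct_sum_def by blast
  have "\<exists>c\<in>{c. (-1) ^ k * c ^ n = lam}. w c \<noteq> 0" using assms(1) w(1) by (metis (mono_tags, lifting) sum.neutral)
  then obtain c where c: "(-1) ^ k * c ^ n = lam" "w c \<noteq> 0" by blast
  then have r: "poly P c = 0" using w(2) H_nonroot[of c] by blast
  moreover have "cmod lam = 1" using root_norm[OF r] c by (auto simp: norm_mult norm_power)
  ultimately show ?thesis using that c by blast
qed

text \<open>A complex eigenvector of the matrix becomes an eigenvector of the complexified M for the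
  same eigenvalue, which lies on the circle by \<open>eigenval_M\<close>.\<close>

lemma S_T_mat: "S \<in> T_mat n"
  unfolding T_mat_def
proof (intro CollectI conjI allI impI)
  note inv = S_inverse[OF hor_data_axioms]
  show "S \<in> carrier_mat n n" by (rule S_carrier)
  show "upper_triangular S" by (rule inv)
  show "S $$ (i, i) = 1" if "i < n" for i using inv(5) that by blast
  fix c assume "eigenvalue (map_mat complex_of_real (mat_inv S * transpose_mat S)) c"
  let ?A = "mat_inv S * transpose_mat S"
  have A: "?A \<in> carrier_mat n n" using inv S_carrier by auto
  obtain v where v: "v \<in> carrier_vec n" "v \<noteq> 0\<^sub>v n" "map_mat complex_of_real ?A *\<^sub>v v = c \<cdot>\<^sub>v v"
    using \<open>eigenvalue _ c\<close> carrier_matD[OF A] unfolding eigenvalue_def eigenvector_def by auto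
  have comp: "(\<Sum>j<n. complex_of_real (?A $$ (i, j)) * v $ j) = c * v $ i" if "i < n" for i
  proof -
    have gen: "(map_mat complex_of_real B *\<^sub>v v) $ i = (\<Sum>j<n. complex_of_real (B $$ (i, j)) * v $ j)"
      if "B \<in> carrier_mat n n" for B
      using that v(1) \<open>i < n\<close> by (simp add: scalar_prod_def atLeast0LessThan)
    show ?thesis using gen[OF A] v(1,3) that by simp
  qed
  let ?a = "\<Sum>j<n. cscale (v $ j) (e j, 0)"
  have pair: "(\<Sum>j<n. cscale (g j) (e j, 0)) = (\<Sum>j<n. Re (g j) *\<^sub>R e j, \<Sum>j<n. Im (g j) *\<^sub>R e j)" for g
    by (simp add: cscale_def sum_prod)
  have "?a \<noteq> 0"
  proof
    assume "?a = 0"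
    then have "(\<Sum>j<n. Re (v $ j) *\<^sub>R e j) = 0" "(\<Sum>j<n. Im (v $ j) *\<^sub>R e j) = 0"
      unfolding pair by (auto simp: zero_prod_def)
    then have "v $ j = 0" if "j < n" for j
      using e_indepD[of "\<lambda>j. Re (v $ j)" j] e_indepD[of "\<lambda>j. Im (v $ j)" j] that by (simp add: complex_eq_iff)
    then show False using v(1,2) by auto
  qed
  moreover have "CM ?a = cscale c ?a"
  proof -
    have Me: "CM (e j, 0) = (\<Sum>i<n. cscale (of_real (?A $$ (i, j))) (e i, 0))" if "j < n" for j
      unfolding pair using M_e[OF that] linear_0[OF lin_M] by simp
    have "CM ?a = (\<Sum>j<n. cscale (v $ j) (\<Sum>i<n. cscale (of_real (?A $$ (i, j))) (e i, 0)))"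
      unfolding M.sum M.scale by (rule sum.cong) (simp_all only: Me lessThan_iff)
    also have "\<dots> = (\<Sum>i<n. cscale (\<Sum>j<n. complex_of_real (?A $$ (i, j)) * v $ j) (e i, 0))"
      unfolding cplx.scale_sum_right cplx.scale_sum_left by (subst sum.swap) (simp add: mult.commute)
    also have "\<dots> = cscale c ?a"
      unfolding cplx.scale_sum_right by (rule sum.cong) (use comp in auto)
    finally show ?thesis .
  qed
  ultimately show "cmod c = 1" by (rule eigenval_M)
qed

lemma linear_extend_e: "\<exists>f. linear f \<and> (\<forall>j<n. f (e j) = (y j :: 'w::real_vector))"
proof -
  obtain f where "linear f" "\<forall>x\<in>e ` {..<n}. f x = y (the_inv_into {..<n} e x)"
    using linear_independent_extend[OF indep_e, of "\<lambda>x. y (the_inv_into {..<n} e x)"] by blast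
  moreover have "the_inv_into {..<n} e (e j) = j" if "j < n" for j
    using the_inv_into_f_f[OF inj_e] that by simp
  ultimately show ?thesis by (intro exI[of _ f]) auto
qed

text \<open>The inclusion concerns all HOR matrices, while the locale fixes one. For another matrix
  a form, a monodromy and a map R are constructed on the same space and basis, and
  \<open>S_T_mat\<close> is applied to them.\<close>

lemma T_HOR_subset: "T_HOR k n \<subseteq> T_mat n"
proof
  fix S' assume "S' \<in> T_HOR k n"
  then obtain p' where p': "p' \<in> Tpol k n" "S' = hor_S n p'" by (auto simp: T_HOR_def)
  obtain b' where hd: "hor_data n k b' p' S'" using hor_data_exists[OF n1 k12 p'(1)] p'(2) by blast
  obtain M' :: "'v \<Rightarrow> 'v" where M': "linear M'" "\<And>j. j < n \<Longrightarrow> M' (e j) = (\<Sum>i<n. (mat_inv S' * transpose_mat S') $$ (i, j) *\<^sub>R e i)"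
    using linear_extend_e[of "\<lambda>j. \<Sum>i<n. (mat_inv S' * transpose_mat S') $$ (i, j) *\<^sub>R e i"] by blast
  obtain R' :: "'v \<Rightarrow> 'v" where R': "linear R'" "\<And>j. j < n \<Longrightarrow> R' (e j) = (\<Sum>i<n. hor_Rmat k S' $$ (i, j) *\<^sub>R e i)"
    using linear_extend_e[of "\<lambda>j. \<Sum>i<n. hor_Rmat k S' $$ (i, j) *\<^sub>R e i"] by blast
  have "\<forall>i. \<exists>f :: 'v \<Rightarrow> real. linear f \<and> (\<forall>j<n. f (e j) = (if i = j then 1 else 0))"
    by (intro allI linear_extend_e)
  from choice[OF this] obtain f where "\<forall>i. linear (f i :: 'v \<Rightarrow> real) \<and> (\<forall>j<n. f i (e j) = (if i = j then 1 else 0))" ..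
  then have f: "\<And>i. linear (f i)" "\<And>i j. j < n \<Longrightarrow> f i (e j) = (if i = j then 1 else 0)" by blast+
  let ?L = "\<lambda>x y. \<Sum>i<n. \<Sum>j<n. f i x * f j y * transpose_mat S' $$ (i, j)"
  have "bilinear ?L" unfolding bilinear_def linear_iff
    by (auto simp: linear_add[OF f(1)] linear_scale[OF f(1)] algebra_simps sum.distrib sum_distrib_left)
  moreover have "?L (e i) (e j) = transpose_mat S' $$ (i, j)" if "i < n" "j < n" for i j
  proof -
    have "?L (e i) (e j) = (\<Sum>i'<n. \<Sum>j'<n. if i' = i \<and> j' = j then transpose_mat S' $$ (i, j) else 0)"
      by (intro sum.cong refl) (use that f(2) in auto)
    also have "\<dots> = (\<Sum>i'<n. if i' = i then transpose_mat S' $$ (i, j) else 0)"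
      by (rule sum.cong) (use that in \<open>auto simp: sum.delta\<close>)
    finally show ?thesis using that by (simp add: sum.delta)
  qed
  ultimately have "hor_space n k b' p' S' e ?L M' R'"
    using M' R' inj_e indep_e span_e by (intro hor_space.intro[OF hd] hor_space_axioms.intro)
  then show "S' \<in> T_mat n" by (rule hor_space.S_T_mat)
qed

end

section \<open>Semisimple and nilpotent part; the polarization sign\<close>

text \<open>Chinese remainder theorem for the moduli (x - c)^m: a new congruence is met by adding a
  multiple of the product of the old moduli.\<close>

lemma poly_crt:
  fixes t :: "complex \<Rightarrow> complex poly"
  assumes "finite K" shows "\<exists>f. \<forall>c\<in>K. [:- c, 1:] ^ m dvd f - t c"
  using assms
proof (induction K rule: finite_induct)
  case (insert x K)
  then obtain f where f: "\<forall>c\<in>K. [:- c, 1:] ^ m dvd f - t c" by blast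
  let ?X = "\<Prod>c\<in>K. [:- c, 1:] ^ m"
  have "poly ?X x \<noteq> 0" using insert.hyps by (auto simp: poly_prod poly_power)
  then obtain u v where uv: "u * [:- x, 1:] ^ m + v * ?X = 1" using linear_power_bezout by blast
  let ?f = "f + v * ?X * (t x - f)"
  have "[:- x, 1:] ^ m dvd ?f - t x"
  proof -
    have vX: "v * ?X = 1 - u * [:- x, 1:] ^ m" using uv by (metis add_diff_cancel_left')
    have "?f - t x = [:- x, 1:] ^ m * (u * (f - t x))"
      unfolding vX by (simp only: algebra_simps mult_1_left)
    then show ?thesis by (rule dvdI)
  qed
  moreover have "[:- c, 1:] ^ m dvd ?f - t c" if c: "c \<in> K" for c
  proof -
    have "[:- c, 1:] ^ m dvd ?X" by (rule dvd_prodI[OF insert.hyps(1) c])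
    then have "[:- c, 1:] ^ m dvd v * ?X * (t x - f)" by (intro dvd_mult2 dvd_mult)
    then have "[:- c, 1:] ^ m dvd (f - t c) + v * ?X * (t x - f)" using f c by (intro dvd_add) auto
    moreover have "(f - t c) + v * ?X * (t x - f) = ?f - t c" by (simp only: algebra_simps)
    ultimately show ?thesis by (simp only:)
  qed
  ultimately have "\<forall>c\<in>insert x K. [:- c, 1:] ^ m dvd ?f - t c" by blast
  then show ?case by blast
qed auto

lemma map_poly_cnj_linear_power: "map_poly cnj ([:- lam, 1:] ^ m) = [:- cnj lam, 1:] ^ m"
proof (induction m)
    case (Suc m)
    have mult: "map_poly cnj (f * g) = map_poly cnj f * map_poly cnj g" for f g :: "complex poly"
      by (rule poly_eqI) (simp add: coeff_map_poly coeff_mult)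
    have "map_poly cnj [:- lam, 1:] = [:- cnj lam, 1:]"
      by (rule poly_eqI) (simp add: coeff_map_poly coeff_pCons split: nat.split)
    then show ?case using Suc by (simp only: power_Suc mult)
  qed (simp add: one_pCons map_poly_pCons)

text \<open>The real operator obtained from F by dropping the imaginary part of its values on real
  vectors. Its complexification is the mean of F and its conjugate
  (\<open>cmap_real_op\<close>).\<close>

definition real_op :: "('v::real_vector \<times> 'v \<Rightarrow> 'v \<times> 'v) \<Rightarrow> 'v \<Rightarrow> 'v" where
  "real_op F x = fst (F (x, 0))"

context clin
begin

lemma linear_real_op: "linear (real_op F)"
proof (rule linearI)
  show "real_op F (x + y) = real_op F x + real_op F y" for x y
    using add[of "(x, 0)" "(y, 0)"] by (simp add: real_op_def)
  show "real_op F (c *\<^sub>R x) = c *\<^sub>R real_op F x" for c x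
    using scale[of "of_real c" "(x, 0)"] by (simp add: real_op_def cscale_def)
qed

lemma cmap_real_op: "cmap (real_op F) a = cscale (1/2) (F a + cconj (F (cconj a)))"
proof (cases a)
  case (Pair x y)
  have "F (x, y) = F (x, 0) + cscale \<i> (F (y, 0))"
    using add[of "(x, 0)" "cscale \<i> (y, 0)"] scale[of \<i> "(y, 0)"] by (simp add: cscale_def)
  moreover have "F (x, - y) = F (x, 0) - cscale \<i> (F (y, 0))"
    using diff[of "(x, 0)" "cscale \<i> (y, 0)"] scale[of \<i> "(y, 0)"] by (simp add: cscale_def)
  ultimately show ?thesis
    by (simp add: Pair real_op_def cconj_def cscale_def prod_eq_iff scaleR_add_right[symmetric] scaleR_2[symmetric])
qed

end

section \<open>Semisimple and unipotent part of the monodromy as polynomials in it\<close>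

context hor_space
begin

abbreviation "G lam \<equiv> gen_eigenspace UNIV CM lam"
definition "Lam = (\<lambda>c. poly Z c) ` {c. poly P c = 0}"

lemma finite_Lam: "finite Lam" unfolding Lam_def using finite_roots by simp

lemma Lam_nonzero: "lam \<in> Lam \<Longrightarrow> lam \<noteq> 0"
  unfolding Lam_def using root_nonzero by (auto simp: poly_Z)

lemma pact_T_H: "a \<in> H c \<Longrightarrow> pact CR (T c ^ n) a = 0"
proof -
  assume a: "a \<in> H c"
  obtain eta where eta: "T c = [:- c, 1:] * eta" by (rule T_eta)
  have "pact CR (T c ^ n) a = pact CR (eta ^ n) (pact CR ([:- c, 1:] ^ n) a)"
    unfolding eta power_mult_distrib by (simp only: R.pact_mult[symmetric] mult.commute)
  also have "\<dots> = 0" using a unfolding H_pact by (simp add: clin.zero[OF R.clin_pact])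
  finally show ?thesis .
qed

lemma H_subset_G: "H c \<subseteq> G (poly Z c)"
  using pact_T_H[of _ c] unfolding M.gen_eigenspace_pact pact_CM_linear_power by blast

lemma G_power_n: assumes "a \<in> G lam" shows "pact CM ([:- lam, 1:] ^ n) a = 0"
proof -
  obtain w where w: "a = (\<Sum>c\<in>{c. (-1) ^ k * c ^ n = lam}. w c)" "\<forall>c\<in>{c. (-1) ^ k * c ^ n = lam}. w c \<in> H c"
    using gen_eigenspace_M[of lam] assms unfolding direct_sum_def by blast
  have "pact CM ([:- lam, 1:] ^ n) (w c) = 0" if "(-1) ^ k * c ^ n = lam" for c
    using pact_T_H[of "w c" c] w(2) that pact_CM_linear_power[of c n "w c"] by (simp add: poly_Z)
  then show ?thesis unfolding w(1) clin.sum[OF M.clin_pact] by (intro sum.neutral) auto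
qed

lemma G_sum: obtains w where "a = (\<Sum>lam\<in>Lam. w lam)" "\<And>lam. w lam \<in> G lam"
proof -
  have "direct_sum {c. poly P c = 0} H UNIV" by (rule direct_sum_H[OF finite_roots]) simp
  then obtain v where v: "a = (\<Sum>c\<in>{c. poly P c = 0}. v c)" "\<forall>c\<in>{c. poly P c = 0}. v c \<in> H c"
    unfolding direct_sum_def by blast
  let ?w = "\<lambda>lam. \<Sum>c\<in>{c\<in>{c. poly P c = 0}. poly Z c = lam}. v c"
  have "a = (\<Sum>lam\<in>Lam. ?w lam)"
    unfolding v(1) Lam_def using sum.image_gen[OF finite_roots] by blast
  moreover have "?w lam \<in> G lam" for lam
    by (rule cplx.subspace_sum[OF M.gen_eigenspace_subspace[OF cplx.subspace_UNIV]])
       (use v(2) H_subset_G in blast)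
  ultimately show ?thesis using that[of ?w] by blast
qed

lemma cconj_G: "a \<in> G lam \<Longrightarrow> cconj a \<in> G (cnj lam)"
proof -
  assume "a \<in> G lam"
  then obtain m where m: "pact CM ([:- lam, 1:] ^ m) a = 0" unfolding M.gen_eigenspace_pact by blast
  have "pact CM ([:- cnj lam, 1:] ^ m) (cconj a) = 0"
    using pact_cconj[OF lin_M, of "[:- lam, 1:] ^ m" a] m by (simp add: map_poly_cnj_linear_power)
  then show ?thesis unfolding M.gen_eigenspace_pact by blast
qed

lemma cnj_Lam: "lam \<in> Lam \<Longrightarrow> cnj lam \<in> Lam"
proof -
  assume "lam \<in> Lam"
  then obtain c where c: "poly P c = 0" "lam = poly Z c" unfolding Lam_def by blast
  then have "poly P (cnj c) = 0" "cnj lam = poly Z (cnj c)" using root_cnj by (auto simp: poly_Z)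
  then show ?thesis unfolding Lam_def by blast
qed

text \<open>\<open>spol\<close> and \<open>upol\<close> are congruent to lam, respectively to x /
  lam, modulo (x - lam)^n for every eigenvalue lam, so at M they give the semisimple and the
  unipotent part. The chosen polynomials may have non-real coefficients, hence the passage to
  \<open>real_op\<close> in \<open>s0\<close> and \<open>u0\<close>.\<close>

definition spol :: "complex poly" where
  "spol = (SOME f. \<forall>lam\<in>Lam. [:- lam, 1:] ^ n dvd f - [:lam:])"
definition upol :: "complex poly" where
  "upol = (SOME f. \<forall>lam\<in>Lam. [:- lam, 1:] ^ n dvd f - Polynomial.smult (1 / lam) [:0, 1:])"
definition s0 :: "'v \<Rightarrow> 'v" where "s0 = real_op (pact CM spol)"
definition u0 :: "'v \<Rightarrow> 'v" where "u0 = real_op (pact CM upol)"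

lemma pact_dvd_G:
  assumes "a \<in> G lam" "[:- lam, 1:] ^ n dvd f - g" shows "pact CM f a = pact CM g a"
proof -
  obtain h where h: "f - g = [:- lam, 1:] ^ n * h" using assms(2) by (rule dvdE)
  have "pact CM (f - g) a = pact CM h (pact CM ([:- lam, 1:] ^ n) a)"
    unfolding h by (simp only: M.pact_mult[symmetric] mult.commute)
  also have "\<dots> = 0" using G_power_n[OF assms(1)] by (simp add: clin.zero[OF M.clin_pact])
  finally show ?thesis by (simp add: M.pact_diff)
qed

lemma lin_s0: "linear s0" and lin_u0: "linear u0"
  unfolding s0_def u0_def by (intro clin.linear_real_op M.clin_pact)+

lemma half_double: "cscale (1/2) (a + a) = a"
  by (simp add: cplx.scale_left_distrib[of "1/2" "1/2" a, simplified, symmetric] cplx.scale_right_distrib)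

text \<open>Conjugation exchanges the spaces of lam and of its conjugate, on which
  \<open>spol\<close> acts by conjugate scalars. So both terms of the mean in
  \<open>cmap_real_op\<close> equal lam times a.\<close>

lemma cmap_s0: assumes "lam \<in> Lam" "a \<in> G lam" shows "cmap s0 a = cscale lam a"
proof -
  have "\<forall>lam\<in>Lam. [:- lam, 1:] ^ n dvd spol - [:lam:]"
    unfolding spol_def by (rule someI_ex) (rule poly_crt[OF finite_Lam])
  then have pl: "pact CM spol a = cscale lam a" if "lam \<in> Lam" "a \<in> G lam" for lam a
    using pact_dvd_G[OF that(2), of spol "[:lam:]"] that(1) by (simp add: M.pact_const)
  have "cconj (pact CM spol (cconj a)) = cscale lam a"
    using pl[OF cnj_Lam[OF assms(1)] cconj_G[OF assms(2)]] by (simp add: cconj_cscale)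
  then show ?thesis unfolding s0_def clin.cmap_real_op[OF M.clin_pact] pl[OF assms] by (simp add: half_double)
qed

lemma cmap_u0: assumes "lam \<in> Lam" "a \<in> G lam" shows "cmap u0 a = cscale (1 / lam) (CM a)"
proof -
  have "\<forall>lam\<in>Lam. [:- lam, 1:] ^ n dvd upol - Polynomial.smult (1 / lam) [:0, 1:]"
    unfolding upol_def by (rule someI_ex) (rule poly_crt[OF finite_Lam])
  then have pl: "pact CM upol a = cscale (1 / lam) (CM a)" if "lam \<in> Lam" "a \<in> G lam" for lam a
    using pact_dvd_G[OF that(2), of upol "Polynomial.smult (1 / lam) [:0, 1:]"] that(1)
    by (simp only: M.pact_smult M.pact_X)
  have "cconj (pact CM upol (cconj a)) = cscale (1 / lam) (CM a)"
    using pl[OF cnj_Lam[OF assms(1)] cconj_G[OF assms(2)]] by (simp add: cconj_cscale cmap_cconj[OF lin_M])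
  then show ?thesis unfolding u0_def clin.cmap_real_op[OF M.clin_pact] pl[OF assms] by (simp add: half_double)
qed

lemma G_invariant: "a \<in> G lam \<Longrightarrow> pact CM f a \<in> G lam"
proof -
  assume a: "a \<in> G lam"
  have "pact CM ([:- lam, 1:] ^ n) (pact CM f a) = pact CM f (pact CM ([:- lam, 1:] ^ n) a)"
    by (simp only: M.pact_mult[symmetric] mult.commute)
  then have "pact CM ([:- lam, 1:] ^ n) (pact CM f a) = 0" using G_power_n[OF a] by (simp add: clin.zero[OF M.clin_pact])
  then show ?thesis unfolding M.gen_eigenspace_pact by blast
qed

lemma G_CM: "a \<in> G lam \<Longrightarrow> CM a \<in> G lam"
  using G_invariant[of a lam "[:0, 1:]"] by (simp only: M.pact_X)

lemma G_scale: "a \<in> G lam \<Longrightarrow> cscale d a \<in> G lam"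
  by (rule cplx.subspace_scale[OF M.gen_eigenspace_subspace[OF cplx.subspace_UNIV]])

lemma s0_u0: "s0 (u0 x) = M x" "u0 (s0 x) = M x"
proof -
  obtain w where w: "(x, 0) = (\<Sum>lam\<in>Lam. w lam)" "\<And>lam. w lam \<in> G lam" using G_sum[where a="(x, 0)"] by blast
  interpret s: clin "cmap s0" by (rule clin_cmap[OF lin_s0])
  interpret u: clin "cmap u0" by (rule clin_cmap[OF lin_u0])
  have su: "cmap s0 (cmap u0 (w lam)) = CM (w lam)" "cmap u0 (cmap s0 (w lam)) = CM (w lam)" if lam: "lam \<in> Lam" for lam
    using cmap_u0[OF lam w(2)] cmap_s0[OF lam w(2)] cmap_s0[OF lam G_CM[OF w(2)]] Lam_nonzero[OF lam]
    by (simp_all add: s.scale u.scale)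
  have "cmap s0 (cmap u0 (x, 0)) = CM (x, 0)" "cmap u0 (cmap s0 (x, 0)) = CM (x, 0)"
    unfolding w(1) s.sum u.sum M.sum by (rule sum.cong[OF refl], erule su)+
  then show "s0 (u0 x) = M x" "u0 (s0 x) = M x" by simp_all
qed

definition u1 :: "'v \<Rightarrow> 'v" where "u1 x = u0 x - x"

lemma lin_u1: "linear u1"
  unfolding u1_def by (rule linear_compose_sub[OF lin_u0]) (simp add: linear_iff)

lemma cmap_u1: assumes "lam \<in> Lam" "a \<in> G lam" shows "cmap u1 a = cscale (1 / lam) (pact CM [:- lam, 1:] a)"
proof -
  have "cmap u1 a = cmap u0 a - a" by (cases a) (simp add: u1_def)
  then show ?thesis using cmap_u0[OF assms] Lam_nonzero[OF assms(1)]
    by (simp add: M.pact_linear cplx.scale_right_diff_distrib)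
qed

lemma cmap_u1_power: assumes "lam \<in> Lam" "a \<in> G lam"
  shows "(cmap u1 ^^ m) a = cscale (1 / lam ^ m) (pact CM ([:- lam, 1:] ^ m) a)"
proof (induction m)
  case (Suc m)
  interpret u: clin "cmap u1" by (rule clin_cmap[OF lin_u1])
  have "(cmap u1 ^^ Suc m) a = cmap u1 (cscale (1 / lam ^ m) (pact CM ([:- lam, 1:] ^ m) a))" using Suc by simp
  also have "\<dots> = cscale (1 / lam ^ m) (cscale (1 / lam) (pact CM [:- lam, 1:] (pact CM ([:- lam, 1:] ^ m) a)))"
    unfolding u.scale cmap_u1[OF assms(1) G_invariant[OF assms(2)]] ..
  finally show ?case by (simp only: M.pact_mult[symmetric] power_Suc) (simp add: mult.commute)
qed simp

lemma u1_nilpotent: "(u1 ^^ n) x = 0"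
proof -
  obtain w where w: "(x, 0) = (\<Sum>lam\<in>Lam. w lam)" "\<And>lam. w lam \<in> G lam" using G_sum[where a="(x, 0)"] by blast
  interpret u: clin "cmap u1 ^^ n" by (rule clin.clin_funpow[OF clin_cmap[OF lin_u1]])
  have "(cmap u1 ^^ n) (x, 0) = 0"
    unfolding w(1) u.sum by (rule sum.neutral) (use cmap_u1_power w(2) G_power_n in auto)
  then show ?thesis by (simp add: cmap_funpow zero_prod_def)
qed

definition M_inv :: "'v set \<Rightarrow> bool" where "M_inv V \<longleftrightarrow> subspace V \<and> (\<forall>x\<in>V. M x \<in> V)"

lemma M_inv_Times: assumes "M_inv V" shows "cplx.subspace (V \<times> V)" "\<And>a. a \<in> V \<times> V \<Longrightarrow> CM a \<in> V \<times> V"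
  using assms csubspace_Times unfolding M_inv_def by (auto simp: cmap_def)

lemma M_inv_pact: "M_inv V \<Longrightarrow> a \<in> V \<times> V \<Longrightarrow> pact CM f a \<in> V \<times> V"
  using M.pact_invariant M_inv_Times by blast

lemma M_inv_s0_u0: assumes "M_inv V" "x \<in> V" shows "s0 x \<in> V" "u0 x \<in> V"
proof -
  have "(x, 0) \<in> V \<times> V" using assms unfolding M_inv_def by (simp add: subspace_0)
  from M_inv_pact[OF assms(1) this] show "s0 x \<in> V" "u0 x \<in> V"
    unfolding s0_def u0_def real_op_def by (metis mem_Times_iff)+
qed

text \<open>The product of all (x - lam)^n annihilates the whole space, and the decomposition that
  it induces on an element of an invariant subspace stays inside that subspace.\<close>

lemma M_inv_G_sum:
  assumes "M_inv V" "a \<in> V \<times> V"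
  obtains w where "a = (\<Sum>lam\<in>Lam. w lam)" "\<And>lam. lam \<in> Lam \<Longrightarrow> w lam \<in> G lam \<and> w lam \<in> V \<times> V"
proof -
  let ?g = "\<Prod>lam\<in>Lam. [:- lam, 1:] ^ n"
  have "pact CM ?g a = 0"
  proof -
    obtain w where w: "a = (\<Sum>lam\<in>Lam. w lam)" "\<And>lam. w lam \<in> G lam" using G_sum[where a=a] by blast
    have "pact CM ?g (w lam) = 0" if lam: "lam \<in> Lam" for lam
    proof -
      have "[:- lam, 1:] ^ n dvd ?g - 0" using dvd_prodI[OF finite_Lam lam, of "\<lambda>lam. [:- lam, 1:] ^ n"] by simp
      from pact_dvd_G[OF w(2) this] show ?thesis by simp
    qed
    then show ?thesis unfolding w(1) clin.sum[OF M.clin_pact] by (rule sum.neutral[OF ballI])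
  qed
  moreover have "?g \<noteq> 0" using finite_Lam by (auto simp: prod_zero_iff)
  ultimately obtain w where w: "\<forall>c. poly ?g c = 0 \<longrightarrow> w c \<in> gen_eigenspace (V \<times> V) CM c" "a = (\<Sum>c\<in>{c. poly ?g c = 0}. w c)"
    using M.gen_eigenspace_decomp[OF M_inv_Times[OF assms(1)], of ?g a] assms(2) by blast
  have "{c. poly ?g c = 0} = Lam" using finite_Lam n0 by (auto simp: poly_prod poly_power prod_zero_iff)
  then show ?thesis using that[of w] w unfolding gen_eigenspace_def by auto
qed

lemma jordan_decomp_exists: assumes "M_inv V" shows "jordan_decomp_on V M s0 u0"
  unfolding jordan_decomp_on_def
proof (intro conjI)
  show "linear_endo_on V s0" "linear_endo_on V u0" unfolding linear_endo_on_def
    using M_inv_s0_u0[OF assms] lin_s0 lin_u0 by (auto simp: linear_add linear_scale)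
  show "\<forall>x\<in>V. s0 (u0 x) = M x \<and> u0 (s0 x) = M x" using s0_u0 by blast
  show "\<exists>m. \<forall>x\<in>V. ((\<lambda>y. u0 y - y) ^^ m) x = 0"
    using u1_nilpotent unfolding u1_def[abs_def] by blast
  let ?B = "\<Union>lam\<in>Lam. G lam \<inter> (V \<times> V)"
  show "\<exists>B. cplx.span B = V \<times> V \<and> (\<forall>b\<in>B. \<exists>c. cmap s0 b = cscale c b)"
  proof (intro exI[of _ ?B] conjI)
    show "\<forall>b\<in>?B. \<exists>c. cmap s0 b = cscale c b" using cmap_s0 by blast
    show "cplx.span ?B = V \<times> V"
    proof
      show "cplx.span ?B \<subseteq> V \<times> V" by (rule cplx.span_minimal) (use M_inv_Times[OF assms] in auto)
      show "V \<times> V \<subseteq> cplx.span ?B"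
      proof
        fix a assume "a \<in> V \<times> V"
        then obtain w where w: "a = (\<Sum>lam\<in>Lam. w lam)" "\<And>lam. lam \<in> Lam \<Longrightarrow> w lam \<in> G lam \<and> w lam \<in> V \<times> V"
          using M_inv_G_sum[OF assms] by blast
        show "a \<in> cplx.span ?B" unfolding w(1) by (intro cplx.span_sum cplx.span_base) (use w(2) in blast)
      qed
    qed
  qed
qed

text \<open>Uniqueness of the semisimple part. As u commutes with s, an eigenvector b of s with
  eigenvalue c satisfies (M - c)^i b = c^i (u - 1)^i b and lies in \<open>G c\<close>. Expand a into
  eigenvectors of s and sort by eigenvalue: independence of the spaces \<open>G c\<close> leaves
  only the part for lam.\<close>

lemma jordan_decomp_cmap_s:
  assumes V: "M_inv V" and J: "jordan_decomp_on V M s u" and a: "a \<in> V \<times> V" "a \<in> G lam"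
  shows "cmap s a = cscale lam a"
proof -
  have s: "\<And>x y. x \<in> V \<Longrightarrow> y \<in> V \<Longrightarrow> s (x + y) = s x + s y" "\<And>c x. x \<in> V \<Longrightarrow> s (c *\<^sub>R x) = c *\<^sub>R s x" "\<And>x. x \<in> V \<Longrightarrow> s x \<in> V"
    and u: "\<And>x y. x \<in> V \<Longrightarrow> y \<in> V \<Longrightarrow> u (x + y) = u x + u y" "\<And>c x. x \<in> V \<Longrightarrow> u (c *\<^sub>R x) = c *\<^sub>R u x" "\<And>x. x \<in> V \<Longrightarrow> u x \<in> V"
    and su: "\<And>x. x \<in> V \<Longrightarrow> s (u x) = M x" "\<And>x. x \<in> V \<Longrightarrow> u (s x) = M x"
    using J unfolding jordan_decomp_on_def linear_endo_on_def by auto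
  obtain B m where B: "cplx.span B = V \<times> V" "\<forall>b\<in>B. \<exists>c. cmap s b = cscale c b"
    and m: "\<forall>x\<in>V. ((\<lambda>y. u y - y) ^^ m) x = 0" using J unfolding jordan_decomp_on_def by auto
  have sV: "subspace V" using V unfolding M_inv_def by blast
  have Vc: "x \<in> V \<Longrightarrow> y \<in> V \<Longrightarrow> x + y \<in> V" "x \<in> V \<Longrightarrow> y \<in> V \<Longrightarrow> x - y \<in> V" "x \<in> V \<Longrightarrow> c *\<^sub>R x \<in> V" for x y c
    using subspace_add[OF sV] subspace_diff[OF sV] subspace_scale[OF sV] by auto
  have fdiff: "f (x - y) = f x - f y" if "x \<in> V" "y \<in> V"
     "\<And>x y. x \<in> V \<Longrightarrow> y \<in> V \<Longrightarrow> f (x + y) = f x + f y" for f :: "'v \<Rightarrow> 'v" and x y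
    using that(3)[of "x - y" y] that(1,2) Vc(2) by simp
  have cs: "cmap f (cscale c y) = cscale c (cmap f y)" if "y \<in> V \<times> V"
     "\<And>x y. x \<in> V \<Longrightarrow> y \<in> V \<Longrightarrow> f (x + y) = f x + f y" "\<And>c x. x \<in> V \<Longrightarrow> f (c *\<^sub>R x) = c *\<^sub>R f x" for f c y
    using that(1) by (cases y) (auto simp: cscale_def that(2,3) fdiff[OF _ _ that(2)] Vc)
  have ca: "cmap s (x + y) = cmap s x + cmap s y" if "x \<in> V \<times> V" "y \<in> V \<times> V" for x y
    using that by (cases x; cases y) (auto simp: s)
  have csum: "cmap s (\<Sum>i\<in>I. w i) = (\<Sum>i\<in>I. cmap s (w i)) \<and> (\<Sum>i\<in>I. w i) \<in> V \<times> V" if "finite I" "\<And>i. i \<in> I \<Longrightarrow> w i \<in> V \<times> V" for I :: "('v \<times> 'v) set" and w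
    using that
  proof (induction I rule: finite_induct)
    case empty
    have "s 0 = 0" using s(2)[of 0 0] subspace_0[OF sV] by simp
    then show ?case using subspace_0[OF sV] by (simp add: cmap_def zero_prod_def)
  next
    case (insert x I)
    then show ?case using ca[of "w x" "\<Sum>i\<in>I. w i"] cplx.subspace_add[OF csubspace_Times[OF sV]] by auto
  qed
  have bG: "b \<in> G c" if b: "b \<in> V \<times> V" "cmap s b = cscale c b" for b c
  proof -
    let ?y = "\<lambda>i. (cmap (\<lambda>y. u y - y) ^^ i) b"
    have y: "?y i \<in> V \<times> V \<and> cmap s (?y i) = cscale c (?y i)" for i
    proof (induction i)
      case (Suc i)
      obtain y1 y2 where y12: "?y i = (y1, y2)" by fastforce
      then have V12: "y1 \<in> V" "y2 \<in> V" using Suc by auto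
      have e: "?y (Suc i) = cmap u (?y i) - ?y i" by (simp add: y12)
      have "cmap s (cmap u (?y i)) = cmap u (cmap s (?y i))" using V12 su by (simp add: y12)
      also have "\<dots> = cscale c (cmap u (?y i))" using Suc cs[OF _ u(1,2)] by simp
      finally have 1: "cmap s (cmap u (?y i)) = cscale c (cmap u (?y i))" .
      have "cmap s (cmap u (?y i) - ?y i) = cmap s (cmap u (?y i)) - cmap s (?y i)"
        using V12 u(3) by (simp add: y12 fdiff[OF _ _ s(1)])
      also have "\<dots> = cscale c (cmap u (?y i) - ?y i)" using 1 Suc by (simp add: cplx.scale_right_diff_distrib)
      finally show ?case unfolding e using V12 u(3) Vc by (simp add: y12)
    qed (use b in simp)
    have "pact CM ([:- c, 1:] ^ i) b = cscale (c ^ i) (?y i)" for i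
    proof (induction i)
      case (Suc i)
      obtain y1 y2 where y12: "?y i = (y1, y2)" by fastforce
      then have V12: "y1 \<in> V" "y2 \<in> V" using y[of i] by auto
      have "CM (?y i) = cmap u (cmap s (?y i))" using V12 su by (simp add: y12)
      also have "\<dots> = cscale c (cmap u (?y i))" using y[of i] cs[OF _ u(1,2)] by simp
      finally have "pact CM [:- c, 1:] (?y i) = cscale c (?y (Suc i))"
        by (simp add: M.pact_linear y12 cplx.scale_right_diff_distrib[symmetric])
      then show ?case unfolding power_Suc M.pact_mult Suc clin.scale[OF M.clin_pact] by (simp add: mult.commute)
    qed simp
    moreover have "?y m = 0" using m b by (cases b) (auto simp: cmap_funpow zero_prod_def)
    ultimately have "pact CM ([:- c, 1:] ^ m) b = 0" by simp
    then show ?thesis unfolding M.gen_eigenspace_pact by blast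
  qed
  have "a \<in> cplx.span B" using B(1) a(1) by simp
  then obtain B0 g where B0: "finite B0" "B0 \<subseteq> B" "a = (\<Sum>b\<in>B0. cscale (g b) b)"
    unfolding cplx.span_explicit by auto
  obtain ev where ev: "\<forall>b\<in>B. cmap s b = cscale (ev b) b" using B(2) by metis
  have BV: "b \<in> V \<times> V" if "b \<in> B" for b using cplx.span_base[OF that] B(1) by simp
  have tV: "cscale (g b) b \<in> V \<times> V" if "b \<in> B0" for b
    using BV B0(2) that cplx.subspace_scale[OF csubspace_Times[OF sV]] by blast
  let ?A = "\<lambda>c. \<Sum>b\<in>{b\<in>B0. ev b = c}. cscale (g b) b"
  let ?C = "insert lam (ev ` B0)"
  \<comment> \<open>The difference of two decompositions of a, one by the eigenvalues of s, the
    other with a itself as the component of lam.\<close>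
  let ?w = "\<lambda>c. ?A c - (if c = lam then a else 0)"
  have AG: "?A c \<in> G c" for c
    by (rule cplx.subspace_sum[OF M.gen_eigenspace_subspace[OF cplx.subspace_UNIV]])
       (use bG ev BV B0(2) G_scale in blast)
  have "(\<Sum>c\<in>?C. ?A c) = (\<Sum>c\<in>ev ` B0. ?A c)"
    by (rule sum.mono_neutral_right) (use B0(1) in \<open>auto intro!: sum.neutral\<close>)
  also have "\<dots> = a" unfolding B0(3) by (rule sum.image_gen[OF B0(1), symmetric])
  finally have "(\<Sum>c\<in>?C. ?w c) = 0"
    unfolding sum_subtractf using B0(1) by (simp add: sum.delta)
  moreover have "?w c \<in> G c" if "c \<in> ?C" for c
    by (rule cplx.subspace_diff[OF M.gen_eigenspace_subspace[OF cplx.subspace_UNIV] AG])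
       (use a(2) cplx.subspace_0[OF M.gen_eigenspace_subspace[OF cplx.subspace_UNIV]] in auto)
  ultimately have "?w lam = 0" using M.gen_eigenspace_indep[of ?C ?w UNIV] B0(1) by blast
  then have aA: "a = ?A lam" by simp
  have "cmap s (?A lam) = (\<Sum>b\<in>{b\<in>B0. ev b = lam}. cmap s (cscale (g b) b))"
    by (rule conjunct1[OF csum]) (use B0(1) tV in auto)
  also have "\<dots> = (\<Sum>b\<in>{b\<in>B0. ev b = lam}. cscale lam (cscale (g b) b))"
    by (rule sum.cong) (use cs[OF BV s(1,2)] ev B0(2) in \<open>auto simp: mult.commute\<close>)
  also have "\<dots> = cscale lam (?A lam)" by (simp only: cplx.scale_sum_right)
  finally show ?thesis using aA by metis
qed

text \<open>Any s of a decomposition agrees with \<open>s0\<close> by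
  \<open>jordan_decomp_cmap_s\<close>, and u agrees with \<open>u0\<close> after \<open>s0\<close>,
  which acts by nonzero scalars on the pieces of V. The map f stands for the monodromy of V, which
  is known on V only.\<close>

lemma unipotent_part_M:
  assumes V: "M_inv V" and f: "\<And>x. x \<in> V \<Longrightarrow> f x = M x"
  shows "unipotent_part V f = restrict u0 V"
proof -
  have eq: "jordan_decomp_on V f s u = jordan_decomp_on V M s u" for s u
    unfolding jordan_decomp_on_def using f by (intro conj_cong refl ball_cong) auto
  have J0: "jordan_decomp_on V M s0 u0" by (rule jordan_decomp_exists[OF V])
  have uq: "u x = u0 x" if J: "jordan_decomp_on V M s u" and x: "x \<in> V" for s u x
  proof -
    have ul: "\<And>x y. x \<in> V \<Longrightarrow> y \<in> V \<Longrightarrow> u (x + y) = u x + u y" "\<And>c x. x \<in> V \<Longrightarrow> u (c *\<^sub>R x) = c *\<^sub>R u x"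
      and su: "\<And>x. x \<in> V \<Longrightarrow> u (s x) = M x"
      using J unfolding jordan_decomp_on_def linear_endo_on_def by auto
    have sV: "subspace V" using V unfolding M_inv_def by blast
    have x0: "(x, 0) \<in> V \<times> V" using x subspace_0[OF sV] by simp
    obtain w where w: "(x, 0) = (\<Sum>lam\<in>Lam. w lam)" "\<And>lam. lam \<in> Lam \<Longrightarrow> w lam \<in> G lam \<and> w lam \<in> V \<times> V"
      using M_inv_G_sum[OF V x0] by blast
    define d where "d = (\<lambda>x. u x - u0 x)"
    have dl: "d (x + y) = d x + d y" "d (c *\<^sub>R x) = c *\<^sub>R d x" if "x \<in> V" "y \<in> V" for c x y
      unfolding d_def ul(1)[OF that] ul(2)[OF that(1)] linear_add[OF lin_u0] linear_scale[OF lin_u0]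
      by (simp_all add: scaleR_diff_right)
    have dd: "d (x - y) = d x - d y" if "x \<in> V" "y \<in> V" for x y
    proof -
      have "x - y \<in> V" using subspace_diff[OF sV] that by blast
      from dl(1)[OF this that(2)] show ?thesis by simp
    qed
    have z: "cmap d (w lam) = 0" if lam: "lam \<in> Lam" for lam
    proof -
      obtain y1 y2 where y12: "w lam = (y1, y2)" by fastforce
      have wG: "w lam \<in> G lam" and wV: "w lam \<in> V \<times> V" using w(2)[OF lam] by (rule conjunct1, rule conjunct2)
      have V12: "y1 \<in> V" "y2 \<in> V" using wV unfolding y12 by (rule SigmaD1, rule SigmaD2)
      have sw: "cmap s (w lam) = cscale lam (w lam)" by (rule jordan_decomp_cmap_s[OF V J wV wG])
      have s0w: "cmap s0 (w lam) = cscale lam (w lam)" by (rule cmap_s0[OF lam wG])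
      have "cmap s (w lam) = cmap s0 (w lam)" by (rule trans[OF sw s0w[symmetric]])
      then have ss: "s y1 = s0 y1" "s y2 = s0 y2" unfolding y12 cmap_Pair by simp_all
      have sy: "s0 y1 \<in> V" "s0 y2 \<in> V" using M_inv_s0_u0[OF V] V12 by auto
      have "d (s0 y1) = 0" "d (s0 y2) = 0" unfolding d_def using ss su[OF V12(1)] su[OF V12(2)] s0_u0(2) by auto
      then have "cmap d (cmap s0 (w lam)) = 0" by (simp add: y12 zero_prod_def)
      then have "cmap d (cscale lam (w lam)) = 0" unfolding s0w .
      moreover have "cmap d (cscale lam (w lam)) = cscale lam (cmap d (w lam))"
      proof -
        have sc: "c *\<^sub>R y1 \<in> V" "c *\<^sub>R y2 \<in> V" for c using V12 subspace_scale[OF sV] by auto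
        have ds: "d (c *\<^sub>R y1) = c *\<^sub>R d y1" "d (c *\<^sub>R y2) = c *\<^sub>R d y2" for c
          using dl(2)[OF V12(1) V12(1)] dl(2)[OF V12(2) V12(2)] by auto
        show ?thesis unfolding y12 cscale_def cmap_Pair fst_conv snd_conv
          using dd[OF sc(1) sc(2)] dl(1)[OF sc(2) sc(1)] ds by simp
      qed
      ultimately show ?thesis using Lam_nonzero[OF lam] by simp
    qed
    have "cmap d (\<Sum>lam\<in>I. w lam) = 0 \<and> (\<Sum>lam\<in>I. w lam) \<in> V \<times> V" if "finite I" "I \<subseteq> Lam" for I
      using that
    proof (induction I rule: finite_induct)
      case empty
      have "d 0 = 0" using dl(2)[OF subspace_0[OF sV] subspace_0[OF sV], of 0] by simp
      then show ?case using subspace_0[OF sV] by (simp add: zero_prod_def)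
    next
      case (insert i I)
      obtain y1 y2 where y12: "w i = (y1, y2)" by fastforce
      obtain z1 z2 where z12: "(\<Sum>lam\<in>I. w lam) = (z1, z2)" by fastforce
      have "y1 \<in> V" "y2 \<in> V" "z1 \<in> V" "z2 \<in> V" using w(2)[of i] y12 insert z12 by auto
      moreover have "d y1 = 0" "d y2 = 0" using z[of i] insert.prems y12 by (auto simp: zero_prod_def)
      moreover have "d z1 = 0" "d z2 = 0" using insert.IH insert.prems z12 by (auto simp: zero_prod_def)
      ultimately show ?case using insert.hyps subspace_add[OF sV] dl(1)
        by (simp add: y12 z12 zero_prod_def)
    qed
    from this[OF finite_Lam] have "cmap d (x, 0) = 0" unfolding w(1) by blast
    then show ?thesis by (simp add: zero_prod_def d_def)
  qed
  show ?thesis unfolding unipotent_part_def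
  proof (rule the_equality)
    have "jordan_decomp_on V M s0 (restrict u0 V)"
    proof -
      have pw: "((\<lambda>y. restrict u0 V y - y) ^^ m) x = ((\<lambda>y. u0 y - y) ^^ m) x \<and> ((\<lambda>y. u0 y - y) ^^ m) x \<in> V" if "x \<in> V" for x m
        using that
      proof (induction m)
        case (Suc m)
        then show ?case using M_inv_s0_u0[OF V] V unfolding M_inv_def by (auto intro: subspace_diff)
      qed simp
      obtain m where "\<forall>x\<in>V. ((\<lambda>y. u0 y - y) ^^ m) x = 0" using J0 unfolding jordan_decomp_on_def by blast
      then have "\<forall>x\<in>V. ((\<lambda>y. restrict u0 V y - y) ^^ m) x = 0" using pw by metis
      moreover have "linear_endo_on V (restrict u0 V)"
      proof -
        have sV: "subspace V" using V unfolding M_inv_def by blast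
        show ?thesis using M_inv_s0_u0(2)[OF V] subspace_add[OF sV] subspace_scale[OF sV]
          unfolding linear_endo_on_def by (simp add: image_subset_iff linear_add[OF lin_u0] linear_scale[OF lin_u0])
      qed
      moreover have "\<forall>x\<in>V. s0 (restrict u0 V x) = M x \<and> restrict u0 V (s0 x) = M x"
        using M_inv_s0_u0[OF V] s0_u0 by auto
      ultimately show ?thesis using J0 unfolding jordan_decomp_on_def by blast
    qed
    then show "restrict u0 V \<in> extensional V \<and> (\<exists>s. jordan_decomp_on V f s (restrict u0 V))"
      unfolding eq by (intro conjI exI[of _ s0]) auto
  next
    fix u assume u: "u \<in> extensional V \<and> (\<exists>s. jordan_decomp_on V f s u)"
    then obtain s where Js: "jordan_decomp_on V M s u" using eq by blast
    show "u = restrict u0 V"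
    proof (rule extensionalityI[of u V])
      show "u \<in> extensional V" using u by (rule conjunct1)
      show "restrict u0 V \<in> extensional V" by simp
      show "u x = restrict u0 V x" if "x \<in> V" for x using uq[OF Js that] that by simp
    qed
  qed
qed

text \<open>The logarithm series of 1 + \<open>u1\<close>, cut off at order d. As
  \<open>nilpotent_part\<close> stops at the dimension of the subspace, d varies with the
  subspace.\<close>

definition Nd :: "nat \<Rightarrow> 'v \<Rightarrow> 'v" where
  "Nd d x = (\<Sum>j=1..d. ((-1) ^ (j + 1) / real j) *\<^sub>R (u1 ^^ j) x)"

lemma lin_u1_pow: "linear (u1 ^^ j)"
proof (induction j)
  case (Suc m) then show ?case using linear_compose[OF Suc lin_u1] by (simp add: o_def)
qed (auto simp: linear_iff)

lemma lin_Nd: "linear (Nd d)"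
  unfolding Nd_def by (intro linear_compose_sum ballI linear_compose_scale_right lin_u1_pow)

lemma nilpotent_part_eq:
  assumes V: "M_inv V" and f: "\<And>x. x \<in> V \<Longrightarrow> f x = M x" and x: "x \<in> V"
  shows "nilpotent_part V f x = Nd (dim V) x"
proof -
  have "((\<lambda>y. restrict u0 V y - y) ^^ j) x = (u1 ^^ j) x \<and> (u1 ^^ j) x \<in> V" for j
  proof (induction j)
    case (Suc j)
    then show ?case using M_inv_s0_u0[OF V] V unfolding M_inv_def by (auto intro: subspace_diff simp: u1_def)
  qed (use x in simp)
  moreover have "unipotent_part V f = restrict u0 V" by (rule unipotent_part_M[OF V]) (rule f)
  ultimately show ?thesis unfolding nilpotent_part_def Nd_def by simp
qed

text \<open>On \<open>G lam\<close> the operator \<open>u1\<close> is (M - lam) / lam. Taking one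
  factor M - lam out of the series leaves a polynomial whose value at lam is the coefficient 1 / lam
  of the linear term.\<close>

lemma Nd_poly:
  assumes lam: "lam \<in> Lam" and d: "d \<ge> 1"
  shows "\<exists>eta. poly eta lam = 1 / lam \<and> (\<forall>a\<in>G lam. cmap (Nd d) a = pact CM ([:- lam, 1:] * eta) a)"
proof -
  define g where "g j = complex_of_real ((-1) ^ (j + 1) / real j) * (1 / lam ^ j)" for j
  define eta where "eta = (\<Sum>j=1..d. Polynomial.smult (g j) ([:- lam, 1:] ^ (j - 1)))"
  have "poly eta lam = (\<Sum>j\<in>{1..d}. g j * 0 ^ (j - 1))" by (simp add: eta_def poly_sum poly_power)
  also have "\<dots> = (\<Sum>j\<in>{1}. g j * 0 ^ (j - 1))"
    by (rule sum.mono_neutral_right) (use d in \<open>auto simp: zero_power\<close>)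
  finally have "poly eta lam = 1 / lam" by (simp add: g_def)
  moreover have "cmap (Nd d) a = pact CM ([:- lam, 1:] * eta) a" if a: "a \<in> G lam" for a
  proof -
    have "cmap (Nd d) a = (\<Sum>j=1..d. cscale (complex_of_real ((-1) ^ (j + 1) / real j)) ((cmap u1 ^^ j) a))"
      by (cases a) (simp add: Nd_def cmap_funpow cscale_def sum_prod)
    also have "\<dots> = (\<Sum>j=1..d. cscale (g j) (pact CM ([:- lam, 1:] ^ j) a))"
      unfolding cmap_u1_power[OF lam a] g_def by simp
    also have "\<dots> = (\<Sum>j=1..d. cscale (g j) (pact CM ([:- lam, 1:] * [:- lam, 1:] ^ (j - 1)) a))"
      by (rule sum.cong) (auto simp: power_eq_if simp del: mult_pCons_left)
    also have "\<dots> = pact CM ([:- lam, 1:] * eta) a"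
      unfolding eta_def sum_distrib_left M.pact_sum mult_smult_right M.pact_smult ..
    finally show ?thesis .
  qed
  ultimately show ?thesis by blast
qed

text \<open>Transport to R: the factor M - lam contributes the derivative of Z at c. Divided by lam
  = Z(c) this is the logarithmic derivative n / c of x^n.\<close>

lemma Nd_H:
  assumes r: "poly P c = 0" and d: "d \<ge> 1"
  shows "\<exists>th. poly th c = of_nat n / c \<and> (\<forall>a\<in>H c. cmap (Nd d) a = pact CR ([:- c, 1:] * th) a)"
proof -
  let ?lam = "poly Z c"
  have lam: "?lam \<in> Lam" using r unfolding Lam_def by blast
  obtain eta where eta: "poly eta ?lam = 1 / ?lam" "\<forall>a\<in>G ?lam. cmap (Nd d) a = pact CM ([:- ?lam, 1:] * eta) a"
    using Nd_poly[OF lam d] by blast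
  obtain et where et: "T c = [:- c, 1:] * et" "poly et c = (-1) ^ k * of_nat n * c ^ (n - 1)" by (rule T_eta)
  let ?th = "et * pcompose eta Z"
  have "poly ?th c = of_nat n / c"
  proof -
    have "c ^ n = c * c ^ (n - 1)" using n0 by (cases n) auto
    then show ?thesis using root_nonzero[OF r] eta(1) et(2) by (simp add: poly_pcompose poly_Z)
  qed
  moreover have "cmap (Nd d) a = pact CR ([:- c, 1:] * ?th) a" if "a \<in> H c" for a
  proof -
    have "cmap (Nd d) a = pact CM ([:- ?lam, 1:] * eta) a" using eta(2) H_subset_G that by blast
    also have "\<dots> = pact CM ([:- ?lam, 1:] ^ 1) (pact CM eta a)" by (simp only: M.pact_mult power_one_right)
    also have "\<dots> = pact CR (T c ^ 1) (pact CR (pcompose eta Z) a)"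
      by (subst pact_CM_linear_power, subst pact_CM) (rule refl)
    also have "\<dots> = pact CR ([:- c, 1:] * ?th) a" unfolding et(1) by (simp only: R.pact_mult power_one_right)
    finally show ?thesis .
  qed
  ultimately show ?thesis by blast
qed

section \<open>The eigenvector of a block and the phase of the form\<close>

lemma cbil_R: "cbil L (CR a) (CR b) = cbil L a b"
  by (cases a; cases b) (simp add: cbil_def L_R)

text \<open>For a zero c, the last nonzero vector of the chain of \<open>Phi (Q c)\<close> under R -
  c, an eigenvector of R.\<close>

definition Ev :: "complex \<Rightarrow> 'v \<times> 'v" where "Ev c = Phi ([:- c, 1:] ^ lad_l c * Q c)"

text \<open>Synthetic division by x - c: the quotient is a combination of Horner polynomials with
  powers of c as coefficients. For \<open>P\<close> it yields the coordinates of the eigenvector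
  \<open>Ev c\<close>.\<close>

lemma horner_geometric:
  "[:- c, 1:] * (\<Sum>j<m. Polynomial.smult (c ^ (m - 1 - j)) (horner q N j)) = horner q N m - [:poly (horner q N m) c:]"
proof (induction m)
  case (Suc m)
  have "(\<Sum>j<Suc m. Polynomial.smult (c ^ (Suc m - 1 - j)) (horner q N j)) =
      Polynomial.smult c (\<Sum>j<m. Polynomial.smult (c ^ (m - 1 - j)) (horner q N j)) + horner q N m"
  proof -
    have "(\<Sum>j<m. Polynomial.smult (c ^ (Suc m - 1 - j)) (horner q N j)) =
        (\<Sum>j<m. Polynomial.smult c (Polynomial.smult (c ^ (m - 1 - j)) (horner q N j)))"
    proof (rule sum.cong)
      fix j assume "j \<in> {..<m}"
      then have "Suc m - 1 - j = Suc (m - 1 - j)" by auto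
      then show "Polynomial.smult (c ^ (Suc m - 1 - j)) (horner q N j) =
        Polynomial.smult c (Polynomial.smult (c ^ (m - 1 - j)) (horner q N j))" by simp
    qed simp
    then show ?thesis unfolding sum.lessThan_Suc by (simp add: smult_sum2)
  qed
  then have "[:- c, 1:] * (\<Sum>j<Suc m. Polynomial.smult (c ^ (Suc m - 1 - j)) (horner q N j)) =
     Polynomial.smult c (horner q N m - [:poly (horner q N m) c:]) + [:- c, 1:] * horner q N m"
    using Suc by (simp only: distrib_left mult_smult_right)
  also have "\<dots> = horner q N (Suc m) - [:poly (horner q N (Suc m)) c:]"
    by (simp add: smult_diff_right algebra_simps) (simp add: pCons_one flip: smult_diff_left)?
  finally show ?case .
qed (simp add: one_pCons)

lemma Ev_expansion: assumes r: "poly P c = 0" shows "Ev c = (\<Sum>j<n. cscale (c ^ (n - 1 - j)) (e j, 0))"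
proof -
  let ?X = "[:- c, 1:]" and ?G = "\<Sum>j<n. Polynomial.smult (c ^ (n - 1 - j)) (horner P n j)"
  have "?X * ?G = P" using horner_geometric[of c n P n] r by (simp add: horner_n)
  also have "P = ?X * (?X ^ lad_l c * Q c)"
    using P_Q[of c] unfolding mu_root[OF r] by (simp only: power_Suc mult.assoc)
  finally have eq: "?X * ?G = ?X * (?X ^ lad_l c * Q c)" .
  have "?X \<noteq> 0" by simp
  from mult_left_cancel[OF this, THEN iffD1, OF eq] have "Ev c = Phi ?G" unfolding Ev_def by (simp only:)
  also have "\<dots> = (\<Sum>j<n. cscale (c ^ (n - 1 - j)) (e j, 0))"
    unfolding Phi_sum Phi_smult by (rule sum.cong) (auto simp: Phi_horner)
  finally show ?thesis .
qed

lemma cbil_sum_right: "cbil L a (\<Sum>i\<in>I. w i) = (\<Sum>i\<in>I. cbil L a (w i))"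
  by (induction I rule: infinite_finite_induct) (auto simp: cbil_zero[OF bil] cbil_add_right[OF bil])

lemma cbil_e0_Ev: assumes r: "poly P c = 0" shows "cbil L (e 0, 0) (Ev c) = c ^ (n - 1)"
proof -
  have "cbil L (e 0, 0) (Ev c) = (\<Sum>j<n. c ^ (n - 1 - j) * of_real (L (e 0) (e j)))"
    unfolding Ev_expansion[OF r] cbil_sum_right cbil_scale_right[OF bil] cbil_real[OF bil] ..
  also have "\<dots> = (\<Sum>j\<in>{0}. c ^ (n - 1 - j) * of_real (L (e 0) (e j)))"
    by (rule sum.mono_neutral_right) (use n0 L_e[of 0] in auto)
  also have "\<dots> = c ^ (n - 1)" using L_e[of 0 0] n0 p_monic by simp
  finally show ?thesis .
qed

lemma CR_Ev: assumes r: "poly P c = 0" shows "CR (Ev c) = cscale c (Ev c)"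
proof -
  have "pact CR [:- c, 1:] (Ev c) = Phi ([:- c, 1:] ^ Suc (lad_l c) * Q c)"
    unfolding Ev_def pact_Phi by (simp only: power_Suc mult.assoc)
  also have "[:- c, 1:] ^ Suc (lad_l c) * Q c = P" using P_Q[of c] unfolding mu_root[OF r] by (rule sym)
  finally show ?thesis using Phi_P by (simp add: R.pact_linear)
qed

lemma norm_1_cnj: assumes "cmod c = 1" shows "cnj c * c = 1" "cnj c = inverse c"
proof -
  have 1: "c * cnj c = 1" using complex_norm_square[of c] assms by simp
  then show "cnj c * c = 1" by (simp only: mult.commute)
  show "cnj c = inverse c" using inverse_unique[OF 1] by simp
qed

text \<open>The conjugate of \<open>Ev c\<close> is an eigenvector for the conjugate of c, which is
  1 / c on the circle. By the isometry, R in the first argument acts as multiplication by c.\<close>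

lemma cbil_Phi_cconj_Ev:
  assumes r: "poly P c = 0"
  shows "cbil L (pact CR g a) (cconj (Ev c)) = poly g c * cbil L a (cconj (Ev c))"
proof -
  have one: "cnj c * c = 1" using norm_1_cnj root_norm[OF r] by blast
  have cR: "CR (cconj (Ev c)) = cscale (cnj c) (cconj (Ev c))"
    by (simp add: cmap_cconj[OF lin_R] CR_Ev[OF r] cconj_cscale)
  have step: "cbil L (CR a) (cconj (Ev c)) = c * cbil L a (cconj (Ev c))" for a
  proof -
    have "cbil L a (cconj (Ev c)) = cnj c * cbil L (CR a) (cconj (Ev c))"
      using cbil_R[of a "cconj (Ev c)"] unfolding cR cbil_scale_right[OF bil] by simp
    then have "c * cbil L a (cconj (Ev c)) = (cnj c * c) * cbil L (CR a) (cconj (Ev c))" by simp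
    then show ?thesis unfolding one by simp
  qed
  show ?thesis
    by (induction g) (auto simp: R.pact_pCons cbil_zero[OF bil] cbil_add_left[OF bil] cbil_scale_left[OF bil] step algebra_simps)
qed

text \<open>The value of \<open>Q c\<close> at c is the product of c - kappa over the other zeros.
  Taking c out of each factor leaves the product whose argument \<open>phase\<close>
  computes.\<close>

lemma Q_prod: assumes r: "poly P c = 0" shows "poly (Q c) c * c ^ Suc (lad_l c) = c ^ n * (\<Prod>j\<in>{j\<in>{1..n}. kap j \<noteq> c}. 1 - kap j / c)"
proof -
  let ?X = "[:- c, 1:]" and ?A = "{j\<in>{1..n}. kap j = c}" and ?B = "{j\<in>{1..n}. kap j \<noteq> c}"
  have AB: "{1..n} = ?A \<union> ?B" by auto
  have cA: "card ?A = Suc (lad_l c)" using mu_root[OF r] order_p by simp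
  have "card {1..n} = card ?A + card ?B" by (subst AB) (rule card_Un_disjoint, auto)
  then have cB: "n = Suc (lad_l c) + card ?B" using cA by simp
  have "P = (\<Prod>j\<in>?A. [:- kap j, 1:]) * (\<Prod>j\<in>?B. [:- kap j, 1:])"
    unfolding p_Pi Pi_kap by (subst AB) (rule prod.union_disjoint, auto)
  also have "(\<Prod>j\<in>?A. [:- kap j, 1:]) = (\<Prod>j\<in>?A. ?X)" by (rule prod.cong) auto
  also have "\<dots> = ?X ^ Suc (lad_l c)" unfolding prod_constant cA ..
  finally have PP: "P = ?X ^ Suc (lad_l c) * (\<Prod>j\<in>?B. [:- kap j, 1:])" .
  have PQ: "P = ?X ^ Suc (lad_l c) * Q c" using P_Q[of c] unfolding mu_root[OF r] .
  have "?X ^ Suc (lad_l c) * Q c = ?X ^ Suc (lad_l c) * (\<Prod>j\<in>?B. [:- kap j, 1:])"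
    by (rule trans[OF PQ[symmetric] PP])
  moreover have "?X ^ Suc (lad_l c) \<noteq> 0" by (rule power_not_zero) simp
  ultimately have "Q c = (\<Prod>j\<in>?B. [:- kap j, 1:])" using mult_left_cancel[THEN iffD1] by blast
  then have "poly (Q c) c = (\<Prod>j\<in>?B. c - kap j)" by (simp add: poly_prod)
  also have "\<dots> = (\<Prod>j\<in>?B. c * (1 - kap j / c))" using root_nonzero[OF r] by (intro prod.cong) (auto simp: field_simps)
  also have "\<dots> = c ^ card ?B * (\<Prod>j\<in>?B. 1 - kap j / c)" by (simp only: prod.distrib prod_constant)
  finally have "poly (Q c) c = c ^ card ?B * (\<Prod>j\<in>?B. 1 - kap j / c)" .
  moreover have "c ^ n = c ^ Suc (lad_l c) * c ^ card ?B" by (subst cB) (rule power_add)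
  ultimately show ?thesis by (simp only: mult_ac)
qed

lemma funpow_pact_H:
  assumes "\<forall>a\<in>H c. F a = pact CR f a" "a \<in> H c"
  shows "(F ^^ m) a = pact CR (f ^ m) a"
proof (induction m)
  case (Suc m)
  then show ?case using assms(1) pact_H[OF assms(2)] by (simp add: R.pact_mult)
qed simp

text \<open>The power l of the logarithm contributes (x - c)^l, and modulo \<open>P\<close> the
  other factors then matter only through their values at c.\<close>

lemma Nd_top:
  assumes r: "poly P c = 0" and d: "d \<ge> 1"
  shows "(cmap (Nd d) ^^ lad_l c) (Phi (Q c * f)) = cscale ((of_nat n / c) ^ lad_l c * poly f c) (Ev c)"
proof -
  let ?l = "lad_l c" and ?X = "[:- c, 1:]"
  obtain th where th: "poly th c = of_nat n / c" "\<forall>a\<in>H c. cmap (Nd d) a = pact CR (?X * th) a"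
    using Nd_H[OF r d] by blast
  have "(cmap (Nd d) ^^ ?l) (Phi (Q c * f)) = pact CR ((?X * th) ^ ?l) (Phi (Q c * f))"
    by (rule funpow_pact_H[OF th(2)]) simp
  also have "\<dots> = Phi (?X ^ ?l * Q c * (th ^ ?l * f))" unfolding pact_Phi power_mult_distrib by (simp only: mult_ac)
  also have "\<dots> = Phi (Polynomial.smult (poly (th ^ ?l * f) c) (?X ^ ?l * Q c))"
    unfolding Phi_eq_iff
  proof -
    let ?h = "th ^ ?l * f"
    have "poly (?h - [:poly ?h c:]) c = 0" by simp
    then have "?X dvd ?h - [:poly ?h c:]" using poly_eq_0_iff_dvd by blast
    then have "?X * (?X ^ ?l * Q c) dvd (?h - [:poly ?h c:]) * (?X ^ ?l * Q c)" by (rule mult_dvd_mono) simp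
    moreover have "?X * (?X ^ ?l * Q c) = P" using P_Q[of c] unfolding mu_root[OF r] by (simp only: power_Suc mult.assoc)
    moreover have "(?h - [:poly ?h c:]) * (?X ^ ?l * Q c) = ?X ^ ?l * Q c * ?h - Polynomial.smult (poly ?h c) (?X ^ ?l * Q c)"
    proof -
      have "(h - [:q:]) * Y = Y * h - Polynomial.smult q Y" for h Y :: "complex poly" and q
        by (simp add: left_diff_distrib mult.commute[of h])
      then show ?thesis .
    qed
    ultimately show "P dvd ?X ^ ?l * Q c * ?h - Polynomial.smult (poly ?h c) (?X ^ ?l * Q c)" by (simp only:)
  qed
  also have "\<dots> = cscale ((of_nat n / c) ^ ?l * poly f c) (Ev c)"
    unfolding Phi_smult Ev_def using th(1) by (simp add: poly_power)
  finally show ?thesis .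
qed

text \<open>If f vanished at c, a factor x - c could be taken out; the cofactor from
  \<open>Nd_H\<close> is invertible modulo (x - c)^(l+1), and this produces a preimage under the
  logarithm.\<close>

lemma not_in_Nd_image:
  assumes r: "poly P c = 0" and d: "d \<ge> 1" and a: "Phi (Q c * f) \<notin> cmap (Nd d) ` H c"
  shows "poly f c \<noteq> 0"
proof
  let ?l = "lad_l c" and ?X = "[:- c, 1:]"
  obtain th where th: "poly th c = of_nat n / c" "\<forall>a\<in>H c. cmap (Nd d) a = pact CR (?X * th) a"
    using Nd_H[OF r d] by blast
  assume "poly f c = 0"
  then have "?X dvd f" using poly_eq_0_iff_dvd by blast
  then obtain g where g: "f = ?X * g" by (rule dvdE)
  have "poly th c \<noteq> 0" using th(1) n0 root_nonzero[OF r] by simp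
  then obtain u v where uv: "u * ?X ^ Suc ?l + v * th = 1" using linear_power_bezout by blast
  have PQ: "?X ^ Suc ?l * Q c = P" using P_Q[of c] unfolding mu_root[OF r] by (rule sym)
  have "Q c * f = Q c * ?X * g * (u * ?X ^ Suc ?l + v * th)" unfolding uv g by (simp only: mult_1_right mult_1_left mult_ac)
  also have "\<dots> = (?X ^ Suc ?l * Q c) * (?X * g * u) + (?X * th) * (Q c * (v * g))" by (simp only: distrib_left mult_ac)
  finally have "Q c * f - (?X * th) * (Q c * (v * g)) = P * (?X * g * u)" unfolding PQ by (metis add_diff_cancel_right')
  then have "Phi (Q c * f) = Phi ((?X * th) * (Q c * (v * g)))" unfolding Phi_eq_iff by (metis dvd_triv_left)
  also have "\<dots> = cmap (Nd d) (Phi (Q c * (v * g)))" using th(2) by (simp only: Phi_Q_in_H pact_Phi)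
  finally show False using a Phi_Q_in_H by blast
qed

text \<open>For a represented by \<open>Q c\<close> times f, the value is n^l times the squared
  modulus of f(c) times the product in \<open>Q_prod\<close>; the powers of c cancel because its
  conjugate is its inverse.\<close>

lemma polar:
  assumes r: "poly P c = 0" and d: "d \<ge> 1" and a: "a \<in> H c" "a \<notin> cmap (Nd d) ` H c"
  shows "\<exists>r>0. cbil L a ((cmap (Nd d) ^^ lad_l c) (cconj a)) = cis (pi / 2 * (2 * lad_al c + real (lad_l c))) * complex_of_real r"
proof -
  let ?l = "lad_l c"
  obtain f where f: "a = Phi (Q c * f)" using a(1) by (rule H_elim)
  have fc: "poly f c \<noteq> 0" using not_in_Nd_image[OF r d] a(2) f by blast
  have c0: "c \<noteq> 0" and cn: "cnj c = inverse c" using root_nonzero[OF r] norm_1_cnj(2) root_norm[OF r] by auto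
  have "(cmap (Nd d) ^^ m) (cconj a) = cconj ((cmap (Nd d) ^^ m) a)" for m
    by (induction m) (auto simp: cmap_cconj[OF lin_Nd])
  then have "(cmap (Nd d) ^^ ?l) (cconj a) = cconj ((cmap (Nd d) ^^ ?l) a)" .
  also have "\<dots> = cscale (cnj ((of_nat n / c) ^ ?l * poly f c)) (cconj (Ev c))"
    unfolding f Nd_top[OF r d] cconj_cscale ..
  finally have "cbil L a ((cmap (Nd d) ^^ ?l) (cconj a)) =
     cnj ((of_nat n / c) ^ ?l * poly f c) * cbil L a (cconj (Ev c))" by (simp only: cbil_scale_right[OF bil])
  also have "cbil L a (cconj (Ev c)) = poly (Q c) c * poly f c * cbil L (e 0, 0) (cconj (Ev c))"
    unfolding f Phi_def cbil_Phi_cconj_Ev[OF r] by simp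
  also have "cbil L (e 0, 0) (cconj (Ev c)) = cnj (c ^ (n - 1))"
    using cbil_cconj[OF bil, of "(e 0, 0)" "Ev c"] cbil_e0_Ev[OF r] by (simp add: cconj_def)
  also have "cnj ((of_nat n / c) ^ ?l * poly f c) * (poly (Q c) c * poly f c * cnj (c ^ (n - 1))) =
     (of_nat n ^ ?l * (cnj (poly f c) * poly f c)) * (poly (Q c) c * c ^ Suc ?l / c ^ n)"
  proof -
    have "c ^ n = c * c ^ (n - 1)" using n0 by (cases n) auto
    then show ?thesis using c0 by (simp add: cn power_divide field_simps)
  qed
  also have "poly (Q c) c * c ^ Suc ?l / c ^ n = (\<Prod>j\<in>{j\<in>{1..n}. kap j \<noteq> c}. 1 - kap j / c)"
    unfolding Q_prod[OF r] using c0 by simp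
  finally have eq: "cbil L a ((cmap (Nd d) ^^ ?l) (cconj a)) =
     (of_nat n ^ ?l * (cnj (poly f c) * poly f c)) * (\<Prod>j\<in>{j\<in>{1..n}. kap j \<noteq> c}. 1 - kap j / c)" .
  obtain r' where r': "r' > 0" "(\<Prod>j\<in>{j\<in>{1..n}. kap j \<noteq> c}. 1 - kap j / c) =
    complex_of_real r' * cis (pi / 2 * (2 * lad_al c + real (lad_l c)))" using phase[OF r] by blast
  have "cnj (poly f c) * poly f c = of_real ((cmod (poly f c))\<^sup>2)"
    using complex_norm_square[of "poly f c"] by (simp add: mult.commute)
  then have "cbil L a ((cmap (Nd d) ^^ ?l) (cconj a)) =
     cis (pi / 2 * (2 * lad_al c + real (lad_l c))) * complex_of_real (real n ^ ?l * (cmod (poly f c))\<^sup>2 * r')"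
    unfolding eq r'(2) by simp
  moreover have "real n ^ ?l * (cmod (poly f c))\<^sup>2 * r' > 0" using n0 fc r' by simp
  ultimately show ?thesis by blast
qed

end

section \<open>The orthogonal decomposition\<close>

lemma (in Vector_Spaces.vector_space) direct_sum_basis:
  assumes A: "finite BA" "independent BA" and B: "finite BB" "independent BB"
    and int: "span BA \<inter> span BB \<subseteq> {0}"
  shows "independent (BA \<union> BB)" "card (BA \<union> BB) = card BA + card BB"
    "span (BA \<union> BB) = {x + y | x y. x \<in> span BA \<and> y \<in> span BB}"
proof -
  have disj: "BA \<inter> BB = {}"
  proof (rule ccontr)
    assume "BA \<inter> BB \<noteq> {}"
    then obtain x where x: "x \<in> BA" "x \<in> BB" by blast
    then have "x = 0" using int span_base by blast
    then show False using x A(2) dependent_zero by blast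
  qed
  show "card (BA \<union> BB) = card BA + card BB" using card_Un_disjoint[OF A(1) B(1) disj] .
  show "span (BA \<union> BB) = {x + y | x y. x \<in> span BA \<and> y \<in> span BB}" by (rule span_Un)
  have "independent ((\<lambda>x. x) ` (BA \<union> BB))"
  proof (rule independent_familyI(2))
    show "finite (BA \<union> BB)" using A B by simp
    fix g assume "(\<Sum>i\<in>BA \<union> BB. scale (g i) i) = 0"
    then have s: "(\<Sum>i\<in>BA. scale (g i) i) + (\<Sum>i\<in>BB. scale (g i) i) = 0"
      using sum.union_disjoint[OF A(1) B(1) disj] by metis
    have iA: "(\<Sum>i\<in>BA. scale (g i) i) \<in> span BA" by (intro span_sum span_scale span_base)
    have iB: "(\<Sum>i\<in>BB. scale (g i) i) \<in> span BB" by (intro span_sum span_scale span_base)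
    have "(\<Sum>i\<in>BA. scale (g i) i) = - (\<Sum>i\<in>BB. scale (g i) i)" using s by (rule eq_neg_iff_add_eq_0[THEN iffD2])
    then have "(\<Sum>i\<in>BA. scale (g i) i) \<in> span BB" using span_neg[OF iB] by (simp only:)
    then have z: "(\<Sum>i\<in>BA. scale (g i) i) = 0" using iA int by blast
    then have z': "(\<Sum>i\<in>BB. scale (g i) i) = 0" using s by simp
    show "\<forall>i\<in>BA \<union> BB. g i = 0"
      using independentD[OF A(2) A(1) subset_refl z] independentD[OF B(2) B(1) subset_refl z'] by blast
  qed
  then show "independent (BA \<union> BB)" by simp
qed

lemma (in Vector_Spaces.vector_space) span_eq_of_card:
  assumes "finite t" "independent s" "s \<subseteq> span t" "card s = card t"
  shows "span s = span t"
proof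
  show "span s \<subseteq> span t" by (rule span_minimal[OF assms(3) subspace_span])
  have fs: "finite s" using independent_span_bound[OF assms(1-3)] by blast
  show "span t \<subseteq> span s"
  proof (rule subsetI, rule ccontr)
    fix x assume x: "x \<in> span t" "x \<notin> span s"
    then have ind: "independent (insert x s)" using independent_insertI assms(2) by blast
    have "insert x s \<subseteq> span t" using x(1) assms(3) by blast
    then have "card (insert x s) \<le> card t" using independent_span_bound[OF assms(1) ind] by blast
    moreover have "x \<notin> s" using x(2) span_base by blast
    ultimately show False using fs assms(4) by simp
  qed
qed

lemma complex_real_basis:
  assumes "Im (cnj a * b) \<noteq> 0"
  shows "\<exists>s t. c = complex_of_real s * a + complex_of_real t * b"
proof (intro exI)
  \<comment> \<open>Cramer's rule for the real coordinates of c: \<open>Im (cnj a * b)\<close> is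
    the determinant of a and b as vectors of the real plane.\<close>
  define D x y where "D = Im (cnj a * b)" "x = Im (cnj c * b)" "y = Im (cnj a * c)"
  have "c * complex_of_real D = complex_of_real x * a + complex_of_real y * b"
    by (simp add: D_x_y_def complex_eq_iff algebra_simps)
  moreover have "complex_of_real D \<noteq> 0" using assms unfolding D_x_y_def of_real_eq_0_iff .
  ultimately have "c = (complex_of_real x * a + complex_of_real y * b) / complex_of_real D"
    by (simp only: eq_divide_eq) simp
  then show "c = complex_of_real (x / D) * a + complex_of_real (y / D) * b" by (simp add: add_divide_distrib)
qed

lemma direct_sum_two:
  fixes A B :: "'w::ab_group_add set"
  assumes neg: "\<And>y. y \<in> B \<Longrightarrow> - y \<in> B" and int: "A \<inter> B \<subseteq> {0}"
  shows "direct_sum {..<2::nat} (\<lambda>i. if i = 0 then A else B) {x + y | x y. x \<in> A \<and> y \<in> B}"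
proof -
  have s2: "(\<Sum>i<2. w i) = w 0 + w 1" for w :: "nat \<Rightarrow> 'w" by (simp add: numeral_2_eq_2)
  have two: "{..<2} = {0, 1::nat}" by auto
  show ?thesis unfolding direct_sum_def
  proof (intro conjI allI impI Set.set_eqI iffI)
    fix x assume "x \<in> {x + y | x y. x \<in> A \<and> y \<in> B}"
    then obtain a b where "x = a + b" "a \<in> A" "b \<in> B" by blast
    then show "x \<in> {\<Sum>i<2. w i | w :: nat \<Rightarrow> 'w. \<forall>i\<in>{..<2}. w i \<in> (if i = 0 then A else B)}"
      by (intro CollectI exI[of _ "\<lambda>i::nat. if i = 0 then a else b"]) (auto simp: s2)
  next
    fix x assume "x \<in> {\<Sum>i<2. w i | w :: nat \<Rightarrow> 'w. \<forall>i\<in>{..<2}. w i \<in> (if i = 0 then A else B)}"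
    then obtain w :: "nat \<Rightarrow> 'w" where w: "x = (\<Sum>i<2. w i)" "\<forall>i\<in>{..<2}. w i \<in> (if i = 0 then A else B)" by blast
    then have "w 0 \<in> A" "w 1 \<in> B" by (auto simp: two)
    then show "x \<in> {x + y | x y. x \<in> A \<and> y \<in> B}" unfolding w(1) s2 by blast
  next
    fix w :: "nat \<Rightarrow> 'w" assume w: "(\<forall>i\<in>{..<2}. w i \<in> (if i = 0 then A else B)) \<and> (\<Sum>i<2. w i) = 0"
    then have ab: "w 0 \<in> A" "w 1 \<in> B" "w 0 = - w 1" by (auto simp: two s2 eq_neg_iff_add_eq_0)
    then have "w 0 \<in> B" using neg by metis
    then have "w 0 = 0" using ab int by blast
    then show "\<forall>i\<in>{..<2}. w i = 0" using ab by (auto simp: two)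
  qed simp
qed

lemma cspan_real: "cplx.span ((\<lambda>x. (x, 0)) ` B) = span B \<times> span B"
proof
  have "subspace (span B)" by simp
  then show "cplx.span ((\<lambda>x. (x, 0)) ` B) \<subseteq> span B \<times> span B"
    by (intro cplx.span_minimal csubspace_Times) (auto simp: span_base span_0)
  have r: "(x, 0) \<in> cplx.span ((\<lambda>x. (x, 0)) ` B)" if "x \<in> span B" for x
    using that
  proof (induction rule: span_induct_alt)
    case base then show ?case using cplx.span_zero by (simp add: zero_prod_def)
  next
    case (step c y z)
    have "(c *\<^sub>R y + z, 0) = cscale (of_real c) (y, 0) + (z, 0)" by (simp add: cscale_def)
    moreover have "(y, 0) \<in> cplx.span ((\<lambda>x. (x, 0)) ` B)" using step by (intro cplx.span_base) auto
    ultimately show ?case using step cplx.span_add[OF cplx.span_scale] by metis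
  qed
  show "span B \<times> span B \<subseteq> cplx.span ((\<lambda>x. (x, 0)) ` B)"
  proof
    fix a assume "a \<in> span B \<times> span B"
    then obtain x y where xy: "a = (x, y)" "x \<in> span B" "y \<in> span B" by blast
    have "a = (x, 0) + cscale \<i> (y, 0)" unfolding xy by (simp add: cscale_def)
    then show "a \<in> cplx.span ((\<lambda>x. (x, 0)) ` B)" using cplx.span_add[OF r[OF xy(2)] cplx.span_scale[OF r[OF xy(3)]]] by simp
  qed
qed

lemma cindependent_real:
  assumes "finite B" "independent B" shows "cplx.independent ((\<lambda>x. (x, 0)) ` B)"
proof (rule cplx.independent_familyI(2)[OF assms(1)])
  fix g :: "'a \<Rightarrow> complex" assume "(\<Sum>i\<in>B. cscale (g i) (i, 0)) = 0"
  moreover have "(\<Sum>i\<in>B. cscale (g i) (i, 0)) = (\<Sum>i\<in>B. Re (g i) *\<^sub>R i, \<Sum>i\<in>B. Im (g i) *\<^sub>R i)"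
    by (simp add: cscale_def sum_prod)
  ultimately have "(\<Sum>i\<in>B. Re (g i) *\<^sub>R i) = 0" "(\<Sum>i\<in>B. Im (g i) *\<^sub>R i) = 0" by (auto simp: zero_prod_def)
  then have "Re (g i) = 0" "Im (g i) = 0" if "i \<in> B" for i
    using real_vector.independentD[OF assms(2,1) subset_refl, of "\<lambda>i. Re (g i)" i]
      real_vector.independentD[OF assms(2,1) subset_refl, of "\<lambda>i. Im (g i)" i] that by auto
  then show "\<forall>i\<in>B. g i = 0" by (simp add: complex_eq_iff)
qed

lemma dim_complexification:
  assumes "finite B" "independent B" shows "cplx.dim (span B \<times> span B) = dim (span B)"
proof -
  have "cplx.dim (span B \<times> span B) = card ((\<lambda>x. (x, 0::'a)) ` B)"
    unfolding cspan_real[symmetric] by (rule cplx.dim_span_eq_card_independent[OF cindependent_real[OF assms]])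
  also have "\<dots> = card B" by (rule card_image) (auto simp: inj_on_def)
  also have "\<dots> = dim (span B)" by (rule real_vector.dim_span_eq_card_independent[OF assms(2), symmetric])
  finally show ?thesis .
qed

context hor_space
begin

lemma fin_basis: assumes "subspace (V :: 'v set)"
  obtains B where "finite B" "independent B" "span B = V" "card B = dim V"
proof -
  obtain B where B: "B \<subseteq> V" "independent B" "V \<subseteq> span B" "card B = dim V" by (rule basis_exists)
  have "finite B" using independent_span_bound[of "e ` {..<n}" B] B(2) span_e by auto
  moreover have "span B = V" using B span_minimal[OF B(1) assms] by blast
  ultimately show ?thesis using that B by blast
qed

lemma cdim_Times: assumes "subspace (V :: 'v set)" shows "cplx.dim (V \<times> V) = dim V"
proof -
  obtain B where "finite B" "independent B" "span B = V" using fin_basis[OF assms] .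
  then show ?thesis using dim_complexification by blast
qed

text \<open>Complex counterpart of \<open>hor_summand\<close> without the case distinction; for real
  c both terms coincide (\<open>HH_real\<close>).\<close>

definition HH :: "complex \<Rightarrow> ('v \<times> 'v) set" where "HH c = {a + b | a b. a \<in> H c \<and> b \<in> H (cnj c)}"
abbreviation "U \<equiv> hor_summand n R"

lemma cconj_H: "a \<in> H c \<Longrightarrow> cconj a \<in> H (cnj c)"
  unfolding H_pact using pact_cconj[OF lin_R, of "[:- c, 1:] ^ n" a] by (simp add: map_poly_cnj_linear_power)

lemma HH_subspace: "cplx.subspace (HH c)"
  unfolding HH_def by (rule cplx.subspace_sums[OF H_subspace H_subspace])

lemma H_HH: "H c \<subseteq> HH c" "H (cnj c) \<subseteq> HH c"
proof -
  have "a + 0 \<in> HH c" if "a \<in> H c" for a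
    unfolding HH_def using that cplx.subspace_0[OF H_subspace] by blast
  then show "H c \<subseteq> HH c" by (simp add: subset_iff)
  have "0 + a \<in> HH c" if "a \<in> H (cnj c)" for a
    unfolding HH_def using that cplx.subspace_0[OF H_subspace] by blast
  then show "H (cnj c) \<subseteq> HH c" by (simp add: subset_iff)
qed

lemma HH_real: "cnj c = c \<Longrightarrow> HH c = H c"
proof -
  assume c: "cnj c = c"
  have "a + b \<in> H c" if "a \<in> H c" "b \<in> H c" for a b using cplx.subspace_add[OF H_subspace that] .
  then have "HH c \<subseteq> H c" unfolding HH_def c by blast
  then show "HH c = H c" using H_HH(1)[of c] by (rule subset_antisym)
qed

lemma cnj_pm: "c \<in> {1, -1} \<Longrightarrow> cnj c = c" by auto

lemma U_eq: "U c = {x. (x, 0) \<in> HH c}"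
proof (cases "c \<in> {1, -1}")
  case True then show ?thesis using HH_real[OF cnj_pm[OF True]] by (auto simp: hor_summand_def real_points_def)
next
  case False then show ?thesis by (simp add: hor_summand_def real_points_def HH_def)
qed

lemma cconj_HH: "a \<in> HH c \<Longrightarrow> cconj a \<in> HH c"
proof -
  assume "a \<in> HH c"
  then obtain x y where xy: "a = x + y" "x \<in> H c" "y \<in> H (cnj c)" unfolding HH_def by blast
  then have "cconj a = cconj y + cconj x" "cconj y \<in> H c" "cconj x \<in> H (cnj c)"
    using cconj_H[OF xy(2)] cconj_H[OF xy(3)] by (auto simp: cconj_add)
  then show ?thesis unfolding HH_def by blast
qed

text \<open>\<open>HH c\<close> is stable under conjugation, so with a it contains the real and
  imaginary parts, the multiples by 1 / 2 and - i / 2 of the sum and the difference of a and its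
  conjugate.\<close>

lemma U_Times: "U c \<times> U c = HH c"
proof (intro Set.set_eqI iffI)
  fix a assume "a \<in> U c \<times> U c"
  then obtain x y where xy: "a = (x, y)" "(x, 0) \<in> HH c" "(y, 0) \<in> HH c" unfolding U_eq by blast
  have "a = (x, 0) + cscale \<i> (y, 0)" unfolding xy by (simp add: cscale_def)
  then show "a \<in> HH c" using cplx.subspace_add[OF HH_subspace xy(2) cplx.subspace_scale[OF HH_subspace xy(3)]] by simp
next
  fix a assume a: "a \<in> HH c"
  obtain x y where xy: "a = (x, y)" by fastforce
  have "cscale (1/2) (a + cconj a) = (x, 0)" "cscale (- \<i> / 2) (a - cconj a) = (y, 0)"
    unfolding xy by (simp_all add: cscale_def cconj_def scaleR_2[symmetric])
  then have "(x, 0) \<in> HH c" "(y, 0) \<in> HH c"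
    using cplx.subspace_scale[OF HH_subspace cplx.subspace_add[OF HH_subspace a cconj_HH[OF a]], of "1/2"]
      cplx.subspace_scale[OF HH_subspace cplx.subspace_diff[OF HH_subspace a cconj_HH[OF a]], of "- \<i> / 2"] by auto
  then show "a \<in> U c \<times> U c" unfolding U_eq xy by blast
qed

lemma U_subspace: "subspace (U c)"
proof (rule subspaceI)
  show "0 \<in> U c" unfolding U_eq using cplx.subspace_0[OF HH_subspace] by (simp add: zero_prod_def)
  show "x + y \<in> U c" if "x \<in> U c" "y \<in> U c" for x y
    using that cplx.subspace_add[OF HH_subspace, of "(x, 0)" c "(y, 0)"] unfolding U_eq by simp
  show "r *\<^sub>R x \<in> U c" if "x \<in> U c" for r x
    using that cplx.subspace_scale[OF HH_subspace, of "(x, 0)" c "of_real r"] unfolding U_eq by (simp add: cscale_def)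
qed

lemma pact_HH: "a \<in> HH c \<Longrightarrow> pact CR f a \<in> HH c"
  unfolding HH_def using pact_H clin.add[OF R.clin_pact] by blast

lemma U_M_inv: "M_inv (U c)"
  unfolding M_inv_def
proof (intro conjI ballI U_subspace)
  fix x assume "x \<in> U c"
  then have "pact CR Z (x, 0) \<in> HH c" using pact_HH unfolding U_eq by blast
  then show "M x \<in> U c" unfolding U_eq CM_eq[symmetric] using linear_0[OF lin_M] by simp
qed

text \<open>Induction on the sum of the nilpotency orders. In R a = c a + a' and R b = d b + b' all
  products with a' or b' vanish by induction, so the isometry multiplies the value by c d.\<close>

lemma cbil_H_orth:
  assumes ab: "a \<in> H c" "b \<in> H d" and cd: "c * d \<noteq> 1"
  shows "cbil L a b = 0"
proof -
  have "cbil L a b = 0" if "i + j \<le> N" "pact CR ([:- c, 1:] ^ i) a = 0" "pact CR ([:- d, 1:] ^ j) b = 0" for N i j a b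
    using that
  proof (induction N arbitrary: i j a b)
    case 0 then show ?case by (simp add: cbil_zero[OF bil])
  next
    case (Suc N)
    show ?case
    proof (cases "i = 0 \<or> j = 0")
      case True then show ?thesis using Suc.prems by (auto simp: cbil_zero[OF bil])
    next
      case False
      then obtain i' j' where ij: "i = Suc i'" "j = Suc j'" by (metis not0_implies_Suc)
      let ?a = "pact CR [:- c, 1:] a" and ?b = "pact CR [:- d, 1:] b"
      have a': "pact CR ([:- c, 1:] ^ i') ?a = 0" using Suc.prems(2) unfolding ij by (simp only: R.pact_mult[symmetric] power_Suc2)
      have b': "pact CR ([:- d, 1:] ^ j') ?b = 0" using Suc.prems(3) unfolding ij by (simp only: R.pact_mult[symmetric] power_Suc2)
      have z: "cbil L a ?b = 0" "cbil L ?a b = 0" "cbil L ?a ?b = 0"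
        using Suc.IH[OF _ Suc.prems(2) b'] Suc.IH[OF _ a' Suc.prems(3)] Suc.IH[OF _ a' b'] Suc.prems(1) ij by auto
      have Ra: "CR a = cscale c a + ?a" and Rb: "CR b = cscale d b + ?b" by (simp_all add: R.pact_linear)
      have "cbil L a b = c * d * cbil L a b"
        using cbil_R[of a b] unfolding Ra Rb
        by (simp add: cbil_add_left[OF bil] cbil_add_right[OF bil] cbil_scale_left[OF bil] cbil_scale_right[OF bil] z mult.commute[of d c])
      then show ?thesis using cd by (metis mult_cancel_right1 mult_1)
    qed
  qed
  then show ?thesis using ab unfolding H_pact by blast
qed

text \<open>One representative of each pair of conjugate points of the circle.\<close>

definition "upper c \<longleftrightarrow> cmod c = 1 \<and> (c \<in> {1, -1} \<or> Im c > 0)"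

lemma norm_1_real: "cmod c = 1 \<Longrightarrow> Im c = 0 \<Longrightarrow> c \<in> {1, -1}"
proof -
  assume "cmod c = 1" "Im c = 0"
  then have "\<bar>Re c\<bar> = 1" by (simp add: cmod_def)
  then show ?thesis using \<open>Im c = 0\<close> by (auto simp: complex_eq_iff abs_if split: if_splits)
qed

lemma upper_Im: "upper c \<Longrightarrow> Im c \<ge> 0" unfolding upper_def by auto

text \<open>Two points of the circle have product 1 only if they are conjugate, which is excluded in
  all four combinations of c, d and their conjugates because both represent different pairs.\<close>

lemma U_orth:
  assumes cd: "upper c" "upper d" "c \<noteq> d" and xy: "x \<in> U c" "y \<in> U d"
  shows "L x y = 0"
proof -
  have inv: "u * v = 1 \<Longrightarrow> cmod u = 1 \<Longrightarrow> v = cnj u" for u v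
    using norm_1_cnj(1)[of u] by (metis mult.commute mult.left_commute mult_1)
  have n: "cmod c = 1" "cmod d = 1" using cd unfolding upper_def by auto
  have ne1: "c * d \<noteq> 1"
  proof
    assume "c * d = 1"
    then have "d = cnj c" using inv n by blast
    then have "Im c = 0" using upper_Im[OF cd(1)] upper_Im[OF cd(2)] by simp
    then show False using \<open>d = cnj c\<close> cd(3) by (auto simp: complex_eq_iff)
  qed
  have ne2: "c * cnj d \<noteq> 1" using inv[of c "cnj d"] n cd(3) by (metis complex_cnj_cnj)
  have ne3: "cnj c * d \<noteq> 1" using inv[of "cnj c" d] n cd(3) by (metis complex_cnj_cnj complex_mod_cnj)
  have ne4: "cnj c * cnj d \<noteq> 1" using ne1 by (metis complex_cnj_cnj complex_cnj_mult complex_cnj_one)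
  obtain a a' where a: "(x, 0) = a + a'" "a \<in> H c" "a' \<in> H (cnj c)" using xy(1) unfolding U_eq HH_def by blast
  obtain b b' where b: "(y, 0) = b + b'" "b \<in> H d" "b' \<in> H (cnj d)" using xy(2) unfolding U_eq HH_def by blast
  have "cbil L (x, 0) (y, 0) = 0"
    unfolding a(1) b(1) cbil_add_left[OF bil] cbil_add_right[OF bil]
    using cbil_H_orth[OF a(2) b(2) ne1] cbil_H_orth[OF a(2) b(3) ne2] cbil_H_orth[OF a(3) b(2) ne3] cbil_H_orth[OF a(3) b(3) ne4] by simp
  then show ?thesis using cbil_real[OF bil] by simp
qed

lemma H_nonzero_iff: "H c \<noteq> {0} \<longleftrightarrow> poly P c = 0"
proof
  assume "poly P c = 0"
  then have "cplx.dim (H c) > 0" using dim_H by simp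
  moreover have "cplx.dim ({0} :: ('v \<times> 'v) set) = 0"
    using cplx.dim_span_eq_card_independent[OF cplx.independent_empty] by (simp add: cplx.span_empty)
  ultimately show "H c \<noteq> {0}" by auto
qed (use H_nonroot in blast)

text \<open>The index set is kept variable for two uses: in (b) the indices 1 and -1 occur even
  where the summand is zero, in (c) only eigenvalues occur.\<close>

lemma U_seifert_decomp:
  assumes fin: "finite J" and up: "\<And>c. c \<in> J \<Longrightarrow> upper c" and rts: "\<And>c. upper c \<Longrightarrow> poly P c = 0 \<Longrightarrow> c \<in> J"
  shows "seifert_decomp UNIV L J U"
proof -
  \<comment> \<open>The representative with nonnegative imaginary part; grouping the block
    components by it yields components in the complexified summands.\<close>
  let ?rep = "\<lambda>d. if Im d < 0 then cnj d else d"
  have span: "\<exists>v. (\<forall>c\<in>J. v c \<in> U c) \<and> x = (\<Sum>c\<in>J. v c)" for x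
  proof -
    have "direct_sum {c. poly P c = 0} H UNIV" by (rule direct_sum_H[OF finite_roots]) simp
    then obtain w where w: "(x, 0) = (\<Sum>c\<in>{c. poly P c = 0}. w c)" "\<forall>c\<in>{c. poly P c = 0}. w c \<in> H c"
      unfolding direct_sum_def by blast
    have repJ: "?rep ` {c. poly P c = 0} \<subseteq> J"
    proof safe
      fix d assume d: "poly P d = 0"
      then have nd: "cmod d = 1" by (rule root_norm)
      have "poly P (?rep d) = 0" using d root_cnj by auto
      moreover have "upper (?rep d)" unfolding upper_def using nd norm_1_real[of d] by (cases "Im d = 0") auto
      ultimately show "?rep d \<in> J" using rts by blast
    qed
    let ?y = "\<lambda>c. \<Sum>d\<in>{d\<in>{c. poly P c = 0}. ?rep d = c}. w d"
    have y: "?y c \<in> U c \<times> U c" for c unfolding U_Times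
    proof (rule cplx.subspace_sum[OF HH_subspace])
      fix d assume d: "d \<in> {d\<in>{c. poly P c = 0}. ?rep d = c}"
      then have "w d \<in> H d" using w(2) by blast
      moreover have "d = c \<or> d = cnj c" using d by (auto split: if_splits)
      ultimately show "w d \<in> HH c" using H_HH by blast
    qed
    have "(\<Sum>c\<in>J. ?y c) = (x, 0)" unfolding w(1) by (rule sum.group[OF finite_roots fin repJ])
    then have "x = fst (\<Sum>c\<in>J. ?y c)" by simp
    also have "\<dots> = (\<Sum>c\<in>J. fst (?y c))" by (rule fst_sum)
    finally have "x = (\<Sum>c\<in>J. fst (?y c))" .
    moreover have "fst (?y c) \<in> U c" for c using y[of c] by (simp only: mem_Times_iff)
    ultimately show ?thesis by (intro exI[of _ "\<lambda>c. fst (?y c)"]) simp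
  qed
  have Lsum: "L a (\<Sum>c\<in>J. v c) = L a (v d)" if "d \<in> J" "a \<in> U d" "\<forall>c\<in>J. v c \<in> U c" for a v d
  proof -
    have "L a (\<Sum>c\<in>J. v c) = (\<Sum>c\<in>J. L a (v c))"
      using bil linear_sum[of "L a"] unfolding bilinear_def by blast
    also have "\<dots> = (\<Sum>c\<in>{d}. L a (v c))"
    proof (rule sum.mono_neutral_right[OF fin])
      show "\<forall>c\<in>J - {d}. L a (v c) = 0" using U_orth[OF up[OF that(1)] up _ that(2)] that(3) by blast
    qed (use that in auto)
    finally show ?thesis by simp
  qed
  have nondeg: "a = 0" if d: "d \<in> J" and a: "a \<in> U d" "\<forall>b\<in>U d. L a b = 0" for a d
  proof (rule L_nondeg)
    fix b
    obtain v where v: "\<forall>c\<in>J. v c \<in> U c" "b = (\<Sum>c\<in>J. v c)" using span by blast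
    show "L a b = 0" unfolding v(2) Lsum[OF d a(1) v(1)] using a(2) v(1) d by blast
  qed
  \<comment> \<open>Pairing a vanishing sum with \<open>U d\<close> isolates its term in
    \<open>U d\<close> by orthogonality, and nondegeneracy there makes this term zero.\<close>
  have indep: "\<forall>i\<in>J. w i = 0" if w: "\<forall>i\<in>J. w i \<in> U i" "(\<Sum>i\<in>J. w i) = 0" for w
  proof
    fix d assume d: "d \<in> J"
    have "L (w d) b = 0" if b: "b \<in> U d" for b
    proof -
      have "0 = L (\<Sum>i\<in>J. w i) b" using w(2) bilinear_lzero[OF bil] by simp
      also have "\<dots> = (\<Sum>c\<in>J. L (w c) b)" using L_sum_left[of "\<lambda>_. 1" w J b] by simp
      also have "\<dots> = (\<Sum>c\<in>{d}. L (w c) b)"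
      proof (rule sum.mono_neutral_right[OF fin])
        show "\<forall>c\<in>J - {d}. L (w c) b = 0" using U_orth[OF up up[OF d] _ _ b] w(1) by blast
      qed (use d in auto)
      finally show ?thesis by simp
    qed
    then show "w d = 0" using nondeg[OF d] w(1) d by blast
  qed
  show ?thesis unfolding seifert_decomp_def
  proof (intro conjI ballI impI)
    show "direct_sum J U UNIV" unfolding direct_sum_def using fin span indep by blast
    show "seifert_pair (U d) L" if d: "d \<in> J" for d
    proof -
      obtain B where "finite B" "span B = U d" using fin_basis[OF U_subspace] by metis
      then show ?thesis unfolding seifert_pair_def using U_subspace bil nondeg[OF d] by blast
    qed
    show "L a b = 0" if "i \<in> J" "j \<in> J" "i \<noteq> j" "a \<in> U i" "b \<in> U j" for i j a b
      using U_orth[OF up[OF that(1)] up[OF that(2)] that(3,4,5)] .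
  qed
qed

lemma Jfull: "finite {c. upper c \<and> H c \<noteq> {0}}"
  by (rule finite_subset[OF _ finite_roots]) (use H_nonzero_iff in auto)

lemma decomp_b:
  "seifert_decomp UNIV L ({1, -1} \<union> {c. cmod c = 1 \<and> Im c > 0 \<and> H c \<noteq> {0}}) U"
proof (rule U_seifert_decomp)
  show "finite ({1, -1} \<union> {c. cmod c = 1 \<and> Im c > 0 \<and> H c \<noteq> {0}})"
    using finite_subset[OF _ Jfull, of "{c. cmod c = 1 \<and> Im c > 0 \<and> H c \<noteq> {0}}"] unfolding upper_def by auto
qed (auto simp: upper_def H_nonzero_iff)

lemma decomp_c: "seifert_decomp UNIV L {c. cmod c = 1 \<and> (c \<in> {1, -1} \<or> Im c > 0) \<and> H c \<noteq> {0}} U"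
  by (rule U_seifert_decomp) (use Jfull in \<open>auto simp: upper_def H_nonzero_iff\<close>)

lemma U_nondeg:
  assumes "upper c" "poly P c = 0" "a \<in> U c" "\<And>b. b \<in> U c \<Longrightarrow> L a b = 0" shows "a = 0"
proof -
  have "c \<in> {c. cmod c = 1 \<and> (c \<in> {1, -1} \<or> Im c > 0) \<and> H c \<noteq> {0}}"
    using assms(1,2) H_nonzero_iff unfolding upper_def by auto
  then have "seifert_pair (U c) L" using decomp_c unfolding seifert_decomp_def by blast
  then show ?thesis using assms unfolding seifert_pair_def by blast
qed

section \<open>Monodromy, logarithm and orthogonal splittings of invariant subspaces\<close>

lemma monodromy_eq:
  assumes V: "M_inv V" and nd: "\<And>a. a \<in> V \<Longrightarrow> (\<forall>b\<in>V. L a b = 0) \<Longrightarrow> a = 0" and x: "x \<in> V"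
  shows "monodromy V L x = M x"
proof -
  have "(THE c. c \<in> V \<and> (\<forall>b\<in>V. L c b = L b x)) = M x"
  proof (rule the_equality)
    show "M x \<in> V \<and> (\<forall>b\<in>V. L (M x) b = L b x)" using V x L_M unfolding M_inv_def by blast
    fix c assume c: "c \<in> V \<and> (\<forall>b\<in>V. L c b = L b x)"
    have "c - M x \<in> V" using c V x subspace_diff unfolding M_inv_def by blast
    moreover have "\<forall>b\<in>V. L (c - M x) b = 0" using c L_M by (simp add: bilinear_lsub[OF bil])
    ultimately show "c = M x" using nd by force
  qed
  then show ?thesis unfolding monodromy_def using x by simp
qed

lemma cmap_monodromy:
  assumes "M_inv V" "\<And>a. a \<in> V \<Longrightarrow> (\<forall>b\<in>V. L a b = 0) \<Longrightarrow> a = 0" "a \<in> V \<times> V"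
  shows "cmap (monodromy V L) a = CM a"
  using assms(3) monodromy_eq[OF assms(1,2)] by (cases a) simp

lemma S1_pair:
  assumes V: "M_inv V" and nd: "\<And>a. a \<in> V \<Longrightarrow> (\<forall>b\<in>V. L a b = 0) \<Longrightarrow> a = 0"
  shows "S1_seifert_pair V L"
  unfolding S1_seifert_pair_def
proof (intro conjI allI impI)
  have sV: "subspace V" using V unfolding M_inv_def by blast
  obtain B where "finite B" "span B = V" using fin_basis[OF sV] by metis
  then show "seifert_pair V L" unfolding seifert_pair_def using sV bil nd by blast
  fix c assume "eigenval_on (V \<times> V) (cmap (monodromy V L)) c"
  then obtain a where "a \<in> V \<times> V" "a \<noteq> 0" "cmap (monodromy V L) a = cscale c a" unfolding eigenval_on_def by blast
  then show "cmod c = 1" using cmap_monodromy[OF V nd] by (metis eigenval_M)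
qed

lemma S1_pair_UNIV: "S1_seifert_pair UNIV L"
  by (rule S1_pair) (auto simp: M_inv_def intro: L_nondeg)

lemma nilpotent_part_monodromy:
  assumes V: "M_inv V" and nd: "\<And>a. a \<in> V \<Longrightarrow> (\<forall>b\<in>V. L a b = 0) \<Longrightarrow> a = 0" and x: "x \<in> V"
  shows "nilpotent_part V (monodromy V L) x = Nd (dim V) x"
  by (rule nilpotent_part_eq[OF V _ x]) (rule monodromy_eq[OF V nd])

lemma Nd_in: assumes "M_inv V" "x \<in> V" shows "Nd d x \<in> V"
proof -
  have sV: "subspace V" using assms unfolding M_inv_def by blast
  have "(u1 ^^ j) x \<in> V" for j
    by (induction j) (use assms M_inv_s0_u0[OF assms(1)] subspace_diff[OF sV] in \<open>auto simp: u1_def\<close>)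
  then show ?thesis unfolding Nd_def by (intro subspace_sum[OF sV] subspace_scale[OF sV])
qed

lemma nilpotent_part_monodromy_pow:
  assumes V: "M_inv V" and nd: "\<And>a. a \<in> V \<Longrightarrow> (\<forall>b\<in>V. L a b = 0) \<Longrightarrow> a = 0" and x: "x \<in> V"
  shows "(nilpotent_part V (monodromy V L) ^^ j) x = (Nd (dim V) ^^ j) x \<and> (Nd (dim V) ^^ j) x \<in> V"
  by (induction j) (use x nilpotent_part_monodromy[OF V nd] Nd_in[OF V] in auto)

text \<open>For a in one part, the component of M a in the other part is orthogonal to that part,
  since L (M a) b = L b a = 0, and nondegeneracy removes it. So orthogonal splittings are
  automatically compatible with M.\<close>

lemma decomp_M_inv:
  assumes V: "M_inv V" and D: "seifert_decomp V L {..<2::nat} W" and i: "i < 2"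
  shows "M_inv (W i)"
proof -
  have ds: "direct_sum {..<2} W V" and sp: "\<And>j. j < 2 \<Longrightarrow> seifert_pair (W j) L"
    and orth: "\<And>i j a b. i < 2 \<Longrightarrow> j < 2 \<Longrightarrow> i \<noteq> j \<Longrightarrow> a \<in> W i \<Longrightarrow> b \<in> W j \<Longrightarrow> L a b = 0"
    using D unfolding seifert_decomp_def by auto
  let ?j = "1 - i"
  have "i = 0 \<or> i = 1" using i by auto
  then have j: "?j < 2" "?j \<noteq> i" "{..<2} = {i, ?j}" by auto
  have WV: "W i \<subseteq> V"
  proof
    fix a assume a: "a \<in> W i"
    have z: "0 \<in> W ?j" using sp[OF j(1)] unfolding seifert_pair_def by (simp add: subspace_0)
    have "a = (\<Sum>m<2. if m = i then a else 0)" using i by (simp add: sum.delta)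
    moreover have "\<forall>m\<in>{..<2}. (if m = i then a else 0) \<in> W m" using a z j(3) by auto
    ultimately show "a \<in> V" using ds unfolding direct_sum_def by blast
  qed
  show ?thesis unfolding M_inv_def
  proof (intro conjI ballI)
    show "subspace (W i)" using sp[OF i] unfolding seifert_pair_def by blast
    fix a assume a: "a \<in> W i"
    then have "M a \<in> V" using WV V unfolding M_inv_def by blast
    then obtain w where w: "M a = (\<Sum>m<2. w m)" "\<forall>m\<in>{..<2}. w m \<in> W m" using ds unfolding direct_sum_def by blast
    have Ma: "M a = w i + w ?j" unfolding w(1) j(3) using j(2) by simp
    have wi: "w i \<in> W i" "w ?j \<in> W ?j" using w(2) j by auto
    have "L (w ?j) b = 0" if b: "b \<in> W ?j" for b
    proof -
      have "L (M a) b = L b a" by (rule L_M)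
      also have "\<dots> = 0" using orth[OF j(1) i j(2) b a] .
      finally have "L (w i) b + L (w ?j) b = 0" unfolding Ma by (simp add: bilinear_ladd[OF bil])
      then show ?thesis using orth[OF i j(1) j(2)[symmetric] wi(1) b] by simp
    qed
    then have "w ?j = 0" using sp[OF j(1)] wi(2) unfolding seifert_pair_def by blast
    then show "M a \<in> W i" using Ma wi(1) by simp
  qed
qed

lemma decomp_disjoint:
  assumes D: "seifert_decomp V L {..<2::nat} W" and x: "x \<in> W 0" "x \<in> W 1" shows "x = 0"
proof -
  have sp: "seifert_pair (W 0) L"
    and orth: "\<And>i j a b. i < 2 \<Longrightarrow> j < 2 \<Longrightarrow> i \<noteq> j \<Longrightarrow> a \<in> W i \<Longrightarrow> b \<in> W j \<Longrightarrow> L a b = 0"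
    using D unfolding seifert_decomp_def by auto
  have "\<forall>b\<in>W 0. L x b = 0" using orth[of 1 0 x] x(2) by simp
  then show ?thesis using sp x(1) unfolding seifert_pair_def by blast
qed

lemma decomp_subset:
  assumes D: "seifert_decomp V L {..<2::nat} W" and i: "i < 2" shows "W i \<subseteq> V"
proof
  fix a assume a: "a \<in> W i"
  have sp: "\<And>j. j < 2 \<Longrightarrow> 0 \<in> W j" using D unfolding seifert_decomp_def seifert_pair_def by (auto simp: subspace_0)
  have "a = (\<Sum>m<2. if m = i then a else 0)" using i by (simp add: sum.delta)
  moreover have "\<forall>m\<in>{..<2}. (if m = i then a else 0) \<in> W m" using a sp by auto
  ultimately show "a \<in> V" using D unfolding direct_sum_def seifert_decomp_def by blast
qed

lemma decomp_sum:
  assumes D: "seifert_decomp V L {..<2::nat} W" and x: "x \<in> V"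
  obtains y z where "x = y + z" "y \<in> W 0" "z \<in> W 1"
proof -
  obtain w where w: "x = (\<Sum>m<2. w m)" "\<forall>m\<in>{..<2}. w m \<in> W m" using D x unfolding seifert_decomp_def direct_sum_def by blast
  have "x = w 0 + w 1" unfolding w(1) by (simp add: numeral_2_eq_2)
  then show ?thesis using that w(2) by auto
qed

text \<open>A nonzero vector that lies in every nonzero invariant subspace would belong to both
  parts of a splitting.\<close>

lemma irreducibleI:
  assumes V: "M_inv V" and nd: "\<And>a. a \<in> V \<Longrightarrow> (\<forall>b\<in>V. L a b = 0) \<Longrightarrow> a = 0" and z: "z \<in> V" "z \<noteq> 0"
    and sub: "\<And>W. M_inv W \<Longrightarrow> W \<subseteq> V \<Longrightarrow> W \<noteq> {0} \<Longrightarrow> z \<in> W"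
  shows "irreducible_S1_pair V L"
  unfolding irreducible_S1_pair_def
proof (intro conjI notI)
  show "S1_seifert_pair V L" by (rule S1_pair[OF V nd])
  show False if "V = {0}" using z that by blast
  assume "\<exists>U. seifert_decomp V L {..<2::nat} U \<and> U 0 \<noteq> {0} \<and> U 1 \<noteq> {0}"
  then obtain W where D: "seifert_decomp V L {..<2::nat} W" and W: "W 0 \<noteq> {0}" "W 1 \<noteq> {0}" by blast
  have "z \<in> W 0" by (rule sub[OF decomp_M_inv[OF V D] decomp_subset[OF D] W(1)]) simp_all
  moreover have "z \<in> W 1" by (rule sub[OF decomp_M_inv[OF V D] decomp_subset[OF D] W(2)]) simp_all
  ultimately show False using decomp_disjoint[OF D] z(2) by blast
qed

lemma Ev_nonzero: assumes "poly P c = 0" shows "Ev c \<noteq> 0"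
proof -
  have "[:- c, 1:] = [:- c, 1:] * 1" "poly 1 c \<noteq> 0" by auto
  from chain_H(2)[OF assms this] show ?thesis unfolding Ev_def pact_Phi .
qed

lemma Ev_in_H: "Ev c \<in> H c"
  unfolding Ev_def Phi_in_H by simp

lemma Phi_top: assumes r: "poly P c = 0" shows "Phi ([:- c, 1:] ^ lad_l c * Q c * h) = cscale (poly h c) (Ev c)"
proof -
  let ?X = "[:- c, 1:]"
  have "poly (h - [:poly h c:]) c = 0" by simp
  then have "?X dvd h - [:poly h c:]" using poly_eq_0_iff_dvd by blast
  then have "?X * (?X ^ lad_l c * Q c) dvd (h - [:poly h c:]) * (?X ^ lad_l c * Q c)" by (rule mult_dvd_mono) simp
  moreover have "?X * (?X ^ lad_l c * Q c) = P" using P_Q[of c] unfolding mu_root[OF r] by (simp only: power_Suc mult.assoc)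
  moreover have "(h - [:q:]) * Y = Y * h - Polynomial.smult q Y" for Y q
    by (simp add: left_diff_distrib mult.commute[of h])
  ultimately have "P dvd ?X ^ lad_l c * Q c * h - Polynomial.smult (poly h c) (?X ^ lad_l c * Q c)" by (simp only:)
  then show ?thesis unfolding Phi_eq_iff[symmetric] Phi_smult Ev_def .
qed

text \<open>Write a as the class of \<open>Q c\<close> times f. Then \<open>P\<close> divides
  \<open>T c * (Q c * f)\<close>, and cancelling (x - c) \<open>Q c\<close> shows that (x - c)^l
  divides f times the cofactor of \<open>T c\<close>. That cofactor is prime to x - c, so f itself
  is a multiple of (x - c)^l.\<close>

lemma H_eigenvector:
  assumes r: "poly P c = 0" and a: "a \<in> H c" "pact CM [:- poly Z c, 1:] a = 0"
  shows "\<exists>g. a = cscale g (Ev c)"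
proof -
  let ?X = "[:- c, 1:]" and ?l = "lad_l c"
  obtain f where f: "a = Phi (Q c * f)" using a(1) by (rule H_elim)
  obtain et where et: "T c = ?X * et" "poly et c = (-1) ^ k * of_nat n * c ^ (n - 1)" by (rule T_eta)
  have ec: "poly et c \<noteq> 0" using et(2) eta_nonzero[OF r] by simp
  have "pact CR (T c ^ 1) a = 0" using a(2) pact_CM_linear_power[of c 1 a] by (simp only: power_one_right)
  then have "P dvd T c * (Q c * f)" by (simp only: f pact_Phi Phi_eq_0_iff power_one_right)
  then obtain g where "T c * (Q c * f) = P * g" by (rule dvdE)
  also have "P * g = ?X ^ Suc ?l * Q c * g" using P_Q[of c] unfolding mu_root[OF r] by (simp only:)
  finally have "(?X * Q c) * (et * f) = (?X * Q c) * (?X ^ ?l * g)" unfolding et(1) by (simp only: power_Suc mult_ac)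
  moreover have "Q c \<noteq> 0" using poly_Q[of c] by auto
  then have "?X * Q c \<noteq> 0" by (intro no_zero_divisors) simp_all
  ultimately have ef: "et * f = ?X ^ ?l * g" using mult_left_cancel[THEN iffD1] by blast
  obtain u v where uv: "u * ?X ^ ?l + v * et = 1" using linear_power_bezout[OF ec] by blast
  have "(u * ?X ^ ?l + v * et) * f = ?X ^ ?l * (u * f) + v * (et * f)" by (simp only: distrib_right distrib_left mult_ac)
  also have "\<dots> = ?X ^ ?l * (u * f + v * g)" unfolding ef by (simp only: distrib_left distrib_right mult_ac)
  finally have "f = ?X ^ ?l * (u * f + v * g)" unfolding uv by (simp only: mult_1_left)
  then have "a = Phi (?X ^ ?l * Q c * (u * f + v * g))" unfolding f by (metis mult.assoc mult.commute)
  then show ?thesis using Phi_top[OF r] by blast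
qed

lemma H_disjoint: assumes "c \<noteq> d" shows "H c \<inter> H d \<subseteq> {0}"
proof
  fix a assume a: "a \<in> H c \<inter> H d"
  let ?w = "\<lambda>x. if x = c then a else - a"
  have "?w c = 0"
    by (rule H_indep[of "{c, d}" ?w c]) (use a assms assms[symmetric] cplx.subspace_neg[OF H_subspace, of a d] in auto)
  then show "a \<in> {0}" by simp
qed

lemma dim_U:
  assumes r: "poly P c = 0"
  shows "cnj c = c \<Longrightarrow> dim (U c) = Suc (lad_l c)" "cnj c \<noteq> c \<Longrightarrow> dim (U c) = 2 * Suc (lad_l c)"
proof -
  have d: "dim (U c) = cplx.dim (HH c)" using cdim_Times[OF U_subspace, of c] unfolding U_Times by simp
  show "dim (U c) = Suc (lad_l c)" if "cnj c = c" unfolding d HH_real[OF that] by (rule dim_H[OF r])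
  show "dim (U c) = 2 * Suc (lad_l c)" if ne: "cnj c \<noteq> c"
  proof -
    obtain v where v: "inj_on v {..<Suc (lad_l c)}" "cplx.independent (v ` {..<Suc (lad_l c)})" "cplx.span (v ` {..<Suc (lad_l c)}) = H c"
      using jordan_R[OF r] unfolding jordan_block_on_def by blast
    obtain w where w: "inj_on w {..<Suc (lad_l (cnj c))}" "cplx.independent (w ` {..<Suc (lad_l (cnj c))})" "cplx.span (w ` {..<Suc (lad_l (cnj c))}) = H (cnj c)"
      using jordan_R[OF root_cnj[OF r]] unfolding jordan_block_on_def by blast
    have int: "cplx.span (v ` {..<Suc (lad_l c)}) \<inter> cplx.span (w ` {..<Suc (lad_l (cnj c))}) \<subseteq> {0}"
      unfolding v(3) w(3) by (rule H_disjoint[OF ne[symmetric]])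
    note b = cplx.direct_sum_basis[OF _ v(2) _ w(2) int]
    have "HH c = cplx.span (v ` {..<Suc (lad_l c)} \<union> w ` {..<Suc (lad_l (cnj c))})"
      unfolding HH_def cplx.span_Un v(3) w(3) ..
    then have "cplx.dim (HH c) = card (v ` {..<Suc (lad_l c)} \<union> w ` {..<Suc (lad_l (cnj c))})"
      using cplx.dim_span_eq_card_independent[OF b(1)] by simp
    also have "\<dots> = Suc (lad_l c) + Suc (lad_l (cnj c))" using b(2) card_image[OF v(1)] card_image[OF w(1)] by simp
    finally show ?thesis unfolding d using lad_l_cnj[OF r] by simp
  qed
qed

lemma jordan_blocks_U:
  assumes r: "poly P c = 0" and ne: "cnj c \<noteq> c" and F: "\<And>a. a \<in> U c \<times> U c \<Longrightarrow> F a = CM a"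
  shows "jordan_blocks_on (U c \<times> U c) F [(Suc (lad_l c), poly Z c), (Suc (lad_l c), cnj (poly Z c))]"
proof -
  let ?l = "[(Suc (lad_l c), poly Z c), (Suc (lad_l c), cnj (poly Z c))]"
  let ?W = "\<lambda>i::nat. if i = 0 then H c else H (cnj c)"
  have cz: "cnj (poly Z c) = poly Z (cnj c)" by (simp add: poly_Z)
  have "direct_sum {..<2} ?W (U c \<times> U c)"
    unfolding U_Times HH_def by (rule direct_sum_two[OF cplx.subspace_neg[OF H_subspace] H_disjoint[OF ne[symmetric]]])
  moreover have "jordan_block_on (?W i) F (fst (?l ! i)) (snd (?l ! i))" if "i < 2" for i
  proof -
    have F': "F a = CM a" if "a \<in> H c \<or> a \<in> H (cnj c)" for a
      using F[of a] that H_HH[of c] unfolding U_Times by blast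
    have "jordan_block_on (H c) F (Suc (lad_l c)) (poly Z c)"
      using jordan_M[OF r] jordan_block_on_cong[of "H c" F CM] F' by blast
    moreover have "jordan_block_on (H (cnj c)) F (Suc (lad_l (cnj c))) (poly Z (cnj c))"
      using jordan_M[OF root_cnj[OF r]] jordan_block_on_cong[of "H (cnj c)" F CM] F' by blast
    moreover have "i = 0 \<or> i = 1" using that by auto
    ultimately show ?thesis using lad_l_cnj[OF r] cz by auto
  qed
  ultimately show ?thesis unfolding jordan_blocks_on_def by (intro exI[of _ ?W]) (simp add: numeral_2_eq_2)
qed

end

section \<open>Real Jordan chains\<close>

context hor_space
begin

definition Tr :: "real \<Rightarrow> 'v \<Rightarrow> 'v" where "Tr r x = M x - r *\<^sub>R x"

lemma lin_Tr: "linear (Tr r)"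
  unfolding Tr_def by (intro linear_compose_sub lin_M) (simp add: linear_iff algebra_simps)

lemma cmap_Tr: "cmap (Tr r) = pact CM [:- complex_of_real r, 1:]"
proof
  fix a show "cmap (Tr r) a = pact CM [:- complex_of_real r, 1:] a"
    by (cases a) (simp add: M.pact_linear Tr_def cscale_def)
qed

lemma pact_Tr_power: "pact CM ([:- complex_of_real r, 1:] ^ i) (x, y) = ((Tr r ^^ i) x, (Tr r ^^ i) y)"
  unfolding M.pact_power cmap_Tr[symmetric] cmap_funpow ..

lemma L_M_M: "L (M x) (M y) = L x y"
  using L_M[of x "M y"] L_M[of y x] by simp

lemma lin_Tr_pow: "linear (Tr r ^^ i)"
proof (induction i)
  case (Suc m) then show ?case using linear_compose[OF Suc lin_Tr] by (simp add: o_def)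
qed (auto simp: linear_iff)

lemma funpow_pact_G:
  assumes "\<forall>a\<in>G lam. F a = pact CM f a" "a \<in> G lam"
  shows "(F ^^ m) a = pact CM (f ^ m) a"
proof (induction m)
  case (Suc m)
  then show ?case using assms(1) G_invariant[OF assms(2)] by (simp add: M.pact_mult)
qed simp

section \<open>Invariant subspaces on which the monodromy has a single real eigenvalue\<close>

context
  fixes lr :: real and l :: nat and V :: "'v set"
  assumes lr: "lr \<in> {1, -1}" and lamL: "complex_of_real lr \<in> Lam" and V: "M_inv V"
    and nil: "\<And>x. x \<in> V \<Longrightarrow> (Tr lr ^^ Suc l) x = 0"
begin

abbreviation "TT \<equiv> Tr lr"

lemma sV: "subspace V" using V unfolding M_inv_def by blast

lemma T_inv: "M_inv W \<Longrightarrow> x \<in> W \<Longrightarrow> (TT ^^ i) x \<in> W"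
  by (induction i) (auto simp: Tr_def M_inv_def subspace_diff subspace_scale)

lemma T_big: assumes "x \<in> V" "j > l" shows "(TT ^^ j) x = 0"
proof -
  have "(TT ^^ j) x = (TT ^^ (j - Suc l)) ((TT ^^ Suc l) x)"
    using assms(2) funpow_add[of "j - Suc l" "Suc l" TT] by simp
  then show ?thesis using nil[OF assms(1)] linear_0[OF lin_Tr_pow] by simp
qed

text \<open>Inserting M = T + lr into the isometry of M and using lr^2 = 1 shows that T is skew up
  to a term with an additional T.\<close>

lemma L_T: "L (TT x) y = - L x (TT y) - lr * L (TT x) (TT y)"
proof -
  have l2: "lr * (lr * z) = z" for z using lr by auto
  have M: "M z = TT z + lr *\<^sub>R z" for z by (simp add: Tr_def)
  have "L (TT x) (TT y) + lr * L (TT x) y + lr * L x (TT y) + lr * (lr * L x y) = L x y"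
    using L_M_M[of x y] unfolding M[of x] M[of y]
    by (simp add: bilinear_ladd[OF bil] bilinear_radd[OF bil] bilinear_lmul[OF bil] bilinear_rmul[OF bil] algebra_simps)
  then have "L (TT x) (TT y) + lr * L (TT x) y + lr * L x (TT y) = 0" unfolding l2 by simp
  then have "lr * (L (TT x) (TT y) + lr * L (TT x) y + lr * L x (TT y)) = 0" by simp
  then have "lr * L (TT x) (TT y) + L (TT x) y + L x (TT y) = 0" by (simp only: distrib_left l2)
  then show ?thesis by simp
qed

text \<open>Moving a T from left to right costs a sign and a term with one more T. If the exponents
  sum to more than l, all of them end up on the right with exponent above l, where the vector is
  zero.\<close>

lemma L_T_zero:
  assumes "x \<in> V" "y \<in> V" shows "i + j > l \<Longrightarrow> L ((TT ^^ i) x) ((TT ^^ j) y) = 0"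
proof (induction i arbitrary: j)
  case 0 then show ?case using T_big[OF assms(2)] bilinear_rzero[OF bil] by simp
next
  case (Suc i)
  \<comment> \<open>The correction term keeps the left exponent and raises the right one; m bounds
    the distance from j to l + 1, where the right vector vanishes.\<close>
  have "L ((TT ^^ Suc i) x) ((TT ^^ j) y) = 0" if "Suc i + j > l" "j + m \<ge> Suc l" for m j
    using that
  proof (induction m arbitrary: j)
    case 0 then show ?case using T_big[OF assms(2), of j] bilinear_rzero[OF bil] by simp
  next
    case (Suc m)
    have "L ((TT ^^ Suc i) x) ((TT ^^ Suc j) y) = 0" by (rule Suc.IH) (use Suc.prems in auto)
    moreover have "L ((TT ^^ i) x) ((TT ^^ Suc j) y) = 0" by (rule \<open>\<And>j. l < i + j \<Longrightarrow> L ((TT ^^ i) x) ((TT ^^ j) y) = 0\<close>) (use Suc.prems in auto)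
    ultimately show ?case using L_T[of "(TT ^^ i) x" "(TT ^^ j) y"] by simp
  qed
  from this[of j "Suc l"] Suc.prems show ?case by simp
qed

text \<open>When the exponents sum to l, the correction terms are zero by \<open>L_T_zero\<close>,
  so that each move of T costs exactly a sign.\<close>

lemma L_T_top:
  assumes "b \<in> V" "i \<le> l" shows "L ((TT ^^ i) b) ((TT ^^ (l - i)) b) = (-1) ^ i * L b ((TT ^^ l) b)"
  using assms(2)
proof (induction i)
  case (Suc i)
  have s: "Suc (l - Suc i) = l - i" using Suc.prems by auto
  have "L ((TT ^^ Suc i) b) ((TT ^^ (l - Suc i)) b) = - L ((TT ^^ i) b) ((TT ^^ (l - i)) b) - lr * L ((TT ^^ Suc i) b) ((TT ^^ (l - i)) b)"
    using L_T[of "(TT ^^ i) b" "(TT ^^ (l - Suc i)) b"] s by (metis funpow.simps(2) o_apply)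
  moreover have "L ((TT ^^ Suc i) b) ((TT ^^ (l - i)) b) = 0" by (rule L_T_zero[OF assms(1) assms(1)]) (use Suc.prems in auto)
  ultimately show ?case using Suc by simp
qed simp

lemma V_G: "V \<times> V \<subseteq> G (complex_of_real lr)"
proof
  fix a assume "a \<in> V \<times> V"
  then obtain x y where "a = (x, y)" "x \<in> V" "y \<in> V" by blast
  then have "pact CM ([:- complex_of_real lr, 1:] ^ Suc l) a = 0"
    unfolding pact_Tr_power[of lr "Suc l" x y] using nil by (simp only: pact_Tr_power) (simp add: zero_prod_def)
  then show "a \<in> G (complex_of_real lr)" unfolding M.gen_eigenspace_pact by blast
qed

lemma pact_nil: "a \<in> V \<times> V \<Longrightarrow> pact CM ([:- complex_of_real lr, 1:] ^ Suc l) a = 0"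
proof -
  assume "a \<in> V \<times> V"
  then obtain x y where "a = (x, y)" "x \<in> V" "y \<in> V" by blast
  then show ?thesis using nil by (simp only: pact_Tr_power) (simp add: zero_prod_def)
qed

text \<open>On V the logarithm is T times a polynomial in M with value 1 / lr at lr. On the image of
  T^l only this value acts, and 1 / lr = lr.\<close>

lemma Nd_T:
  assumes d: "d \<ge> 1" and x: "x \<in> V" shows "(Nd d ^^ l) x = (lr ^ l) *\<^sub>R (TT ^^ l) x"
proof -
  let ?lam = "complex_of_real lr" let ?X = "[:- ?lam, 1:]"
  obtain eta where eta: "poly eta ?lam = 1 / ?lam" "\<forall>a\<in>G ?lam. cmap (Nd d) a = pact CM (?X * eta) a"
    using Nd_poly[OF lamL d] by blast
  have x0: "(x, 0) \<in> V \<times> V" using x subspace_0[OF sV] by simp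
  have "(cmap (Nd d) ^^ l) (x, 0) = pact CM ((?X * eta) ^ l) (x, 0)"
    by (rule funpow_pact_G[OF eta(2)]) (use x0 V_G in blast)
  also have "\<dots> = pact CM (eta ^ l) (pact CM (?X ^ l) (x, 0))"
    unfolding power_mult_distrib by (simp only: M.pact_mult[symmetric] mult.commute)
  also have "\<dots> = cscale (poly (eta ^ l) ?lam) (pact CM (?X ^ l) (x, 0))"
  proof -
    let ?h = "eta ^ l"
    have "poly (?h - [:poly ?h ?lam:]) ?lam = 0" by simp
    then have "?X dvd ?h - [:poly ?h ?lam:]" using poly_eq_0_iff_dvd by blast
    then obtain g where g: "?h - [:poly ?h ?lam:] = ?X * g" by (rule dvdE)
    have "pact CM (?h - [:poly ?h ?lam:]) (pact CM (?X ^ l) (x, 0)) = pact CM g (pact CM (?X ^ Suc l) (x, 0))"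
      unfolding g by (simp only: M.pact_mult[symmetric] power_Suc mult_ac)
    also have "\<dots> = 0" unfolding pact_nil[OF x0] by (rule clin.zero[OF M.clin_pact])
    finally have "pact CM ?h (pact CM (?X ^ l) (x, 0)) - cscale (poly ?h ?lam) (pact CM (?X ^ l) (x, 0)) = 0"
      unfolding M.pact_diff M.pact_const .
    then show ?thesis by (rule right_minus_eq[THEN iffD1])
  qed
  also have "poly (eta ^ l) ?lam = complex_of_real (lr ^ l)" using eta(1) lr by (auto simp: poly_power)
  finally have "((Nd d ^^ l) x, (Nd d ^^ l) 0) = cscale (complex_of_real (lr ^ l)) ((TT ^^ l) x, (TT ^^ l) 0)"
    unfolding pact_Tr_power cmap_funpow .
  then show ?thesis by (simp add: cscale_def)
qed

text \<open>The cofactor of T in the logarithm is invertible modulo T^(l+1); applying its inverse, a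
  polynomial in M, gives the preimage inside W.\<close>

lemma T_in_Nd_image:
  assumes d: "d \<ge> 1" and W: "M_inv W" "W \<subseteq> V" and x: "x \<in> W" shows "TT x \<in> Nd d ` W"
proof -
  let ?lam = "complex_of_real lr" let ?X = "[:- ?lam, 1:]"
  obtain eta where eta: "poly eta ?lam = 1 / ?lam" "\<forall>a\<in>G ?lam. cmap (Nd d) a = pact CM (?X * eta) a"
    using Nd_poly[OF lamL d] by blast
  have "poly eta ?lam \<noteq> 0" using eta(1) lr by auto
  then obtain u v where uv: "u * ?X ^ Suc l + v * eta = 1" using linear_power_bezout by blast
  have x0: "(x, 0) \<in> W \<times> W" using x W(1) unfolding M_inv_def by (simp add: subspace_0)
  let ?y = "pact CM v (x, 0)"
  have y: "?y \<in> W \<times> W" by (rule M_inv_pact[OF W(1) x0])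
  have "(TT x, TT 0) = pact CM ?X (x, 0)" unfolding cmap_Tr[symmetric] by simp
  also have "\<dots> = pact CM (?X * (u * ?X ^ Suc l + v * eta)) (x, 0)" unfolding uv by simp
  also have "\<dots> = pact CM (?X * u) (pact CM (?X ^ Suc l) (x, 0)) + pact CM (?X * eta) ?y"
    by (simp only: M.pact_mult[symmetric] M.pact_add[symmetric] distrib_left mult_ac)
  also have "pact CM (?X ^ Suc l) (x, 0) = 0" by (rule pact_nil) (use x0 W(2) in blast)
  also have "pact CM (?X * eta) ?y = cmap (Nd d) ?y"
  proof -
    have "W \<times> W \<subseteq> V \<times> V" using W(2) by auto
    then have "?y \<in> G ?lam" by (rule subsetD[OF subset_trans[OF _ V_G] y])
    from bspec[OF eta(2) this] show ?thesis by (rule sym)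
  qed
  finally have "(TT x, TT 0) = cmap (Nd d) ?y" unfolding clin.zero[OF M.clin_pact] by (simp only: add_0)
  then have "TT x = Nd d (fst ?y)" by (cases ?y) simp
  moreover have "fst ?y \<in> W" using y by (simp only: mem_Times_iff)
  ultimately show ?thesis by (rule image_eqI)
qed

definition chain :: "'v \<Rightarrow> 'v set" where "chain b = span ((\<lambda>i. (TT ^^ i) b) ` {..l})"

lemma chain_subspace: "subspace (chain b)" unfolding chain_def by simp

lemma chain_elem: "i \<le> l \<Longrightarrow> (TT ^^ i) b \<in> chain b"
  unfolding chain_def by (intro span_base) auto

lemma chain_elim: assumes "x \<in> chain b" obtains g where "x = (\<Sum>i\<le>l. g i *\<^sub>R (TT ^^ i) b)"
  using real_vector.span_familyE[of "{..l}" x "\<lambda>i. (TT ^^ i) b"] assms unfolding chain_def by auto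

context
  fixes b assumes b: "b \<in> V"
begin

lemma chain_elem': "(TT ^^ i) b \<in> chain b"
  using chain_elem[of i b] T_big[OF b, of i] subspace_0[OF chain_subspace] by (cases "i \<le> l") auto

lemma chain_sub: "chain b \<subseteq> V"
  unfolding chain_def by (intro span_minimal sV) (use T_inv[OF V b] in auto)

lemma chain_M_inv: "M_inv (chain b)"
  unfolding M_inv_def
proof (intro conjI ballI chain_subspace)
  fix x assume "x \<in> chain b"
  then obtain g where g: "x = (\<Sum>i\<le>l. g i *\<^sub>R (TT ^^ i) b)" by (rule chain_elim)
  have "M ((TT ^^ i) b) = (TT ^^ Suc i) b + lr *\<^sub>R (TT ^^ i) b" for i by (simp add: Tr_def)
  then have "M ((TT ^^ i) b) \<in> chain b" for i
    using subspace_add[OF chain_subspace chain_elem'[of "Suc i"] subspace_scale[OF chain_subspace chain_elem'[of i]]] by metis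
  then show "M x \<in> chain b"
    unfolding g linear_sum[OF lin_M] linear_scale[OF lin_M]
    by (intro subspace_sum[OF chain_subspace] subspace_scale[OF chain_subspace])
qed

context
  assumes top: "(TT ^^ l) b \<noteq> 0"
begin

lemma chain_pact:
  "pact CM ([:- complex_of_real lr, 1:] ^ Suc l) (b, 0) = 0" "pact CM ([:- complex_of_real lr, 1:] ^ l) (b, 0) \<noteq> 0"
  using pact_nil[of "(b, 0)"] b subspace_0[OF sV] top by (auto simp: pact_Tr_power zero_prod_def)

lemma chain_Times:
  "chain b \<times> chain b = cplx.span ((\<lambda>i. pact CM ([:- complex_of_real lr, 1:] ^ i) (b, 0)) ` {..l})"
proof -
  have "(\<lambda>i. pact CM ([:- complex_of_real lr, 1:] ^ i) (b, 0)) ` {..l} = (\<lambda>x. (x, 0)) ` (\<lambda>i. (TT ^^ i) b) ` {..l}"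
    unfolding image_image pact_Tr_power using linear_0[OF lin_Tr_pow] by simp
  then show ?thesis unfolding chain_def cspan_real[symmetric] by simp
qed

lemma chain_jordan: "jordan_block_on (chain b \<times> chain b) CM (Suc l) (complex_of_real lr)"
  and chain_dim: "dim (chain b) = Suc l"
proof -
  note jb = M.jordan_block_chain[OF chain_pact chain_Times]
  show "jordan_block_on (chain b \<times> chain b) CM (Suc l) (complex_of_real lr)" by (rule jb)
  have "dim (chain b) = cplx.dim (chain b \<times> chain b)" by (rule cdim_Times[OF chain_subspace, symmetric])
  also have "\<dots> = Suc l"
    unfolding chain_Times cplx.dim_span_eq_card_independent[OF jb(3)] card_image[OF jb(2)] by simp
  finally show "dim (chain b) = Suc l" .
qed

text \<open>The term with the lowest exponent i decides: T^(l-i) carries it to a multiple of T^l b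
  and all later terms to zero.\<close>

lemma chain_lead:
  assumes "x \<in> chain b" "x \<noteq> 0"
  obtains i g where "i \<le> l" "g i \<noteq> 0" "\<And>j. j < i \<Longrightarrow> g j = 0" "x = (\<Sum>j\<le>l. g j *\<^sub>R (TT ^^ j) b)"
    "(TT ^^ (l - i)) x = g i *\<^sub>R (TT ^^ l) b"
proof -
  obtain g where g: "x = (\<Sum>j\<le>l. g j *\<^sub>R (TT ^^ j) b)" using assms(1) by (rule chain_elim)
  have ex: "\<exists>i. i \<le> l \<and> g i \<noteq> 0"
  proof (rule ccontr)
    assume "\<not> ?thesis"
    then have "x = 0" unfolding g by (intro sum.neutral) auto
    then show False using assms(2) by blast
  qed
  define i where "i = (LEAST i. i \<le> l \<and> g i \<noteq> 0)"
  have i: "i \<le> l" "g i \<noteq> 0" using LeastI_ex[OF ex] unfolding i_def by auto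
  have low: "g j = 0" if "j < i" for j
    using not_less_Least[OF that[unfolded i_def]] that i(1) by auto
  have "(TT ^^ (l - i)) x = (\<Sum>j\<le>l. g j *\<^sub>R (TT ^^ (l - i)) ((TT ^^ j) b))"
    unfolding g linear_sum[OF lin_Tr_pow] linear_scale[OF lin_Tr_pow] ..
  also have "\<dots> = (\<Sum>j\<le>l. g j *\<^sub>R (TT ^^ (l - i + j)) b)" by (simp add: funpow_add)
  also have "\<dots> = (\<Sum>j\<in>{i}. g j *\<^sub>R (TT ^^ (l - i + j)) b)"
  proof (rule sum.mono_neutral_right)
    show "\<forall>j\<in>{..l} - {i}. g j *\<^sub>R (TT ^^ (l - i + j)) b = 0"
    proof
      fix j assume j: "j \<in> {..l} - {i}"
      show "g j *\<^sub>R (TT ^^ (l - i + j)) b = 0"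
      proof (cases "j < i")
        case False
        then have "l - i + j > l" using j i(1) by simp arith
        then show ?thesis using T_big[OF b] by simp
      qed (use low in simp)
    qed
  qed (use i in auto)
  also have "\<dots> = g i *\<^sub>R (TT ^^ l) b" using i(1) by simp
  finally show ?thesis using that i low g by blast
qed

text \<open>Pairing x with T^(l-i) b, where i is its lowest exponent, leaves a single term by
  \<open>L_T_zero\<close>: the Gram matrix of a chain is triangular with respect to the
  antidiagonal.\<close>

lemma chain_nondeg:
  assumes Lb: "L b ((TT ^^ l) b) \<noteq> 0" and x: "x \<in> chain b" "\<forall>y\<in>chain b. L x y = 0" shows "x = 0"
proof (rule ccontr)
  assume "x \<noteq> 0"
  then obtain i g where i: "i \<le> l" "g i \<noteq> 0" "\<And>j. j < i \<Longrightarrow> g j = 0" "x = (\<Sum>j\<le>l. g j *\<^sub>R (TT ^^ j) b)"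
    using chain_lead[OF x(1)] by metis
  have "L x ((TT ^^ (l - i)) b) = (\<Sum>j\<le>l. g j * L ((TT ^^ j) b) ((TT ^^ (l - i)) b))"
    unfolding i(4) by (rule L_sum_left)
  also have "\<dots> = (\<Sum>j\<in>{i}. g j * L ((TT ^^ j) b) ((TT ^^ (l - i)) b))"
  proof (rule sum.mono_neutral_right)
    show "\<forall>j\<in>{..l} - {i}. g j * L ((TT ^^ j) b) ((TT ^^ (l - i)) b) = 0"
    proof
      fix j assume j: "j \<in> {..l} - {i}"
      show "g j * L ((TT ^^ j) b) ((TT ^^ (l - i)) b) = 0"
      proof (cases "j < i")
        case False
        then have "j + (l - i) > l" using j i(1) by simp arith
        then show ?thesis using L_T_zero[OF b b] by simp
      qed (use i(3) in simp)
    qed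
  qed (use i in auto)
  also have "\<dots> = g i * ((-1) ^ i * L b ((TT ^^ l) b))" using L_T_top[OF b i(1)] by simp
  finally have "L x ((TT ^^ (l - i)) b) \<noteq> 0" using i(2) Lb by simp
  then show False using x(2) chain_elem' by blast
qed

text \<open>By \<open>chain_lead\<close> a power of T sends any nonzero element to a nonzero
  multiple of T^l b. This is the common vector that \<open>irreducibleI\<close> asks for.\<close>

lemma chain_sub_contains:
  assumes "M_inv W" "W \<subseteq> chain b" "W \<noteq> {0}" shows "(TT ^^ l) b \<in> W"
proof -
  have sW: "subspace W" using assms(1) unfolding M_inv_def by blast
  obtain x where x: "x \<in> W" "x \<noteq> 0" using assms(3) subspace_0[OF sW] by blast
  then have "x \<in> chain b" using assms(2) by blast
  then obtain i g where i: "g i \<noteq> 0" "(TT ^^ (l - i)) x = g i *\<^sub>R (TT ^^ l) b" using chain_lead[OF _ x(2)] by metis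
  have "(1 / g i) *\<^sub>R (TT ^^ (l - i)) x \<in> W" using subspace_scale[OF sW T_inv[OF assms(1) x(1)]] .
  then show ?thesis unfolding i(2) using i(1) by simp
qed

text \<open>The hypothesis pos says that L w (T^l w), rescaled by lr^l as in \<open>Nd_T\<close>,
  has the sign eps at all vectors with nonzero top; par is the parity condition on irreducible pairs
  with one block.\<close>

lemma Seif1_chain:
  assumes par: "lr = (-1) ^ l" and eps: "eps \<in> {1, -1}"
    and pos: "\<And>w. w \<in> V \<Longrightarrow> (TT ^^ l) w \<noteq> 0 \<Longrightarrow> eps * (lr ^ l * L w ((TT ^^ l) w)) > 0"
  shows "Seif1 (complex_of_real lr) (l + 1) (complex_of_real eps) (chain b) L"
proof -
  let ?W = "chain b" and ?lam = "complex_of_real lr"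
  have Lb: "L b ((TT ^^ l) b) \<noteq> 0" using pos[OF b top] by auto
  have nd: "\<And>a. a \<in> ?W \<Longrightarrow> (\<forall>y\<in>?W. L a y = 0) \<Longrightarrow> a = 0" using chain_nondeg[OF Lb] .
  note Wi = chain_M_inv
  have mon: "\<And>a. a \<in> ?W \<times> ?W \<Longrightarrow> cmap (monodromy ?W L) a = CM a" by (rule cmap_monodromy[OF Wi nd])
  show ?thesis unfolding Seif1_def Let_def
  proof (intro conjI ballI)
    show "?lam = 1 \<and> odd (l + 1) \<or> ?lam = - 1 \<and> even (l + 1)" unfolding par by (cases "even l") auto
    show "complex_of_real eps \<in> {1, -1}" using eps by auto
    show "irreducible_S1_pair ?W L"
      by (rule irreducibleI[OF Wi nd _ top]) (use chain_elem' chain_sub_contains in auto)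
    show "dim ?W = l + 1" using chain_dim by simp
    have Ws: "cplx.subspace (?W \<times> ?W)" by (rule csubspace_Times[OF chain_subspace])
    have "gen_eigenspace (?W \<times> ?W) (cmap (monodromy ?W L)) ?lam = gen_eigenspace (?W \<times> ?W) CM ?lam"
      by (rule gen_eigenspace_cong[OF mon M_inv_Times(2)[OF Wi] Ws])
    also have "\<dots> = ?W \<times> ?W"
      unfolding M.gen_eigenspace_pact using pact_nil chain_sub by blast
    finally show "gen_eigenspace (?W \<times> ?W) (cmap (monodromy ?W L)) ?lam = ?W \<times> ?W" .
    show "jordan_blocks_on (?W \<times> ?W) (cmap (monodromy ?W L)) [(l + 1, ?lam)]"
      using jordan_blocks_single[of "?W \<times> ?W" "cmap (monodromy ?W L)" "Suc l" ?lam] chain_jordan jordan_block_on_cong[OF mon]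
      by simp
    fix a assume a: "a \<in> ?W - nilpotent_part ?W (monodromy ?W L) ` ?W"
    let ?N = "nilpotent_part ?W (monodromy ?W L)"
    have d1: "dim ?W \<ge> 1" using chain_dim by simp
    have im: "?N ` ?W = Nd (dim ?W) ` ?W" by (rule image_cong[OF refl nilpotent_part_monodromy[OF Wi nd]])
    obtain g where g: "a = (\<Sum>j\<le>l. g j *\<^sub>R (TT ^^ j) b)" using a chain_elim by blast
    \<comment> \<open>If T^l a were zero, the lowest exponent of a would be positive, a would be T
      of an element of the chain and so lie in the image of the logarithm.\<close>
    have Ta: "(TT ^^ l) a \<noteq> 0"
    proof
      assume T0: "(TT ^^ l) a = 0"
      have "a \<noteq> 0"
      proof
        assume "a = 0"
        then have "a = Nd (dim ?W) 0" using linear_0[OF lin_Nd] by simp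
        then show False using a im subspace_0[OF chain_subspace] by blast
      qed
      then obtain i g where i: "i \<le> l" "g i \<noteq> 0" "\<And>j. j < i \<Longrightarrow> g j = 0" "a = (\<Sum>j\<le>l. g j *\<^sub>R (TT ^^ j) b)" "(TT ^^ (l - i)) a = g i *\<^sub>R (TT ^^ l) b"
        using chain_lead[of a] a by blast
      have i0: "i > 0"
      proof (rule ccontr)
        assume "\<not> i > 0" then have "i = 0" by simp
        then show False using i(5) T0 i(2) top by simp
      qed
      let ?y = "\<Sum>j<l. g (Suc j) *\<^sub>R (TT ^^ j) b"
      have y: "?y \<in> ?W" by (intro subspace_sum[OF chain_subspace] subspace_scale[OF chain_subspace] chain_elem')
      have "a = g 0 *\<^sub>R b + (\<Sum>j<l. g (Suc j) *\<^sub>R (TT ^^ Suc j) b)"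
        unfolding i(4) by (subst sum.atMost_shift) simp
      also have "\<dots> = TT ?y" using i(3)[OF i0] by (simp add: linear_sum[OF lin_Tr] linear_scale[OF lin_Tr])
      finally have "a \<in> Nd (dim ?W) ` ?W" using T_in_Nd_image[OF d1 Wi chain_sub y] by simp
      then show False using a im by blast
    qed
    have aV: "a \<in> V" using a chain_sub by blast
    have Nl: "(?N ^^ (l + 1 - 1)) a = (lr ^ l) *\<^sub>R (TT ^^ l) a"
      using nilpotent_part_monodromy_pow[OF Wi nd, of a l] a Nd_T[OF d1 aV] by simp
    have "L a ((?N ^^ (l + 1 - 1)) a) = lr ^ l * L a ((TT ^^ l) a)" unfolding Nl by (simp add: bilinear_rmul[OF bil])
    then have e: "eps * L a ((?N ^^ (l + 1 - 1)) a) > 0" using pos[OF aV Ta] by simp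
    have "complex_of_real (L a ((?N ^^ (l + 1 - 1)) a)) = complex_of_real eps * complex_of_real (eps * L a ((?N ^^ (l + 1 - 1)) a))"
      using eps by auto
    then show "\<exists>r>0. complex_of_real (L a ((?N ^^ (l + 1 - 1)) a)) = complex_of_real eps * complex_of_real r"
      using e by blast
  qed
qed

text \<open>Orthogonal projection onto the chain, one coefficient at a time: after s steps the
  difference x - w is orthogonal to all T^j b with j > l - s.\<close>

lemma chain_project:
  assumes Lb: "L b ((TT ^^ l) b) \<noteq> 0" shows "\<exists>w\<in>chain b. \<forall>y\<in>chain b. L (x - w) y = 0"
proof -
  have "\<exists>w\<in>chain b. \<forall>j\<le>l. j + s > l \<longrightarrow> L (x - w) ((TT ^^ j) b) = 0" if "s \<le> Suc l" for s
    using that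
  proof (induction s)
    case 0 then show ?case using subspace_0[OF chain_subspace] by auto
  next
    case (Suc s)
    then obtain w where w: "w \<in> chain b" "\<forall>j\<le>l. j + s > l \<longrightarrow> L (x - w) ((TT ^^ j) b) = 0" by auto
    have sl: "s \<le> l" using Suc by simp
    have nz: "L ((TT ^^ s) b) ((TT ^^ (l - s)) b) \<noteq> 0" using L_T_top[OF b sl] Lb by simp
    \<comment> \<open>Adding t T^s b corrects the pairing with T^(l-s) b and keeps the earlier ones,
      since exponents summing to more than l pair to zero.\<close>
    define t where "t = L (x - w) ((TT ^^ (l - s)) b) / L ((TT ^^ s) b) ((TT ^^ (l - s)) b)"
    let ?w = "w + t *\<^sub>R (TT ^^ s) b"
    have L': "L (x - ?w) z = L (x - w) z - t * L ((TT ^^ s) b) z" for z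
      by (simp add: bilinear_lsub[OF bil] bilinear_ladd[OF bil] bilinear_lmul[OF bil])
    have "L (x - ?w) ((TT ^^ j) b) = 0" if j: "j \<le> l" "j + Suc s > l" for j
    proof (cases "j + s > l")
      case True then show ?thesis unfolding L' using w(2) j L_T_zero[OF b b, of s j] by simp
    next
      case False
      then have "j = l - s" using j by auto
      then show ?thesis unfolding L' using nz by (simp add: t_def)
    qed
    moreover have "?w \<in> chain b" by (intro subspace_add[OF chain_subspace w(1)] subspace_scale[OF chain_subspace] chain_elem')
    ultimately show ?case by blast
  qed
  from this[of "Suc l"] obtain w where w: "w \<in> chain b" "\<forall>j\<le>l. L (x - w) ((TT ^^ j) b) = 0" by auto
  have "L (x - w) y = 0" if yc: "y \<in> chain b" for y
  proof -
    obtain g where g: "y = (\<Sum>i\<le>l. g i *\<^sub>R (TT ^^ i) b)" using yc by (rule chain_elim)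
    have "linear (L (x - w))" using bil unfolding bilinear_def by blast
    then show ?thesis unfolding g using w(2) by (simp add: linear_sum linear_cmul)
  qed
  then show ?thesis using w(1) by blast
qed

text \<open>By \<open>L_T\<close>, orthogonality of a vector to the chain of b passes to its image
  under T and so spreads over the chain of b2. The reversed order follows from L y x = L (M x) y and
  the invariance of the chain of b2.\<close>

lemma chain_orth:
  assumes b2: "b2 \<in> V" and orth: "\<forall>y\<in>chain b. L b2 y = 0"
  shows "x \<in> chain b2 \<Longrightarrow> y \<in> chain b \<Longrightarrow> L x y = 0 \<and> L y x = 0"
proof -
  have step: "L (TT z) ((TT ^^ i) b) = 0" if z: "\<And>i. L z ((TT ^^ i) b) = 0" for z i
  proof -
    have "L (TT z) ((TT ^^ i) b) = 0" if "i + m \<ge> Suc l" for m i using that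
    proof (induction m arbitrary: i)
      case 0 then show ?case using T_big[OF b, of i] bilinear_rzero[OF bil] by simp
    next
      case (Suc m)
      have "L (TT z) ((TT ^^ Suc i) b) = 0" by (rule Suc.IH) (use Suc.prems in auto)
      then show ?case using L_T[of z "(TT ^^ i) b"] z[of "Suc i"] by simp
    qed
    from this[of i "Suc l"] show ?thesis by simp
  qed
  have it: "\<forall>i. L ((TT ^^ j) b2) ((TT ^^ i) b) = 0" for j
  proof (induction j)
    case 0 then show ?case using orth chain_elem' by auto
  next
    case (Suc j) then show ?case using step[of "(TT ^^ j) b2"] by simp
  qed
  have left: "L x y = 0" if x: "x \<in> chain b2" and y: "y \<in> chain b" for x y
  proof -
    obtain g where g: "x = (\<Sum>i\<le>l. g i *\<^sub>R (TT ^^ i) b2)" using x by (rule chain_elim)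
    obtain h where h: "y = (\<Sum>i\<le>l. h i *\<^sub>R (TT ^^ i) b)" using y by (rule chain_elim)
    have "L z y = 0" if "\<And>i. L z ((TT ^^ i) b) = 0" for z
    proof -
      have "linear (L z)" using bil unfolding bilinear_def by blast
      then show ?thesis unfolding h using that by (simp add: linear_sum linear_cmul)
    qed
    then show ?thesis unfolding g L_sum_left using it by simp
  qed
  show "L x y = 0 \<and> L y x = 0" if x: "x \<in> chain b2" and y: "y \<in> chain b" for x y
  proof
    show "L x y = 0" by (rule left[OF x y])
    have "M x \<in> chain b2"
    proof -
      have "M ((TT ^^ i) b2) = (TT ^^ Suc i) b2 + lr *\<^sub>R (TT ^^ i) b2" for i by (simp add: Tr_def)
      moreover have ce: "(TT ^^ i) b2 \<in> chain b2" for i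
        using chain_elem[of i b2] T_big[OF b2, of i] subspace_0[OF chain_subspace] by (cases "i \<le> l") auto
      ultimately have Mi: "M ((TT ^^ i) b2) \<in> chain b2" for i
        using subspace_add[OF chain_subspace ce[of "Suc i"] subspace_scale[OF chain_subspace ce[of i]]] by metis
      obtain g where g: "x = (\<Sum>i\<le>l. g i *\<^sub>R (TT ^^ i) b2)" using x by (rule chain_elim)
      show ?thesis unfolding g linear_sum[OF lin_M] linear_scale[OF lin_M]
        by (intro subspace_sum[OF chain_subspace] subspace_scale[OF chain_subspace] Mi)
    qed
    then show "L y x = 0" using left[OF _ y] L_M[of x y] by metis
  qed
qed

end

end

end

end

section \<open>Summands with real monodromy eigenvalue\<close>

lemma direct_sum_one: "direct_sum {..<1::nat} (\<lambda>_. V) V"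
proof -
  have "V = {\<Sum>i<1. w i | w :: nat \<Rightarrow> _. \<forall>i\<in>{..<1}. w i \<in> V}"
  proof (intro Set.set_eqI iffI)
    fix x assume "x \<in> V"
    then show "x \<in> {\<Sum>i<1. w i | w :: nat \<Rightarrow> _. \<forall>i\<in>{..<1}. w i \<in> V}"
      by (intro CollectI exI[of _ "\<lambda>_. x"]) simp
  qed auto
  then show ?thesis unfolding direct_sum_def by simp
qed

lemma sum_of_copies_one: "Q V L \<Longrightarrow> seifert_pair V L \<Longrightarrow> sum_of_copies Q V L"
  unfolding sum_of_copies_def seifert_decomp_def
  by (intro exI[of _ "1::nat"] exI[of _ "\<lambda>_. V"]) (simp add: direct_sum_one[unfolded One_nat_def])

lemma add_cconj: "a + cconj a = (fst (a + cconj a), 0)"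
  by (simp add: cconj_def prod_eq_iff)

context hor_space
begin

lemma pact_T_H_l: assumes r: "poly P c = 0" and a: "a \<in> H c" shows "pact CR (T c ^ Suc (lad_l c)) a = 0"
proof -
  obtain f where f: "a = Phi (Q c * f)" using a by (rule H_elim)
  obtain et where et: "T c = [:- c, 1:] * et" by (rule T_eta)
  have PQ: "[:- c, 1:] ^ Suc (lad_l c) * Q c = P" using P_Q[of c] unfolding mu_root[OF r] by (rule sym)
  have "T c ^ Suc (lad_l c) * (Q c * f) = ([:- c, 1:] ^ Suc (lad_l c) * Q c) * (et ^ Suc (lad_l c) * f)"
    unfolding et power_mult_distrib by (simp only: mult_ac)
  then have "P dvd T c ^ Suc (lad_l c) * (Q c * f)" unfolding PQ by (rule dvdI)
  then show ?thesis unfolding f pact_Phi Phi_eq_0_iff .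
qed

lemma Nd_nil_H: assumes r: "poly P c = 0" and d: "d \<ge> 1" and a: "a \<in> H c" shows "(cmap (Nd d) ^^ Suc (lad_l c)) a = 0"
proof -
  obtain f where f: "a = Phi (Q c * f)" using a by (rule H_elim)
  obtain th where th: "\<forall>a\<in>H c. cmap (Nd d) a = pact CR ([:- c, 1:] * th) a" using Nd_H[OF r d] by blast
  have PQ: "[:- c, 1:] ^ Suc (lad_l c) * Q c = P" using P_Q[of c] unfolding mu_root[OF r] by (rule sym)
  have "(cmap (Nd d) ^^ Suc (lad_l c)) a = pact CR (([:- c, 1:] * th) ^ Suc (lad_l c)) a" by (rule funpow_pact_H[OF th a])
  also have "\<dots> = Phi (([:- c, 1:] ^ Suc (lad_l c) * Q c) * (th ^ Suc (lad_l c) * f))"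
    unfolding f pact_Phi power_mult_distrib by (simp only: mult_ac)
  also have "\<dots> = 0" unfolding PQ Phi_eq_0_iff by (rule dvd_triv_left)
  finally show ?thesis .
qed

lemma Nd_pow_H: assumes r: "poly P c = 0" and d: "d \<ge> 1" and a: "a \<in> H c" shows "(cmap (Nd d) ^^ m) a \<in> H c"
proof -
  obtain th where th: "\<forall>a\<in>H c. cmap (Nd d) a = pact CR ([:- c, 1:] * th) a" using Nd_H[OF r d] by blast
  show ?thesis unfolding funpow_pact_H[OF th a] by (rule pact_H[OF a])
qed

lemma polar':
  assumes r: "poly P c = 0" and d: "d \<ge> 1" and a: "a \<in> H c" and nz: "(cmap (Nd d) ^^ lad_l c) a \<noteq> 0"
  shows "\<exists>r>0. cbil L a ((cmap (Nd d) ^^ lad_l c) (cconj a)) = cis (pi / 2 * (2 * lad_al c + real (lad_l c))) * complex_of_real r"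
proof (rule polar[OF r d a])
  show "a \<notin> cmap (Nd d) ` H c"
  proof
    assume "a \<in> cmap (Nd d) ` H c"
    then obtain a' where a': "a = cmap (Nd d) a'" "a' \<in> H c" by blast
    have "(cmap (Nd d) ^^ lad_l c) a = (cmap (Nd d) ^^ Suc (lad_l c)) a'" unfolding a'(1) by (simp add: funpow_swap1)
    then show False using nz Nd_nil_H[OF r d a'(2)] by simp
  qed
qed

lemma cconj_Nd_pow: "(cmap (Nd d) ^^ m) (cconj a) = cconj ((cmap (Nd d) ^^ m) a)"
  by (induction m) (simp_all add: cmap_cconj[OF lin_Nd])

text \<open>The components of a real vector in two conjugate blocks are unique, hence conjugate to
  each other.\<close>

lemma U_conj_decomp:
  assumes ne: "cnj c \<noteq> c" and x: "x \<in> U c"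
  obtains a where "a \<in> H c" "(x, 0) = a + cconj a"
proof -
  obtain a b where ab: "(x, 0) = a + b" "a \<in> H c" "b \<in> H (cnj c)" using x unfolding U_eq HH_def by blast
  have "cconj (x, 0) = (x, 0)" by (simp add: cconj_def)
  then have eq: "cconj a + cconj b = a + b" using ab(1) by (metis cconj_add)
  have ca: "cconj a \<in> H (cnj c)" and cb: "cconj b \<in> H c" using cconj_H[OF ab(2)] cconj_H[OF ab(3)] by auto
  have "a - cconj b = cconj a - b" using eq by (simp add: algebra_simps)
  moreover have "a - cconj b \<in> H c" by (rule cplx.subspace_diff[OF H_subspace ab(2) cb])
  moreover have "cconj a - b \<in> H (cnj c)" by (rule cplx.subspace_diff[OF H_subspace ca ab(3)])
  ultimately have "cconj a - b \<in> H (cnj c) \<inter> H c" by simp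
  then have "cconj a - b = 0" using H_disjoint[OF ne] by blast
  then have "b = cconj a" by (rule eq_iff_diff_eq_0[THEN iffD2, THEN sym])
  then show ?thesis using that ab by blast
qed

lemma U_nondegenerate:
  assumes "upper c" "poly P c = 0" "a \<in> U c" "\<forall>b\<in>U c. L a b = 0" shows "a = 0"
  using U_nondeg[OF assms(1,2,3)] assms(4) by blast

lemma U_monodromy:
  assumes "upper c" "poly P c = 0" "a \<in> U c \<times> U c" shows "cmap (monodromy (U c) L) a = CM a"
  by (rule cmap_monodromy[OF U_M_inv U_nondegenerate[OF assms(1,2)] assms(3)])

text \<open>For non-real c write w as a plus its conjugate. Products within one block vanish because
  c^2 is not 1, and the two mixed ones are conjugate, so the value is twice the real part of the
  number in \<open>polar\<close>. It has a constant sign when the phase is 1 or -1, and is zero when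
  the phase is imaginary.\<close>

lemma L_N_U:
  assumes r: "poly P c = 0" and d: "d \<ge> 1" and w: "w \<in> U c"
  shows "\<exists>q\<ge>0. ((Nd d ^^ lad_l c) w \<noteq> 0 \<longrightarrow> q > 0) \<and>
    L w ((Nd d ^^ lad_l c) w) = cos (pi / 2 * (2 * lad_al c + real (lad_l c))) * q"
proof (cases "(Nd d ^^ lad_l c) w = 0")
  case True then show ?thesis using bilinear_rzero[OF bil] by (intro exI[of _ 0]) simp
next
  case nz: False
  let ?N = "cmap (Nd d) ^^ lad_l c"
  interpret N: clin ?N by (rule clin.clin_funpow[OF clin_cmap[OF lin_Nd]])
  have N0: "?N (w, 0) = ((Nd d ^^ lad_l c) w, 0)"
  proof -
    have "(Nd d ^^ m) 0 = 0" for m by (induction m) (simp_all add: linear_0[OF lin_Nd])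
    then show ?thesis by (simp add: cmap_funpow)
  qed
  have LC: "cbil L (w, 0) (?N (w, 0)) = complex_of_real (L w ((Nd d ^^ lad_l c) w))" unfolding N0 by (rule cbil_real[OF bil])
  show ?thesis
  proof (cases "cnj c = c")
    case True
    have w0: "(w, 0) \<in> H c" using w HH_real[OF True] unfolding U_eq by blast
    have "?N (w, 0) \<noteq> 0" using nz unfolding N0 by (simp add: zero_prod_def)
    from polar'[OF r d w0 this] obtain q where q: "q > 0"
      "cbil L (w, 0) (?N (w, 0)) = cis (pi / 2 * (2 * lad_al c + real (lad_l c))) * complex_of_real q"
      by (auto simp: cconj_def)
    have "L w ((Nd d ^^ lad_l c) w) = cos (pi / 2 * (2 * lad_al c + real (lad_l c))) * q"
      using arg_cong[OF q(2), of Re] unfolding LC by simp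
    then show ?thesis using q(1) by (intro exI[of _ q]) simp
  next
    case False
    obtain a where a: "a \<in> H c" "(w, 0) = a + cconj a" using U_conj_decomp[OF False w] by blast
    have ca: "cconj a \<in> H (cnj c)" by (rule cconj_H[OF a(1)])
    have Na: "?N a \<noteq> 0"
    proof
      assume "?N a = 0"
      then have "?N (w, 0) = 0" unfolding a(2) N.add cconj_Nd_pow by simp
      then show False using nz unfolding N0 by (simp add: zero_prod_def)
    qed
    obtain q where q: "q > 0" "cbil L a (?N (cconj a)) = cis (pi / 2 * (2 * lad_al c + real (lad_l c))) * complex_of_real q"
      using polar'[OF r d a(1) Na] by blast
    have NH: "?N a \<in> H c" by (rule Nd_pow_H[OF r d a(1)])
    have NH': "?N (cconj a) \<in> H (cnj c)" unfolding cconj_Nd_pow by (rule cconj_H[OF NH])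
    have cc: "c * c \<noteq> 1"
    proof
      assume "c * c = 1"
      then have "cnj c * (c * c) = cnj c" by simp
      then have "c = cnj c" using norm_1_cnj(1)[OF root_norm[OF r]] by (simp add: mult.assoc[symmetric])
      then show False using False by simp
    qed
    have cc': "cnj c * cnj c \<noteq> 1" using cc by (metis complex_cnj_cnj complex_cnj_mult complex_cnj_one)
    have "cbil L (cconj a) (?N a) = cnj (cbil L a (?N (cconj a)))"
      unfolding cconj_Nd_pow using cbil_cconj[OF bil, of a "cconj (?N a)"] by simp
    then have "cbil L (w, 0) (?N (w, 0)) = cbil L a (?N (cconj a)) + cnj (cbil L a (?N (cconj a)))"
      unfolding a(2) N.add cbil_add_left[OF bil] cbil_add_right[OF bil]
      using cbil_H_orth[OF a(1) NH cc] cbil_H_orth[OF ca NH' cc'] by simp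
    then have "complex_of_real (L w ((Nd d ^^ lad_l c) w)) = complex_of_real (2 * Re (cbil L a (?N (cconj a))))"
      unfolding LC complex_add_cnj by simp
    then have "L w ((Nd d ^^ lad_l c) w) = 2 * Re (cbil L a (?N (cconj a)))" by (simp only: of_real_eq_iff)
    also have "\<dots> = cos (pi / 2 * (2 * lad_al c + real (lad_l c))) * (2 * q)" unfolding q(2) by simp
    finally show ?thesis using q(1) by (intro exI[of _ "2 * q"]) simp
  qed
qed

section \<open>A single zero whose monodromy eigenvalue is real\<close>

context
  fixes c :: complex and lr :: real
  assumes r: "poly P c = 0" and up: "upper c" and Zc: "poly Z c = complex_of_real lr"
begin

abbreviation "ll \<equiv> lad_l c"

lemma lr_pm: "lr \<in> {1, -1}"
proof -
  have "cmod (poly Z c) = 1" using root_norm[OF r] by (simp add: poly_Z norm_mult norm_power)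
  then have "\<bar>lr\<bar> = 1" unfolding Zc by simp
  then show ?thesis by auto
qed

lemma lr_Lam: "complex_of_real lr \<in> Lam"
  using r Zc unfolding Lam_def by force

lemma nilU: "x \<in> U c \<Longrightarrow> (Tr lr ^^ Suc ll) x = 0"
proof -
  assume "x \<in> U c"
  then obtain a b where ab: "(x, 0) = a + b" "a \<in> H c" "b \<in> H (cnj c)" unfolding U_eq HH_def by blast
  have Zc': "poly Z (cnj c) = complex_of_real lr" using arg_cong[OF Zc, of cnj] by (simp add: poly_Z)
  have "pact CM ([:- complex_of_real lr, 1:] ^ Suc ll) a = 0"
    using pact_CM_linear_power[of c "Suc ll" a] pact_T_H_l[OF r ab(2)] unfolding Zc by (rule trans)
  moreover have "pact CM ([:- complex_of_real lr, 1:] ^ Suc ll) b = 0"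
    using pact_CM_linear_power[of "cnj c" "Suc ll" b] pact_T_H_l[OF root_cnj[OF r] ab(3)] unfolding Zc' lad_l_cnj[OF r] by (rule trans)
  ultimately have "pact CM ([:- complex_of_real lr, 1:] ^ Suc ll) (x, 0) = 0"
    unfolding ab(1) clin.add[OF M.clin_pact] by (simp only: add_0)
  then show ?thesis unfolding pact_Tr_power by (simp add: zero_prod_def del: funpow.simps)
qed

lemmas U_base = lr_pm lr_Lam U_M_inv[of c] nilU

lemma NdT: "d \<ge> 1 \<Longrightarrow> x \<in> U c \<Longrightarrow> (Nd d ^^ ll) x = (lr ^ ll) *\<^sub>R (Tr lr ^^ ll) x"
  by (rule Nd_T[OF U_base])

lemma L_T_U:
  assumes w: "w \<in> U c"
  shows "\<exists>q\<ge>0. ((Tr lr ^^ ll) w \<noteq> 0 \<longrightarrow> q > 0) \<and>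
    lr ^ ll * L w ((Tr lr ^^ ll) w) = cos (pi / 2 * (2 * lad_al c + real ll)) * q"
proof -
  have lz: "lr ^ ll \<noteq> 0" using lr_pm by auto
  obtain q where "q \<ge> 0" "(Nd 1 ^^ ll) w \<noteq> 0 \<longrightarrow> q > 0" "L w ((Nd 1 ^^ ll) w) = cos (pi / 2 * (2 * lad_al c + real ll)) * q"
    using L_N_U[OF r _ w, of 1] by auto
  then show ?thesis unfolding NdT[OF order_refl w] bilinear_rmul[OF bil] using lz by auto
qed

text \<open>If 2 alpha + l = 2 m, the phase is cos (pi m), and e^(-2 pi i alpha) = e^(pi i l) gives
  the eigenvalue (-1)^l, the parity of the one-block pairs.\<close>

lemma cos_eps:
  assumes "even i" "2 * lad_al c + real ll = real_of_int i"
  shows "cos (pi / 2 * (2 * lad_al c + real ll)) \<in> {1, -1}"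
    "cis (pi / 2 * (2 * lad_al c + real ll)) = complex_of_real (cos (pi / 2 * (2 * lad_al c + real ll)))"
    "lr = (-1) ^ ll"
proof -
  obtain m where m: "i = 2 * m" using assms(1) by blast
  have e: "pi / 2 * (2 * lad_al c + real ll) = pi * real_of_int m" unfolding assms(2) m by simp
  have s: "sin (pi * real_of_int m) = 0" by (metis mult.commute sin_zero_iff_int2)
  have "(cos (pi * real_of_int m))\<^sup>2 = 1" using sin_cos_squared_add[of "pi * real_of_int m"] s by simp
  then show "cos (pi / 2 * (2 * lad_al c + real ll)) \<in> {1, -1}" unfolding e by (auto simp: power2_eq_1_iff)
  show "cis (pi / 2 * (2 * lad_al c + real ll)) = complex_of_real (cos (pi / 2 * (2 * lad_al c + real ll)))"
    unfolding e by (simp add: complex_eq_iff s)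
  have "complex_of_real lr = cis (- 2 * pi * lad_al c)" using cis_lad_al[OF r] Zc by (simp add: poly_Z)
  also have "\<dots> = cis (- 2 * pi * (- real ll / 2))"
    unfolding cis_neg_2pi_eq_iff using assms(2) m by (auto intro!: Ints_of_int[of m, THEN back_subst[of "\<lambda>x. x \<in> \<int>"]])
  also have "\<dots> = cis pi ^ ll" unfolding Complex.DeMoivre by (simp add: mult.commute)
  also have "\<dots> = complex_of_real ((-1) ^ ll)" by simp
  finally show "lr = (-1) ^ ll" by (simp only: of_real_eq_iff)
qed

lemma U_top: "\<exists>b\<in>U c. (Tr lr ^^ ll) b \<noteq> 0"
proof (rule ccontr)
  assume "\<not> ?thesis"
  then have z: "\<And>x. x \<in> U c \<Longrightarrow> (Tr lr ^^ ll) x = 0" by blast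
  have "Phi (Q c) \<in> U c \<times> U c" unfolding U_Times using H_HH(1) Phi_Q_in_H[of c 1] by auto
  then obtain x y where xy: "Phi (Q c) = (x, y)" "x \<in> U c" "y \<in> U c" by blast
  have "pact CM ([:- complex_of_real lr, 1:] ^ ll) (Phi (Q c)) = 0" unfolding xy(1) pact_Tr_power using z xy by (simp add: zero_prod_def)
  then have "pact CR (T c ^ ll) (Phi (Q c)) = 0" using pact_CM_linear_power[of c ll "Phi (Q c)"] unfolding Zc by simp
  moreover obtain et where et: "T c = [:- c, 1:] * et" "poly et c = (-1) ^ k * of_nat n * c ^ (n - 1)" by (rule T_eta)
  ultimately show False using chain_H(2)[OF r et(1)] eta_nonzero[OF r] et(2) by simp
qed

lemma subspace_eq_dim:
  assumes "subspace A" "subspace B" "A \<subseteq> B" "dim A = dim (B :: 'v set)" shows "A = B"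
proof -
  obtain BA where A: "finite BA" "independent BA" "span BA = A" "card BA = dim A" using fin_basis[OF assms(1)] .
  obtain BB where B: "finite BB" "independent BB" "span BB = B" "card BB = dim B" using fin_basis[OF assms(2)] .
  have "BA \<subseteq> span BB" using A(3) B(3) assms(3) span_base by blast
  then have "span BA = span BB" using real_vector.span_eq_of_card[OF B(1) A(2)] A(4) B(4) assms(4) by simp
  then show ?thesis using A(3) B(3) by simp
qed

text \<open>The form has the same sign at every w with nonzero top, so each such b generates a
  summand of the required type.\<close>

lemma U_Seif1_chain:
  assumes ev: "even i" "2 * lad_al c + real ll = real_of_int i" and b: "b \<in> U c" "(Tr lr ^^ ll) b \<noteq> 0"
  shows "Seif1 (poly Z c) (ll + 1) (cis (pi / 2 * (2 * lad_al c + real ll))) (chain lr ll b) L"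
proof -
  let ?eps = "cos (pi / 2 * (2 * lad_al c + real ll))"
  have e2: "?eps * (?eps * q) = q" for q using cos_eps(1)[OF ev] by auto
  have pos: "?eps * (lr ^ ll * L w ((Tr lr ^^ ll) w)) > 0" if wU: "w \<in> U c" and wz: "(Tr lr ^^ ll) w \<noteq> 0" for w
  proof -
    obtain q where q: "q > 0" "lr ^ ll * L w ((Tr lr ^^ ll) w) = ?eps * q" using L_T_U[OF wU] wz by blast
    show ?thesis unfolding q(2) e2 by (rule q(1))
  qed
  show ?thesis unfolding Zc cos_eps(2)[OF ev]
    by (rule Seif1_chain[OF U_base b cos_eps(3)[OF ev] cos_eps(1)[OF ev] pos])
qed

lemma U_real_Seif1:
  assumes re: "cnj c = c" and ev: "even i" "2 * lad_al c + real ll = real_of_int i"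
  shows "sum_of_copies (Seif1 (poly Z c) (ll + 1) (cis (pi / 2 * (2 * lad_al c + real ll)))) (U c) L"
proof -
  obtain b where b: "b \<in> U c" "(Tr lr ^^ ll) b \<noteq> 0" using U_top by blast
  note S = U_Seif1_chain[OF ev b]
  have "chain lr ll b = U c"
  proof (rule subspace_eq_dim)
    show "subspace (chain lr ll b)" by (rule chain_subspace[OF U_base])
    show "subspace (U c)" by (rule U_subspace)
    show "chain lr ll b \<subseteq> U c" by (rule chain_sub[OF U_base b(1)])
    show "dim (chain lr ll b) = dim (U c)" using S dim_U(1)[OF r re] unfolding Seif1_def Let_def by simp
  qed
  moreover have "seifert_pair (chain lr ll b) L"
    using S unfolding Seif1_def Let_def irreducible_S1_pair_def S1_seifert_pair_def by blast
  ultimately show ?thesis using S by (intro sum_of_copies_one) simp_all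
qed

text \<open>The real vector made from a complex multiple of the eigenvector. For non-real c these
  vectors form the kernel of T on \<open>U c\<close>, a real plane parametrised by the complex
  numbers.\<close>

definition rho :: "complex \<Rightarrow> 'v" where "rho al = fst (cscale al (Ev c) + cconj (cscale al (Ev c)))"

lemma rho_Pair: "(rho al, 0) = cscale al (Ev c) + cconj (cscale al (Ev c))"
  unfolding rho_def by (rule add_cconj[symmetric])

lemma rho_linear: "rho (complex_of_real s * a + complex_of_real t * b) = s *\<^sub>R rho a + t *\<^sub>R rho b"
  unfolding rho_def by (cases "Ev c") (simp add: cscale_def cconj_def algebra_simps)

context
  assumes ne: "cnj c \<noteq> c"
begin

lemma rho_eq_0: "rho al = 0 \<Longrightarrow> al = 0"
proof -
  assume "rho al = 0"
  then have z: "cscale al (Ev c) + cconj (cscale al (Ev c)) = 0" using rho_Pair[of al] by (simp add: zero_prod_def)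
  have a: "cscale al (Ev c) \<in> H c" by (rule cplx.subspace_scale[OF H_subspace Ev_in_H])
  have "cscale al (Ev c) = - cconj (cscale al (Ev c))" using z by (rule eq_neg_iff_add_eq_0[THEN iffD2])
  moreover have "- cconj (cscale al (Ev c)) \<in> H (cnj c)" by (rule cplx.subspace_neg[OF H_subspace cconj_H[OF a]])
  ultimately have "cscale al (Ev c) \<in> H c \<inter> H (cnj c)" using a by simp
  then have "cscale al (Ev c) = 0" using H_disjoint[OF ne[symmetric]] by blast
  then show ?thesis using Ev_nonzero[OF r] by simp
qed

text \<open>T kills the two conjugate components of x separately, as the blocks of c and its
  conjugate meet in 0, and \<open>H_eigenvector\<close> describes each.\<close>

lemma ker_rho:
  assumes x: "x \<in> U c" "Tr lr x = 0" shows "\<exists>al. x = rho al"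
proof -
  obtain a where a: "a \<in> H c" "(x, 0) = a + cconj a" using U_conj_decomp[OF ne x(1)] by blast
  let ?X = "[:- complex_of_real lr, 1:]"
  have "pact CM ?X (x, 0) = (Tr lr x, Tr lr 0)" unfolding cmap_Tr[symmetric] by simp
  then have "pact CM ?X (x, 0) = 0" using x(2) linear_0[OF lin_Tr] by (simp add: zero_prod_def)
  then have z: "pact CM ?X a + pact CM ?X (cconj a) = 0" unfolding a(2) clin.add[OF M.clin_pact] .
  have i1: "pact CM ?X a \<in> H c" unfolding pact_CM by (rule pact_H[OF a(1)])
  have i2: "pact CM ?X (cconj a) \<in> H (cnj c)" unfolding pact_CM by (rule pact_H[OF cconj_H[OF a(1)]])
  have "pact CM ?X a = - pact CM ?X (cconj a)" using z by (rule eq_neg_iff_add_eq_0[THEN iffD2])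
  then have "pact CM ?X a \<in> H (cnj c)" using cplx.subspace_neg[OF H_subspace i2] by simp
  then have "pact CM ?X a = 0" using i1 H_disjoint[OF ne[symmetric]] by blast
  then obtain g where "a = cscale g (Ev c)" using H_eigenvector[OF r a(1)] unfolding Zc by blast
  then have "(x, 0::'v) = (rho g, 0)" using a(2) unfolding rho_Pair by simp
  then show ?thesis by blast
qed

text \<open>T^l sends the generator \<open>Phi (Q c)\<close> to a nonzero multiple g of
  \<open>Ev c\<close>; the witness is the real vector made from the generator scaled by al /
  g.\<close>

lemma rho_top: "\<exists>y\<in>U c. (Tr lr ^^ ll) y = rho al"
proof -
  let ?X = "[:- complex_of_real lr, 1:]"
  obtain et where et: "T c = [:- c, 1:] * et" "poly et c = (-1) ^ k * of_nat n * c ^ (n - 1)" by (rule T_eta)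
  have ec: "poly et c \<noteq> 0" using et(2) eta_nonzero[OF r] by simp
  let ?g = "poly (et ^ ll) c"
  have g: "?g \<noteq> 0" using ec by (simp add: poly_power)
  have "pact CM (?X ^ ll) (Phi (Q c)) = pact CR (T c ^ ll) (Phi (Q c))" using pact_CM_linear_power[of c ll] unfolding Zc by blast
  also have "\<dots> = Phi ([:- c, 1:] ^ ll * Q c * et ^ ll)" unfolding pact_Phi et(1) power_mult_distrib by (simp only: mult_ac)
  also have "\<dots> = cscale ?g (Ev c)" by (rule Phi_top[OF r])
  finally have top: "pact CM (?X ^ ll) (Phi (Q c)) = cscale ?g (Ev c)" .
  let ?a = "cscale (al / ?g) (Phi (Q c))"
  have a: "?a \<in> H c" using cplx.subspace_scale[OF H_subspace] Phi_Q_in_H[of c 1] by simp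
  obtain y where y: "(y, 0) = ?a + cconj ?a" using add_cconj[of ?a] by metis
  have "?a + cconj ?a \<in> HH c" unfolding HH_def using a cconj_H[OF a] by blast
  then have yU: "y \<in> U c" unfolding U_eq y[symmetric] by blast
  have pa: "pact CM (?X ^ ll) ?a = cscale al (Ev c)" unfolding clin.scale[OF M.clin_pact] top using g by simp
  have "cconj (pact CM (?X ^ ll) ?a) = pact CM (?X ^ ll) (cconj ?a)"
    unfolding pact_cconj[OF lin_M] map_poly_cnj_linear_power by simp
  then have "pact CM (?X ^ ll) (y, 0) = (rho al, 0)" unfolding y rho_Pair clin.add[OF M.clin_pact] pa by simp
  then have "(Tr lr ^^ ll) y = rho al" unfolding pact_Tr_power by simp
  then show ?thesis using yU by blast
qed

lemma top_rho: assumes "x \<in> U c" shows "\<exists>al. (Tr lr ^^ ll) x = rho al"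
proof (rule ker_rho)
  show "(Tr lr ^^ ll) x \<in> U c" by (rule T_inv[OF U_base U_M_inv assms])
  show "Tr lr ((Tr lr ^^ ll) x) = 0" using nilU[OF assms] by simp
qed

lemma chain_top_multiple:
  assumes "w \<in> chain lr ll b" "b \<in> U c" shows "\<exists>t. (Tr lr ^^ ll) w = t *\<^sub>R (Tr lr ^^ ll) b"
proof -
  obtain g where g: "w = (\<Sum>i\<le>ll. g i *\<^sub>R (Tr lr ^^ i) b)" using chain_elim[OF U_base assms(1)] by blast
  have "(Tr lr ^^ ll) w = (\<Sum>j\<le>ll. g j *\<^sub>R (Tr lr ^^ (ll + j)) b)"
    unfolding g linear_sum[OF lin_Tr_pow] linear_scale[OF lin_Tr_pow] by (simp add: funpow_add)
  also have "\<dots> = (\<Sum>j\<in>{0}. g j *\<^sub>R (Tr lr ^^ (ll + j)) b)"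
    by (rule sum.mono_neutral_right) (use T_big[OF U_base assms(2)] in auto)
  finally show ?thesis by auto
qed

text \<open>Two chains fill \<open>U c\<close>: one from a vector with top \<open>rho 1\<close>, the
  other from a vector whose top is \<open>rho\<close> of the imaginary unit, made orthogonal to the
  first chain.\<close>

lemma U_even_Seif1:
  assumes ev: "even i" "2 * lad_al c + real ll = real_of_int i"
  shows "sum_of_copies (Seif1 (poly Z c) (ll + 1) (cis (pi / 2 * (2 * lad_al c + real ll)))) (U c) L"
proof -
  obtain b1 where b1: "b1 \<in> U c" "(Tr lr ^^ ll) b1 = rho 1" using rho_top by blast
  have t1: "(Tr lr ^^ ll) b1 \<noteq> 0" using rho_eq_0[of 1] b1(2) by auto
  note S1 = U_Seif1_chain[OF ev b1(1) t1]
  let ?W1 = "chain lr ll b1"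
  obtain x where x: "x \<in> U c" "(Tr lr ^^ ll) x = rho \<i>" using rho_top by blast
  have Lb: "L b1 ((Tr lr ^^ ll) b1) \<noteq> 0"
  proof -
    obtain q where q: "q > 0" "lr ^ ll * L b1 ((Tr lr ^^ ll) b1) = cos (pi / 2 * (2 * lad_al c + real ll)) * q"
      using L_T_U[OF b1(1)] t1 by blast
    moreover have "cos (pi / 2 * (2 * lad_al c + real ll)) \<noteq> 0" using cos_eps(1)[OF ev] by auto
    ultimately have "lr ^ ll * L b1 ((Tr lr ^^ ll) b1) \<noteq> 0" by simp
    then show ?thesis by simp
  qed
  obtain w where w: "w \<in> ?W1" "\<forall>y\<in>?W1. L (x - w) y = 0"
    using chain_project[OF U_base b1(1) t1 Lb, of x] by blast
  have W1U: "?W1 \<subseteq> U c" by (rule chain_sub[OF U_base b1(1)])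
  let ?b2 = "x - w"
  have b2: "?b2 \<in> U c" using subspace_diff[OF U_subspace x(1)] w(1) W1U by blast
  \<comment> \<open>Subtracting w changes the top by a real multiple of \<open>rho 1\<close>, which
    cannot cancel \<open>rho\<close> of the imaginary unit.\<close>
  have t2: "(Tr lr ^^ ll) ?b2 \<noteq> 0"
  proof
    assume z: "(Tr lr ^^ ll) ?b2 = 0"
    obtain t where t: "(Tr lr ^^ ll) w = t *\<^sub>R (Tr lr ^^ ll) b1" using chain_top_multiple[OF w(1) b1(1)] by blast
    have "0 = rho \<i> - t *\<^sub>R rho 1" using z unfolding linear_diff[OF lin_Tr_pow] t x(2) b1(2) by simp
    also have "\<dots> = rho (complex_of_real 1 * \<i> + complex_of_real (- t) * 1)" unfolding rho_linear by simp
    finally have "\<i> - complex_of_real t = 0" using rho_eq_0[of "complex_of_real 1 * \<i> + complex_of_real (- t) * 1"] by simp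
    then show False by (simp add: complex_eq_iff)
  qed
  note S2 = U_Seif1_chain[OF ev b2 t2]
  let ?W2 = "chain lr ll ?b2"
  have W2U: "?W2 \<subseteq> U c" by (rule chain_sub[OF U_base b2])
  have orth: "L y z = 0 \<and> L z y = 0" if "y \<in> ?W2" "z \<in> ?W1" for y z
    using chain_orth[OF U_base b1(1) t1 b2 w(2) that] .
  have sp: "seifert_pair ?W1 L" "seifert_pair ?W2 L"
    using S1 S2 unfolding Seif1_def Let_def irreducible_S1_pair_def S1_seifert_pair_def by blast+
  have int: "?W1 \<inter> ?W2 \<subseteq> {0}"
  proof
    fix z assume z: "z \<in> ?W1 \<inter> ?W2"
    then have "\<forall>y\<in>?W1. L z y = 0" using orth by blast
    then show "z \<in> {0}" using sp(1) z unfolding seifert_pair_def by blast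
  qed
  have sum: "{y + z | y z. y \<in> ?W1 \<and> z \<in> ?W2} = U c"
  proof (rule subspace_eq_dim)
    show "subspace {y + z | y z. y \<in> ?W1 \<and> z \<in> ?W2}" by (rule subspace_sums[OF chain_subspace[OF U_base] chain_subspace[OF U_base]])
    show "subspace (U c)" by (rule U_subspace)
    show "{y + z | y z. y \<in> ?W1 \<and> z \<in> ?W2} \<subseteq> U c" using W1U W2U subspace_add[OF U_subspace] by blast
    obtain B1 where B1: "finite B1" "independent B1" "span B1 = ?W1" "card B1 = dim ?W1" using fin_basis[OF chain_subspace[OF U_base]] .
    obtain B2 where B2: "finite B2" "independent B2" "span B2 = ?W2" "card B2 = dim ?W2" using fin_basis[OF chain_subspace[OF U_base]] .
    have i: "span B1 \<inter> span B2 \<subseteq> {0}" unfolding B1(3) B2(3) by (rule int)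
    note b = real_vector.direct_sum_basis[OF B1(1,2) B2(1,2) i]
    have "dim {y + z | y z. y \<in> ?W1 \<and> z \<in> ?W2} = card (B1 \<union> B2)"
      using real_vector.dim_span_eq_card_independent[OF b(1)] unfolding b(3) B1(3) B2(3) .
    also have "\<dots> = dim ?W1 + dim ?W2" unfolding b(2) B1(4) B2(4) ..
    also have "\<dots> = 2 * Suc ll" using S1 S2 unfolding Seif1_def Let_def by simp
    finally show "dim {y + z | y z. y \<in> ?W1 \<and> z \<in> ?W2} = dim (U c)" using dim_U(2)[OF r ne] by simp
  qed
  let ?W = "\<lambda>i::nat. if i = 0 then ?W1 else ?W2"
  have "direct_sum {..<2::nat} ?W (U c)"
    unfolding sum[symmetric] by (rule direct_sum_two[OF subspace_neg[OF chain_subspace[OF U_base]] int])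
  then have "seifert_decomp (U c) L {..<2::nat} ?W"
    unfolding seifert_decomp_def using sp orth by auto
  moreover have "\<forall>i<2. Seif1 (poly Z c) (ll + 1) (cis (pi / 2 * (2 * lad_al c + real ll))) (?W i) L"
    using S1 S2 by simp
  ultimately show ?thesis unfolding sum_of_copies_def by blast
qed

text \<open>The form B(u, v) = L u (T^l v) is alternating on \<open>U c\<close>. In a splitting both
  parts contain kernel vectors x0 and x1 of T, and some z in the first part has L z x0 nonzero. As B
  is alternating, T^l z is no real multiple of x0; so x0 and T^l z span the kernel plane inside the
  first part, which then contains x1.\<close>

lemma U_odd_irreducible:
  assumes Lz: "\<And>w. w \<in> U c \<Longrightarrow> L w ((Tr lr ^^ ll) w) = 0"
  shows "irreducible_S1_pair (U c) L"
  unfolding irreducible_S1_pair_def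
proof (intro conjI notI)
  let ?T = "Tr lr ^^ ll"
  show "S1_seifert_pair (U c) L" by (rule S1_pair[OF U_M_inv U_nondegenerate[OF up r]])
  show False if "U c = {0}" using dim_U(2)[OF r ne] that real_vector.dim_span[of "{} :: 'v set"] real_vector.dim_eq_card_independent[OF real_vector.independent_empty, where ?'a = 'v] by simp
  assume "\<exists>W. seifert_decomp (U c) L {..<2::nat} W \<and> W 0 \<noteq> {0} \<and> W 1 \<noteq> {0}"
  then obtain W where D: "seifert_decomp (U c) L {..<2::nat} W" and W: "W 0 \<noteq> {0}" "W 1 \<noteq> {0}" by blast
  have Wi: "M_inv (W i)" "W i \<subseteq> U c" "subspace (W i)" if "i < 2" for i
    using decomp_M_inv[OF U_M_inv D that] decomp_subset[OF D that] unfolding M_inv_def by blast+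
  have kerx: "\<exists>x\<in>W i. x \<noteq> 0 \<and> Tr lr x = 0" if i: "i < 2" "W i \<noteq> {0}" for i
  proof -
    obtain x where x: "x \<in> W i" "x \<noteq> 0" using i(2) subspace_0[OF Wi(3)[OF i(1)]] by blast
    have "(Tr lr ^^ Suc ll) x = 0" using nilU x(1) Wi(2)[OF i(1)] by blast
    then have ex: "\<exists>m. (Tr lr ^^ m) x = 0" by blast
    define m where "m = (LEAST m. (Tr lr ^^ m) x = 0)"
    have m: "(Tr lr ^^ m) x = 0" unfolding m_def by (rule LeastI_ex[OF ex])
    have "m \<noteq> 0" using m x(2) by (metis funpow_0)
    then obtain j where j: "m = Suc j" by (metis not0_implies_Suc)
    have "(Tr lr ^^ j) x \<noteq> 0" using not_less_Least[of j "\<lambda>m. (Tr lr ^^ m) x = 0"] j unfolding m_def by simp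
    moreover have "Tr lr ((Tr lr ^^ j) x) = 0" using m j by simp
    ultimately show ?thesis using T_inv[OF U_base Wi(1)[OF i(1)] x(1)] by blast
  qed
  obtain x0 where x0: "x0 \<in> W 0" "x0 \<noteq> 0" "Tr lr x0 = 0" using kerx[of 0] W(1) by auto
  obtain x1 where x1: "x1 \<in> W 1" "x1 \<noteq> 0" "Tr lr x1 = 0" using kerx[of 1] W(2) by auto
  obtain a0 where a0: "x0 = rho a0" using ker_rho x0 Wi(2)[of 0] by auto
  obtain a1 where a1: "x1 = rho a1" using ker_rho x1 Wi(2)[of 1] by auto
  obtain y where y: "y \<in> U c" "?T y = x0" using rho_top a0 by blast
  obtain y0 y1 where yy: "y = y0 + y1" "y0 \<in> W 0" "y1 \<in> W 1" using decomp_sum[OF D y(1)] by blast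
  \<comment> \<open>The element x0 - T^l y0 of the first part equals T^l y1 in the second part,
    hence is zero.\<close>
  have Ty: "?T y0 = x0"
  proof -
    have "x0 - ?T y0 = ?T y1" using y(2) unfolding yy(1) linear_add[OF lin_Tr_pow] by (simp add: algebra_simps)
    moreover have "x0 - ?T y0 \<in> W 0" using subspace_diff[OF Wi(3)[of 0] x0(1)] T_inv[OF U_base Wi(1)[of 0] yy(2)] by simp
    moreover have "?T y1 \<in> W 1" using T_inv[OF U_base Wi(1)[of 1] yy(3)] by simp
    ultimately have "x0 - ?T y0 = 0" using decomp_disjoint[OF D] by simp
    then show ?thesis by simp
  qed
  have sk: "L u (?T v) = - L v (?T u)" if "u \<in> U c" "v \<in> U c" for u v
  proof -
    have "L (u + v) (?T (u + v)) = 0" using Lz subspace_add[OF U_subspace that] by blast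
    then show ?thesis using Lz[OF that(1)] Lz[OF that(2)]
      by (simp add: linear_add[OF lin_Tr_pow] bilinear_ladd[OF bil] bilinear_radd[OF bil])
  qed
  have y0U: "y0 \<in> U c" using yy(2) Wi(2)[of 0] by auto
  have "\<exists>z\<in>W 0. L z x0 \<noteq> 0"
  proof (rule ccontr)
    assume "\<not> ?thesis"
    then have "L z x0 = 0" if "z \<in> W 0" for z using that by blast
    then have "L x0 z = 0" if "z \<in> W 0" for z
      using L_M[of z x0] Wi(1)[of 0] that unfolding M_inv_def by force
    moreover have "seifert_pair (W 0) L" using D unfolding seifert_decomp_def by auto
    ultimately have "x0 = 0" using x0(1) unfolding seifert_pair_def by blast
    then show False using x0(2) by blast
  qed
  then obtain z where z: "z \<in> W 0" "L z x0 \<noteq> 0" by blast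
  have zU: "z \<in> U c" using z(1) Wi(2)[of 0] by auto
  obtain a2 where a2: "?T z = rho a2" using top_rho[OF zU] by blast
  have a0n: "a0 \<noteq> 0"
  proof
    assume "a0 = 0"
    then have "x0 = 0" unfolding a0 rho_def by simp
    then show False using x0(2) by blast
  qed
  \<comment> \<open>This determinant is nonzero when a0 and a2 are independent over the reals;
    otherwise T^l z would be a real multiple of x0.\<close>
  have "Im (cnj a0 * a2) \<noteq> 0"
  proof
    assume im: "Im (cnj a0 * a2) = 0"
    define q where "q = Re (cnj a0 * a2)"
    define s where "s = (cmod a0)\<^sup>2"
    define t where "t = q / s"
    have s0: "s \<noteq> 0" unfolding s_def using a0n by simp
    have "cnj a0 * a2 = complex_of_real q" using im unfolding q_def by (simp add: complex_eq_iff)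
    then have "(cnj a0 * a0) * a2 = complex_of_real q * a0" by (metis mult.assoc mult.commute)
    moreover have "cnj a0 * a0 = complex_of_real s" unfolding s_def using complex_norm_square[of a0] by (simp add: mult.commute)
    ultimately have "complex_of_real s * a2 = complex_of_real q * a0" by simp
    then have "a2 = complex_of_real t * a0 + complex_of_real 0 * 0" using s0 by (simp add: t_def field_simps)
    then have Tz: "?T z = t *\<^sub>R x0" unfolding a2 a0 using rho_linear[of t a0 0 0] by simp
    have "L z x0 = - L y0 (?T z)" using sk[OF zU y0U] unfolding Ty .
    also have "\<dots> = - t * L y0 (?T y0)" unfolding Tz Ty by (simp add: bilinear_rmul[OF bil])
    also have "\<dots> = 0" using Lz[OF y0U] by simp
    finally show False using z(2) by blast
  qed
  then obtain s t where st: "a1 = complex_of_real s * a0 + complex_of_real t * a2" using complex_real_basis by blast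
  have "x1 = s *\<^sub>R x0 + t *\<^sub>R ?T z" unfolding a1 st rho_linear a0 a2 ..
  moreover have "?T z \<in> W 0" using T_inv[OF U_base Wi(1)[of 0] z(1)] by simp
  ultimately have "x1 \<in> W 0" using subspace_add[OF Wi(3)[of 0]] subspace_scale[OF Wi(3)[of 0]] x0(1) by simp
  then show False using decomp_disjoint[OF D _ x1(1)] x1(2) by blast
qed

text \<open>For odd 2 alpha + l the phase is imaginary, so L w (T^l w) vanishes and the summand does
  not split. The eigenvalue is now (-1)^(l+1), the opposite parity.\<close>

lemma U_odd_Seif2:
  assumes od: "odd i" "2 * lad_al c + real ll = real_of_int i"
  shows "sum_of_copies (Seif2 (poly Z c) (ll + 1)) (U c) L"
proof -
  obtain m where m: "i = 2 * m + 1" using od(1) by (rule oddE)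
  have cz: "cos (pi / 2 * (2 * lad_al c + real ll)) = 0"
    unfolding od(2) m cos_zero_iff_int by (intro exI[of _ "2 * m + 1"]) simp
  have Lz: "L w ((Tr lr ^^ ll) w) = 0" if "w \<in> U c" for w
    using L_T_U[OF that] lr_pm unfolding cz by auto
  have irr: "irreducible_S1_pair (U c) L" by (rule U_odd_irreducible[OF Lz])
  have "complex_of_real lr = cis (- 2 * pi * lad_al c)" using cis_lad_al[OF r] Zc by (simp add: poly_Z)
  also have "\<dots> = cis (- 2 * pi * (- real (Suc ll) / 2))"
  proof -
    have "lad_al c - (- real (Suc ll) / 2) = real_of_int (m + 1)" using od(2) m by (simp add: field_simps)
    then have "lad_al c - (- real (Suc ll) / 2) \<in> \<int>" by (metis Ints_of_int)
    then show ?thesis unfolding cis_neg_2pi_eq_iff .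
  qed
  also have "\<dots> = cis pi ^ Suc ll" unfolding Complex.DeMoivre by (rule arg_cong[of _ _ cis]) (simp add: field_simps)
  finally have lam: "poly Z c = (-1) ^ Suc ll" unfolding Zc by simp
  have "Seif2 (poly Z c) (ll + 1) (U c) L" unfolding Seif2_def Let_def
  proof (intro conjI)
    show "poly Z c = 1 \<and> even (ll + 1) \<or> poly Z c = - 1 \<and> odd (ll + 1)" unfolding lam by (cases "even ll") auto
    show "irreducible_S1_pair (U c) L" by (rule irr)
    show "dim (U c) = 2 * (ll + 1)" using dim_U(2)[OF r ne] by simp
    have "gen_eigenspace (U c \<times> U c) (cmap (monodromy (U c) L)) (poly Z c) = gen_eigenspace (U c \<times> U c) CM (poly Z c)"
      by (rule gen_eigenspace_cong[OF U_monodromy[OF up r] M_inv_Times(2)[OF U_M_inv] csubspace_Times[OF U_subspace]])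
    also have "\<dots> = U c \<times> U c"
      unfolding M.gen_eigenspace_pact Zc using pact_nil[OF U_base] by blast
    finally show "gen_eigenspace (U c \<times> U c) (cmap (monodromy (U c) L)) (poly Z c) = U c \<times> U c" .
    have "cnj (poly Z c) = poly Z c" unfolding Zc by simp
    then show "jordan_blocks_on (U c \<times> U c) (cmap (monodromy (U c) L)) [(ll + 1, poly Z c), (ll + 1, poly Z c)]"
      using jordan_blocks_U[OF r ne U_monodromy[OF up r]] by simp
  qed
  moreover have "seifert_pair (U c) L"
    using irr unfolding irreducible_S1_pair_def S1_seifert_pair_def by blast
  ultimately show ?thesis by (rule sum_of_copies_one)
qed

end

end

end

section \<open>Summands with non-real monodromy eigenvalue\<close>

context hor_space
begin

lemma lam_cis: assumes "poly P c = 0" shows "poly Z c = cis (- 2 * pi * lad_al c)"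
  unfolding cis_lad_al[OF assms] by (simp add: poly_Z)

lemma lam_cnj: "poly Z (cnj c) = cnj (poly Z c)"
  by (simp add: poly_Z)

context
  fixes c :: complex
  assumes r: "poly P c = 0" and up: "upper c" and ne: "cnj c \<noteq> c"
    and ni: "2 * lad_al c + real (lad_l c) \<notin> \<int>"
begin

lemma lam_not_real: "poly Z c \<noteq> cnj (poly Z c)"
proof
  assume "poly Z c = cnj (poly Z c)"
  then have "Im (poly Z c) = 0" by (simp add: complex_eq_iff)
  then have "sin (- 2 * pi * lad_al c) = 0" unfolding lam_cis[OF r] by simp
  then obtain i :: int where i: "- 2 * pi * lad_al c = of_int i * pi" unfolding sin_zero_iff_int2 by blast
  have "pi * (2 * lad_al c) = pi * (- of_int i)" using i by (simp add: algebra_simps)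
  then have "2 * lad_al c = - of_int i" by (rule mult_left_cancel[OF pi_neq_zero, THEN iffD1])
  then have "2 * lad_al c + real (lad_l c) = of_int (int (lad_l c) - i)" by simp
  then show False using ni by (metis Ints_of_int)
qed

lemma G_disjoint: assumes "a \<in> G (poly Z c)" "a \<in> G (cnj (poly Z c))" shows "a = 0"
proof -
  let ?w = "\<lambda>x. if x = poly Z c then a else - a"
  have "- a \<in> G (cnj (poly Z c))" using G_scale[OF assms(2), of "-1"] by simp
  then have "\<forall>x\<in>{poly Z c, cnj (poly Z c)}. ?w x = 0"
    using lam_not_real assms(1) by (intro M.gen_eigenspace_indep[where X = UNIV]) auto
  then show ?thesis by auto
qed

lemma HH_G: assumes a: "a \<in> HH c" "a \<in> G (poly Z c)" shows "a \<in> H c"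
proof -
  obtain u v where uv: "a = u + v" "u \<in> H c" "v \<in> H (cnj c)" using a(1) unfolding HH_def by blast
  have sub: "cplx.subspace (G (poly Z c))" by (rule M.gen_eigenspace_subspace) simp
  have "u \<in> G (poly Z c)" using uv(2) H_subset_G by blast
  then have "a - u \<in> G (poly Z c)" by (rule cplx.subspace_diff[OF sub a(2)])
  then have "v \<in> G (poly Z c)" unfolding uv(1) by simp
  moreover have "v \<in> G (cnj (poly Z c))" using uv(3) H_subset_G[of "cnj c"] unfolding lam_cnj by blast
  ultimately have "v = 0" by (rule G_disjoint)
  then show ?thesis using uv by simp
qed

text \<open>It kills the complexified summand and has just the two eigenvalues as zeros. It serves
  to decompose inside an invariant subspace, where block components are not given in
  advance.\<close>

definition U_annihilator :: "complex poly" where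
  "U_annihilator = [:- poly Z c, 1:] ^ n * [:- cnj (poly Z c), 1:] ^ n"

lemma U_annihilator: "U_annihilator \<noteq> 0" "{x. poly U_annihilator x = 0} = {poly Z c, cnj (poly Z c)}"
  "a \<in> HH c \<Longrightarrow> pact CM U_annihilator a = 0"
proof -
  show "U_annihilator \<noteq> 0" unfolding U_annihilator_def by simp
  show "{x. poly U_annihilator x = 0} = {poly Z c, cnj (poly Z c)}"
    unfolding U_annihilator_def using n0 by (auto simp: poly_power)
  assume "a \<in> HH c"
  then obtain u v where uv: "a = u + v" "u \<in> H c" "v \<in> H (cnj c)" unfolding HH_def by blast
  have u: "pact CM ([:- poly Z c, 1:] ^ n) u = 0" using G_power_n uv(2) H_subset_G by blast
  have v: "pact CM ([:- cnj (poly Z c), 1:] ^ n) v = 0"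
    using G_power_n uv(3) H_subset_G[of "cnj c"] unfolding lam_cnj by blast
  have comm: "U_annihilator = [:- cnj (poly Z c), 1:] ^ n * [:- poly Z c, 1:] ^ n"
    unfolding U_annihilator_def by (rule mult.commute)
  have "pact CM U_annihilator u = 0" unfolding comm M.pact_mult u
    by (rule clin.zero[OF M.clin_pact])
  moreover have "pact CM U_annihilator v = 0" unfolding U_annihilator_def M.pact_mult v
    by (rule clin.zero[OF M.clin_pact])
  ultimately show "pact CM U_annihilator a = 0" unfolding uv(1) clin.add[OF M.clin_pact] by simp
qed

text \<open>The complexification of W splits into its parts for the two conjugate eigenvalues. The
  part for the eigenvalue of c is nonzero, and the last nonzero power of M minus this eigenvalue
  applied to it is an eigenvector in the block of c, hence a multiple of
  \<open>Ev c\<close>.\<close>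

lemma Ev_in_invariant:
  assumes W: "M_inv W" "W \<subseteq> U c" "W \<noteq> {0}"
  shows "Ev c \<in> W \<times> W"
proof -
  let ?X = "[:- poly Z c, 1:]"
  have sW: "subspace W" using W(1) unfolding M_inv_def by blast
  obtain x where x: "x \<in> W" "x \<noteq> 0" using W(3) subspace_0[OF sW] by blast
  have x0: "(x, 0) \<in> W \<times> W" using x(1) subspace_0[OF sW] by simp
  have WH: "W \<times> W \<subseteq> HH c" using W(2) unfolding U_Times[symmetric] by blast
  have "pact CM U_annihilator (x, 0) = 0" using U_annihilator(3) WH x0 by blast
  from M.gen_eigenspace_decomp[OF M_inv_Times[OF W(1)] U_annihilator(1) x0 this]
  obtain w where w: "\<And>z. poly U_annihilator z = 0 \<Longrightarrow> w z \<in> gen_eigenspace (W \<times> W) CM z"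
    "(x, 0) = (\<Sum>z\<in>{z. poly U_annihilator z = 0}. w z)" by blast
  have w1: "w (poly Z c) \<in> gen_eigenspace (W \<times> W) CM (poly Z c)"
    and w2: "w (cnj (poly Z c)) \<in> gen_eigenspace (W \<times> W) CM (cnj (poly Z c))"
    using w(1) U_annihilator(2) by blast+
  have xs: "(x, 0) = w (poly Z c) + w (cnj (poly Z c))"
    using w(2) lam_not_real unfolding U_annihilator(2) by simp
  define a where "a = w (poly Z c)"
  have gG: "gen_eigenspace (W \<times> W) CM z \<subseteq> G z" for z unfolding gen_eigenspace_def by blast
  have aW: "a \<in> W \<times> W" using w1 unfolding a_def gen_eigenspace_def by blast
  have aG: "a \<in> G (poly Z c)" using w1 gG unfolding a_def by blast
  have aH: "a \<in> H c" using HH_G aW WH aG by blast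
  \<comment> \<open>If this part were zero, x would lie in the space of the conjugate eigenvalue
    and, being real, in that of the eigenvalue too.\<close>
  have an: "a \<noteq> 0"
  proof
    assume "a = 0"
    then have "(x, 0) = w (cnj (poly Z c))" using xs unfolding a_def by simp
    then have g: "(x, 0) \<in> G (cnj (poly Z c))" using w2 gG by auto
    then have "(x, 0) \<in> G (poly Z c)" using cconj_G[OF g] by (simp add: cconj_def)
    then have "(x, 0::'v) = 0" using g by (rule G_disjoint)
    then show False using x(2) by (simp add: zero_prod_def)
  qed
  have ex: "\<exists>m. pact CM (?X ^ m) a = 0" using G_power_n[OF aG] by blast
  define m where "m = (LEAST m. pact CM (?X ^ m) a = 0)"
  have m: "pact CM (?X ^ m) a = 0" unfolding m_def by (rule LeastI_ex[OF ex])
  have "m \<noteq> 0"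
  proof
    assume "m = 0"
    then show False using m an by simp
  qed
  then obtain j where j: "m = Suc j" by (metis not0_implies_Suc)
  define b where "b = pact CM (?X ^ j) a"
  have bn: "b \<noteq> 0" using not_less_Least[of j "\<lambda>m. pact CM (?X ^ m) a = 0"] j unfolding m_def b_def by simp
  have bz: "pact CM ?X b = 0" using m unfolding j b_def power_Suc M.pact_mult .
  have bW: "b \<in> W \<times> W" unfolding b_def by (rule M_inv_pact[OF W(1) aW])
  have bH: "b \<in> H c" unfolding b_def pact_CM by (rule pact_H[OF aH])
  obtain g where g: "b = cscale g (Ev c)" using H_eigenvector[OF r bH bz] by blast
  have "g \<noteq> 0"
  proof
    assume "g = 0"
    then show False using bn g by simp
  qed
  then have "Ev c = cscale (1 / g) b" unfolding g by simp
  then show ?thesis using cplx.subspace_scale[OF csubspace_Times[OF sW] bW] by simp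
qed

lemma U_irreducible: "irreducible_S1_pair (U c) L"
proof -
  \<comment> \<open>Every nonzero invariant subspace contains both the real and the imaginary part
    of the eigenvector; one of them is nonzero.\<close>
  define z where "z = (if fst (Ev c) \<noteq> 0 then fst (Ev c) else snd (Ev c))"
  have "Ev c \<in> U c \<times> U c" unfolding U_Times using H_HH(1) Ev_in_H by blast
  then have zU: "z \<in> U c" unfolding z_def by (auto simp: mem_Times_iff)
  have zn: "z \<noteq> 0" using Ev_nonzero[OF r] unfolding z_def by (auto simp: prod_eq_iff)
  show ?thesis
  proof (rule irreducibleI[OF U_M_inv U_nondegenerate[OF up r] zU zn])
    fix W assume "M_inv W" "W \<subseteq> U c" "W \<noteq> {0}"
    then have "Ev c \<in> W \<times> W" by (rule Ev_in_invariant)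
    then show "z \<in> W" unfolding z_def by (auto simp: mem_Times_iff)
  qed
qed

lemma U_Seif2z:
  "sum_of_copies (Seif2z (poly Z c) (lad_l c + 1) (cis (pi / 2 * (2 * lad_al c + real (lad_l c))))) (U c) L"
proof -
  let ?l = "lad_l c" and ?lam = "poly Z c" and ?zeta = "cis (pi / 2 * (2 * lad_al c + real (lad_l c)))"
  let ?M = "cmap (monodromy (U c) L)" and ?N = "nilpotent_part (U c) (monodromy (U c) L)"
  note nd = U_nondegenerate[OF up r]
  have ge: "gen_eigenspace (U c \<times> U c) ?M = gen_eigenspace (U c \<times> U c) CM"
    by (rule ext) (rule gen_eigenspace_cong[OF U_monodromy[OF up r] M_inv_Times(2)[OF U_M_inv] csubspace_Times[OF U_subspace]])
  have "Seif2z ?lam (?l + 1) ?zeta (U c) L" unfolding Seif2z_def Let_def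
  proof (intro conjI ballI)
    show "cmod ?lam = 1" unfolding lam_cis[OF r] by simp
    show "cmod ?zeta = 1" by simp
    show "?lam \<noteq> 1" "?lam \<noteq> -1" using lam_not_real by auto
    \<comment> \<open>Squaring the phase gives e^(2 pi i alpha) e^(pi i l), whose first factor is
      the conjugate of the eigenvalue.\<close>
    have "?zeta\<^sup>2 = cis (2 * pi * lad_al c + real ?l * pi)"
      unfolding Complex.DeMoivre by (rule arg_cong[of _ _ cis]) (simp add: field_simps)
    also have "\<dots> = cis (2 * pi * lad_al c) * cis pi ^ ?l" unfolding Complex.DeMoivre cis_mult ..
    also have "cis (2 * pi * lad_al c) = cnj ?lam" unfolding lam_cis[OF r] cis_cnj by simp
    finally show "?zeta\<^sup>2 = cnj ?lam * (- 1) ^ (?l + 1 + 1)" by simp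
    show "irreducible_S1_pair (U c) L" by (rule U_irreducible)
    show "dim (U c) = 2 * (?l + 1)" using dim_U(2)[OF r ne] by simp
    show "direct_sum {?lam, cnj ?lam} (gen_eigenspace (U c \<times> U c) ?M) (U c \<times> U c)" unfolding ge
    proof (rule M.direct_sum_gen_eigenspace[OF M_inv_Times[OF U_M_inv]])
      show "finite {?lam, cnj ?lam}" by (intro finite.intros)
      show "U_annihilator \<noteq> 0" by (rule U_annihilator)
      show "\<And>a. a \<in> U c \<times> U c \<Longrightarrow> pact CM U_annihilator a = 0" unfolding U_Times by (rule U_annihilator(3))
      show "{x. poly U_annihilator x = 0} \<subseteq> {?lam, cnj ?lam}" unfolding U_annihilator(2) ..
    qed
    show "jordan_blocks_on (U c \<times> U c) ?M [(?l + 1, ?lam), (?l + 1, cnj ?lam)]"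
      using jordan_blocks_U[OF r ne U_monodromy[OF up r]] by simp
    fix a assume a: "a \<in> gen_eigenspace (U c \<times> U c) ?M ?lam - cmap ?N ` (U c \<times> U c)"
    let ?d = "dim (U c)"
    have d: "?d \<ge> 1" using dim_U(2)[OF r ne] by simp
    have Np: "(cmap ?N ^^ j) b = (cmap (Nd ?d) ^^ j) b" if "b \<in> U c \<times> U c" for b j
      using that nilpotent_part_monodromy_pow[OF U_M_inv nd] by (cases b) (simp add: cmap_funpow)
    have aU: "a \<in> HH c" using a unfolding ge gen_eigenspace_def U_Times by blast
    have "a \<in> G ?lam" using a unfolding ge gen_eigenspace_def by blast
    then have aH: "a \<in> H c" by (rule HH_G[OF aU])
    have "a \<notin> cmap (Nd ?d) ` H c"
    proof
      assume "a \<in> cmap (Nd ?d) ` H c"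
      then obtain b where b: "b \<in> H c" "a = cmap (Nd ?d) b" by blast
      have bU: "b \<in> U c \<times> U c" using b(1) H_HH(1) unfolding U_Times by blast
      have "a = cmap ?N b" using Np[OF bU, of 1] b(2) by simp
      then show False using a bU by blast
    qed
    from polar[OF r d aH this] obtain s where s: "s > 0"
      "cbil L a ((cmap (Nd ?d) ^^ ?l) (cconj a)) = ?zeta * complex_of_real s" by blast
    have "cconj a \<in> U c \<times> U c" unfolding U_Times by (rule cconj_HH[OF aU])
    then have "(cmap ?N ^^ (?l + 1 - 1)) (cconj a) = (cmap (Nd ?d) ^^ ?l) (cconj a)" using Np by simp
    then show "\<exists>s>0. cbil L a ((cmap ?N ^^ (?l + 1 - 1)) (cconj a)) = ?zeta * complex_of_real s"
      using s by auto
  qed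
  moreover have "seifert_pair (U c) L"
    using U_irreducible unfolding irreducible_S1_pair_def S1_seifert_pair_def by blast
  ultimately show ?thesis by (rule sum_of_copies_one)
qed

end

end

section \<open>The polarized enhancement\<close>

lemma size_spp_ladder: "size (spp_ladder al m l) = l + 1"
  by (simp add: spp_ladder_def)

lemma size_spp_partner: "size (spp_partner al m l) = l + 1"
  unfolding spp_partner_def by (rule size_spp_ladder)

context hor_space
begin

lemma ladder_partner:
  assumes "poly P c = 0" shows "hor_ladder k S (cnj c) = spp_partner (lad_al c) 1 (lad_l c)"
  unfolding hor_ladder_def spp_partner_def lad_l_cnj[OF assms] lad_al_cnj[OF assms] by simp

lemma ladder_single:
  assumes "poly P c = 0" "c \<in> {1, -1}" shows "single_ladder (lad_al c) 1 (lad_l c)"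
  using ladder_partner[OF assms(1)] unfolding cnj_pm[OF assms(2)] hor_ladder_def single_ladder_def .

abbreviation "Jroots \<equiv> {c. cmod c = 1 \<and> (c \<in> {1, -1} \<or> Im c > 0) \<and> H c \<noteq> {0}}"
abbreviation "J_ladders \<equiv> (\<lambda>c. if c \<in> {1, -1} then hor_ladder k S c
                    else hor_ladder k S c + hor_ladder k S (cnj c))"

lemma JrootsD: assumes "c \<in> Jroots" shows "upper c" "poly P c = 0" "c \<notin> {1, -1} \<Longrightarrow> cnj c \<noteq> c"
  using assms unfolding upper_def H_nonzero_iff by (auto simp: complex_eq_iff)

lemma finite_Jroots: "finite Jroots"
  by (rule finite_subset[OF _ finite_roots]) (use JrootsD(2) in blast)

text \<open>The zeros are the indices together with the conjugates of the non-real ones, so the sum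
  over zeros is regrouped by conjugate pairs.\<close>

lemma Spp_Jroots: "hor_Spp k S = (\<Sum>c\<in>Jroots. J_ladders c)"
proof -
  let ?f = "hor_ladder k S" and ?K = "{c \<in> Jroots. c \<notin> {1, -1}}"
  have KIm: "Im c > 0" if "c \<in> ?K" for c using that by blast
  have JIm: "Im c \<ge> 0" if "c \<in> Jroots" for c using upper_Im[OF JrootsD(1)[OF that]] .
  have "c \<in> Jroots \<union> cnj ` ?K" if c: "poly P c = 0" for c
  proof (cases "Im c < 0")
    case True
    then have im: "Im (cnj c) > 0" by simp
    have "x \<notin> {1, -1}" if "Im x > 0" for x :: complex using that by auto
    then have "cnj c \<notin> {1, -1}" using im by blast
    moreover have "cmod (cnj c) = 1" using root_norm[OF c] by simp
    moreover have "H (cnj c) \<noteq> {0}" unfolding H_nonzero_iff by (rule root_cnj[OF c])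
    ultimately have "cnj c \<in> ?K" using im by blast
    then have "cnj (cnj c) \<in> cnj ` ?K" by (rule imageI)
    then show ?thesis unfolding complex_cnj_cnj by (rule UnI2)
  next
    case False
    then have "c \<in> {1, -1} \<or> Im c > 0" using norm_1_real[OF root_norm[OF c]] by fastforce
    then show ?thesis using root_norm[OF c] H_nonzero_iff[of c] c by blast
  qed
  moreover have "poly P c = 0" if "c \<in> Jroots \<union> cnj ` ?K" for c using that JrootsD(2) root_cnj by blast
  ultimately have roots: "{c. poly P c = 0} = Jroots \<union> cnj ` ?K" by blast
  have disj: "Jroots \<inter> cnj ` ?K = {}"
  proof -
    have False if x: "x \<in> Jroots" "x \<in> cnj ` ?K" for x
    proof -
      obtain y where y: "y \<in> ?K" "x = cnj y" using x(2) by blast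
      have "Im x < 0" unfolding y(2) using KIm[OF y(1)] by simp
      then show False using JIm[OF x(1)] by linarith
    qed
    then show ?thesis by blast
  qed
  have finK: "finite ?K" by (rule finite_subset[OF _ finite_Jroots]) blast
  have "hor_Spp k S = sum ?f {c. poly P c = 0}" unfolding hor_Spp_def hor_poly_S ..
  also have "\<dots> = sum ?f Jroots + sum ?f (cnj ` ?K)"
    unfolding roots by (rule sum.union_disjoint[OF finite_Jroots finite_imageI[OF finK] disj])
  also have "sum ?f (cnj ` ?K) = (\<Sum>c\<in>?K. ?f (cnj c))"
    by (subst sum.reindex) (auto intro: inj_onI)
  also have "\<dots> = (\<Sum>c\<in>Jroots. if c \<notin> {1, -1} then ?f (cnj c) else {#})"
    by (rule sum.inter_filter[OF finite_Jroots])
  also have "sum ?f Jroots + \<dots> = (\<Sum>c\<in>Jroots. J_ladders c)"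
    unfolding sum.distrib[symmetric] by (rule sum.cong) auto
  finally show ?thesis .
qed

lemma lam_real:
  assumes r: "poly P c = 0" and i: "2 * lad_al c + real (lad_l c) = real_of_int i"
  shows "\<exists>lr. poly Z c = complex_of_real lr"
proof -
  have "- 2 * pi * lad_al c = of_int (int (lad_l c) - i) * pi"
  proof -
    have al: "2 * lad_al c = real_of_int i - real (lad_l c)" using i by simp
    have "- 2 * pi * lad_al c = - pi * (2 * lad_al c)" by simp
    also have "\<dots> = of_int (int (lad_l c) - i) * pi" unfolding al by (simp add: algebra_simps)
    finally show ?thesis .
  qed
  then have "sin (- 2 * pi * lad_al c) = 0" unfolding sin_zero_iff_int2 by blast
  then have "poly Z c = complex_of_real (cos (- 2 * pi * lad_al c))"
    unfolding lam_cis[OF r] by (simp add: complex_eq_iff)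
  then show ?thesis by blast
qed

lemma polarized: "polarized_enhancement 1 UNIV L Jroots U J_ladders"
  unfolding polarized_enhancement_def
proof (intro exI conjI ballI)
  let ?z = "\<lambda>c. cis (pi / 2 * (2 * lad_al c + real (lad_l c)))"
  have d: "2 * lad_al c + real (lad_l c) + 1 - of_int 1 = 2 * lad_al c + real (lad_l c)" for c by simp
  show "let d = 2 * lad_al c + real (lad_l c) + 1 - of_int 1 in \<not> is_odd_int d \<longrightarrow> ?z c = cis (pi / 2 * d)" for c
    unfolding d Let_def by simp
  show "enhancement 1 UNIV L Jroots U J_ladders lad_al lad_l ?z"
    unfolding enhancement_def d
  proof (intro conjI ballI)
    show "S1_seifert_pair UNIV L" by (rule S1_pair_UNIV)
    show "seifert_decomp UNIV L Jroots U" by (rule decomp_c)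
    fix c assume c: "c \<in> Jroots"
    note up = JrootsD(1)[OF c] and r = JrootsD(2)[OF c] and ne = JrootsD(3)[OF c]
    let ?al = "lad_al c" and ?l = "lad_l c"
    \<comment> \<open>A zero 1 or -1 is its own conjugate, so its ladder is its own partner, and
      only the even case below can occur for it.\<close>
    have zero: "2 * ?al + real ?l = 0" if "c \<in> {1, -1}"
      using lad_al_cnj[OF r] unfolding cnj_pm[OF that] by simp
    show "ladder_copies ?al 1 ?l (J_ladders c)"
    proof (cases "c \<in> {1, -1}")
      case True
      then have "J_ladders c = repeat_mset 1 (spp_ladder ?al 1 ?l)" by (simp add: hor_ladder_def)
      then show ?thesis unfolding ladder_copies_def using ladder_single[OF r True] by blast
    next
      case False
      have J: "J_ladders c = spp_ladder ?al 1 ?l + spp_partner ?al 1 ?l"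
        using False ladder_partner[OF r] by (simp add: hor_ladder_def)
      show ?thesis
      proof (cases "2 * ?al + real ?l = 0")
        case True
        \<comment> \<open>A non-real zero can carry a single ladder as well; the conjugate zero then
          carries the same one, and the pair counts as two copies of it.\<close>
        have "real_of_int 1 - real ?l - 1 - ?al = ?al" using True by simp
        then have sp: "spp_partner ?al 1 ?l = spp_ladder ?al 1 ?l" unfolding spp_partner_def by simp
        have "J_ladders c = repeat_mset 2 (spp_ladder ?al 1 ?l)" unfolding J sp by (rule multiset_eqI) simp
        moreover have "single_ladder ?al 1 ?l" unfolding single_ladder_def sp ..
        ultimately show ?thesis unfolding ladder_copies_def by (metis one_le_numeral)
      next
        case nz: False
        have "J_ladders c = repeat_mset 1 (spp_ladder ?al 1 ?l + spp_partner ?al 1 ?l)" unfolding J by simp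
        moreover have "2 * ?al + real ?l + 1 - of_int 1 \<noteq> 0" using nz by simp
        ultimately show ?thesis unfolding ladder_copies_def by blast
      qed
    qed
    show "size (J_ladders c) = dim (U c)"
    proof (cases "c \<in> {1, -1}")
      case True
      then show ?thesis using dim_U(1)[OF r cnj_pm[OF True]] by (simp add: hor_ladder_def size_spp_ladder)
    next
      case False
      then show ?thesis using dim_U(2)[OF r ne[OF False]] ladder_partner[OF r]
        by (simp add: hor_ladder_def size_spp_ladder size_spp_partner)
    qed
    have lam: "(-1) powi (1 + 1) * cis (- 2 * pi * ?al) = poly Z c"
      unfolding lam_cis[OF r] by (simp add: power_int_def)
    show "let lam = (-1) powi (1 + 1) * cis (- 2 * pi * ?al); d = 2 * ?al + real ?l in
        (d \<notin> \<int> \<longrightarrow> sum_of_copies (Seif2z lam (?l + 1) (?z c)) (U c) L) \<and>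
        (is_odd_int d \<longrightarrow> sum_of_copies (Seif2 lam (?l + 1)) (U c) L) \<and>
        (is_even_int d \<longrightarrow> sum_of_copies (Seif1 lam (?l + 1) (?z c)) (U c) L)"
      unfolding Let_def lam
    proof (intro conjI impI)
      assume ni: "2 * ?al + real ?l \<notin> \<int>"
      have "c \<notin> {1, -1}"
      proof
        assume "c \<in> {1, -1}"
        then show False using zero ni Ints_0 by metis
      qed
      then show "sum_of_copies (Seif2z (poly Z c) (?l + 1) (?z c)) (U c) L" by (rule U_Seif2z[OF r up ne ni])
    next
      assume "is_odd_int (2 * ?al + real ?l)"
      then obtain i where i: "odd i" "2 * ?al + real ?l = real_of_int i" unfolding is_odd_int_def by blast
      obtain lr where lr: "poly Z c = complex_of_real lr" using lam_real[OF r i(2)] by blast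
      have "c \<notin> {1, -1}"
      proof
        assume "c \<in> {1, -1}"
        then have "real_of_int i = 0" using zero i(2) by simp
        then show False using i(1) by simp
      qed
      then show "sum_of_copies (Seif2 (poly Z c) (?l + 1)) (U c) L" by (rule U_odd_Seif2[OF r up lr ne i])
    next
      assume "is_even_int (2 * ?al + real ?l)"
      then obtain i where i: "even i" "2 * ?al + real ?l = real_of_int i" unfolding is_even_int_def by blast
      obtain lr where lr: "poly Z c = complex_of_real lr" using lam_real[OF r i(2)] by blast
      show "sum_of_copies (Seif1 (poly Z c) (?l + 1) (?z c)) (U c) L"
      proof (cases "c \<in> {1, -1}")
        case True
        show ?thesis by (rule U_real_Seif1[OF r up lr cnj_pm[OF True] i])
      next
        case False
        show ?thesis by (rule U_even_Seif1[OF r up lr ne[OF False] i])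
      qed
    qed
  qed
qed

lemma nilpotent_part_M: "nilpotent_part UNIV M = Nd n"
proof
  fix x
  have "M_inv UNIV" unfolding M_inv_def by simp
  moreover have "dim (UNIV :: 'v set) = n"
    using real_vector.dim_span_eq_card_independent[OF indep_e] card_image[OF inj_e] unfolding span_e by simp
  ultimately show "nilpotent_part UNIV M x = Nd n x" using nilpotent_part_eq[of UNIV M x] by simp
qed

lemma part_a:
  "(-1) ^ k \<cdot>\<^sub>m (mat_inv S * transpose_mat S) = hor_Rmat k S ^\<^sub>m n \<and>
   (\<forall>x. (-1) ^ k *\<^sub>R M x = (R ^^ n) x) \<and>
   (\<forall>c. eigenval_on UNIV CR c \<longleftrightarrow> poly P c = 0) \<and>
   (\<forall>c. gen_eigenspace UNIV CR c = H c) \<and>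
   (\<forall>lam. direct_sum {c. (-1) ^ k * c ^ n = lam} H (gen_eigenspace UNIV CM lam)) \<and>
   T_HOR k n \<subseteq> T_mat n \<and>
   (\<forall>c. poly P c = 0 \<longrightarrow> (\<exists>q mu. jordan_blocks_on (H c) CM [(q, mu)]) \<and>
      (\<exists>q mu. jordan_blocks_on (H c) CR [(q, mu)]))"
proof (intro conjI allI impI)
  show "(-1) ^ k *\<^sub>R M x = (R ^^ n) x" for x
    unfolding M_eq scaleR_scaleR by (simp add: power_add[symmetric])
  show "\<exists>q mu. jordan_blocks_on (H c) CM [(q, mu)]" if "poly P c = 0" for c
    using jordan_blocks_single[OF jordan_M[OF that]] by blast
  show "\<exists>q mu. jordan_blocks_on (H c) CR [(q, mu)]" if "poly P c = 0" for c
    using jordan_blocks_single[OF jordan_R(1)[OF that]] by blast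
qed (rule mat_eq eigenval_R gen_eigenspace_R gen_eigenspace_M T_HOR_subset)+

lemma part_c:
  "(let J = Jroots; P = J_ladders in
      hor_Spp k S = (\<Sum>c\<in>J. P c) \<and> polarized_enhancement 1 UNIV L J U P) \<and>
   hor_Spp k S = (\<Sum>c \<in> {c. eigenval_on UNIV CR c}. hor_ladder k S c) \<and>
   (\<forall>c. eigenval_on UNIV CR c \<longrightarrow>
      (let al = lad_al c; l = lad_l c in
         l + 1 = cplx.dim (H c) \<and>
         cis (- 2 * pi * al) = (-1) ^ k * c ^ n \<and>
         (\<forall>a \<in> H c - cmap (nilpotent_part UNIV M) ` H c.
            \<exists>r>0. cbil L a ((cmap (nilpotent_part UNIV M) ^^ l) (cconj a)) =
                    cis (pi / 2 * (2 * al + real l)) * complex_of_real r) \<and>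
         (c \<in> {1, -1} \<longrightarrow> single_ladder al 1 l) \<and>
         (c \<notin> {1, -1} \<longrightarrow> hor_ladder k S (cnj c) = spp_partner al 1 l)))"
  unfolding Let_def nilpotent_part_M eigenval_R
proof (intro conjI allI impI ballI)
  show "hor_Spp k S = (\<Sum>c\<in>Jroots. J_ladders c)" by (rule Spp_Jroots)
  show "polarized_enhancement 1 UNIV L Jroots U J_ladders" by (rule polarized)
  show "hor_Spp k S = (\<Sum>c \<in> {c. poly P c = 0}. hor_ladder k S c)" unfolding hor_Spp_def hor_poly_S ..
  fix c assume r: "poly P c = 0"
  show "lad_l c + 1 = cplx.dim (H c)" using dim_H[OF r] by simp
  show "cis (- 2 * pi * lad_al c) = (-1) ^ k * c ^ n" by (rule cis_lad_al[OF r])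
  show "\<exists>r>0. cbil L a ((cmap (Nd n) ^^ lad_l c) (cconj a)) =
      cis (pi / 2 * (2 * lad_al c + real (lad_l c))) * complex_of_real r"
    if "a \<in> H c - cmap (Nd n) ` H c" for a
    using polar[OF r n1] that by blast
  show "single_ladder (lad_al c) 1 (lad_l c)" if "c \<in> {1, -1}" by (rule ladder_single[OF r that])
  show "hor_ladder k S (cnj c) = spp_partner (lad_al c) 1 (lad_l c)" by (rule ladder_partner[OF r])
qed

end

theorem theorem4p5:
  fixes n k :: nat and S :: "real mat" and p :: "real poly"
    and e :: "nat \<Rightarrow> 'v::real_vector" and L :: "'v \<Rightarrow> 'v \<Rightarrow> real"
    and M R N :: "'v \<Rightarrow> 'v"
  assumes "n \<ge> 1" and "k \<in> {1, 2}"
    and "S \<in> T_HOR k n" and "p \<in> Tpol k n" and "S = hor_S n p"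
    and "inj_on e {..<n}" and "independent (e ` {..<n})" and "span (e ` {..<n}) = UNIV"
    and "bilinear L" and "\<And>i j. i < n \<Longrightarrow> j < n \<Longrightarrow> L (e i) (e j) = transpose_mat S $$ (i, j)"
    and "linear M"
    and "\<And>j. j < n \<Longrightarrow> M (e j) = (\<Sum>i<n. (mat_inv S * transpose_mat S) $$ (i, j) *\<^sub>R e i)"
    and "linear R"
    and "\<And>j. j < n \<Longrightarrow> R (e j) = (\<Sum>i<n. hor_Rmat k S $$ (i, j) *\<^sub>R e i)"
    and "N = nilpotent_part UNIV M"
  shows
    "\<comment> \<open>(a)\<close>
     ((-1) ^ k \<cdot>\<^sub>m (mat_inv S * transpose_mat S) = hor_Rmat k S ^\<^sub>m n \<and>
      (\<forall>x. (-1) ^ k *\<^sub>R M x = (R ^^ n) x) \<and>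
      (\<forall>c. eigenval_on UNIV (cmap R) c \<longleftrightarrow> poly (map_poly complex_of_real p) c = 0) \<and>
      (\<forall>c. gen_eigenspace UNIV (cmap R) c = hor_eigenspace n R c) \<and>
      (\<forall>lam. direct_sum {c. (-1) ^ k * c ^ n = lam} (hor_eigenspace n R)
                (gen_eigenspace UNIV (cmap M) lam)) \<and>
      T_HOR k n \<subseteq> T_mat n \<and>
      (\<forall>c. poly (map_poly complex_of_real p) c = 0 \<longrightarrow>
         (\<exists>q mu. jordan_blocks_on (hor_eigenspace n R c) (cmap M) [(q, mu)]) \<and>
         (\<exists>q mu. jordan_blocks_on (hor_eigenspace n R c) (cmap R) [(q, mu)])))
    \<and> \<comment> \<open>(b)\<close>
     ((\<forall>a b. L (R a) (R b) = L a b) \<and>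
      seifert_decomp UNIV L
        ({1, -1} \<union> {c. cmod c = 1 \<and> Im c > 0 \<and> hor_eigenspace n R c \<noteq> {0}}) (hor_summand n R))
    \<and> \<comment> \<open>(c)\<close>
     ((let J = {c. cmod c = 1 \<and> (c \<in> {1, -1} \<or> Im c > 0) \<and> hor_eigenspace n R c \<noteq> {0}};
           P = (\<lambda>c. if c \<in> {1, -1} then hor_ladder k S c
                    else hor_ladder k S c + hor_ladder k S (cnj c)) in
         hor_Spp k S = (\<Sum>c\<in>J. P c) \<and>
         polarized_enhancement 1 UNIV L J (hor_summand n R) P) \<and>
      hor_Spp k S = (\<Sum>c \<in> {c. eigenval_on UNIV (cmap R) c}. hor_ladder k S c) \<and>
      (\<forall>c. eigenval_on UNIV (cmap R) c \<longrightarrow>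
         (let al = hor_ladder_alpha k S c; l = hor_ladder_l k S c in
            l + 1 = cplx.dim (hor_eigenspace n R c) \<and>
            cis (- 2 * pi * al) = (-1) ^ k * c ^ n \<and>
            (\<forall>a \<in> hor_eigenspace n R c - cmap N ` hor_eigenspace n R c.
               \<exists>r>0. cbil L a ((cmap N ^^ l) (cconj a)) =
                       cis (pi / 2 * (2 * al + real l)) * complex_of_real r) \<and>
            (c \<in> {1, -1} \<longrightarrow> single_ladder al 1 l) \<and>
            (c \<notin> {1, -1} \<longrightarrow> hor_ladder k S (cnj c) = spp_partner al 1 l))))
    \<and> \<comment> \<open>(d)\<close>
     (\<forall>g. hor_path k n S g \<longrightarrow>
        (\<exists>al. hor_lift k n g al \<and>
           (\<forall>al'. hor_lift k n g al' \<longrightarrow> (\<forall>j\<in>{1..n}. \<forall>r\<in>{0..1}. al' j r = al j r)) \<and>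
           hor_Sp k S = image_mset (\<lambda>j. al j 1) (mset_set {1..n})))"
proof -
  obtain b where "hor_data n k b p S" using hor_data_exists[of n k p] assms(1,2,4,5) by blast
  then interpret hor_space n k b p S e L M R
    using assms(6-14) by (intro hor_space.intro hor_space_axioms.intro)
  show ?thesis unfolding assms(15)
    by (rule conjI[OF part_a conjI[OF conjI[OF _ decomp_b] conjI[OF part_c]]])
      (use L_R path_lift[OF assms(1,2)] in blast)+
qed

end
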